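(* Let $\mathcal Z:\mathbb R^{\mathbb N}\to\mathcal M_0$ be the limiting random model associated with the noise $\xi^Q$ and let $(\Theta_t)_{t\in\mathbb R}$ be the time-translation maps on $\mathcal M_0$ (see context). Then $(\mathcal M_0,\mathcal B(\mathcal M_0),(\mathcal Z)_\#\mathbb P,\{\Theta_t\}_{t\in\mathbb R})$, where $(\mathcal Z)_\#\mathbb P$ is the law of $\mathcal Z$, is an ergodic, invertible measurable metric dynamical system.
   Context: **Metric dynamical systems.** $(\overline\Omega,\overline{\mathcal F},\overline{\mathbb P},\{\bar\theta_t\}_{t\in\mathbb R})$ is an invertible measurable metric dynamical system if $\bar\theta_0=\mathrm{id}$, $\bar\theta_{t+s}=\bar\theta_t\circ\bar\theta_s$, $(t,\omega)\mapsto\bar\theta_t\omega$ is jointly measurable, and $\overline{\mathbb P}\circ\bar\theta_t^{-1}=\overline{\mathbb P}$ for all $t$. It is ergodic if every $A\in\overline{\mathcal F}$ with $\bar\theta_t^{-1}A=A$ for all $t$ has $\overline{\mathbb P}(A)\in\{0,1\}$. **Regularity structure and models.** Fix $d\ge1$, $\kappa\in(0,\frac13)$, $1+\kappa<\gamma_1<2-2\kappa$. $\mathbb T^d=(\mathbb R/2\pi\mathbb Z)^d$. For $z=(t,x),w=(r,y)\in\mathbb R^{d+1}$, $d(z,w)=\max\{|t-r|^{1/2},\|x-y\|_{\mathbb T^d}\}$ (torus distance; when compared with $\Gamma_{z,w}$, representatives satisfy $|x-y|=\|x-y\|_{\mathbb T^d}$). $Q^l_z(r,y)=l^{-d-2}Q((r-t)/l^2,(y-x)/l)$;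 $\mathcal B_0^2$: $C^2$ functions supported in the unit ball with $C^2$-norm $\le1$. $\mathcal T$ is the real vector space with basis $\mathcal A=\{\Xi,\mathsf I\Xi,X_i\Xi,\mathbf 1,\mathsf I,X_i:1\le i\le d\}$ and homogeneities $|\Xi|=-1-\kappa$, $|\mathsf I\Xi|=-2\kappa$, $|X_i\Xi|=-\kappa$, $|\mathbf 1|=0$, $|\mathsf I|=1-\kappa$, $|X_i|=1$; $\|\tau\|_a$ is the absolute value of the $a$-coefficient. A model $\mathcal Z=(\Pi,\Gamma)$ consists of linear $\Pi_z:\mathcal T\to\mathcal S'(\mathbb R^{d+1})$, $\Gamma_{z,w}:\mathcal T\to\mathcal T$ with $\Pi_z\mathbf 1=1$, $\Pi_z(X_i)(w)=w_i-z_i$, $\Pi_z(\mathsf I)=g-g(z)$ for a continuous $g$, $\Gamma_{z,w}\Xi=\Xi$, $\Gamma_{z,w}\mathbf 1=\mathbf 1$, $\Gamma_{z,w}\tau=\tau-\Pi_z(\tau)(w)\mathbf 1$, $\Gamma_{z,w}(\tau\Xi)=\tau\Xi-\Pi_z(\tau)(w)\Xi$ for $\tau\in\{\mathsf I,X_i\}$, $\Gamma_{z,w}\Gamma_{w,v}=\Gamma_{z,v}$, $\Pi_z\Gamma_{z,w}=\Pi_w$, everything invariant under simultaneous spatial translation by $2\pi\mathbb Z^d$, with finite seminorms $\|\Pi\|_{\mathcal O}=\max_a\sup_{Q\in\mathcal B_0^2,0<l\le1,z\in\mathcal O}l^{-|a|}|\langle\Pi_za,Q_z^l\rangle|$ and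 $\|\Gamma\|_{\mathcal O}=1+\max_{|a_1|<|a_2|}\sup_{z\ne w\in\mathcal O}\|\Gamma_{z,w}a_2\|_{a_1}d(z,w)^{|a_1|-|a_2|}$ for compact $\mathcal O$. $\|\mathcal Z;\widetilde{\mathcal Z}\|_{\mathcal O}$ is the sum of the same expressions for the differences $\Pi-\widetilde\Pi$, $\Gamma-\widetilde\Gamma$ (without the $1+$). The space $\mathcal M$ of models carries the metric $\sum_n2^{-n}\|\mathcal Z;\widetilde{\mathcal Z}\|_{\mathcal O_n}/(1+\|\mathcal Z;\widetilde{\mathcal Z}\|_{\mathcal O_n})$, $\mathcal O_n=[-n,n]\times[-\pi,\pi]^d$. For $f\in C(\mathbb R\times\mathbb T^d)$, $g\in C^1(\mathbb R\times\mathbb T^d)$, $c\in\mathbb R$, $\mathbf M(f,g,c)\in\mathcal M$ is the model with $\Pi_z\Xi=f$, $\Pi_z\mathsf I=g-g(z)$, $\Pi_z(\mathsf I\Xi)=(g-g(z))f-c$, $\Pi_z(X_i\Xi)=f\,\Pi_zX_i$. $\mathcal M_0$ is the closure in $\mathcal M$ of the set of all $\mathbf M(f,g,c)$ (a Polish space). **Noise and limiting model.** $Q\ge0$ is bounded self-adjoint on $L^2(\mathbb T^d)$ with $Qe^{ik\cdot x}=q_ke^{ik\cdot x}$, $0\le q_k=q_{-k}\le C(1+|k|^2)^{-\beta}$, $\beta\in(0,\frac d2)$, $\beta-\frac d2>-\kappa$. $\overline{\mathcal H}^Q$ is the completion of $L^2(\mathbb R;L^2(\mathbb T^d))$ modulo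 null vectors under $\langle f,g\rangle=\int_{\mathbb R}\langle Qf(t),g(t)\rangle_{L^2(\mathbb T^d)}dt$; $(f_n)_{n\ge1}$ is an orthonormal basis; $(\Omega,\mathcal F,\mathbb P)=(\mathbb R^{\mathbb N},\mathcal B(\mathbb R^{\mathbb N}),\gamma^{\otimes\mathbb N})$ with $\gamma$ the standard Gaussian measure; $W^Q(f)=L^2\text{-}\lim_N\sum_{n\le N}\omega_n\langle f,f_n\rangle$. $\rho:\mathbb R\times\mathbb R^d\to[0,2]$ is smooth, compactly supported, $\int\rho=1$, even in both variables; $\xi^\epsilon(z)=W^Q((\rho^\epsilon_z)^{\rm per})$ (version continuous in $z$; per = spatial periodization). $K$ is the singular part of the heat kernel $G=K+S$ of $\partial_t-\Delta$ on $\mathbb R^d$: $S$ smooth, $K$ supported in $\{t\ge0,|x|^2+t\le1\}$, even in $x$, equal to $G$ for $|x|^2+t<\frac12$, smooth off the origin, annihilating polynomials of parabolic degree $\le r$ for some $r>\gamma_1+2$. $C_\epsilon=\mathbb E[\xi^\epsilon(z)(K*\xi^\epsilon)(z)]$ (independent of $z$). $\mathcal Z^\epsilon=\mathbf M(\xi^\epsilon,K*\xi^\epsilon,C_\epsilon)$ (and $\mathbf M(0,0,0)$ on the exceptional null set). The limiting model $\mathcal Z:\Omega\to\mathcal M_0$ is the random model with $\lim_{\epsilon\to0}\mathbb E\|\mathcal Z^\epsilon;\mathcal Z\|_{\mathcal O}=0$ for every compact $\mathcal O$ (it exists and does not depend on $\rho$). **Translations.** For a distribution $\Upsilon$, $\langle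 U_t\Upsilon,\phi\rangle=\langle\Upsilon,\phi(\cdot-(t,0))\rangle$, so $(U_tf)(s,x)=f(s+t,x)$. $\Theta_t(\Pi,\Gamma)$ is the model with $(\Theta_t\Pi)_z\tau=U_t(\Pi_{z+(t,0)}\tau)$ and $\Gamma$ determined from $\Theta_t\Pi$ by the formulas above. *)

theory Defs
  imports "HOL-Probability.Probability"
begin

section \<open>Space-time, periodicity, differentiability\<close>

type_synonym 'd spacetime = "real \<times> (real ^ 'd)"

definition lattice_vec :: "int ^ 'd \<Rightarrow> real ^ ('d::finite)" where
  "lattice_vec k = (\<chi> i. 2 * pi * of_int (k $ i))"

text \<open>Functions on the torus are functions on the whole of \<open>\<real>\<^sup>d\<close> that are invariant under
  \<open>2\<pi>\<int>\<^sup>d\<close>; they are integrated over the fundamental cell.\<close>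

definition periodic :: "(real ^ 'd \<Rightarrow> 'b) \<Rightarrow> bool" where
  "periodic u \<longleftrightarrow> (\<forall>k x. u (x + lattice_vec k) = u x)"

definition space_periodic :: "(('d::finite) spacetime \<Rightarrow> 'b) \<Rightarrow> bool" where
  "space_periodic f \<longleftrightarrow> (\<forall>t. periodic (\<lambda>x. f (t, x)))"

definition torus_cell :: "(real ^ ('d::finite)) set" where
  "torus_cell = {x. \<forall>i. - pi \<le> x $ i \<and> x $ i \<le> pi}"

definition torus_dist :: "real ^ 'd \<Rightarrow> real ^ ('d::finite) \<Rightarrow> real" where
  "torus_dist x y = (INF k. norm (x - y + lattice_vec k))"

definition par_dist :: "'d spacetime \<Rightarrow> ('d::finite) spacetime \<Rightarrow> real" where
  "par_dist z w = max (sqrt \<bar>fst z - fst w\<bar>) (torus_dist (snd z) (snd w))"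

primrec Ck_on :: "nat \<Rightarrow> ('a::euclidean_space \<Rightarrow> real) \<Rightarrow> 'a set \<Rightarrow> bool" where
  "Ck_on 0 f S \<longleftrightarrow> continuous_on S f"
| "Ck_on (Suc k) f S \<longleftrightarrow> (\<forall>x\<in>S. f differentiable (at x)) \<and>
     (\<forall>b\<in>Basis. Ck_on k (\<lambda>x. frechet_derivative f (at x) b) S)"

definition smooth_on :: "('a::euclidean_space \<Rightarrow> real) \<Rightarrow> 'a set \<Rightarrow> bool" where
  "smooth_on f S \<longleftrightarrow> (\<forall>k. Ck_on k f S)"

definition C_torus :: "(('d::finite) spacetime \<Rightarrow> real) set" where
  "C_torus = {f. continuous_on UNIV f \<and> space_periodic f}"

definition C1_torus :: "(('d::finite) spacetime \<Rightarrow> real) set" where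
  "C1_torus = {g. Ck_on 1 g UNIV \<and> space_periodic g}"

section \<open>Distributions\<close>

definition test_functions :: "(('d::finite) spacetime \<Rightarrow> real) set" where
  "test_functions = {\<phi>. Ck_on 2 \<phi> UNIV \<and> (\<exists>C. compact C \<and> (\<forall>z. z \<notin> C \<longrightarrow> \<phi> z = 0))}"

definition C2_norm :: "(('d::finite) spacetime \<Rightarrow> real) \<Rightarrow> real" where
  "C2_norm \<phi> = Sup (
     {\<bar>\<phi> z\<bar> | z. True} \<union>
     {\<bar>frechet_derivative \<phi> (at z) b\<bar> | z b. b \<in> Basis} \<union>
     {\<bar>frechet_derivative (\<lambda>w. frechet_derivative \<phi> (at w) b) (at z) c\<bar> | z b c.
        b \<in> Basis \<and> c \<in> Basis})"

definition unit_tests :: "(('d::finite) spacetime \<Rightarrow> real) set" where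
  "unit_tests = {\<phi> \<in> test_functions. (\<forall>z. z \<notin> cball 0 1 \<longrightarrow> \<phi> z = 0) \<and> C2_norm \<phi> \<le> 1}"

definition rescale :: "real \<Rightarrow> 'd spacetime \<Rightarrow> ('d spacetime \<Rightarrow> real) \<Rightarrow> ('d::finite) spacetime \<Rightarrow> real" where
  "rescale l z \<phi> w =
     \<phi> ((fst w - fst z) / l\<^sup>2, (snd w - snd z) /\<^sub>R l) / l ^ (CARD('d) + 2)"

text \<open>Since the model seminorms test against functions that are merely \<open>C\<^sup>2\<close>, distributions are
  taken to act on compactly supported \<open>C\<^sup>2\<close> functions: these are the distributions of order at
  most two, each of which is determined by its restriction to smooth test functions, and finiteness
  of the seminorms allows no others. The value 0 off the test functions makes the representation
  unique.\<close>

type_synonym 'd functional = "('d spacetime \<Rightarrow> real) \<Rightarrow> real"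

definition distributions :: "('d::finite) functional set" where
  "distributions = {\<Upsilon>.
     (\<forall>\<phi>. \<phi> \<notin> test_functions \<longrightarrow> \<Upsilon> \<phi> = 0) \<and>
     (\<forall>\<phi>\<in>test_functions. \<forall>\<psi>\<in>test_functions. \<forall>a b.
        \<Upsilon> (\<lambda>w. a * \<phi> w + b * \<psi> w) = a * \<Upsilon> \<phi> + b * \<Upsilon> \<psi>) \<and>
     (\<forall>C. compact C \<longrightarrow> (\<exists>B. \<forall>\<phi>\<in>test_functions.
        (\<forall>z. z \<notin> C \<longrightarrow> \<phi> z = 0) \<longrightarrow> \<bar>\<Upsilon> \<phi>\<bar> \<le> B * C2_norm \<phi>))}"

definition of_fun :: "('d spacetime \<Rightarrow> real) \<Rightarrow> ('d::finite) functional" where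
  "of_fun h \<phi> = (if \<phi> \<in> test_functions then (LINT w|lborel. h w * \<phi> w) else 0)"

text \<open>The pointwise values of a distribution given by a continuous function.\<close>

definition cont_density :: "('d::finite) functional \<Rightarrow> 'd spacetime \<Rightarrow> real" where
  "cont_density \<Upsilon> = (THE h. continuous_on UNIV h \<and> \<Upsilon> = of_fun h)"

definition time_shift :: "real \<Rightarrow> 'd functional \<Rightarrow> ('d::finite) functional" where
  "time_shift t \<Upsilon> \<phi> = \<Upsilon> (\<lambda>w. \<phi> (w - (t, 0)))"

section \<open>Models\<close>

datatype 'd symb = Xi | IXi | XXi 'd | Unit | II | XX 'd

lemma UNIV_symb: "UNIV = {Xi, IXi, Unit, II} \<union> range XXi \<union> range XX"
proof -
  have "x \<in> {Xi, IXi, Unit, II} \<union> range XXi \<union> range XX" for x :: "'d symb"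
    by (cases x) auto
  then show ?thesis by blast
qed

instance symb :: (finite) finite
  by standard (subst UNIV_symb, simp)

type_synonym 'd tspace = "real ^ ('d symb)"

primrec homog :: "real \<Rightarrow> 'd symb \<Rightarrow> real" where
  "homog \<kappa> Xi = - 1 - \<kappa>"
| "homog \<kappa> IXi = - 2 * \<kappa>"
| "homog \<kappa> (XXi i) = - \<kappa>"
| "homog \<kappa> Unit = 0"
| "homog \<kappa> II = 1 - \<kappa>"
| "homog \<kappa> (XX i) = 1"

abbreviation bas :: "('d::finite) symb \<Rightarrow> 'd tspace" where
  "bas a \<equiv> axis a 1"

type_synonym 'd pimap = "'d spacetime \<Rightarrow> 'd tspace \<Rightarrow> 'd functional"
type_synonym 'd gmap = "'d spacetime \<Rightarrow> 'd spacetime \<Rightarrow> 'd tspace \<Rightarrow> 'd tspace"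
type_synonym 'd model = "'d pimap \<times> 'd gmap"

definition Gamma_formulas :: "('d::finite) pimap \<Rightarrow> 'd gmap \<Rightarrow> bool" where
  "Gamma_formulas P \<Gamma> \<longleftrightarrow> (\<forall>z w.
     linear (\<Gamma> z w) \<and>
     \<Gamma> z w (bas Xi) = bas Xi \<and>
     \<Gamma> z w (bas Unit) = bas Unit \<and>
     \<Gamma> z w (bas II) = bas II - cont_density (P z (bas II)) w *\<^sub>R bas Unit \<and>
     (\<forall>i. \<Gamma> z w (bas (XX i)) = bas (XX i) - cont_density (P z (bas (XX i))) w *\<^sub>R bas Unit) \<and>
     \<Gamma> z w (bas IXi) = bas IXi - cont_density (P z (bas II)) w *\<^sub>R bas Xi \<and>
     (\<forall>i. \<Gamma> z w (bas (XXi i)) = bas (XXi i) - cont_density (P z (bas (XX i))) w *\<^sub>R bas Xi))"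

definition Gamma_of :: "('d::finite) pimap \<Rightarrow> 'd gmap" where
  "Gamma_of P = (THE \<Gamma>. Gamma_formulas P \<Gamma>)"

definition Pi_seminorm :: "real \<Rightarrow> ('d::finite) spacetime set \<Rightarrow> 'd pimap \<Rightarrow> ennreal" where
  "Pi_seminorm \<kappa> S P = (SUP a. SUP \<phi>\<in>unit_tests. SUP l\<in>{0<..1}. SUP z\<in>S.
     ennreal (l powr (- homog \<kappa> a) * \<bar>P z (bas a) (rescale l z \<phi>)\<bar>))"

text \<open>Pairs of points of \<open>S\<close>, distinct on the torus, where the second point is replaced by a
  representative that is closest to the first one.\<close>

definition torus_pairs :: "('d::finite) spacetime set \<Rightarrow> ('d spacetime \<times> 'd spacetime) set" where
  "torus_pairs S = {(z, w). z \<in> S \<and> (\<exists>k. w + (0, lattice_vec k) \<in> S) \<and> z \<noteq> w \<and>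
     norm (snd z - snd w) = torus_dist (snd z) (snd w)}"

definition Gamma_seminorm :: "real \<Rightarrow> ('d::finite) spacetime set \<Rightarrow> 'd gmap \<Rightarrow> ennreal" where
  "Gamma_seminorm \<kappa> S \<Gamma> = (SUP (a, b)\<in>{(a, b). homog \<kappa> a < homog \<kappa> b}. SUP (z, w)\<in>torus_pairs S.
     ennreal (\<bar>\<Gamma> z w (bas b) $ a\<bar> * par_dist z w powr (homog \<kappa> a - homog \<kappa> b)))"

definition is_model :: "real \<Rightarrow> ('d::finite) model \<Rightarrow> bool" where
  "is_model \<kappa> \<Z> \<longleftrightarrow> (case \<Z> of (P, \<Gamma>) \<Rightarrow>
     (\<forall>z \<tau>. P z \<tau> \<in> distributions) \<and>
     (\<forall>z \<phi>. linear (\<lambda>\<tau>. P z \<tau> \<phi>)) \<and>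
     (\<forall>z. P z (bas Unit) = of_fun (\<lambda>_. 1)) \<and>
     (\<forall>z i. P z (bas (XX i)) = of_fun (\<lambda>w. snd w $ i - snd z $ i)) \<and>
     (\<exists>g. continuous_on UNIV g \<and> (\<forall>z. P z (bas II) = of_fun (\<lambda>w. g w - g z))) \<and>
     Gamma_formulas P \<Gamma> \<and>
     (\<forall>z w v. \<Gamma> z w \<circ> \<Gamma> w v = \<Gamma> z v) \<and>
     (\<forall>z w. P z \<circ> \<Gamma> z w = P w) \<and>
     (\<forall>k z \<tau> \<phi>. P (z + (0, lattice_vec k)) \<tau> (\<lambda>w. \<phi> (w - (0, lattice_vec k))) = P z \<tau> \<phi>) \<and>
     (\<forall>k z w. \<Gamma> (z + (0, lattice_vec k)) (w + (0, lattice_vec k)) = \<Gamma> z w) \<and>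
     (\<forall>S. compact S \<longrightarrow> Pi_seminorm \<kappa> S P < \<infinity> \<and> 1 + Gamma_seminorm \<kappa> S \<Gamma> < \<infinity>))"

definition models :: "real \<Rightarrow> ('d::finite) model set" where
  "models \<kappa> = {\<Z>. is_model \<kappa> \<Z>}"

definition model_diff :: "real \<Rightarrow> ('d::finite) spacetime set \<Rightarrow> 'd model \<Rightarrow> 'd model \<Rightarrow> ennreal" where
  "model_diff \<kappa> S \<Z> \<Z>' =
     Pi_seminorm \<kappa> S (\<lambda>z \<tau> \<phi>. fst \<Z> z \<tau> \<phi> - fst \<Z>' z \<tau> \<phi>) +
     Gamma_seminorm \<kappa> S (\<lambda>z w \<tau>. snd \<Z> z w \<tau> - snd \<Z>' z w \<tau>)"

definition model_box :: "nat \<Rightarrow> (('d::finite) spacetime) set" where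
  "model_box n = {- real n..real n} \<times> torus_cell"

definition model_dist :: "real \<Rightarrow> ('d::finite) model \<Rightarrow> 'd model \<Rightarrow> real" where
  "model_dist \<kappa> \<Z> \<Z>' = (\<Sum>n. (1/2) ^ Suc n *
     (enn2real (model_diff \<kappa> (model_box (Suc n)) \<Z> \<Z>') /
       (1 + enn2real (model_diff \<kappa> (model_box (Suc n)) \<Z> \<Z>'))))"

definition model_topology :: "real \<Rightarrow> ('d::finite) model topology" where
  "model_topology \<kappa> = Metric_space.mtopology (models \<kappa>) (model_dist \<kappa>)"

primrec canonical_fun ::
    "('d spacetime \<Rightarrow> real) \<Rightarrow> ('d spacetime \<Rightarrow> real) \<Rightarrow> real \<Rightarrow> ('d::finite) spacetime \<Rightarrow>
     'd symb \<Rightarrow> 'd spacetime \<Rightarrow> real" where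
  "canonical_fun f g c z Xi = f"
| "canonical_fun f g c z IXi = (\<lambda>w. (g w - g z) * f w - c)"
| "canonical_fun f g c z (XXi i) = (\<lambda>w. f w * (snd w $ i - snd z $ i))"
| "canonical_fun f g c z Unit = (\<lambda>w. 1)"
| "canonical_fun f g c z II = (\<lambda>w. g w - g z)"
| "canonical_fun f g c z (XX i) = (\<lambda>w. snd w $ i - snd z $ i)"

definition canonical_Pi ::
    "('d spacetime \<Rightarrow> real) \<Rightarrow> ('d spacetime \<Rightarrow> real) \<Rightarrow> real \<Rightarrow> ('d::finite) pimap" where
  "canonical_Pi f g c z \<tau> = of_fun (\<lambda>w. \<Sum>a\<in>UNIV. \<tau> $ a * canonical_fun f g c z a w)"

definition canonical_model ::
    "('d spacetime \<Rightarrow> real) \<Rightarrow> ('d spacetime \<Rightarrow> real) \<Rightarrow> real \<Rightarrow> ('d::finite) model" where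
  "canonical_model f g c = (canonical_Pi f g c, Gamma_of (canonical_Pi f g c))"

definition models0 :: "real \<Rightarrow> ('d::finite) model set" where
  "models0 \<kappa> = (model_topology \<kappa>) closure_of
     {canonical_model f g c | f g c. f \<in> C_torus \<and> g \<in> C1_torus}"

definition borel_models0 :: "real \<Rightarrow> ('d::finite) model measure" where
  "borel_models0 \<kappa> =
     sigma (models0 \<kappa>) {U. openin (subtopology (model_topology \<kappa>) (models0 \<kappa>)) U}"

definition time_translation :: "real \<Rightarrow> ('d::finite) model \<Rightarrow> 'd model" where
  "time_translation t \<Z> =
     (let P = (\<lambda>z \<tau>. time_shift t (fst \<Z> (z + (t, 0)) \<tau>)) in (P, Gamma_of P))"

section \<open>The noise\<close>

definition L2_torus :: "(real ^ ('d::finite) \<Rightarrow> complex) set" where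
  "L2_torus = {u. u \<in> borel_measurable borel \<and> periodic u \<and>
     set_integrable lborel torus_cell (\<lambda>x. (cmod (u x))\<^sup>2)}"

definition L2_inner :: "(real ^ 'd \<Rightarrow> complex) \<Rightarrow> (real ^ ('d::finite) \<Rightarrow> complex) \<Rightarrow> complex" where
  "L2_inner u v = (LINT x:torus_cell|lborel. u x * cnj (v x))"

definition L2_norm_torus :: "(real ^ ('d::finite) \<Rightarrow> complex) \<Rightarrow> real" where
  "L2_norm_torus u = sqrt (LINT x:torus_cell|lborel. (cmod (u x))\<^sup>2)"

definition fourier_mode :: "int ^ 'd \<Rightarrow> real ^ ('d::finite) \<Rightarrow> complex" where
  "fourier_mode k x = cis (\<Sum>i\<in>UNIV. of_int (k $ i) * x $ i)"

text \<open>An operator on \<open>L\<^sup>2\<close> is a map between representatives; boundedness together with linearity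
  makes it compatible with almost everywhere equality.\<close>

definition covariance_operator ::
    "((real ^ 'd \<Rightarrow> complex) \<Rightarrow> (real ^ ('d::finite) \<Rightarrow> complex)) \<Rightarrow> (int ^ 'd \<Rightarrow> real) \<Rightarrow> real \<Rightarrow> bool" where
  "covariance_operator Q q \<beta> \<longleftrightarrow>
     (\<forall>u\<in>L2_torus. Q u \<in> L2_torus) \<and>
     (\<forall>u\<in>L2_torus. \<forall>v\<in>L2_torus. \<forall>a b.
        AE x in lborel. Q (\<lambda>y. a * u y + b * v y) x = a * Q u x + b * Q v x) \<and>
     (\<exists>B. \<forall>u\<in>L2_torus. L2_norm_torus (Q u) \<le> B * L2_norm_torus u) \<and>
     (\<forall>u\<in>L2_torus. \<forall>v\<in>L2_torus. L2_inner (Q u) v = L2_inner u (Q v)) \<and>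
     (\<forall>u\<in>L2_torus. 0 \<le> Re (L2_inner (Q u) u)) \<and>
     (\<forall>k. AE x in lborel. Q (fourier_mode k) x = of_real (q k) * fourier_mode k x) \<and>
     (\<forall>k. 0 \<le> q k \<and> q k = q (- k)) \<and>
     (\<exists>C. \<forall>k. q k \<le> C * (1 + (\<Sum>i\<in>UNIV. (of_int (k $ i))\<^sup>2)) powr (- \<beta>))"

text \<open>Real-valued elements of \<open>L\<^sup>2(\<real>; L\<^sup>2(\<T>\<^sup>d))\<close>, as jointly measurable functions.\<close>

definition time_slice :: "('d spacetime \<Rightarrow> real) \<Rightarrow> real \<Rightarrow> real ^ ('d::finite) \<Rightarrow> complex" where
  "time_slice f t x = of_real (f (t, x))"

definition L2_time_torus :: "(('d::finite) spacetime \<Rightarrow> real) set" where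
  "L2_time_torus = {f. f \<in> borel_measurable borel \<and> (\<forall>t. time_slice f t \<in> L2_torus) \<and>
     integrable lborel (\<lambda>t. (L2_norm_torus (time_slice f t))\<^sup>2)}"

definition Q_form ::
    "((real ^ 'd \<Rightarrow> complex) \<Rightarrow> (real ^ ('d::finite) \<Rightarrow> complex)) \<Rightarrow>
     ('d spacetime \<Rightarrow> real) \<Rightarrow> ('d spacetime \<Rightarrow> real) \<Rightarrow> real" where
  "Q_form Q f g = (LINT t|lborel. Re (L2_inner (Q (time_slice f t)) (time_slice g t)))"

text \<open>The Hilbert space \<open>'h\<close> together with \<open>\<iota>\<close> is a completion of \<open>L\<^sup>2(\<real>; L\<^sup>2(\<T>\<^sup>d))\<close> modulo
  null vectors; it is unique up to isometry. Preservation of the form makes \<open>\<iota>\<close> linear and sends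
  null vectors to 0.\<close>

definition is_Q_completion ::
    "((real ^ 'd \<Rightarrow> complex) \<Rightarrow> (real ^ ('d::finite) \<Rightarrow> complex)) \<Rightarrow>
     (('d spacetime \<Rightarrow> real) \<Rightarrow> 'h::{real_inner,complete_space}) \<Rightarrow> bool" where
  "is_Q_completion Q \<iota> \<longleftrightarrow>
     (\<forall>f\<in>L2_time_torus. \<forall>g\<in>L2_time_torus. \<iota> f \<bullet> \<iota> g = Q_form Q f g) \<and>
     closure (\<iota> ` L2_time_torus) = UNIV"

definition orthonormal_basis :: "(nat \<Rightarrow> 'h::{real_inner,complete_space}) \<Rightarrow> bool" where
  "orthonormal_basis e \<longleftrightarrow>
     (\<forall>m n. e m \<bullet> e n = (if m = n then 1 else 0)) \<and> closure (span (range e)) = UNIV"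

definition gauss_space :: "(nat \<Rightarrow> real) measure" where
  "gauss_space = (\<Pi>\<^sub>M n\<in>UNIV. std_normal_distribution)"

text \<open>\<open>X\<close> is a version of \<open>W\<^sup>Q(h)\<close>.\<close>

definition is_white_noise_integral ::
    "(nat \<Rightarrow> 'h::{real_inner,complete_space}) \<Rightarrow> 'h \<Rightarrow> ((nat \<Rightarrow> real) \<Rightarrow> real) \<Rightarrow> bool" where
  "is_white_noise_integral e h X \<longleftrightarrow> X \<in> borel_measurable gauss_space \<and>
     (\<lambda>N. \<integral>\<^sup>+\<omega>. ennreal (((\<Sum>n<N. \<omega> n * (h \<bullet> e n)) - X \<omega>)\<^sup>2) \<partial>gauss_space) \<longlonglongrightarrow> 0"

definition mollifier :: "(('d::finite) spacetime \<Rightarrow> real) \<Rightarrow> bool" where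
  "mollifier \<rho> \<longleftrightarrow> smooth_on \<rho> UNIV \<and> (\<exists>C. compact C \<and> (\<forall>z. z \<notin> C \<longrightarrow> \<rho> z = 0)) \<and>
     (\<forall>z. 0 \<le> \<rho> z \<and> \<rho> z \<le> 2) \<and> (LINT z|lborel. \<rho> z) = 1 \<and>
     (\<forall>t x. \<rho> (- t, x) = \<rho> (t, x) \<and> \<rho> (t, - x) = \<rho> (t, x))"

definition periodize :: "(('d::finite) spacetime \<Rightarrow> real) \<Rightarrow> 'd spacetime \<Rightarrow> real" where
  "periodize \<phi> w = (\<Sum>\<^sub>\<infinity>k. \<phi> (w + (0, lattice_vec k)))"

definition heat_kernel :: "('d::finite) spacetime \<Rightarrow> real" where
  "heat_kernel z = (if fst z > 0
     then exp (- (norm (snd z))\<^sup>2 / (4 * fst z)) / (4 * pi * fst z) powr (real CARD('d) / 2)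
     else 0)"

definition singular_kernel :: "real \<Rightarrow> (('d::finite) spacetime \<Rightarrow> real) \<Rightarrow> bool" where
  "singular_kernel \<gamma>\<^sub>1 K \<longleftrightarrow>
     smooth_on (\<lambda>z. heat_kernel z - K z) UNIV \<and>
     (\<forall>t x. K (t, x) \<noteq> 0 \<longrightarrow> t \<ge> 0 \<and> (norm x)\<^sup>2 + t \<le> 1) \<and>
     (\<forall>t x. K (t, - x) = K (t, x)) \<and>
     (\<forall>t x. (norm x)\<^sup>2 + t < 1/2 \<longrightarrow> K (t, x) = heat_kernel (t, x)) \<and>
     smooth_on K (- {0}) \<and>
     (\<exists>r > \<gamma>\<^sub>1 + 2. \<forall>(m::nat) (\<alpha> :: 'd \<Rightarrow> nat). 2 * real m + (\<Sum>i\<in>UNIV. real (\<alpha> i)) \<le> r \<longrightarrow>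
        (LINT z|lborel. K z * (fst z ^ m * (\<Prod>i\<in>UNIV. snd z $ i ^ \<alpha> i))) = 0)"

definition convolve ::
    "(('d::finite) spacetime \<Rightarrow> real) \<Rightarrow> ('d spacetime \<Rightarrow> real) \<Rightarrow> 'd spacetime \<Rightarrow> real" where
  "convolve K f z = (LINT w|lborel. K (z - w) * f w)"

text \<open>\<open>\<xi>\<close> is a continuous version of \<open>\<xi>\<^sup>\<epsilon>\<close> with exceptional null set \<open>N\<close>.\<close>

definition mollified_noise ::
    "(('d spacetime \<Rightarrow> real) \<Rightarrow> 'h) \<Rightarrow> (nat \<Rightarrow> 'h::{real_inner,complete_space}) \<Rightarrow>
     ('d spacetime \<Rightarrow> real) \<Rightarrow> ('d spacetime \<Rightarrow> real) \<Rightarrow> real \<Rightarrow>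
     ((nat \<Rightarrow> real) \<Rightarrow> ('d::finite) spacetime \<Rightarrow> real) \<Rightarrow> (nat \<Rightarrow> real) set \<Rightarrow> bool" where
  "mollified_noise \<iota> e \<rho> K \<epsilon> \<xi> N \<longleftrightarrow>
     (\<forall>z. is_white_noise_integral e (\<iota> (periodize (rescale \<epsilon> z \<rho>))) (\<lambda>\<omega>. \<xi> \<omega> z)) \<and>
     N \<in> null_sets gauss_space \<and>
     (\<forall>\<omega>. \<omega> \<notin> N \<longrightarrow> \<xi> \<omega> \<in> C_torus \<and> convolve K (\<xi> \<omega>) \<in> C1_torus)"

definition renorm_const ::
    "(('d::finite) spacetime \<Rightarrow> real) \<Rightarrow> ((nat \<Rightarrow> real) \<Rightarrow> 'd spacetime \<Rightarrow> real) \<Rightarrow>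
     (nat \<Rightarrow> real) set \<Rightarrow> real" where
  "renorm_const K \<xi> N = (LINT \<omega>:(- N)|gauss_space. \<xi> \<omega> 0 * convolve K (\<xi> \<omega>) 0)"

definition approx_model ::
    "(('d::finite) spacetime \<Rightarrow> real) \<Rightarrow> ((nat \<Rightarrow> real) \<Rightarrow> 'd spacetime \<Rightarrow> real) \<Rightarrow>
     (nat \<Rightarrow> real) set \<Rightarrow> (nat \<Rightarrow> real) \<Rightarrow> 'd model" where
  "approx_model K \<xi> N \<omega> =
     (if \<omega> \<in> N then canonical_model (\<lambda>_. 0) (\<lambda>_. 0) 0
      else canonical_model (\<xi> \<omega>) (convolve K (\<xi> \<omega>)) (renorm_const K \<xi> N))"

definition limiting_model ::
    "real \<Rightarrow> (('d::finite) spacetime \<Rightarrow> real) \<Rightarrow>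
     (real \<Rightarrow> (nat \<Rightarrow> real) \<Rightarrow> 'd spacetime \<Rightarrow> real) \<Rightarrow> (real \<Rightarrow> (nat \<Rightarrow> real) set) \<Rightarrow>
     ((nat \<Rightarrow> real) \<Rightarrow> 'd model) \<Rightarrow> bool" where
  "limiting_model \<kappa> K \<xi> N \<Z> \<longleftrightarrow>
     \<Z> \<in> measurable gauss_space (borel_models0 \<kappa>) \<and>
     (\<forall>S. compact S \<longrightarrow>
        ((\<lambda>\<epsilon>. \<integral>\<^sup>+\<omega>. model_diff \<kappa> S (approx_model K (\<xi> \<epsilon>) (N \<epsilon>) \<omega>) (\<Z> \<omega>) \<partial>gauss_space) \<longlongrightarrow> 0)
          (at_right 0))"

section \<open>Metric dynamical systems\<close>

definition metric_dynamical_system :: "'a measure \<Rightarrow> (real \<Rightarrow> 'a \<Rightarrow> 'a) \<Rightarrow> bool" where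
  "metric_dynamical_system M \<theta> \<longleftrightarrow> prob_space M \<and>
     (\<forall>\<omega>\<in>space M. \<theta> 0 \<omega> = \<omega>) \<and>
     (\<forall>t s. \<forall>\<omega>\<in>space M. \<theta> (t + s) \<omega> = \<theta> t (\<theta> s \<omega>)) \<and>
     (\<lambda>(t, \<omega>). \<theta> t \<omega>) \<in> measurable (borel \<Otimes>\<^sub>M M) M \<and>
     (\<forall>t. distr M M (\<theta> t) = M)"

definition ergodic_mds :: "'a measure \<Rightarrow> (real \<Rightarrow> 'a \<Rightarrow> 'a) \<Rightarrow> bool" where
  "ergodic_mds M \<theta> \<longleftrightarrow> metric_dynamical_system M \<theta> \<and>
     (\<forall>A\<in>sets M. (\<forall>t. \<theta> t -` A \<inter> space M = A) \<longrightarrow> measure M A \<in> {0, 1})"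

end

theory Submission
  imports Defs
begin

text \<open>
  The delay of functions by time \<open>a\<close> preserves the covariance form, so it extends to an isometry of the
  completion, and its second quantisation is a measure preserving map \<open>\<theta> a\<close> of the Gaussian space
  with \<open>W f \<circ> \<theta> a = W (delay a f)\<close>. Consequently \<open>\<xi>\<^sup>\<epsilon> \<circ> \<theta> a\<close> is \<open>\<xi>\<^sup>\<epsilon>\<close> advanced by \<open>a\<close>, the
  approximating models are intertwined with the time translations, and this passes to the limit:
  \<open>\<Z> \<circ> \<theta> a\<close> is almost surely the translate of \<open>\<Z>\<close>. Since models are determined by countably many
  evaluations, only the convergence of evaluations is needed here. So the law of \<open>\<Z>\<close>
  is invariant, and the preimage \<open>B\<close> under \<open>\<Z>\<close> of an invariant set is invariant under all \<open>\<theta> a\<close>. Such a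
  \<open>B\<close> has probability 0 or 1: for \<open>f\<close> supported in a bounded time interval, infinitely many delays \<open>f\<^sub>k\<close> of \<open>f\<close>
  are pairwise orthogonal, so the centred variables \<open>exp (i W (f\<^sub>k))\<close> are orthogonal and their equal
  correlations with \<open>B\<close> vanish by Bessel's inequality. Hence \<open>B\<close> is independent of the noise and so
  of itself.
\<close>

section \<open>Gaussian families and characteristic functions\<close>

text \<open>Because the noise is white in time, functions with disjoint time supports are exactly
  orthogonal for the covariance form; this is why no decay of correlations has to be estimated. The
  maps \<theta> are second quantisations, fixed only up to null sets, so no group law is asked of
  them: each delay is handled alone, with its own null set, and the exact group law and the joint
  measurability are proved for \<open>time_translation\<close> on models. Joint measurability is
  where \<open>models0\<close> matters. Translations by bounded times are equicontinuous on all of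
  \<open>models\<close>, but continuity in time is obtained first for canonical models, whose f, g
  and first derivatives of g move continuously, and is then carried to the closure. The
  approximating models enter only through real evaluations, whose measurability is a Fubini
  statement; they are never treated as random elements of a metric space. Everything Gaussian is
  reduced to one-dimensional characteristic functions by trading exponentials for indicators one
  coordinate at a time.\<close>

lemma (in prob_space) charfun_split_real:
  fixes X G :: "'a \<Rightarrow> real"
  assumes [measurable]: "X \<in> borel_measurable M" "C \<in> sets borel"
    and G: "integrable M G" and nn: "\<And>\<omega>. 0 \<le> G \<omega>"
    and eq: "\<And>s. (LINT \<omega>|M. iexp (s * X \<omega>) * of_real (G \<omega>)) = of_real (exp (- (s\<^sup>2) / 2)) * of_real (LINT \<omega>|M. G \<omega>)"
  shows "(LINT \<omega>|M. indicator C (X \<omega>) * G \<omega>) = measure std_normal_distribution C * (LINT \<omega>|M. G \<omega>)"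
proof (cases "(LINT \<omega>|M. G \<omega>) = 0")
  case True
  then have "AE \<omega> in M. G \<omega> = 0"
    using integral_nonneg_eq_0_iff_AE[OF G] nn by auto
  then have "AE \<omega> in M. indicator C (X \<omega>) * G \<omega> = 0" by auto
  then have "(LINT \<omega>|M. indicator C (X \<omega>) * G \<omega>) = 0"
    by (rule integral_eq_zero_AE)
  with True show ?thesis by simp
next
  case False
  have Gm [measurable]: "G \<in> borel_measurable M" using G by auto
  define m where "m = (LINT \<omega>|M. G \<omega>)"
  have m: "m > 0" using False nn integral_nonneg_AE[of G M] unfolding m_def by (metis AE_I2 less_eq_real_def)
  \<comment> \<open>Tilting by \<open>G / m\<close> turns the hypothesis into the statement that
    \<open>X\<close> has the standard normal characteristic function under \<open>D\<close>. Levy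
    uniqueness identifies the law of \<open>X\<close> under \<open>D\<close>, and undoing the tilt
    gives the claim.\<close>
  define D where "D = density M (\<lambda>\<omega>. ennreal (G \<omega> / m))"
  have gm: "\<And>\<omega>. 0 \<le> G \<omega> / m" using nn m by simp
  have "emeasure D (space D) = (\<integral>\<^sup>+\<omega>. ennreal (G \<omega> / m) \<partial>M)"
    unfolding D_def by (simp add: emeasure_density space_density cong: nn_integral_cong)
  also have "\<dots> = ennreal (LINT \<omega>|M. G \<omega> / m)"
    using G gm by (intro nn_integral_eq_integral) auto
  also have "(LINT \<omega>|M. G \<omega> / m) = 1" using m by (simp add: m_def)
  finally have "prob_space D" by (intro prob_spaceI) simp
  interpret D: prob_space D by fact
  have XD [measurable]: "X \<in> borel_measurable D" unfolding D_def by measurable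
  have rd: "real_distribution (distr D borel X)"
    using XD by (rule D.real_distribution_distr)
  have "char (distr D borel X) = char std_normal_distribution"
  proof
    fix s
    have "char (distr D borel X) s = (LINT \<omega>|D. iexp (s * X \<omega>))"
      unfolding char_def by (subst integral_distr) auto
    also have "\<dots> = (LINT \<omega>|M. (G \<omega> / m) *\<^sub>R iexp (s * X \<omega>))"
      unfolding D_def using gm by (subst integral_density) auto
    also have "\<dots> = (LINT \<omega>|M. (iexp (s * X \<omega>) * of_real (G \<omega>)) / of_real m)"
      by (intro Bochner_Integration.integral_cong) (auto simp: scaleR_conv_of_real)
    also have "\<dots> = (LINT \<omega>|M. iexp (s * X \<omega>) * of_real (G \<omega>)) / of_real m"
      by (rule integral_divide_zero)
    also have "\<dots> = of_real (exp (- (s\<^sup>2) / 2))"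
      unfolding eq using m by (simp add: m_def)
    finally show "char (distr D borel X) s = char std_normal_distribution s"
      by (simp add: char_std_normal_distribution)
  qed
  then have "distr D borel X = std_normal_distribution"
    by (intro Levy_uniqueness rd real_dist_normal_dist)
  then have "measure std_normal_distribution C = measure (distr D borel X) C" by simp
  also have "\<dots> = (LINT x|distr D borel X. indicator C x)"
    by simp
  also have "\<dots> = (LINT \<omega>|D. indicator C (X \<omega>))"
    by (subst integral_distr) auto
  also have "\<dots> = (LINT \<omega>|M. (G \<omega> / m) *\<^sub>R indicator C (X \<omega>))"
    unfolding D_def using gm by (subst integral_density) auto
  also have "\<dots> = (LINT \<omega>|M. (indicator C (X \<omega>) * G \<omega>) / m)"
    by (intro Bochner_Integration.integral_cong) auto
  finally show ?thesis using m by (simp add: m_def field_simps)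
qed

text \<open>Tilting needs a nonnegative weight, which a complex \<open>G\<close> does not give. For
  \<open>cmod a = 1\<close> both \<open>H\<close> and \<open>H + Re (a * G)\<close> are nonnegative
  and factorise, and subtracting one identity from the other leaves \<open>Re (a * G)\<close>. The
  values 1 and \<i> of \<open>a\<close> recover the real and the imaginary part.\<close>

lemma (in prob_space) charfun_split:
  fixes X H :: "'a \<Rightarrow> real" and G :: "'a \<Rightarrow> complex"
  assumes [measurable]: "X \<in> borel_measurable M" "C \<in> sets borel"
    and H: "integrable M H" and G [measurable]: "G \<in> borel_measurable M" and GH: "\<And>\<omega>. cmod (G \<omega>) \<le> H \<omega>"
    and eqH: "\<And>s. (LINT \<omega>|M. iexp (s * X \<omega>) * of_real (H \<omega>)) = of_real (exp (- (s\<^sup>2) / 2)) * of_real (LINT \<omega>|M. H \<omega>)"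
    and eqG: "\<And>s. (LINT \<omega>|M. iexp (s * X \<omega>) * G \<omega>) = of_real (exp (- (s\<^sup>2) / 2)) * (LINT \<omega>|M. G \<omega>)"
  shows "(LINT \<omega>|M. indicator C (X \<omega>) * G \<omega>) = measure std_normal_distribution C * (LINT \<omega>|M. G \<omega>)"
proof -
  have [measurable]: "H \<in> borel_measurable M" using H by auto
  have Gi: "integrable M G" by (rule Bochner_Integration.integrable_bound[OF H]) (auto intro!: AE_I2 order_trans[OF GH])
  have iG: "integrable M (\<lambda>\<omega>. iexp (s * X \<omega>) * G \<omega>)" for s
    by (rule Bochner_Integration.integrable_bound[OF H]) (auto simp: norm_mult intro!: AE_I2 order_trans[OF GH])
  have iG': "integrable M (\<lambda>\<omega>. iexp (s * X \<omega>) * cnj (G \<omega>))" for s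
    using integrable_cnj[OF iG[of "- s"]] by (simp add: exp_cnj)
  have iH: "integrable M (\<lambda>\<omega>. iexp (s * X \<omega>) * of_real (H \<omega>))" for s
    by (rule Bochner_Integration.integrable_bound[OF H]) (auto simp: norm_mult intro: order_trans)
  have Hnn: "0 \<le> H \<omega>" for \<omega> using GH[of \<omega>] norm_ge_zero order_trans by blast
  \<comment> \<open>Conjugation changes the frequency \<open>s\<close> into \<open>- s\<close>. The
    Gaussian factor is even, so the conjugate of \<open>G\<close> factorises as well, and with it
    every \<open>Re (a * G)\<close>.\<close>
  have eqG': "(LINT \<omega>|M. iexp (s * X \<omega>) * cnj (G \<omega>)) = of_real (exp (- (s\<^sup>2) / 2)) * cnj (LINT \<omega>|M. G \<omega>)" for s
  proof -
    have "(LINT \<omega>|M. iexp (s * X \<omega>) * cnj (G \<omega>)) = (LINT \<omega>|M. cnj (iexp ((- s) * X \<omega>) * G \<omega>))"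
      by (intro Bochner_Integration.integral_cong) (auto simp: exp_cnj)
    also have "\<dots> = cnj (LINT \<omega>|M. iexp ((- s) * X \<omega>) * G \<omega>)"
      by (rule Bochner_Integration.integral_cnj)
    finally show ?thesis unfolding eqG by simp
  qed
  have *: "(LINT \<omega>|M. indicator C (X \<omega>) * (H \<omega> + F \<omega>)) = measure std_normal_distribution C * (LINT \<omega>|M. H \<omega> + F \<omega>)"
    and int: "integrable M F"
    if F: "F = (\<lambda>\<omega>. Re (a * G \<omega>))" and a: "cmod a = 1" for a F
  proof -
    show int: "integrable M F" unfolding F using Gi by simp
    have F2: "complex_of_real (F \<omega>) = (a * G \<omega> + cnj a * cnj (G \<omega>)) / 2" for \<omega>
      unfolding F using complex_add_cnj[of "a * G \<omega>"] by simp
    have nn: "0 \<le> H \<omega> + F \<omega>" for \<omega>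
    proof -
      have "\<bar>F \<omega>\<bar> \<le> cmod (a * G \<omega>)" unfolding F by (rule abs_Re_le_cmod)
      then show ?thesis using GH[of \<omega>] a by (simp add: norm_mult)
    qed
    have iF: "(LINT \<omega>|M. iexp (s * X \<omega>) * of_real (F \<omega>)) =
       of_real (exp (- (s\<^sup>2) / 2)) * of_real (LINT \<omega>|M. F \<omega>)" for s
    proof -
      have "(LINT \<omega>|M. iexp (s * X \<omega>) * of_real (F \<omega>)) =
          (LINT \<omega>|M. (a/2) * (iexp (s * X \<omega>) * G \<omega>) + (cnj a/2) * (iexp (s * X \<omega>) * cnj (G \<omega>)))"
        by (intro Bochner_Integration.integral_cong) (auto simp: F2 field_simps)
      also have "\<dots> = (a/2) * (LINT \<omega>|M. iexp (s * X \<omega>) * G \<omega>) + (cnj a/2) * (LINT \<omega>|M. iexp (s * X \<omega>) * cnj (G \<omega>))"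
        by (subst Bochner_Integration.integral_add) (use iG iG' in auto)
      also have "\<dots> = of_real (exp (- (s\<^sup>2) / 2)) * ((a * (LINT \<omega>|M. G \<omega>) + cnj (a * (LINT \<omega>|M. G \<omega>)))/2)"
        unfolding eqG eqG' by (simp add: field_simps)
      also have "(a * (LINT \<omega>|M. G \<omega>) + cnj (a * (LINT \<omega>|M. G \<omega>)))/2 = of_real (Re (a * (LINT \<omega>|M. G \<omega>)))"
        unfolding complex_add_cnj by simp
      also have "Re (a * (LINT \<omega>|M. G \<omega>)) = (LINT \<omega>|M. F \<omega>)"
      proof -
        have "(LINT \<omega>|M. F \<omega>) = Re (LINT \<omega>|M. a * G \<omega>)"
          unfolding F using Gi by (intro integral_Re) auto
        then show ?thesis by simp
      qed
      finally show ?thesis .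
    qed
    have iF': "integrable M (\<lambda>\<omega>. iexp (s * X \<omega>) * of_real (F \<omega>))" for s
      by (rule Bochner_Integration.integrable_bound[OF int]) (use int in \<open>auto simp: norm_mult\<close>)
    show "(LINT \<omega>|M. indicator C (X \<omega>) * (H \<omega> + F \<omega>)) = measure std_normal_distribution C * (LINT \<omega>|M. H \<omega> + F \<omega>)"
    proof (rule charfun_split_real)
      show "(LINT \<omega>|M. iexp (s * X \<omega>) * of_real (H \<omega> + F \<omega>)) =
       of_real (exp (- (s\<^sup>2) / 2)) * of_real (LINT \<omega>|M. H \<omega> + F \<omega>)" for s
        unfolding of_real_add distrib_left
        unfolding Bochner_Integration.integral_add[OF iH iF'] Bochner_Integration.integral_add[OF H int] eqH iF
        by (simp add: algebra_simps)
    qed (use H int nn in auto)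
  qed
  have ind: "integrable M (\<lambda>\<omega>. indicator C (X \<omega>) * f \<omega>)" if "integrable M f" for f :: "'a \<Rightarrow> real"
    by (rule Bochner_Integration.integrable_bound[OF that]) (use that in \<open>auto split: split_indicator\<close>)
  have indG: "integrable M (\<lambda>\<omega>. indicator C (X \<omega>) * G \<omega>)"
    by (rule Bochner_Integration.integrable_bound[OF Gi]) (auto split: split_indicator)
  have H0: "(LINT \<omega>|M. indicator C (X \<omega>) * H \<omega>) = measure std_normal_distribution C * (LINT \<omega>|M. H \<omega>)"
    by (rule charfun_split_real) (use H Hnn eqH in auto)
  have **: "(LINT \<omega>|M. indicator C (X \<omega>) * Re (a * G \<omega>)) = measure std_normal_distribution C * (LINT \<omega>|M. Re (a * G \<omega>))"
    if a: "cmod a = 1" for a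
  proof -
    note h = *[OF refl a] int[OF refl a]
    show ?thesis using h(1) H0 unfolding distrib_left
      by (subst (asm) Bochner_Integration.integral_add[OF ind[OF H] ind[OF h(2)]],
          subst (asm) Bochner_Integration.integral_add[OF H h(2)]) (simp add: algebra_simps)
  qed
  have r1: "Re (indicator C x * g) = indicator C x * Re g" "Im (indicator C x * g) = indicator C x * Im g" for x and g :: complex
    by (auto split: split_indicator)
  show ?thesis
  proof (rule complex_eqI)
    show "Re (LINT \<omega>|M. indicator C (X \<omega>) * G \<omega>) = Re (measure std_normal_distribution C * (LINT \<omega>|M. G \<omega>))"
      unfolding integral_Re[OF indG, symmetric] r1 using **[of 1] integral_Re[OF Gi] by simp
  next
    \<comment> \<open>For \<open>a\<close> equal to \<i> the real part of \<open>a * G\<close> is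
      minus the imaginary part of \<open>G\<close>, hence the signs.\<close>
    have "- Im (LINT \<omega>|M. indicator C (X \<omega>) * G \<omega>) = - Im (measure std_normal_distribution C * (LINT \<omega>|M. G \<omega>))"
      unfolding integral_Im[OF indG, symmetric] r1 using **[of \<i>] integral_Im[OF Gi] by simp
    then show "Im (LINT \<omega>|M. indicator C (X \<omega>) * G \<omega>) = Im (measure std_normal_distribution C * (LINT \<omega>|M. G \<omega>))"
      by simp
  qed
qed

section \<open>The countable product of standard normal laws\<close>

lemma sets_gauss_space: "sets gauss_space = sets (\<Pi>\<^sub>M n\<in>UNIV. borel)"
  unfolding gauss_space_def by (intro sets_PiM_cong) auto

lemma space_gauss_space [simp]: "space gauss_space = UNIV"
  by (simp add: sets_eq_imp_space_eq[OF sets_gauss_space] space_PiM PiE_UNIV_domain)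

lemma prob_space_std_normal: "prob_space std_normal_distribution"
  using real_dist_normal_dist real_distribution.axioms(1) by blast

interpretation gauss: prob_space gauss_space
  unfolding gauss_space_def by (intro prob_space_PiM prob_space_std_normal)

text \<open>Each induction step trades one exponential for an indicator:
  \<open>charfun_split\<close> is applied to the variable \<open>X k\<close>, the indicators already
  present form the bound \<open>H\<close>, and these together with the remaining exponentials form
  \<open>G\<close>. The frequencies are generalised in the induction because the factorisation at
  \<open>X k\<close> needs every frequency there. At \<open>k = N\<close> only indicators are
  left.\<close>

lemma (in prob_space) gaussian_cylinder:
  fixes X :: "nat \<Rightarrow> 'a \<Rightarrow> real"
  assumes X [measurable]: "\<And>n. X n \<in> borel_measurable M"
    and chr: "\<And>N s. (LINT \<omega>|M. iexp (\<Sum>n<N. s n * X n \<omega>)) = of_real (exp (- (\<Sum>n<N. (s n)\<^sup>2) / 2))"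
    and C [measurable]: "\<And>n. C n \<in> sets borel"
  shows "k \<le> N \<Longrightarrow> (LINT \<omega>|M. of_real (\<Prod>n<k. indicator (C n) (X n \<omega>)) * iexp (\<Sum>n\<in>{k..<N}. s n * X n \<omega>)) =
     complex_of_real ((\<Prod>n<k. measure std_normal_distribution (C n)) * exp (- (\<Sum>n\<in>{k..<N}. (s n)\<^sup>2) / 2))"
proof (induction k arbitrary: s N)
  case 0
  then show ?case using chr[of s N] by (simp add: atLeast0LessThan)
next
  case (Suc k)
  define H where "H \<omega> = (\<Prod>n<k. indicator (C n) (X n \<omega>) :: real)" for \<omega>
  define G where "G \<omega> = of_real (H \<omega>) * iexp (\<Sum>n\<in>{Suc k..<N}. s n * X n \<omega>)" for \<omega>
  have H01: "0 \<le> H \<omega> \<and> H \<omega> \<le> 1" for \<omega>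
    unfolding H_def by (intro conjI prod_nonneg prod_le_1) auto
  have [measurable]: "H \<in> borel_measurable M" "G \<in> borel_measurable M"
    unfolding H_def[abs_def] G_def[abs_def] by measurable
  have Hi: "integrable M H"
    by (rule integrable_const_bound[of _ 1]) (use H01 in auto)
  have split: "{k..<N} = insert k {Suc k..<N}" using Suc.prems by auto
  \<comment> \<open>The induction hypothesis with the k-th frequency replaced by \<open>t\<close>
    gives the dependence on \<open>t\<close>; \<open>t = 0\<close> then gives the mean of
    \<open>G\<close>.\<close>
  have eq1: "(LINT \<omega>|M. iexp (t * X k \<omega>) * G \<omega>) =
      of_real ((\<Prod>n<k. measure std_normal_distribution (C n)) * exp (- (t\<^sup>2 + (\<Sum>n\<in>{Suc k..<N}. (s n)\<^sup>2)) / 2))" for t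
  proof -
    have "iexp (t * X k \<omega>) * G \<omega> = of_real (H \<omega>) * iexp (\<Sum>n\<in>{k..<N}. (s(k:=t)) n * X n \<omega>)" for \<omega>
    proof -
      have "(\<Sum>n\<in>{k..<N}. (s(k:=t)) n * X n \<omega>) = t * X k \<omega> + (\<Sum>n\<in>{Suc k..<N}. s n * X n \<omega>)"
        unfolding split by (subst sum.insert) (auto intro!: sum.cong)
      then show ?thesis unfolding G_def by (simp only: of_real_add distrib_left exp_add mult_ac)
    qed
    then have "(LINT \<omega>|M. iexp (t * X k \<omega>) * G \<omega>) = of_real ((\<Prod>n<k. measure std_normal_distribution (C n)) * exp (- (\<Sum>n\<in>{k..<N}. ((s(k:=t)) n)\<^sup>2) / 2))"
      using Suc.IH[of N "s(k:=t)"] Suc.prems by (simp add: H_def)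
    also have "(\<Sum>n\<in>{k..<N}. ((s(k:=t)) n)\<^sup>2) = t\<^sup>2 + (\<Sum>n\<in>{Suc k..<N}. (s n)\<^sup>2)"
      unfolding split by (subst sum.insert) (auto intro!: sum.cong)
    finally show ?thesis .
  qed
  have eqH: "(LINT \<omega>|M. iexp (t * X k \<omega>) * of_real (H \<omega>)) =
      of_real ((\<Prod>n<k. measure std_normal_distribution (C n)) * exp (- (t\<^sup>2) / 2))" for t
    using Suc.IH[of "Suc k" "\<lambda>_. t"] by (simp add: H_def mult.commute)
  have e0: "complex_of_real (LINT \<omega>|M. H \<omega>) = of_real (\<Prod>n<k. measure std_normal_distribution (C n))"
    using eqH[of 0] by simp
  have "(LINT \<omega>|M. indicator (C k) (X k \<omega>) * G \<omega>) = measure std_normal_distribution (C k) * (LINT \<omega>|M. G \<omega>)"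
  proof (rule charfun_split[OF X C Hi])
    show "cmod (G \<omega>) \<le> H \<omega>" for \<omega> using H01[of \<omega>] unfolding G_def by (simp add: norm_mult)
    show "(LINT \<omega>|M. iexp (t * X k \<omega>) * of_real (H \<omega>)) = of_real (exp (- (t\<^sup>2) / 2)) * of_real (LINT \<omega>|M. H \<omega>)" for t
      unfolding eqH e0 by simp
    have "(LINT \<omega>|M. G \<omega>) = of_real ((\<Prod>n<k. measure std_normal_distribution (C n)) * exp (- ((\<Sum>n\<in>{Suc k..<N}. (s n)\<^sup>2)) / 2))"
      using eq1[of 0] by simp
    note Gint = this
    show "(LINT \<omega>|M. iexp (t * X k \<omega>) * G \<omega>) = of_real (exp (- (t\<^sup>2) / 2)) * (LINT \<omega>|M. G \<omega>)" for t
    proof -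
      have "exp (- (t\<^sup>2 + (\<Sum>n\<in>{Suc k..<N}. (s n)\<^sup>2)) / 2) = exp (- (t\<^sup>2) / 2) * exp (- (\<Sum>n\<in>{Suc k..<N}. (s n)\<^sup>2) / 2)"
        by (simp add: exp_add[symmetric] add_divide_distrib diff_divide_distrib)
      then show ?thesis unfolding eq1 Gint by (simp only: of_real_mult mult_ac)
    qed
  qed auto
  moreover have "indicator (C k) (X k \<omega>) * G \<omega> = of_real (\<Prod>n<Suc k. indicator (C n) (X n \<omega>)) * iexp (\<Sum>n\<in>{Suc k..<N}. s n * X n \<omega>)" for \<omega>
    unfolding G_def H_def by (simp split: split_indicator)
  ultimately show ?case using eq1[of 0] by (simp add: mult_ac)
qed

text \<open>Cylinder sets generate the product \<sigma>-algebra, and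
  \<open>gaussian_cylinder\<close> with all exponentials traded gives their probabilities. It is
  applied twice: to the image of the Gaussian measure under a second quantisation, and to the
  Gaussian measure conditioned on an event.\<close>

lemma (in prob_space) distr_gauss_spaceI:
  fixes X :: "nat \<Rightarrow> 'a \<Rightarrow> real"
  assumes X [measurable]: "\<And>n. X n \<in> borel_measurable M"
    and chr: "\<And>N s. (LINT \<omega>|M. iexp (\<Sum>n<N. s n * X n \<omega>)) = of_real (exp (- (\<Sum>n<N. (s n)\<^sup>2) / 2))"
  shows "distr M gauss_space (\<lambda>\<omega> n. X n \<omega>) = gauss_space"
proof -
  have meas: "(\<lambda>\<omega> n. X n \<omega>) \<in> measurable M gauss_space"
    unfolding measurable_cong_sets[OF refl sets_gauss_space]
    by (rule measurable_PiM_single') auto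
  interpret D: prob_space "distr M gauss_space (\<lambda>\<omega> n. X n \<omega>)" by (rule prob_space_distr) fact
  interpret P: product_prob_space "\<lambda>_::nat. std_normal_distribution" UNIV
    by (intro product_prob_spaceI prob_space_std_normal)
  show ?thesis
  proof (rule measure_eqI_PiM_infinite)
    fix A and J :: "nat set"
    assume J: "finite J" and A: "\<And>i. i \<in> J \<Longrightarrow> A i \<in> sets std_normal_distribution"
    \<comment> \<open>Filling up with \<open>UNIV\<close> replaces the index set \<open>J\<close> by
      an initial segment, the shape in which the cylinder formula is available.\<close>
    define C where "C n = (if n \<in> J then A n else UNIV)" for n
    have [measurable]: "C n \<in> sets borel" for n using A by (auto simp: C_def)
    obtain k where k: "J \<subseteq> {..<k}" using J finite_nat_iff_bounded by auto
    have emb: "prod_emb UNIV (\<lambda>_. std_normal_distribution) J (Pi\<^sub>E J A) = prod_emb UNIV (\<lambda>_. std_normal_distribution) {..<k} (Pi\<^sub>E {..<k} C)"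
      using k by (auto simp: prod_emb_def C_def restrict_def PiE_def Pi_def extensional_def)
    let ?E = "{\<omega>. \<forall>n<k. \<omega> n \<in> C n}"
    have E: "prod_emb UNIV (\<lambda>_. std_normal_distribution) {..<k} (Pi\<^sub>E {..<k} C) = ?E"
      by (auto simp: prod_emb_def restrict_def PiE_def Pi_def extensional_def)
    have "?E \<in> sets gauss_space"
      unfolding E[symmetric] gauss_space_def by (intro sets_PiM_I) auto
    have "measure (distr M gauss_space (\<lambda>\<omega> n. X n \<omega>)) ?E = (LINT x|distr M gauss_space (\<lambda>\<omega> n. X n \<omega>). indicator ?E x)"
      by simp
    also have "\<dots> = (LINT \<omega>|M. indicator ?E (\<lambda>n. X n \<omega>))"
      by (rule integral_distr[OF meas borel_measurable_indicator]) fact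
    also have "\<dots> = (LINT \<omega>|M. (\<Prod>n<k. indicator (C n) (X n \<omega>)))"
      by (intro Bochner_Integration.integral_cong) (auto simp: indicator_def)
    also have "\<dots> = (\<Prod>n<k. measure std_normal_distribution (C n))"
    proof -
      have "(LINT \<omega>|M. complex_of_real (\<Prod>n<k. indicator (C n) (X n \<omega>))) = of_real (\<Prod>n<k. measure std_normal_distribution (C n))"
        using gaussian_cylinder[of X C k k, OF X chr] by simp
      then show ?thesis by (simp only: integral_complex_of_real of_real_eq_iff)
    qed
    finally have m: "measure (distr M gauss_space (\<lambda>\<omega> n. X n \<omega>)) ?E = (\<Prod>n<k. measure std_normal_distribution (C n))" .
    have "emeasure gauss_space ?E = (\<Prod>n<k. emeasure std_normal_distribution (C n))"
      unfolding E[symmetric] gauss_space_def by (subst P.emeasure_PiM_emb) auto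
    also have "\<dots> = ennreal (\<Prod>n<k. measure std_normal_distribution (C n))"
      by (simp add: finite_measure.emeasure_eq_measure[OF prob_space.finite_measure[OF prob_space_std_normal]] prod_ennreal)
    finally show "emeasure (distr M gauss_space (\<lambda>\<omega> n. X n \<omega>)) (prod_emb UNIV (\<lambda>_. std_normal_distribution) J (Pi\<^sub>E J A)) =
      emeasure gauss_space (prod_emb UNIV (\<lambda>_. std_normal_distribution) J (Pi\<^sub>E J A))"
      unfolding emb E D.emeasure_eq_measure m by simp
  next
    show "finite_measure (distr M gauss_space (\<lambda>\<omega> n. X n \<omega>))" by unfold_locales
  qed (simp_all add: gauss_space_def)
qed

section \<open>Gaussian integrals of Hilbert space vectors\<close>

lemma coord_measurable: "(\<lambda>\<omega>. \<omega> n) \<in> borel_measurable gauss_space"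
  unfolding measurable_cong_sets[OF sets_gauss_space refl] by measurable

lemma coord_sum_measurable [measurable]: "(\<lambda>\<omega>. \<Sum>n\<in>F. \<omega> n * a n) \<in> borel_measurable gauss_space"
  by (intro borel_measurable_sum borel_measurable_times coord_measurable borel_measurable_const)

lemma distr_coord: "distr gauss_space borel (\<lambda>\<omega>. \<omega> n) = std_normal_distribution"
proof -
  interpret P: product_prob_space "\<lambda>_::nat. std_normal_distribution" UNIV
    by (intro product_prob_spaceI prob_space_std_normal)
  have "distr gauss_space std_normal_distribution (\<lambda>\<omega>. \<omega> n) = std_normal_distribution"
    unfolding gauss_space_def by (rule P.PiM_component) simp
  moreover have "distr gauss_space std_normal_distribution (\<lambda>\<omega>. \<omega> n) = distr gauss_space borel (\<lambda>\<omega>. \<omega> n)"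
    by (intro distr_cong) auto
  ultimately show ?thesis by simp
qed

lemma indep_coords: "gauss.indep_vars (\<lambda>_. borel) (\<lambda>n \<omega>. \<omega> n) UNIV"
proof (subst gauss.indep_vars_iff_distr_eq_PiM)
  have "distr gauss_space (\<Pi>\<^sub>M i\<in>UNIV. borel) (\<lambda>x. \<lambda>i\<in>UNIV. x i) = distr gauss_space gauss_space (\<lambda>x. x)"
    by (intro distr_cong) (auto simp: sets_gauss_space)
  also have "\<dots> = gauss_space" by (rule distr_id)
  also have "\<dots> = (\<Pi>\<^sub>M i\<in>UNIV. distr gauss_space borel (\<lambda>\<omega>. \<omega> i))"
    unfolding distr_coord by (simp add: gauss_space_def)
  finally show "distr gauss_space (Pi\<^sub>M UNIV (\<lambda>_. borel)) (\<lambda>x. \<lambda>i\<in>UNIV. x i) =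
    (\<Pi>\<^sub>M i\<in>UNIV. distr gauss_space borel (\<lambda>x. x i))" .
qed (auto intro: coord_measurable)

lemma coord_moments:
  shows coord_integrable: "integrable gauss_space (\<lambda>\<omega>. \<omega> n)"
    and coord_mean: "(LINT \<omega>|gauss_space. \<omega> n) = 0"
    and coord_sq_integrable: "integrable gauss_space (\<lambda>\<omega>. (\<omega> n)\<^sup>2)"
    and coord_sq: "(LINT \<omega>|gauss_space. (\<omega> n)\<^sup>2) = 1"
proof -
  have i: "integrable (distr gauss_space borel (\<lambda>\<omega>. \<omega> n)) (\<lambda>x. x ^ k)" for k
    unfolding distr_coord by (rule integrable_std_normal_distribution_moment)
  show "integrable gauss_space (\<lambda>\<omega>. \<omega> n)" using i[of 1] by (subst (asm) integrable_distr_eq) (auto intro: coord_measurable)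
  show "integrable gauss_space (\<lambda>\<omega>. (\<omega> n)\<^sup>2)" using i[of 2] by (subst (asm) integrable_distr_eq) (auto intro: coord_measurable)
  have "(LINT \<omega>|gauss_space. (\<omega> n) ^ k) = (LINT x|std_normal_distribution. x ^ k)" for k
    unfolding distr_coord[of n, symmetric] by (subst integral_distr) (auto intro: coord_measurable)
  from this[of 1] this[of 2] show "(LINT \<omega>|gauss_space. \<omega> n) = 0" "(LINT \<omega>|gauss_space. (\<omega> n)\<^sup>2) = 1"
    using integral_std_normal_distribution_moment_odd[of 1] std_normal_distribution_even_moments(1)[of 1]
    by (simp_all add: fact_numeral)
qed

lemma coord_prod:
  assumes "n \<noteq> m"
  shows "integrable gauss_space (\<lambda>\<omega>. \<omega> n * \<omega> m)" "(LINT \<omega>|gauss_space. \<omega> n * \<omega> m) = 0"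
proof -
  have ind: "gauss.indep_var borel (\<lambda>\<omega>. \<omega> n) borel (\<lambda>\<omega>. \<omega> m)"
    using gauss.indep_vars_sum[of "{m}" n "\<lambda>n \<omega>. \<omega> n"] gauss.indep_vars_subset[OF indep_coords] assms by simp
  show "integrable gauss_space (\<lambda>\<omega>. \<omega> n * \<omega> m)"
    by (rule gauss.indep_var_integrable[OF ind coord_integrable coord_integrable])
  show "(LINT \<omega>|gauss_space. \<omega> n * \<omega> m) = 0"
    using gauss.indep_var_lebesgue_integral[OF ind coord_integrable coord_integrable] by (simp add: coord_mean)
qed

lemma coord_sum_sq:
  fixes a :: "nat \<Rightarrow> real"
  assumes "finite F"
  shows "(\<integral>\<^sup>+\<omega>. ennreal ((\<Sum>n\<in>F. \<omega> n * a n)\<^sup>2) \<partial>gauss_space) = ennreal (\<Sum>n\<in>F. (a n)\<^sup>2)"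
proof -
  have eq: "(\<Sum>n\<in>F. \<omega> n * a n)\<^sup>2 = (\<Sum>n\<in>F. \<Sum>m\<in>F. (a n * a m) * (\<omega> n * \<omega> m))" for \<omega> :: "nat \<Rightarrow> real"
    unfolding power2_eq_square sum_product by (simp add: mult_ac)
  have i: "integrable gauss_space (\<lambda>\<omega>. \<omega> n * \<omega> m)" for n m :: nat
    using coord_prod(1)[of n m] coord_sq_integrable[of n] by (cases "n = m") (auto simp: power2_eq_square)
  have v: "(LINT \<omega>|gauss_space. \<omega> n * \<omega> m) = (if n = m then 1 else 0)" for n m :: nat
    using coord_prod(2)[of n m] coord_sq[of n] by (cases "n = m") (auto simp: power2_eq_square)
  have int: "integrable gauss_space (\<lambda>\<omega>. (\<Sum>n\<in>F. \<omega> n * a n)\<^sup>2)"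
    unfolding eq by (intro Bochner_Integration.integrable_sum integrable_mult_right i)
  have "(LINT \<omega>|gauss_space. (\<Sum>n\<in>F. \<omega> n * a n)\<^sup>2) = (\<Sum>n\<in>F. \<Sum>m\<in>F. (a n * a m) * (if n = m then 1 else 0))"
    unfolding eq
    by (subst Bochner_Integration.integral_sum, intro Bochner_Integration.integrable_sum integrable_mult_right i,
        intro sum.cong refl, subst Bochner_Integration.integral_sum)
       (auto intro!: integrable_mult_right i sum.cong simp: v)
  also have "\<dots> = (\<Sum>n\<in>F. (a n)\<^sup>2)"
    using assms by (simp add: if_distrib sum.delta power2_eq_square cong: if_cong)
  finally show ?thesis
    using int by (subst nn_integral_eq_integral) auto
qed

lemma gauss_iexp_integrable:
  assumes [measurable]: "X \<in> borel_measurable gauss_space"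
  shows "integrable gauss_space (\<lambda>\<omega>. iexp (X \<omega>))"
  by (rule gauss.integrable_const_bound[of _ 1]) auto

lemma coord_sum_char:
  fixes a :: "nat \<Rightarrow> real"
  shows "(LINT \<omega>|gauss_space. iexp (\<Sum>n<N. \<omega> n * a n)) = of_real (exp (- (\<Sum>n<N. (a n)\<^sup>2) / 2))"
proof -
  have "(LINT \<omega>|gauss_space. iexp (\<Sum>n<N. \<omega> n * a n)) = (LINT \<omega>|gauss_space. (\<Prod>n<N. iexp (\<omega> n * a n)))"
    by (intro Bochner_Integration.integral_cong refl) (simp add: exp_sum sum_distrib_left)
  also have "\<dots> = (\<Prod>n<N. LINT \<omega>|gauss_space. iexp (\<omega> n * a n))"
  proof (rule gauss.indep_vars_lebesgue_integral)
    show "gauss.indep_vars (\<lambda>_. borel) (\<lambda>n \<omega>. iexp (\<omega> n * a n)) {..<N}"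
      by (rule gauss.indep_vars_compose2[OF gauss.indep_vars_subset[OF indep_coords]]) auto
    show "integrable gauss_space (\<lambda>\<omega>. iexp (\<omega> n * a n))" for n
      by (intro gauss_iexp_integrable borel_measurable_times coord_measurable borel_measurable_const)
  qed auto
  also have "\<dots> = (\<Prod>n<N. of_real (exp (- (a n)\<^sup>2 / 2)))"
  proof (intro prod.cong refl)
    fix n
    have "(LINT \<omega>|gauss_space. iexp (\<omega> n * a n)) = char (distr gauss_space borel (\<lambda>\<omega>. \<omega> n)) (a n)"
      unfolding char_def by (subst integral_distr) (auto simp: mult.commute intro: coord_measurable)
    also have "\<dots> = of_real (exp (- (a n)\<^sup>2 / 2))"
      unfolding distr_coord char_std_normal_distribution by simp
    finally show "(LINT \<omega>|gauss_space. iexp (\<omega> n * a n)) = of_real (exp (- (a n)\<^sup>2 / 2))" .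
  qed
  also have "\<dots> = of_real (exp (- (\<Sum>n<N. (a n)\<^sup>2) / 2))"
    by (simp add: exp_sum[symmetric] sum_negf sum_divide_distrib flip: of_real_prod)
  finally show ?thesis .
qed

section \<open>Orthonormal expansions and the white noise integral\<close>

lemma orthonormal_basis_inner_sum:
  assumes "orthonormal_basis e"
  shows "(\<Sum>n<N. a n *\<^sub>R e n) \<bullet> (\<Sum>n<N. b n *\<^sub>R e n) = (\<Sum>n<N. a n * b n)"
proof -
  have ee: "e m \<bullet> e n = (if m = n then 1 else 0)" for m n using assms by (auto simp: orthonormal_basis_def)
  have "(\<Sum>n<N. a n *\<^sub>R e n) \<bullet> (\<Sum>n<N. b n *\<^sub>R e n) = (\<Sum>n<N. a n *\<^sub>R e n \<bullet> (\<Sum>m<N. b m *\<^sub>R e m))"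
    by (rule inner_sum_left)
  also have "\<dots> = (\<Sum>n<N. \<Sum>m<N. a n * b m * (if n = m then 1 else 0))"
    by (simp add: inner_sum_right ee mult_ac sum_distrib_left)
  finally have "(\<Sum>n<N. a n *\<^sub>R e n) \<bullet> (\<Sum>n<N. b n *\<^sub>R e n) = (\<Sum>n<N. \<Sum>m<N. a n * b m * (if n = m then 1 else 0))" .
  then show ?thesis by (simp add: if_distrib sum.delta cong: if_cong)
qed

text \<open>The error \<open>x - P N x\<close> is never longer than \<open>x\<close>, and on the
  span of the basis it vanishes from some \<open>N\<close> on. Density of the span then gives
  convergence everywhere, and the Pythagorean identity \<open>d\<close> turns this into the sum of
  squares.\<close>

lemma parseval_sums:
  fixes e :: "nat \<Rightarrow> 'h::{real_inner,complete_space}"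
  assumes e: "orthonormal_basis e"
  shows "(\<lambda>n. (h \<bullet> e n)\<^sup>2) sums (norm h)\<^sup>2"
proof -
  define P where "P N x = (\<Sum>n<N. (x \<bullet> e n) *\<^sub>R e n)" for N x
  have ee: "e m \<bullet> e n = (if m = n then 1 else 0)" for m n using e by (auto simp: orthonormal_basis_def)
  have Pin: "P N x \<bullet> x = (\<Sum>n<N. (x \<bullet> e n)\<^sup>2)" for N x
    unfolding P_def inner_sum_left by (simp add: power2_eq_square inner_commute[of "e _" x])
  have PP: "P N x \<bullet> P N x = (\<Sum>n<N. (x \<bullet> e n)\<^sup>2)" for N x
    unfolding P_def using orthonormal_basis_inner_sum[OF e] by (simp add: power2_eq_square)
  have d: "(norm (x - P N x))\<^sup>2 = (norm x)\<^sup>2 - (\<Sum>n<N. (x \<bullet> e n)\<^sup>2)" for N x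
  proof -
    have "(x - p) \<bullet> (x - p) = x \<bullet> x - 2 * (p \<bullet> x) + p \<bullet> p" for p
      by (simp add: inner_diff_left inner_diff_right inner_commute[of x p])
    from this[of "P N x"] show ?thesis
      unfolding power2_norm_eq_inner Pin PP by simp
  qed
  have dle: "norm (x - P N x) \<le> norm x" for N x
  proof (rule power2_le_imp_le)
    show "(norm (x - P N x))\<^sup>2 \<le> (norm x)\<^sup>2" unfolding d by (simp add: sum_nonneg)
  qed simp
  have Padd: "P N (x + y) = P N x + P N y" for N x y
    unfolding P_def by (simp add: inner_add_left scaleR_add_left sum.distrib)
  have Pdiff: "P N (x - y) = P N x - P N y" for N x y
    unfolding P_def by (simp add: inner_diff_left scaleR_diff_left sum_subtractf)
  have Pscale: "P N (c *\<^sub>R x) = c *\<^sub>R P N x" for N c x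
    unfolding P_def by (simp add: scaleR_sum_right)
  have fin: "\<exists>N. \<forall>M\<ge>N. P M x = x" if "x \<in> span (range e)" for x
    using that
  proof (induction rule: span_induct_alt)
    case base
    then show ?case by (simp add: P_def)
  next
    case (step c x y)
    then obtain k N where k: "x = e k" and N: "\<forall>M\<ge>N. P M y = y" by auto
    have "P M x = x" if "M \<ge> Suc k" for M
      using that unfolding P_def k by (simp add: ee if_distrib[of "\<lambda>c. c *\<^sub>R _"] sum.delta cong: if_cong)
    with N show ?case by (intro exI[of _ "max N (Suc k)"]) (auto simp: Padd Pscale)
  qed
  have lim: "(\<lambda>N. \<Sum>n<N. (h \<bullet> e n) *\<^sub>R e n) \<longlonglongrightarrow> h"
    unfolding P_def[symmetric]
  proof (rule metric_LIMSEQ_I)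
    fix r :: real assume "r > 0"
    have "h \<in> closure (span (range e))" using e by (auto simp: orthonormal_basis_def)
    then obtain x where x: "x \<in> span (range e)" "dist x h < r"
      using \<open>r > 0\<close> closure_approachable by blast
    obtain N where N: "\<forall>M\<ge>N. P M x = x" using fin[OF x(1)] by auto
    have "dist (P M h) h < r" if "M \<ge> N" for M
    proof -
      \<comment> \<open>As \<open>P M x = x\<close>, the error at \<open>h\<close> is the error at
        \<open>h - x\<close>, which is no longer than \<open>h - x\<close> itself.\<close>
      have "h - P M h = (h - x) - P M (h - x)" using N that by (simp add: Pdiff)
      then have "norm (h - P M h) = norm ((h - x) - P M (h - x))" by (rule arg_cong)
      also have "\<dots> \<le> norm (h - x)" by (rule dle)
      finally have "norm (h - P M h) \<le> norm (h - x)" .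
      then show ?thesis using x(2) by (simp add: dist_norm norm_minus_commute)
    qed
    then show "\<exists>N. \<forall>M\<ge>N. dist (P M h) h < r" by blast
  qed
  have "(\<lambda>N. (norm h)\<^sup>2 - (norm (h - P N h))\<^sup>2) \<longlonglongrightarrow> (norm h)\<^sup>2 - (norm (h - h))\<^sup>2"
    using lim unfolding P_def[symmetric] by (intro tendsto_intros)
  then show "(\<lambda>n. (h \<bullet> e n)\<^sup>2) sums (norm h)\<^sup>2"
    unfolding sums_def d by simp
qed

lemma white_noise_integral_measurable:
  "is_white_noise_integral e h X \<Longrightarrow> X \<in> borel_measurable gauss_space"
  by (simp add: is_white_noise_integral_def)

lemma sq_add_le: "(x + y)\<^sup>2 \<le> 2 * x\<^sup>2 + 2 * (y::real)\<^sup>2"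
  using sum_squares_bound[of x y] by (simp add: power2_sum)

text \<open>A crude form of Minkowski's inequality in \<open>ennreal\<close>, so no integrability
  has to be known in advance. Its factor 2 is harmless because it serves only for limits at 0 and
  for bounds up to a constant.\<close>

lemma nn_sq_add_le:
  assumes [measurable]: "f \<in> borel_measurable M" "g \<in> borel_measurable M"
  shows "(\<integral>\<^sup>+x. ennreal ((f x + g x)\<^sup>2) \<partial>M) \<le> 2 * (\<integral>\<^sup>+x. ennreal ((f x)\<^sup>2) \<partial>M) + 2 * (\<integral>\<^sup>+x. ennreal ((g x)\<^sup>2) \<partial>M)"
proof -
  have "(\<integral>\<^sup>+x. ennreal ((f x + g x)\<^sup>2) \<partial>M) \<le> (\<integral>\<^sup>+x. 2 * ennreal ((f x)\<^sup>2) + 2 * ennreal ((g x)\<^sup>2) \<partial>M)"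
  proof (intro nn_integral_mono)
    fix x
    have "ennreal ((f x + g x)\<^sup>2) \<le> ennreal (2 * (f x)\<^sup>2 + 2 * (g x)\<^sup>2)"
      by (intro ennreal_leI sq_add_le)
    then show "ennreal ((f x + g x)\<^sup>2) \<le> 2 * ennreal ((f x)\<^sup>2) + 2 * ennreal ((g x)\<^sup>2)"
      by (simp add: ennreal_plus ennreal_mult)
  qed
  also have "\<dots> = 2 * (\<integral>\<^sup>+x. ennreal ((f x)\<^sup>2) \<partial>M) + 2 * (\<integral>\<^sup>+x. ennreal ((g x)\<^sup>2) \<partial>M)"
    by (simp add: nn_integral_add nn_integral_cmult)
  finally show ?thesis .
qed

lemma nn_sq_scale:
  assumes [measurable]: "f \<in> borel_measurable M"
  shows "(\<integral>\<^sup>+x. ennreal ((c * f x)\<^sup>2) \<partial>M) = ennreal (c\<^sup>2) * (\<integral>\<^sup>+x. ennreal ((f x)\<^sup>2) \<partial>M)"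
  unfolding power_mult_distrib by (subst ennreal_mult) (auto intro!: nn_integral_cmult)

lemma white_noise_integral_linear:
  assumes X: "is_white_noise_integral e h X" and Y: "is_white_noise_integral e g Y"
  shows "is_white_noise_integral e (a *\<^sub>R h + b *\<^sub>R g) (\<lambda>\<omega>. a * X \<omega> + b * Y \<omega>)"
proof -
  note [measurable] = white_noise_integral_measurable[OF X] white_noise_integral_measurable[OF Y]
  let ?S = "\<lambda>h N \<omega>. \<Sum>n<N. \<omega> n * (h \<bullet> e n)"
  let ?I = "\<lambda>f. \<integral>\<^sup>+\<omega>. ennreal ((f \<omega>)\<^sup>2) \<partial>gauss_space"
  have lim: "(\<lambda>N. 2 * (ennreal (a\<^sup>2) * ?I (\<lambda>\<omega>. ?S h N \<omega> - X \<omega>)) + 2 * (ennreal (b\<^sup>2) * ?I (\<lambda>\<omega>. ?S g N \<omega> - Y \<omega>))) \<longlonglongrightarrow> 2 * (ennreal (a\<^sup>2) * 0) + 2 * (ennreal (b\<^sup>2) * 0)"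
    using X Y unfolding is_white_noise_integral_def
    by (intro tendsto_add ennreal_tendsto_cmult) auto
  have "(\<lambda>N. ?I (\<lambda>\<omega>. ?S (a *\<^sub>R h + b *\<^sub>R g) N \<omega> - (a * X \<omega> + b * Y \<omega>))) \<longlonglongrightarrow> 0"
  proof (rule tendsto_sandwich[OF _ _ tendsto_const])
    show "(\<lambda>N. 2 * (ennreal (a\<^sup>2) * ?I (\<lambda>\<omega>. ?S h N \<omega> - X \<omega>)) + 2 * (ennreal (b\<^sup>2) * ?I (\<lambda>\<omega>. ?S g N \<omega> - Y \<omega>))) \<longlonglongrightarrow> 0"
      using lim by simp
    have "?I (\<lambda>\<omega>. ?S (a *\<^sub>R h + b *\<^sub>R g) N \<omega> - (a * X \<omega> + b * Y \<omega>)) \<le> 2 * (ennreal (a\<^sup>2) * ?I (\<lambda>\<omega>. ?S h N \<omega> - X \<omega>)) + 2 * (ennreal (b\<^sup>2) * ?I (\<lambda>\<omega>. ?S g N \<omega> - Y \<omega>))" for N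
    proof -
      have "?S (a *\<^sub>R h + b *\<^sub>R g) N \<omega> - (a * X \<omega> + b * Y \<omega>) = a * (?S h N \<omega> - X \<omega>) + b * (?S g N \<omega> - Y \<omega>)" for \<omega>
        by (simp add: inner_add_left algebra_simps sum.distrib sum_distrib_left)
      then have "?I (\<lambda>\<omega>. ?S (a *\<^sub>R h + b *\<^sub>R g) N \<omega> - (a * X \<omega> + b * Y \<omega>)) \<le>
         2 * ?I (\<lambda>\<omega>. a * (?S h N \<omega> - X \<omega>)) + 2 * ?I (\<lambda>\<omega>. b * (?S g N \<omega> - Y \<omega>))"
        by (simp only:) (rule nn_sq_add_le; measurable)
      also have "?I (\<lambda>\<omega>. a * (?S h N \<omega> - X \<omega>)) = ennreal (a\<^sup>2) * ?I (\<lambda>\<omega>. ?S h N \<omega> - X \<omega>)"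
        by (rule nn_sq_scale) measurable
      also have "?I (\<lambda>\<omega>. b * (?S g N \<omega> - Y \<omega>)) = ennreal (b\<^sup>2) * ?I (\<lambda>\<omega>. ?S g N \<omega> - Y \<omega>)"
        by (rule nn_sq_scale) measurable
      finally show ?thesis .
    qed
    then show "\<forall>\<^sub>F N in sequentially. ?I (\<lambda>\<omega>. ?S (a *\<^sub>R h + b *\<^sub>R g) N \<omega> - (a * X \<omega> + b * Y \<omega>)) \<le> 2 * (ennreal (a\<^sup>2) * ?I (\<lambda>\<omega>. ?S h N \<omega> - X \<omega>)) + 2 * (ennreal (b\<^sup>2) * ?I (\<lambda>\<omega>. ?S g N \<omega> - Y \<omega>))"
      by simp
  qed auto
  then show ?thesis unfolding is_white_noise_integral_def by auto
qed

lemma white_noise_integral_coord: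
  assumes "orthonormal_basis e"
  shows "is_white_noise_integral e (e k) (\<lambda>\<omega>. \<omega> k)"
proof -
  have "\<forall>\<^sub>F N in sequentially. (\<integral>\<^sup>+\<omega>. ennreal (((\<Sum>n<N. \<omega> n * (e k \<bullet> e n)) - \<omega> k)\<^sup>2) \<partial>gauss_space) = 0"
    using eventually_gt_at_top[of k]
  proof eventually_elim
    case (elim N)
    have "(\<Sum>n<N. \<omega> n * (e k \<bullet> e n)) = \<omega> k" for \<omega> :: "nat \<Rightarrow> real"
    proof -
      have "e k \<bullet> e n = (if k = n then 1 else 0)" for n using assms by (auto simp: orthonormal_basis_def)
      then have "(\<Sum>n<N. \<omega> n * (e k \<bullet> e n)) = (\<Sum>n<N. if k = n then \<omega> n else 0)"
        by (intro sum.cong) auto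
      then show ?thesis using elim by simp
    qed
    then show ?case by simp
  qed
  then show ?thesis
    unfolding is_white_noise_integral_def by (auto intro: tendsto_eventually coord_measurable)
qed

lemma white_noise_integral_zero: "is_white_noise_integral e 0 (\<lambda>_. 0)"
  unfolding is_white_noise_integral_def by simp

lemma white_noise_integral_sum:
  assumes "\<And>n. n < (N::nat) \<Longrightarrow> is_white_noise_integral e (h n) (X n)"
  shows "is_white_noise_integral e (\<Sum>n<N. s n *\<^sub>R h n) (\<lambda>\<omega>. \<Sum>n<N. s n * X n \<omega>)"
  using assms
proof (induction N)
  case 0
  then show ?case by (simp add: white_noise_integral_zero)
next
  case (Suc N)
  then show ?case
    using white_noise_integral_linear[of e "\<Sum>n<N. s n *\<^sub>R h n" "\<lambda>\<omega>. \<Sum>n<N. s n * X n \<omega>" "h N" "X N" 1 "s N"] by simp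
qed

text \<open>The factor 2 is inherited from \<open>nn_sq_add_le\<close>; the second moment itself is
  \<open>(norm h)\<^sup>2\<close>. The bound serves as continuity of the integral in
  \<open>h\<close>, for which the constant does not matter.\<close>

lemma white_noise_integral_norm:
  assumes e: "orthonormal_basis e" and X: "is_white_noise_integral e h X"
  shows "(\<integral>\<^sup>+\<omega>. ennreal ((X \<omega>)\<^sup>2) \<partial>gauss_space) \<le> ennreal (2 * (norm h)\<^sup>2)"
proof -
  note [measurable] = white_noise_integral_measurable[OF X]
  let ?S = "\<lambda>h N \<omega>. \<Sum>n<N. \<omega> n * (h \<bullet> e n)"
  let ?I = "\<lambda>f. \<integral>\<^sup>+\<omega>. ennreal ((f \<omega>)\<^sup>2) \<partial>gauss_space"
  have "?I X \<le> 2 * ?I (\<lambda>\<omega>. ?S h N \<omega> - X \<omega>) + ennreal (2 * (norm h)\<^sup>2)" for N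
  proof -
    have "?I (\<lambda>\<omega>. X \<omega> - ?S h N \<omega> + ?S h N \<omega>) \<le> 2 * ?I (\<lambda>\<omega>. X \<omega> - ?S h N \<omega>) + 2 * ?I (?S h N)"
      by (rule nn_sq_add_le) measurable
    also have "?I (?S h N) = ennreal (\<Sum>n<N. (h \<bullet> e n)\<^sup>2)"
      by (rule coord_sum_sq) simp
    also have "2 * ennreal (\<Sum>n<N. (h \<bullet> e n)\<^sup>2) \<le> 2 * ennreal ((norm h)\<^sup>2)"
      using sum_le_suminf[OF sums_summable[OF parseval_sums[OF e]], of "{..<N}" h] sums_unique[OF parseval_sums[OF e, of h]]
      by (intro mult_left_mono ennreal_leI) auto
    finally show ?thesis by (simp add: power2_commute ennreal_mult)
  qed
  moreover have "(\<lambda>N. 2 * ?I (\<lambda>\<omega>. ?S h N \<omega> - X \<omega>) + ennreal (2 * (norm h)\<^sup>2)) \<longlonglongrightarrow> 2 * 0 + ennreal (2 * (norm h)\<^sup>2)"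
    using X unfolding is_white_noise_integral_def
    by (intro tendsto_add ennreal_tendsto_cmult tendsto_const) auto
  ultimately show ?thesis
    by (intro LIMSEQ_le_const) auto
qed

text \<open>The variance of \<bar>D\<bar> is nonnegative, which is Jensen's inequality for the
  square.\<close>

lemma (in prob_space) nn_integral_abs_le_sqrt:
  fixes D :: "'a \<Rightarrow> real"
  assumes [measurable]: "D \<in> borel_measurable M" and B: "(\<integral>\<^sup>+\<omega>. ennreal ((D \<omega>)\<^sup>2) \<partial>M) \<le> ennreal (B\<^sup>2)" and "B \<ge> 0"
  shows "integrable M D" "(LINT \<omega>|M. \<bar>D \<omega>\<bar>) \<le> B"
proof -
  have sq: "integrable M (\<lambda>\<omega>. (D \<omega>)\<^sup>2)"
    using B by (intro integrableI_nonneg) (auto simp: less_top[symmetric] top_unique)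
  show i: "integrable M D"
    by (rule square_integrable_imp_integrable[OF _ sq]) measurable
  have "ennreal (LINT \<omega>|M. (D \<omega>)\<^sup>2) \<le> ennreal (B\<^sup>2)"
    using B by (subst nn_integral_eq_integral[OF sq, symmetric]) auto
  then have "(LINT \<omega>|M. (D \<omega>)\<^sup>2) \<le> B\<^sup>2" by simp
  moreover have "(LINT \<omega>|M. \<bar>D \<omega>\<bar>)\<^sup>2 \<le> (LINT \<omega>|M. (D \<omega>)\<^sup>2)"
    using variance_eq[of "\<lambda>\<omega>. \<bar>D \<omega>\<bar>"] variance_positive[of "\<lambda>\<omega>. \<bar>D \<omega>\<bar>"] i sq by simp
  ultimately have "(LINT \<omega>|M. \<bar>D \<omega>\<bar>)\<^sup>2 \<le> B\<^sup>2" by linarith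
  then show "(LINT \<omega>|M. \<bar>D \<omega>\<bar>) \<le> B"
    using \<open>B \<ge> 0\<close> by (rule power2_le_imp_le)
qed

lemma iexp_lipschitz: "cmod (iexp x - iexp y) \<le> \<bar>x - y\<bar>"
proof -
  have "cmod (iexp x - iexp y) = cmod (iexp y * (iexp (x - y) - 1))"
    by (simp add: right_diff_distrib exp_add[symmetric] flip: distrib_left of_real_add)
  also have "\<dots> \<le> \<bar>x - y\<bar>"
    using iexp_approx1[of "x - y" 0] by (simp add: norm_mult)
  finally show ?thesis .
qed

text \<open>Characteristic functions pass to the L2 limit because \<open>iexp\<close> is Lipschitz
  with constant 1. For the partial sums they are explicit, and Parseval's identity gives their
  limit.\<close>

lemma white_noise_integral_char:
  assumes e: "orthonormal_basis e" and X: "is_white_noise_integral e h X"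
  shows "(LINT \<omega>|gauss_space. iexp (X \<omega>)) = of_real (exp (- (norm h)\<^sup>2 / 2))"
proof -
  note [measurable] = white_noise_integral_measurable[OF X]
  let ?S = "\<lambda>N \<omega>. \<Sum>n<N. \<omega> n * (h \<bullet> e n)"
  let ?I = "\<lambda>f. \<integral>\<^sup>+\<omega>. ennreal ((f \<omega>)\<^sup>2) \<partial>gauss_space"
  have l1: "(\<lambda>N. (LINT \<omega>|gauss_space. iexp (?S N \<omega>))) \<longlonglongrightarrow> of_real (exp (- (norm h)\<^sup>2 / 2))"
    unfolding coord_sum_char
    by (intro tendsto_of_real tendsto_exp tendsto_divide tendsto_minus tendsto_const parseval_sums[OF e, unfolded sums_def]) simp
  have l2: "(\<lambda>N. (LINT \<omega>|gauss_space. iexp (?S N \<omega>))) \<longlonglongrightarrow> (LINT \<omega>|gauss_space. iexp (X \<omega>))"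
  proof (rule metric_LIMSEQ_I)
    fix r :: real assume r: "r > 0"
    have "(\<lambda>N. ?I (\<lambda>\<omega>. ?S N \<omega> - X \<omega>)) \<longlonglongrightarrow> 0" using X by (simp add: is_white_noise_integral_def)
    then have "\<forall>\<^sub>F N in sequentially. ?I (\<lambda>\<omega>. ?S N \<omega> - X \<omega>) < ennreal ((r/2)\<^sup>2)"
      using r by (intro order_tendstoD) auto
    then obtain N0 where N0: "\<And>N. N \<ge> N0 \<Longrightarrow> ?I (\<lambda>\<omega>. ?S N \<omega> - X \<omega>) < ennreal ((r/2)\<^sup>2)"
      unfolding eventually_sequentially by auto
    have "dist (LINT \<omega>|gauss_space. iexp (?S N \<omega>)) (LINT \<omega>|gauss_space. iexp (X \<omega>)) < r" if "N \<ge> N0" for N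
    proof -
      have i: "integrable gauss_space (\<lambda>\<omega>. ?S N \<omega> - X \<omega>)" "(LINT \<omega>|gauss_space. \<bar>?S N \<omega> - X \<omega>\<bar>) \<le> r/2"
        using gauss.nn_integral_abs_le_sqrt[of "\<lambda>\<omega>. ?S N \<omega> - X \<omega>" "r/2"] N0[OF that] r by auto
      have "dist (LINT \<omega>|gauss_space. iexp (?S N \<omega>)) (LINT \<omega>|gauss_space. iexp (X \<omega>)) =
          cmod (LINT \<omega>|gauss_space. iexp (?S N \<omega>) - iexp (X \<omega>))"
        unfolding dist_norm by (subst Bochner_Integration.integral_diff; (intro gauss_iexp_integrable)?; measurable)
      also have "\<dots> \<le> (LINT \<omega>|gauss_space. cmod (iexp (?S N \<omega>) - iexp (X \<omega>)))"
        by (rule integral_norm_bound)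
      also have "\<dots> \<le> (LINT \<omega>|gauss_space. \<bar>?S N \<omega> - X \<omega>\<bar>)"
      proof (rule integral_mono)
        show "integrable gauss_space (\<lambda>\<omega>. cmod (iexp (?S N \<omega>) - iexp (X \<omega>)))"
          by (intro integrable_norm Bochner_Integration.integrable_diff gauss_iexp_integrable) measurable
        show "cmod (iexp (?S N \<omega>) - iexp (X \<omega>)) \<le> \<bar>?S N \<omega> - X \<omega>\<bar>" for \<omega>
          by (rule iexp_lipschitz)
      qed (use i in auto)
      finally show ?thesis using i(2) r by simp
    qed
    then show "\<exists>N0. \<forall>N\<ge>N0. dist (LINT \<omega>|gauss_space. iexp (?S N \<omega>)) (LINT \<omega>|gauss_space. iexp (X \<omega>)) < r" by blast
  qed
  show ?thesis by (rule LIMSEQ_unique[OF l2 l1])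
qed

text \<open>Completeness of L2, made explicit so that the limit is an honest measurable function: a
  fast subsequence of the partial sums converges almost surely, its limit is taken as
  \<open>X\<close>, and Fatou's lemma shows that the whole sequence converges to \<open>X\<close> in
  mean square.\<close>

lemma white_noise_integral_exists:
  assumes e: "orthonormal_basis e"
  shows "\<exists>X. is_white_noise_integral e h X"
proof -
  define a where "a n = h \<bullet> e n" for n
  \<comment> \<open>The energy beyond the first \<open>N\<close> coordinates. It bounds the squared
    L2 distance between \<open>S N\<close> and every later partial sum.\<close>
  define T where "T N = (norm h)\<^sup>2 - (\<Sum>n<N. (a n)\<^sup>2)" for N
  define S where "S N \<omega> = (\<Sum>n<N. \<omega> n * a n)" for N and \<omega> :: "nat \<Rightarrow> real"
  let ?I = "\<lambda>f. \<integral>\<^sup>+\<omega>. ennreal ((f \<omega>)\<^sup>2) \<partial>gauss_space"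
  have Sm [measurable]: "S N \<in> borel_measurable gauss_space" for N
    unfolding S_def[abs_def] by measurable
  have sums: "(\<lambda>n. (a n)\<^sup>2) sums (norm h)\<^sup>2" unfolding a_def by (rule parseval_sums[OF e])
  have T0: "T \<longlonglongrightarrow> 0"
    using tendsto_diff[OF tendsto_const sums[unfolded sums_def], of "(norm h)\<^sup>2"] unfolding T_def by simp
  have Tnn: "0 \<le> T N" for N
    using sum_le_suminf[OF sums_summable[OF sums], of "{..<N}"] sums_unique[OF sums] unfolding T_def by simp
  have d1: "?I (\<lambda>\<omega>. S i \<omega> - S j \<omega>) \<le> ennreal (T i)" if "i \<le> j" for i j
  proof -
    have eq: "S i \<omega> - S j \<omega> = - (\<Sum>n\<in>{i..<j}. \<omega> n * a n)" for \<omega>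
      unfolding S_def using sum_diff[of "{..<j}" "{..<i}" "\<lambda>n. \<omega> n * a n"] that
      by (simp add: lessThan_minus_lessThan)
    have "?I (\<lambda>\<omega>. S i \<omega> - S j \<omega>) = ennreal (\<Sum>n\<in>{i..<j}. (a n)\<^sup>2)"
      unfolding eq power2_minus by (rule coord_sum_sq) simp
    also have "(\<Sum>n\<in>{i..<j}. (a n)\<^sup>2) \<le> T i"
      using Tnn[of j] sum_diff[of "{..<j}" "{..<i}" "\<lambda>n. (a n)\<^sup>2"] that unfolding T_def
      by (simp add: lessThan_minus_lessThan)
    finally show ?thesis by (simp add: ennreal_leI)
  qed
  have d2: "?I (\<lambda>\<omega>. S i \<omega> - S j \<omega>) \<le> ennreal (T i + T j)" for i j
  proof (cases "i \<le> j")
    case True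
    have "ennreal (T i) \<le> ennreal (T i + T j)" using Tnn by (intro ennreal_leI) simp
    then show ?thesis using d1[OF True] by (rule order_trans[rotated])
  next
    case False
    then have "?I (\<lambda>\<omega>. S j \<omega> - S i \<omega>) \<le> ennreal (T j)" by (intro d1) simp
    also have "ennreal (T j) \<le> ennreal (T i + T j)" using Tnn by (intro ennreal_leI) simp
    finally show ?thesis by (simp add: power2_commute)
  qed
  \<comment> \<open>With these thresholds the squared L2 norm of the k-th increment is at most
    \<open>(1/4)^k\<close>, so its mean absolute value is at most \<open>(1/2)^k\<close>, which is
    summable.\<close>
  have "\<exists>N. T N < (1/4)^k / 2" for k :: nat
    using order_tendstoD(2)[OF T0, of "(1/4)^k / 2"] unfolding eventually_sequentially by auto
  then obtain r where r: "\<And>k. T (r k) < (1/4)^k / 2" by metis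
  define D where "D k \<omega> = S (r (Suc k)) \<omega> - S (r k) \<omega>" for k \<omega>
  have [measurable]: "D k \<in> borel_measurable gauss_space" for k
    unfolding D_def[abs_def] by measurable
  have Dk: "(\<integral>\<^sup>+\<omega>. ennreal \<bar>D k \<omega>\<bar> \<partial>gauss_space) \<le> ennreal ((1/2)^k)" for k
  proof -
    have "T (r (Suc k)) + T (r k) \<le> ((1/2)^k)\<^sup>2"
    proof -
      have "((1/2)^k)\<^sup>2 = (1/4::real)^k"
        by (simp add: power2_eq_square power_mult_distrib[symmetric])
      moreover have "(1/4::real)^Suc k \<le> (1/4)^k" by simp
      ultimately show ?thesis using r[of k] r[of "Suc k"] by linarith
    qed
    then have "?I (D k) \<le> ennreal (((1/2)^k)\<^sup>2)"
      unfolding D_def[abs_def] by (intro order_trans[OF d2 ennreal_leI])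
    from gauss.nn_integral_abs_le_sqrt[OF _ this] show ?thesis
      by (subst nn_integral_eq_integral) (auto intro: ennreal_leI)
  qed
  have "(\<integral>\<^sup>+\<omega>. (\<Sum>k. ennreal \<bar>D k \<omega>\<bar>) \<partial>gauss_space) = (\<Sum>k. \<integral>\<^sup>+\<omega>. ennreal \<bar>D k \<omega>\<bar> \<partial>gauss_space)"
    by (rule nn_integral_suminf) measurable
  also have "\<dots> \<le> (\<Sum>k. ennreal ((1/2)^k))"
    by (intro suminf_le Dk) auto
  also have "\<dots> = ennreal (\<Sum>k. (1/2)^k)"
    by (intro suminf_ennreal2) (auto intro: summable_geometric)
  also have "\<dots> < \<infinity>" by simp
  finally have "(\<integral>\<^sup>+\<omega>. (\<Sum>k. ennreal \<bar>D k \<omega>\<bar>) \<partial>gauss_space) \<noteq> \<infinity>" by simp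
  then have AE1: "AE \<omega> in gauss_space. (\<Sum>k. ennreal \<bar>D k \<omega>\<bar>) \<noteq> \<infinity>"
    by (intro nn_integral_noteq_infinite) measurable
  define X where "X \<omega> = lim (\<lambda>k. S (r k) \<omega>)" for \<omega>
  have [measurable]: "X \<in> borel_measurable gauss_space"
    unfolding X_def[abs_def] by (rule borel_measurable_lim_metric) (rule Sm)
  have AE2: "AE \<omega> in gauss_space. (\<lambda>k. S (r k) \<omega>) \<longlonglongrightarrow> X \<omega>"
    using AE1
  proof eventually_elim
    case (elim \<omega>)
    then have "summable (\<lambda>k. \<bar>D k \<omega>\<bar>)"
      by (intro summable_suminf_not_top) auto
    then have "summable (\<lambda>k. D k \<omega>)" by (rule summable_rabs_cancel)
    then have "convergent (\<lambda>k. S (r k) \<omega> - S (r 0) \<omega>)"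
      unfolding summable_iff_convergent D_def sum_lessThan_telescope[of "\<lambda>k. S (r k) \<omega>"] .
    then have "convergent (\<lambda>k. S (r k) \<omega>)"
      by (simp add: convergent_diff_const_right_iff)
    then show ?case unfolding X_def by (simp add: convergent_LIMSEQ_iff)
  qed
  \<comment> \<open>Fatou along the almost surely convergent subsequence carries the distance
    between partial sums to the limit, for every \<open>N\<close> and not only along the
    subsequence.\<close>
  have bound: "?I (\<lambda>\<omega>. S N \<omega> - X \<omega>) \<le> ennreal (T N)" for N
  proof -
    have "?I (\<lambda>\<omega>. S N \<omega> - X \<omega>) = (\<integral>\<^sup>+\<omega>. liminf (\<lambda>k. ennreal ((S N \<omega> - S (r k) \<omega>)\<^sup>2)) \<partial>gauss_space)"
    proof (rule nn_integral_cong_AE)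
      show "AE \<omega> in gauss_space. ennreal ((S N \<omega> - X \<omega>)\<^sup>2) = liminf (\<lambda>k. ennreal ((S N \<omega> - S (r k) \<omega>)\<^sup>2))"
        using AE2
      proof eventually_elim
        case (elim \<omega>)
        have "(\<lambda>k. ennreal ((S N \<omega> - S (r k) \<omega>)\<^sup>2)) \<longlonglongrightarrow> ennreal ((S N \<omega> - X \<omega>)\<^sup>2)"
          by (intro tendsto_ennrealI tendsto_power tendsto_diff tendsto_const elim)
        from lim_imp_Liminf[OF sequentially_bot this] show ?case by (rule sym)
      qed
    qed
    also have "\<dots> \<le> liminf (\<lambda>k. ?I (\<lambda>\<omega>. S N \<omega> - S (r k) \<omega>))"
      by (rule nn_integral_liminf) measurable
    also have "\<dots> \<le> liminf (\<lambda>k. ennreal (T N + (1/4)^k / 2))"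
    proof (rule Liminf_mono, rule always_eventually, rule allI)
      fix k
      have "ennreal (T N + T (r k)) \<le> ennreal (T N + (1/4)^k / 2)" using r[of k] by (intro ennreal_leI) simp
      then show "?I (\<lambda>\<omega>. S N \<omega> - S (r k) \<omega>) \<le> ennreal (T N + (1/4)^k / 2)"
        using d2[of N "r k"] by (rule order_trans[rotated])
    qed
    also have "\<dots> = ennreal (T N)"
    proof (rule lim_imp_Liminf[OF sequentially_bot])
      have "(\<lambda>k. T N + (1/4)^k / 2) \<longlonglongrightarrow> T N + 0 / 2"
        by (intro tendsto_intros LIMSEQ_power_zero) auto
      then show "(\<lambda>k. ennreal (T N + (1/4)^k / 2)) \<longlonglongrightarrow> ennreal (T N)"
        by (intro tendsto_ennrealI) simp
    qed
    finally show ?thesis .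
  qed
  have "(\<lambda>N. ?I (\<lambda>\<omega>. S N \<omega> - X \<omega>)) \<longlonglongrightarrow> 0"
  proof (rule tendsto_sandwich[OF _ _ tendsto_const])
    show "(\<lambda>N. ennreal (T N)) \<longlonglongrightarrow> 0" using tendsto_ennrealI[OF T0] by simp
  qed (use bound in auto)
  then have "is_white_noise_integral e h X"
    unfolding is_white_noise_integral_def S_def a_def by simp
  then show ?thesis by blast
qed

text \<open>The squared distance between the partial sum and \<open>V h\<close> consists of inner
  products only, all of which \<open>V\<close> preserves, so it equals the tail energy of
  \<open>h\<close>. Linearity of \<open>V\<close> is thus drawn from the inner products.\<close>

lemma orthonormal_isometry_expansion:
  fixes V :: "'h::{real_inner,complete_space} \<Rightarrow> 'h"
  assumes e: "orthonormal_basis e" and V: "\<And>x y. V x \<bullet> V y = x \<bullet> y"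
  shows "(\<lambda>N. \<Sum>n<N. (h \<bullet> e n) *\<^sub>R V (e n)) \<longlonglongrightarrow> V h"
proof -
  have ee: "V (e m) \<bullet> V (e n) = (if m = n then 1 else 0)" for m n using e V by (auto simp: orthonormal_basis_def)
  have d: "(norm ((\<Sum>n<N. (h \<bullet> e n) *\<^sub>R V (e n)) - V h))\<^sup>2 = (norm h)\<^sup>2 - (\<Sum>n<N. (h \<bullet> e n)\<^sup>2)" for N
  proof -
    define p where "p = (\<Sum>n<N. (h \<bullet> e n) *\<^sub>R V (e n))"
    have 1: "p \<bullet> V h = (\<Sum>n<N. (h \<bullet> e n)\<^sup>2)"
      unfolding p_def inner_sum_left by (simp add: V power2_eq_square inner_commute[of "e _" h])
    have "p \<bullet> p = (\<Sum>n<N. ((h \<bullet> e n) *\<^sub>R V (e n)) \<bullet> p)"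
      unfolding p_def by (rule inner_sum_left)
    also have "\<dots> = (\<Sum>n<N. (h \<bullet> e n)\<^sup>2)"
    proof (intro sum.cong refl)
      fix n assume "n \<in> {..<N}"
      then have "V (e n) \<bullet> p = h \<bullet> e n"
        unfolding p_def inner_sum_right by (simp add: ee if_distrib[of "\<lambda>c. _ * c"] sum.delta cong: if_cong)
      then show "((h \<bullet> e n) *\<^sub>R V (e n)) \<bullet> p = (h \<bullet> e n)\<^sup>2" by (simp add: power2_eq_square)
    qed
    finally have 2: "p \<bullet> p = (\<Sum>n<N. (h \<bullet> e n)\<^sup>2)" .
    have "(norm (p - V h))\<^sup>2 = p \<bullet> p - 2 * (p \<bullet> V h) + V h \<bullet> V h"
      unfolding power2_norm_eq_inner by (simp add: inner_diff_left inner_diff_right inner_commute[of "V h" p])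
    then show ?thesis unfolding p_def[symmetric] 1 2 V by (simp add: power2_norm_eq_inner)
  qed
  have "(\<lambda>N. (norm ((\<Sum>n<N. (h \<bullet> e n) *\<^sub>R V (e n)) - V h))\<^sup>2) \<longlonglongrightarrow> (norm h)\<^sup>2 - (norm h)\<^sup>2"
    unfolding d by (intro tendsto_diff tendsto_const parseval_sums[OF e, unfolded sums_def])
  then have "(\<lambda>N. sqrt ((norm ((\<Sum>n<N. (h \<bullet> e n) *\<^sub>R V (e n)) - V h))\<^sup>2)) \<longlonglongrightarrow> sqrt 0"
    by (intro tendsto_real_sqrt) simp
  then have "(\<lambda>N. norm ((\<Sum>n<N. (h \<bullet> e n) *\<^sub>R V (e n)) - V h)) \<longlonglongrightarrow> 0" by simp
  then have "(\<lambda>N. (\<Sum>n<N. (h \<bullet> e n) *\<^sub>R V (e n)) - V h) \<longlonglongrightarrow> 0" by (rule tendsto_norm_zero_cancel)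
  then show ?thesis by (rule LIM_zero_cancel)
qed

text \<open>\<theta> sends a point to the values there of versions of the integrals of
  \<open>V (e n)\<close>. Since the \<open>V (e n)\<close> are orthonormal, these are again
  independent standard normals, so \<theta> preserves the measure. Nothing makes \<theta>
  invertible.\<close>

lemma white_noise_isometry_lift:
  fixes V :: "'h::{real_inner,complete_space} \<Rightarrow> 'h"
  assumes e: "orthonormal_basis e" and V: "\<And>x y. V x \<bullet> V y = x \<bullet> y"
  obtains \<theta> where "\<theta> \<in> measurable gauss_space gauss_space" "distr gauss_space gauss_space \<theta> = gauss_space"
    "\<And>h X Y. is_white_noise_integral e h X \<Longrightarrow> is_white_noise_integral e (V h) Y \<Longrightarrow> AE \<omega> in gauss_space. X (\<theta> \<omega>) = Y \<omega>"
proof -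
  have "\<forall>n. \<exists>X. is_white_noise_integral e (V (e n)) X" using white_noise_integral_exists[OF e] by blast
  then obtain U where U: "\<And>n. is_white_noise_integral e (V (e n)) (U n)" unfolding choice_iff by blast
  note Um [measurable] = white_noise_integral_measurable[OF U]
  define \<theta> where "\<theta> = (\<lambda>\<omega> n. U n \<omega>)"
  have \<theta>m: "\<theta> \<in> measurable gauss_space gauss_space"
    unfolding \<theta>_def measurable_cong_sets[OF refl sets_gauss_space]
    by (rule measurable_PiM_single') (auto simp: Um)
  have \<theta>d: "distr gauss_space gauss_space \<theta> = gauss_space"
    unfolding \<theta>_def
  proof (rule gauss.distr_gauss_spaceI[OF Um])
    fix N and s :: "nat \<Rightarrow> real"
    have "is_white_noise_integral e (\<Sum>n<N. s n *\<^sub>R V (e n)) (\<lambda>\<omega>. \<Sum>n<N. s n * U n \<omega>)"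
      by (rule white_noise_integral_sum) (rule U)
    from white_noise_integral_char[OF e this]
    have "(LINT \<omega>|gauss_space. iexp (\<Sum>n<N. s n * U n \<omega>)) = of_real (exp (- (norm (\<Sum>n<N. s n *\<^sub>R V (e n)))\<^sup>2 / 2))" .
    also have "(norm (\<Sum>n<N. s n *\<^sub>R V (e n)))\<^sup>2 = (\<Sum>n<N. (s n)\<^sup>2)"
    proof -
      have ee: "V (e m) \<bullet> V (e n) = (if m = n then 1 else 0)" for m n using e V by (auto simp: orthonormal_basis_def)
      define p where "p = (\<Sum>n<N. s n *\<^sub>R V (e n))"
      have "p \<bullet> p = (\<Sum>n<N. (s n *\<^sub>R V (e n)) \<bullet> p)"
        unfolding p_def by (rule inner_sum_left)
      also have "\<dots> = (\<Sum>n<N. (s n)\<^sup>2)"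
      proof (intro sum.cong refl)
        fix n assume "n \<in> {..<N}"
        then have "V (e n) \<bullet> p = s n"
          unfolding p_def inner_sum_right by (simp add: ee if_distrib[of "\<lambda>c. _ * c"] sum.delta cong: if_cong)
        then show "(s n *\<^sub>R V (e n)) \<bullet> p = (s n)\<^sup>2" by (simp add: power2_eq_square)
      qed
      finally show ?thesis by (simp add: p_def power2_norm_eq_inner)
    qed
    finally show "(LINT \<omega>|gauss_space. iexp (\<Sum>n<N. s n * U n \<omega>)) = of_real (exp (- (\<Sum>n<N. (s n)\<^sup>2) / 2))" .
  qed
  have lift: "AE \<omega> in gauss_space. X (\<theta> \<omega>) = Y \<omega>"
    if X: "is_white_noise_integral e h X" and Y: "is_white_noise_integral e (V h) Y" for h X Y
  proof -
    note Xm [measurable] = white_noise_integral_measurable[OF X] and Ym [measurable] = white_noise_integral_measurable[OF Y]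
    have X\<theta> [measurable]: "(\<lambda>\<omega>. X (\<theta> \<omega>)) \<in> borel_measurable gauss_space"
      by (rule measurable_compose[OF \<theta>m Xm])
    let ?S = "\<lambda>N \<omega>. \<Sum>n<N. \<omega> n * (h \<bullet> e n)"
    let ?I = "\<lambda>f. \<integral>\<^sup>+\<omega>. ennreal ((f \<omega>)\<^sup>2) \<partial>gauss_space"
    have S\<theta> [measurable]: "(\<lambda>\<omega>. ?S N (\<theta> \<omega>)) \<in> borel_measurable gauss_space" for N
      by (rule measurable_compose[OF \<theta>m coord_sum_measurable])
    \<comment> \<open>Compare both sides with the N-th partial sum evaluated at \<theta>. The first
      error is transported by the measure preserving \<theta> and becomes the error defining
      \<open>X\<close>. The second is a white noise integral of the error in the expansion of
      \<open>V h\<close>.\<close>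
    have b: "?I (\<lambda>\<omega>. X (\<theta> \<omega>) - Y \<omega>) \<le> 2 * ?I (\<lambda>\<omega>. ?S N \<omega> - X \<omega>) + 2 * ennreal (2 * (norm ((\<Sum>n<N. (h \<bullet> e n) *\<^sub>R V (e n)) - V h))\<^sup>2)" for N
    proof -
      have "?I (\<lambda>\<omega>. X (\<theta> \<omega>) - Y \<omega>) = ?I (\<lambda>\<omega>. (X (\<theta> \<omega>) - ?S N (\<theta> \<omega>)) + (?S N (\<theta> \<omega>) - Y \<omega>))"
        by simp
      also have "\<dots> \<le> 2 * ?I (\<lambda>\<omega>. X (\<theta> \<omega>) - ?S N (\<theta> \<omega>)) + 2 * ?I (\<lambda>\<omega>. ?S N (\<theta> \<omega>) - Y \<omega>)"
        by (rule nn_sq_add_le; intro borel_measurable_diff X\<theta> S\<theta> Ym)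
      also have "?I (\<lambda>\<omega>. X (\<theta> \<omega>) - ?S N (\<theta> \<omega>)) = (\<integral>\<^sup>+\<omega>. ennreal ((X \<omega> - ?S N \<omega>)\<^sup>2) \<partial>distr gauss_space gauss_space \<theta>)"
        by (subst nn_integral_distr[OF \<theta>m]) auto
      also have "\<dots> = ?I (\<lambda>\<omega>. ?S N \<omega> - X \<omega>)" unfolding \<theta>d by (simp add: power2_commute)
      also have "?I (\<lambda>\<omega>. ?S N (\<theta> \<omega>) - Y \<omega>) \<le> ennreal (2 * (norm ((\<Sum>n<N. (h \<bullet> e n) *\<^sub>R V (e n)) - V h))\<^sup>2)"
      proof (rule white_noise_integral_norm[OF e])
        have "is_white_noise_integral e (\<Sum>n<N. (h \<bullet> e n) *\<^sub>R V (e n)) (\<lambda>\<omega>. \<Sum>n<N. (h \<bullet> e n) * U n \<omega>)"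
          by (rule white_noise_integral_sum) (rule U)
        from white_noise_integral_linear[OF this Y, of 1 "-1"]
        show "is_white_noise_integral e ((\<Sum>n<N. (h \<bullet> e n) *\<^sub>R V (e n)) - V h) (\<lambda>\<omega>. ?S N (\<theta> \<omega>) - Y \<omega>)"
          by (simp add: \<theta>_def mult.commute)
      qed
      finally show ?thesis by (simp add: add_left_mono mult_left_mono)
    qed
    have l: "(\<lambda>N. 2 * ?I (\<lambda>\<omega>. ?S N \<omega> - X \<omega>) + 2 * ennreal (2 * (norm ((\<Sum>n<N. (h \<bullet> e n) *\<^sub>R V (e n)) - V h))\<^sup>2)) \<longlonglongrightarrow> 2 * 0 + 2 * ennreal (2 * (norm (V h - V h))\<^sup>2)"
      using X unfolding is_white_noise_integral_def
      by (intro tendsto_add ennreal_tendsto_cmult tendsto_ennrealI tendsto_mult tendsto_power tendsto_norm tendsto_diff tendsto_const orthonormal_isometry_expansion[OF e V]) auto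
    have "?I (\<lambda>\<omega>. X (\<theta> \<omega>) - Y \<omega>) \<le> 2 * 0 + 2 * ennreal (2 * (norm (V h - V h))\<^sup>2)"
      using b by (intro LIMSEQ_le_const[OF l]) auto
    then have "?I (\<lambda>\<omega>. X (\<theta> \<omega>) - Y \<omega>) = 0" by simp
    then have "AE \<omega> in gauss_space. ennreal ((X (\<theta> \<omega>) - Y \<omega>)\<^sup>2) = 0"
      by (subst (asm) nn_integral_0_iff_AE) auto
    then show ?thesis by eventually_elim (simp add: ennreal_eq_0_iff)
  qed
  show ?thesis by (rule that[OF \<theta>m \<theta>d lift])
qed

lemma iexp_diff: "iexp (x - y) = iexp x * cnj (iexp y)"
  by (simp add: exp_cnj exp_add[symmetric] right_diff_distrib)

text \<open>The variables iexp W(h k) with orthogonal h k are uncorrelated, so the correlation with a fixed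
  bounded variable, which does not depend on k here, has to be the product of the means.\<close>

lemma char_on_invariant_event:
  fixes h :: "'h::{real_inner,complete_space}"
  assumes e: "orthonormal_basis e" and B: "B \<in> sets gauss_space"
    and X: "is_white_noise_integral e h X"
    and g: "\<And>k::nat. norm (g k) = norm h" "\<And>j k. j \<noteq> k \<Longrightarrow> g j \<bullet> g k = 0"
    and Y: "\<And>k. is_white_noise_integral e (g k) (Y k)"
    and eq: "\<And>k. (LINT \<omega>|gauss_space. indicator B \<omega> * iexp (Y k \<omega>)) = (LINT \<omega>|gauss_space. indicator B \<omega> * iexp (X \<omega>))"
  shows "(LINT \<omega>|gauss_space. indicator B \<omega> * iexp (X \<omega>)) = of_real (measure gauss_space B * exp (- (norm h)\<^sup>2 / 2))"
proof -
  note Ym [measurable] = white_noise_integral_measurable[OF Y]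
  note [measurable] = B
  define m where "m = exp (- (norm h)\<^sup>2 / 2)"
  define Z where "Z k \<omega> = iexp (Y k \<omega>) - of_real m" for k \<omega>
  have Zm [measurable]: "Z k \<in> borel_measurable gauss_space" for k
    unfolding Z_def[abs_def] by measurable
  have mean: "(LINT \<omega>|gauss_space. iexp (Y k \<omega>)) = of_real m" for k
    using white_noise_integral_char[OF e Y[of k]] by (simp add: g(1) m_def)
  have iY: "integrable gauss_space (\<lambda>\<omega>. iexp (Y k \<omega>))" for k by (rule gauss_iexp_integrable[OF Ym])
  have icY: "integrable gauss_space (\<lambda>\<omega>. cnj (iexp (Y k \<omega>)))" for k by (rule integrable_cnj[OF iY])
  have iYY: "integrable gauss_space (\<lambda>\<omega>. iexp (Y j \<omega>) * cnj (iexp (Y k \<omega>)))" for j k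
    unfolding iexp_diff[symmetric] by (rule gauss_iexp_integrable) (intro borel_measurable_diff Ym)
  have YY: "(LINT \<omega>|gauss_space. iexp (Y j \<omega>) * cnj (iexp (Y k \<omega>))) = (if j = k then 1 else of_real (m\<^sup>2))" for j k
  proof (cases "j = k")
    case True
    then show ?thesis unfolding iexp_diff[symmetric] by (simp add: gauss.prob_space[simplified])
  next
    case False
    have "is_white_noise_integral e (g j - g k) (\<lambda>\<omega>. Y j \<omega> - Y k \<omega>)"
      using white_noise_integral_linear[OF Y[of j] Y[of k], of 1 "-1"] by simp
    from white_noise_integral_char[OF e this]
    have "(LINT \<omega>|gauss_space. iexp (Y j \<omega>) * cnj (iexp (Y k \<omega>))) = of_real (exp (- (norm (g j - g k))\<^sup>2 / 2))"
      unfolding iexp_diff .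
    \<comment> \<open>Orthogonality doubles the squared norm, so the mean of the mixed product is
      the product \<open>m\<^sup>2\<close> of the two means: after centring, the variables are
      orthogonal.\<close>
    also have "(norm (g j - g k))\<^sup>2 = (norm h)\<^sup>2 + (norm h)\<^sup>2"
    proof -
      have "(norm (g j - g k))\<^sup>2 = g j \<bullet> g j + g k \<bullet> g k"
        using g(2)[OF False] g(2)[of k j] False by (simp add: power2_norm_eq_inner inner_diff_left inner_diff_right)
      then show ?thesis using g(1)[of j] g(1)[of k] by (simp add: power2_norm_eq_inner[symmetric])
    qed
    also have "exp (- ((norm h)\<^sup>2 + (norm h)\<^sup>2) / 2) = m\<^sup>2"
      unfolding m_def power2_eq_square[of "exp _"] exp_add[symmetric] by (simp add: field_simps)
    finally show ?thesis using False by simp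
  qed
  have ZZ: "Z j \<omega> * cnj (Z k \<omega>) = iexp (Y j \<omega>) * cnj (iexp (Y k \<omega>)) - of_real m * iexp (Y j \<omega>) - of_real m * cnj (iexp (Y k \<omega>)) + of_real (m\<^sup>2)" for j k \<omega>
    unfolding Z_def by (simp add: algebra_simps power2_eq_square)
  have iZZ: "integrable gauss_space (\<lambda>\<omega>. Z j \<omega> * cnj (Z k \<omega>))" for j k
    unfolding ZZ by (intro Bochner_Integration.integrable_add Bochner_Integration.integrable_diff integrable_mult_right iYY iY icY gauss.integrable_const)
  have IZZ: "(LINT \<omega>|gauss_space. Z j \<omega> * cnj (Z k \<omega>)) = (if j = k then of_real (1 - m\<^sup>2) else 0)" for j k
  proof -
    have c: "(LINT \<omega>|gauss_space. cnj (iexp (Y k \<omega>))) = of_real m"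
      using mean[of k] by (simp del: complex_cnj_cnj)
    have "(LINT \<omega>|gauss_space. Z j \<omega> * cnj (Z k \<omega>)) =
       (LINT \<omega>|gauss_space. iexp (Y j \<omega>) * cnj (iexp (Y k \<omega>))) - of_real m * (LINT \<omega>|gauss_space. iexp (Y j \<omega>))
        - of_real m * (LINT \<omega>|gauss_space. cnj (iexp (Y k \<omega>))) + of_real (m\<^sup>2)"
      unfolding ZZ
      by (subst Bochner_Integration.integral_add, intro Bochner_Integration.integrable_diff integrable_mult_right iYY iY icY, rule gauss.integrable_const,
          subst Bochner_Integration.integral_diff, intro Bochner_Integration.integrable_diff integrable_mult_right iYY iY, intro integrable_mult_right icY,
          subst Bochner_Integration.integral_diff, rule iYY, intro integrable_mult_right iY)
         (simp add: gauss.prob_space[simplified])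
    then show ?thesis unfolding YY mean c by (simp add: power2_eq_square)
  qed
  define c where "c = (LINT \<omega>|gauss_space. indicator B \<omega> * iexp (X \<omega>))"
  \<comment> \<open>The correlation of \<open>B\<close> with the sum \<open>F\<close> grows linearly
    in \<open>N\<close>, while the L2 norm of \<open>F\<close>, a sum of orthogonal variables of
    variance at most 1, grows at most like the square root of \<open>N\<close>. Dividing by
    \<open>N\<close> forces the common correlation to vanish.\<close>
  have bound: "real N * cmod (c - of_real (measure gauss_space B * m)) \<le> sqrt (real N)" for N
  proof -
    define F where "F \<omega> = (\<Sum>k<N. Z k \<omega>)" for \<omega>
    have Fm [measurable]: "F \<in> borel_measurable gauss_space"
      unfolding F_def[abs_def] by (intro borel_measurable_sum Zm)
    have FF: "complex_of_real ((cmod (F \<omega>))\<^sup>2) = (\<Sum>j<N. \<Sum>k<N. Z j \<omega> * cnj (Z k \<omega>))" for \<omega>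
      unfolding complex_norm_square F_def cnj_sum sum_product by simp
    have iF: "integrable gauss_space (\<lambda>\<omega>. complex_of_real ((cmod (F \<omega>))\<^sup>2))"
      unfolding FF by (intro Bochner_Integration.integrable_sum iZZ)
    then have iF': "integrable gauss_space (\<lambda>\<omega>. (cmod (F \<omega>))\<^sup>2)" by (rule complex_of_real_integrable_eq[THEN iffD1])
    have "complex_of_real (LINT \<omega>|gauss_space. (cmod (F \<omega>))\<^sup>2) = (LINT \<omega>|gauss_space. (\<Sum>j<N. \<Sum>k<N. Z j \<omega> * cnj (Z k \<omega>)))"
      unfolding FF[symmetric] by (rule integral_complex_of_real[symmetric])
    also have "\<dots> = (\<Sum>j<N. \<Sum>k<N. (LINT \<omega>|gauss_space. Z j \<omega> * cnj (Z k \<omega>)))"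
      by (subst Bochner_Integration.integral_sum; (intro Bochner_Integration.integrable_sum iZZ sum.cong refl)?)
         (subst Bochner_Integration.integral_sum; (intro iZZ refl)?)
    also have "\<dots> = of_real (real N * (1 - m\<^sup>2))"
      unfolding IZZ by (simp add: sum.delta)
    finally have "(LINT \<omega>|gauss_space. (cmod (F \<omega>))\<^sup>2) = real N * (1 - m\<^sup>2)"
      by (simp only: of_real_eq_iff)
    also have "\<dots> \<le> (sqrt (real N))\<^sup>2" by (simp add: mult_left_le)
    finally have le: "(LINT \<omega>|gauss_space. (cmod (F \<omega>))\<^sup>2) \<le> (sqrt (real N))\<^sup>2" .
    have nn: "(\<integral>\<^sup>+\<omega>. ennreal ((cmod (F \<omega>))\<^sup>2) \<partial>gauss_space) \<le> ennreal ((sqrt (real N))\<^sup>2)"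
      using le by (subst nn_integral_eq_integral[OF iF']) (auto intro: ennreal_leI)
    have cF: "integrable gauss_space (\<lambda>\<omega>. cmod (F \<omega>))" "(LINT \<omega>|gauss_space. \<bar>cmod (F \<omega>)\<bar>) \<le> sqrt (real N)"
      using gauss.nn_integral_abs_le_sqrt[OF measurable_compose[OF Fm borel_measurable_norm] nn] by simp_all
    have iBY: "integrable gauss_space (\<lambda>\<omega>. indicator B \<omega> * iexp (Y k \<omega>))" for k
      by (rule Bochner_Integration.integrable_bound[OF iY[of k]]) (auto split: split_indicator)
    have Bm: "(\<lambda>\<omega>. indicator B \<omega> * complex_of_real m) = (\<lambda>\<omega>. complex_of_real (indicator B \<omega> * m))"
      by (auto split: split_indicator)
    have iB: "integrable gauss_space (\<lambda>\<omega>. indicator B \<omega> * complex_of_real m)"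
      unfolding Bm complex_of_real_integrable_eq by (intro integrable_mult_left) (simp add: gauss.emeasure_eq_measure)
    have IB: "(LINT \<omega>|gauss_space. indicator B \<omega> * complex_of_real m) = of_real (measure gauss_space B * m)"
      unfolding Bm integral_complex_of_real by simp
    have BZ: "(LINT \<omega>|gauss_space. indicator B \<omega> * Z k \<omega>) = c - of_real (measure gauss_space B * m)"
      and iBZ: "integrable gauss_space (\<lambda>\<omega>. indicator B \<omega> * Z k \<omega>)" for k
    proof -
      show "integrable gauss_space (\<lambda>\<omega>. indicator B \<omega> * Z k \<omega>)"
        unfolding Z_def right_diff_distrib by (intro Bochner_Integration.integrable_diff iBY iB)
      have "(LINT \<omega>|gauss_space. indicator B \<omega> * Z k \<omega>) = (LINT \<omega>|gauss_space. indicator B \<omega> * iexp (Y k \<omega>)) - (LINT \<omega>|gauss_space. indicator B \<omega> * of_real m)"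
        unfolding Z_def right_diff_distrib by (rule Bochner_Integration.integral_diff[OF iBY iB])
      then show "(LINT \<omega>|gauss_space. indicator B \<omega> * Z k \<omega>) = c - of_real (measure gauss_space B * m)"
        unfolding eq c_def IB .
    qed
    have "of_nat N * (c - of_real (measure gauss_space B * m)) = (\<Sum>k<N. (LINT \<omega>|gauss_space. indicator B \<omega> * Z k \<omega>))"
      unfolding BZ by simp
    also have "\<dots> = (LINT \<omega>|gauss_space. indicator B \<omega> * F \<omega>)"
      unfolding F_def sum_distrib_left by (rule Bochner_Integration.integral_sum[symmetric]) (rule iBZ)
    finally have "real N * cmod (c - of_real (measure gauss_space B * m)) = cmod (LINT \<omega>|gauss_space. indicator B \<omega> * F \<omega>)"
      by (metis norm_mult norm_of_nat)
    also have "\<dots> \<le> (LINT \<omega>|gauss_space. cmod (indicator B \<omega> * F \<omega>))" by (rule integral_norm_bound)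
    also have "\<dots> \<le> (LINT \<omega>|gauss_space. \<bar>cmod (F \<omega>)\<bar>)"
    proof (rule integral_mono)
      show "integrable gauss_space (\<lambda>\<omega>. cmod (indicator B \<omega> * F \<omega>))"
        by (rule Bochner_Integration.integrable_bound[OF cF(1)]) (auto split: split_indicator)
      show "integrable gauss_space (\<lambda>\<omega>. \<bar>cmod (F \<omega>)\<bar>)" using cF(1) by simp
    qed (auto split: split_indicator)
    also have "\<dots> \<le> sqrt (real N)" by (rule cF(2))
    finally show ?thesis .
  qed
  have "cmod (c - of_real (measure gauss_space B * m)) \<le> 0"
  proof (rule LIMSEQ_le_const)
    show "(\<lambda>N. 1 / sqrt (real N)) \<longlonglongrightarrow> 0"
      by (intro tendsto_divide_0[OF tendsto_const] filterlim_at_top_imp_at_infinity filterlim_compose[OF sqrt_at_top filterlim_real_sequentially])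
    have "cmod (c - of_real (measure gauss_space B * m)) \<le> 1 / sqrt (real N)" if "N \<ge> 1" for N
    proof -
      have "sqrt (real N) * (sqrt (real N) * cmod (c - of_real (measure gauss_space B * m))) \<le> sqrt (real N) * 1"
        using bound[of N] by (simp add: mult.assoc[symmetric])
      then have "sqrt (real N) * cmod (c - of_real (measure gauss_space B * m)) \<le> 1"
        using that by (subst (asm) mult_le_cancel_left_pos) auto
      then show ?thesis using that by (simp add: field_simps)
    qed
    then show "\<exists>N. \<forall>n\<ge>N. cmod (c - of_real (measure gauss_space B * m)) \<le> 1 / sqrt (real n)" by blast
  qed
  then show ?thesis by (simp add: c_def m_def)
qed

text \<open>If conditioning on \<open>B\<close> leaves all characteristic functions unchanged, then
  the conditional law is the Gaussian law itself. It gives \<open>B\<close> mass 1, so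
  \<open>B\<close> has Gaussian measure 1.\<close>

lemma zero_one_of_char_on_event:
  assumes e: "orthonormal_basis e" and B: "B \<in> sets gauss_space" and D: "closure D = UNIV"
    and chr: "\<And>h X. h \<in> D \<Longrightarrow> is_white_noise_integral e h X \<Longrightarrow>
      (LINT \<omega>|gauss_space. indicator B \<omega> * iexp (X \<omega>)) = of_real (measure gauss_space B * exp (- (norm h)\<^sup>2 / 2))"
  shows "measure gauss_space B \<in> {0, 1}"
proof (cases "measure gauss_space B = 0")
  case False
  note [measurable] = B
  define p where "p = measure gauss_space B"
  have p: "p > 0" using False by (simp add: p_def zero_less_measure_iff)
  \<comment> \<open>The basis vectors and their combinations may lie outside \<open>D\<close>. Both
    sides are continuous in \<open>h\<close>: the left because the integral is L2 continuous in
    \<open>h\<close> and \<open>iexp\<close> is Lipschitz.\<close>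
  have chr': "(LINT \<omega>|gauss_space. indicator B \<omega> * iexp (X \<omega>)) = of_real (p * exp (- (norm h)\<^sup>2 / 2))"
    if X: "is_white_noise_integral e h X" for h X
  proof -
    have "\<forall>n. \<exists>g\<in>D. dist g h < 1 / real (Suc n)"
      using D closure_approachable[of h D] by auto
    then obtain g where g: "\<And>n. g n \<in> D" "\<And>n. dist (g n) h < 1 / real (Suc n)" unfolding Bex_def choice_iff by blast
    have gl: "g \<longlonglongrightarrow> h"
    proof (rule tendsto_dist_iff[THEN iffD2], rule tendsto_sandwich[OF _ _ tendsto_const LIMSEQ_inverse_real_of_nat])
      have "dist (g n) h \<le> inverse (real (Suc n))" for n using g(2)[of n] by (simp add: inverse_eq_divide)
      then show "\<forall>\<^sub>F n in sequentially. dist (g n) h \<le> inverse (real (Suc n))" by simp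
    qed auto
    have "\<forall>n. \<exists>Y. is_white_noise_integral e (g n) Y" using white_noise_integral_exists[OF e] by blast
    then obtain Y where Y: "\<And>n. is_white_noise_integral e (g n) (Y n)" unfolding choice_iff by blast
    note Ym [measurable] = white_noise_integral_measurable[OF Y] and Xm [measurable] = white_noise_integral_measurable[OF X]
    have iB: "integrable gauss_space (\<lambda>\<omega>. indicator B \<omega> * iexp (X \<omega>))"
      if "X \<in> borel_measurable gauss_space" for X
      by (rule Bochner_Integration.integrable_bound[OF gauss_iexp_integrable[OF that]]) (use that in \<open>auto split: split_indicator\<close>)
    have d: "cmod ((LINT \<omega>|gauss_space. indicator B \<omega> * iexp (Y n \<omega>)) - (LINT \<omega>|gauss_space. indicator B \<omega> * iexp (X \<omega>))) \<le> sqrt 2 * norm (g n - h)" for n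
    proof -
      have "is_white_noise_integral e (g n - h) (\<lambda>\<omega>. Y n \<omega> - X \<omega>)"
        using white_noise_integral_linear[OF Y[of n] X, of 1 "-1"] by simp
      from white_noise_integral_norm[OF e this]
      have le: "(\<integral>\<^sup>+\<omega>. ennreal ((Y n \<omega> - X \<omega>)\<^sup>2) \<partial>gauss_space) \<le> ennreal ((sqrt 2 * norm (g n - h))\<^sup>2)"
        by (simp add: power_mult_distrib)
      have L: "integrable gauss_space (\<lambda>\<omega>. Y n \<omega> - X \<omega>)" "(LINT \<omega>|gauss_space. \<bar>Y n \<omega> - X \<omega>\<bar>) \<le> sqrt 2 * norm (g n - h)"
        using gauss.nn_integral_abs_le_sqrt[OF borel_measurable_diff[OF Ym Xm] le] by simp_all
      have "cmod ((LINT \<omega>|gauss_space. indicator B \<omega> * iexp (Y n \<omega>)) - (LINT \<omega>|gauss_space. indicator B \<omega> * iexp (X \<omega>))) =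
         cmod (LINT \<omega>|gauss_space. indicator B \<omega> * iexp (Y n \<omega>) - indicator B \<omega> * iexp (X \<omega>))"
        by (subst Bochner_Integration.integral_diff[OF iB[OF Ym] iB[OF Xm]]) simp
      also have "\<dots> \<le> (LINT \<omega>|gauss_space. cmod (indicator B \<omega> * iexp (Y n \<omega>) - indicator B \<omega> * iexp (X \<omega>)))"
        by (rule integral_norm_bound)
      also have "\<dots> \<le> (LINT \<omega>|gauss_space. \<bar>Y n \<omega> - X \<omega>\<bar>)"
      proof (rule integral_mono)
        show "integrable gauss_space (\<lambda>\<omega>. cmod (indicator B \<omega> * iexp (Y n \<omega>) - indicator B \<omega> * iexp (X \<omega>)))"
          by (intro integrable_norm Bochner_Integration.integrable_diff iB Ym Xm)
        show "integrable gauss_space (\<lambda>\<omega>. \<bar>Y n \<omega> - X \<omega>\<bar>)" using L(1) by simp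
        show "cmod (indicator B \<omega> * iexp (Y n \<omega>) - indicator B \<omega> * iexp (X \<omega>)) \<le> \<bar>Y n \<omega> - X \<omega>\<bar>" for \<omega>
          using iexp_lipschitz[of "Y n \<omega>" "X \<omega>"] by (auto split: split_indicator)
      qed
      finally show ?thesis using L(2) by linarith
    qed
    have l0: "(\<lambda>n. sqrt 2 * norm (g n - h)) \<longlonglongrightarrow> sqrt 2 * norm (h - h)"
      by (intro tendsto_mult tendsto_norm tendsto_diff tendsto_const gl)
    have l1: "(\<lambda>n. (LINT \<omega>|gauss_space. indicator B \<omega> * iexp (Y n \<omega>)) - (LINT \<omega>|gauss_space. indicator B \<omega> * iexp (X \<omega>))) \<longlonglongrightarrow> 0"
    proof (rule Lim_null_comparison[OF always_eventually])
      show "(\<lambda>n. sqrt 2 * norm (g n - h)) \<longlonglongrightarrow> 0" using l0 by simp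
    qed (use d in blast)
    have l2: "(\<lambda>n. (LINT \<omega>|gauss_space. indicator B \<omega> * iexp (Y n \<omega>))) \<longlonglongrightarrow> of_real (p * exp (- (norm h)\<^sup>2 / 2))"
      unfolding chr[OF g(1) Y] p_def
      by (intro tendsto_of_real tendsto_mult tendsto_exp tendsto_divide tendsto_minus tendsto_power tendsto_norm tendsto_const gl) simp
    show ?thesis using LIMSEQ_unique[OF LIM_zero_cancel[OF l1] l2] .
  qed
  define M where "M = density gauss_space (\<lambda>\<omega>. ennreal (indicator B \<omega> / p))"
  have setsM: "sets M = sets gauss_space" by (simp add: M_def)
  have eB: "emeasure M A = ennreal (measure gauss_space (A \<inter> B) / p)" if [measurable]: "A \<in> sets gauss_space" for A
  proof -
    have "emeasure M A = (\<integral>\<^sup>+\<omega>. ennreal (indicator (A \<inter> B) \<omega> / p) \<partial>gauss_space)"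
      unfolding M_def by (subst emeasure_density) (auto intro!: nn_integral_cong split: split_indicator)
    also have "\<dots> = ennreal (LINT \<omega>|gauss_space. indicator (A \<inter> B) \<omega> / p)"
      using p by (intro nn_integral_eq_integral) (auto simp: gauss.emeasure_eq_measure)
    finally show ?thesis by (simp add: Int_commute)
  qed
  have "emeasure M (space M) = 1"
    using eB[of UNIV] sets.top[of gauss_space] p by (simp add: M_def p_def)
  then interpret M: prob_space M by (rule prob_spaceI)
  have cm: "(\<lambda>\<omega>. \<omega> n) \<in> borel_measurable M" for n
    unfolding measurable_cong_sets[OF setsM refl] by (rule coord_measurable)
  have "distr M gauss_space (\<lambda>\<omega> n. \<omega> n) = gauss_space"
  proof (rule M.distr_gauss_spaceI[OF cm])
    fix N and s :: "nat \<Rightarrow> real"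
    have W: "is_white_noise_integral e (\<Sum>n<N. s n *\<^sub>R e n) (\<lambda>\<omega>. \<Sum>n<N. s n * \<omega> n)"
      by (rule white_noise_integral_sum) (rule white_noise_integral_coord[OF e])
    note Wm [measurable] = white_noise_integral_measurable[OF W]
    have "(LINT \<omega>|M. iexp (\<Sum>n<N. s n * \<omega> n)) = (LINT \<omega>|gauss_space. (indicator B \<omega> / p) *\<^sub>R iexp (\<Sum>n<N. s n * \<omega> n))"
    proof -
      have "(\<lambda>\<omega>. iexp (\<Sum>n<N. s n * \<omega> n)) \<in> borel_measurable gauss_space"
        using borel_measurable_integrable[OF gauss_iexp_integrable[OF Wm]] .
      then show ?thesis unfolding M_def using p by (intro integral_density) auto
    qed
    also have "\<dots> = (LINT \<omega>|gauss_space. (indicator B \<omega> * iexp (\<Sum>n<N. s n * \<omega> n)) / of_real p)"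
      by (intro Bochner_Integration.integral_cong refl) (auto split: split_indicator simp: scaleR_conv_of_real)
    also have "\<dots> = (LINT \<omega>|gauss_space. indicator B \<omega> * iexp (\<Sum>n<N. s n * \<omega> n)) / of_real p"
      by (rule integral_divide_zero)
    also have "\<dots> = of_real (exp (- (norm (\<Sum>n<N. s n *\<^sub>R e n))\<^sup>2 / 2))"
      unfolding chr'[OF W] using p by simp
    also have "(norm (\<Sum>n<N. s n *\<^sub>R e n))\<^sup>2 = (\<Sum>n<N. (s n)\<^sup>2)"
      unfolding power2_norm_eq_inner orthonormal_basis_inner_sum[OF e] by (simp add: power2_eq_square)
    finally show "(LINT \<omega>|M. iexp (\<Sum>n<N. s n * \<omega> n)) = of_real (exp (- (\<Sum>n<N. (s n)\<^sup>2) / 2))" .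
  qed
  then have "emeasure gauss_space B = emeasure (distr M gauss_space (\<lambda>\<omega>. \<omega>)) B" by simp
  also have "\<dots> = emeasure M B"
    by (subst emeasure_distr) (auto simp: measurable_cong_sets[OF setsM refl] B sets_eq_imp_space_eq[OF setsM])
  also have "\<dots> = 1" using eB[OF B] p by (simp add: p_def)
  finally show ?thesis by (simp add: gauss.emeasure_eq_measure)
qed simp

section \<open>The covariance form\<close>

text \<open>The representative modulo the lattice with all coordinates at least -pi and below pi.
  Composition with it makes any Borel function of space periodic.\<close>

definition cell_rep :: "real ^ ('d::finite) \<Rightarrow> real ^ 'd" where
  "cell_rep x = (\<chi> i. x $ i - 2 * pi * of_int \<lfloor>(x $ i + pi) / (2 * pi)\<rfloor>)"

lemma cell_rep_lattice: "\<exists>k. cell_rep x = x + lattice_vec k"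
  by (rule exI[of _ "\<chi> i. - \<lfloor>(x $ i + pi) / (2 * pi)\<rfloor>"])
     (simp add: cell_rep_def lattice_vec_def vec_eq_iff)

lemma cell_rep_add_lattice: "cell_rep (x + lattice_vec k) = cell_rep x"
proof -
  have "(x $ i + 2 * pi * of_int (k $ i) + pi) / (2 * pi) = (x $ i + pi) / (2 * pi) + of_int (k $ i)" for i
    by (simp add: field_simps)
  then have "\<lfloor>(x $ i + 2 * pi * of_int (k $ i) + pi) / (2 * pi)\<rfloor> = \<lfloor>(x $ i + pi) / (2 * pi)\<rfloor> + k $ i" for i
    by simp
  then show ?thesis
    by (simp add: cell_rep_def lattice_vec_def vec_eq_iff algebra_simps)
qed

lemma cell_rep_measurable [measurable]: "cell_rep \<in> borel_measurable borel"
proof (rule borel_measurable_euclidean_space[THEN iffD2], rule ballI)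
  fix b :: "real ^ 'd" assume "b \<in> Basis"
  then obtain i where b: "b = axis i 1" by (auto simp: Basis_vec_def)
  have c [measurable]: "(\<lambda>x::real^'d. x $ i) \<in> borel_measurable borel"
    by (intro borel_measurable_continuous_onI continuous_intros)
  show "(\<lambda>x. cell_rep x \<bullet> b) \<in> borel_measurable borel"
    unfolding b inner_axis cell_rep_def by simp
qed

lemma torus_cell_cbox: "torus_cell = cbox (\<chi> i. - pi) (\<chi> i. pi)"
  by (auto simp: torus_cell_def mem_box_cart)

lemma torus_cell_measurable [measurable]: "torus_cell \<in> sets borel"
  unfolding torus_cell_cbox by simp

lemma emeasure_torus_cell: "emeasure lborel torus_cell < \<infinity>"
  unfolding torus_cell_cbox by (simp add: emeasure_lborel_cbox_eq)

lemma borel_measurable_cnj [measurable (raw)]: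
  "f \<in> borel_measurable M \<Longrightarrow> (\<lambda>x. cnj (f x)) \<in> borel_measurable M"
  by (rule measurable_compose[OF _ borel_measurable_continuous_onI[OF continuous_on_cnj[OF continuous_on_id]]])

text \<open>The pointwise inequality \<open>2 * a * b\<close> \<le>
  \<open>a\<^sup>2 + b\<^sup>2\<close> stands in for Cauchy-Schwarz; it gives integrability and a
  bound that is good enough for integrability in time.\<close>

lemma L2_torus_integrable_prod:
  assumes u: "u \<in> L2_torus" and v: "v \<in> L2_torus"
  shows "set_integrable lborel torus_cell (\<lambda>x. u x * cnj (v x))"
    and "cmod (L2_inner u v) \<le> ((L2_norm_torus u)\<^sup>2 + (L2_norm_torus v)\<^sup>2) / 2"
proof -
  have [measurable]: "u \<in> borel_measurable borel" "v \<in> borel_measurable borel"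
    using u v by (auto simp: L2_torus_def)
  have iu: "set_integrable lborel torus_cell (\<lambda>x. (cmod (u x))\<^sup>2)" and iv: "set_integrable lborel torus_cell (\<lambda>x. (cmod (v x))\<^sup>2)"
    using u v by (auto simp: L2_torus_def)
  have nu: "(L2_norm_torus u)\<^sup>2 = (LINT x:torus_cell|lborel. (cmod (u x))\<^sup>2)" and nv: "(L2_norm_torus v)\<^sup>2 = (LINT x:torus_cell|lborel. (cmod (v x))\<^sup>2)"
    unfolding L2_norm_torus_def by (auto intro!: real_sqrt_pow2 simp: set_lebesgue_integral_def)
  have iw: "set_integrable lborel torus_cell (\<lambda>x. ((cmod (u x))\<^sup>2 + (cmod (v x))\<^sup>2) / 2)"
    by (intro set_integrable_divide set_integral_add(1) iu iv)
  have le: "cmod (u x * cnj (v x)) \<le> ((cmod (u x))\<^sup>2 + (cmod (v x))\<^sup>2) / 2" for x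
    using sum_squares_bound[of "cmod (u x)" "cmod (v x)"] by (simp add: norm_mult)
  show i: "set_integrable lborel torus_cell (\<lambda>x. u x * cnj (v x))"
    unfolding set_integrable_def
  proof (rule Bochner_Integration.integrable_bound[OF iw[unfolded set_integrable_def]])
    show "AE x in lborel. norm (indicat_real torus_cell x *\<^sub>R (u x * cnj (v x))) \<le> norm (indicat_real torus_cell x *\<^sub>R (((cmod (u x))\<^sup>2 + (cmod (v x))\<^sup>2) / 2))"
      using le by (auto split: split_indicator)
  qed measurable
  have "cmod (L2_inner u v) \<le> (LINT x:torus_cell|lborel. cmod (u x * cnj (v x)))"
    unfolding L2_inner_def by (rule set_integral_norm_bound[OF i])
  also have "\<dots> \<le> (LINT x:torus_cell|lborel. ((cmod (u x))\<^sup>2 + (cmod (v x))\<^sup>2) / 2)"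
    by (rule set_integral_mono[OF set_integrable_norm[OF i] iw]) (rule le)
  also have "\<dots> = ((L2_norm_torus u)\<^sup>2 + (L2_norm_torus v)\<^sup>2) / 2"
    unfolding nu nv by (simp add: set_integral_add(2)[OF iu iv])
  finally show "cmod (L2_inner u v) \<le> ((L2_norm_torus u)\<^sup>2 + (L2_norm_torus v)\<^sup>2) / 2" .
qed

lemma L2_torus_boundedI:
  fixes u :: "real ^ ('d::finite) \<Rightarrow> complex"
  assumes [measurable]: "u \<in> borel_measurable borel" and "periodic u" and b: "\<And>x. x \<in> torus_cell \<Longrightarrow> cmod (u x) \<le> C"
  shows "u \<in> L2_torus"
proof -
  have "integrable lborel (\<lambda>x::real^'d. indicator torus_cell x *\<^sub>R C\<^sup>2)"
    using emeasure_torus_cell by (intro integrable_scaleR_left integrable_real_indicator) auto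
  then have "set_integrable lborel torus_cell (\<lambda>x. (cmod (u x))\<^sup>2)"
    unfolding set_integrable_def
    by (rule Bochner_Integration.integrable_bound)
       (auto split: split_indicator intro!: power_mono b)
  then show ?thesis using assms(1,2) by (auto simp: L2_torus_def)
qed

lemma periodic_at_cell_rep: "periodic f \<Longrightarrow> f (cell_rep x) = f x"
  using cell_rep_lattice[of x] by (auto simp: periodic_def)

text \<open>An operator such as \<open>Q\<close> picks a representative \<open>F t\<close>
  separately for each time, so nothing says that \<open>F t x\<close> is jointly measurable and
  Fubini cannot be used. Instead the second argument is built up: indicators of rectangles are
  covered by the weak hypothesis, a disjoint-union induction gives all Borel sets, then come simple
  functions and dominated limits.\<close>

lemma weakly_measurable_inner:
  fixes F :: "real \<Rightarrow> real ^ ('d::finite) \<Rightarrow> complex"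
  assumes F: "\<And>t. F t \<in> L2_torus"
    and weak: "\<And>v. v \<in> L2_torus \<Longrightarrow> (\<lambda>t. L2_inner (F t) v) \<in> borel_measurable borel"
    and g: "g \<in> L2_time_torus"
  shows "(\<lambda>t. L2_inner (F t) (time_slice g t)) \<in> borel_measurable borel"
proof -
  have Fm [measurable]: "F t \<in> borel_measurable borel" for t using F[of t] by (auto simp: L2_torus_def)
  have gm [measurable]: "g \<in> borel_measurable borel" and gs: "\<And>t. time_slice g t \<in> L2_torus"
    using g by (auto simp: L2_time_torus_def)
  have one: "(\<lambda>_. 1) \<in> L2_torus" by (rule L2_torus_boundedI[where C=1]) (auto simp: periodic_def)
  have Fi: "set_integrable lborel torus_cell (F t)" for t
    using L2_torus_integrable_prod(1)[OF F[of t] one] by simp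
  \<comment> \<open>Evaluating \<open>h\<close> at \<open>cell_rep x\<close> makes indicators of
    arbitrary Borel sets periodic in space, so that they become legitimate vectors of
    \<open>L2_torus\<close>. For the periodic \<open>g\<close> it changes nothing.\<close>
  define J where "J h t = (LINT x:torus_cell|lborel. F t x * of_real (h (t, cell_rep x)))" for h :: "'d spacetime \<Rightarrow> real" and t
  have hm: "(\<lambda>x. h (t, cell_rep x)) \<in> borel_measurable borel" if "h \<in> borel_measurable borel" for h :: "'d spacetime \<Rightarrow> real" and t
  proof -
    have "(\<lambda>x. (t, cell_rep x)) \<in> borel_measurable borel" by (simp add: borel_prod[symmetric])
    from measurable_compose[OF this that] show ?thesis .
  qed
  have ib: "set_integrable lborel torus_cell (\<lambda>x. F t x * of_real (h (t, cell_rep x)))"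
    if [measurable]: "h \<in> borel_measurable borel" and b: "\<And>p. \<bar>h p\<bar> \<le> C" for h :: "'d spacetime \<Rightarrow> real" and C t
  proof -
    note [measurable] = hm[OF that(1)]
    have "set_integrable lborel torus_cell (\<lambda>x. C * cmod (F t x))"
      by (intro set_integrable_mult_right set_integrable_norm Fi)
    then show ?thesis unfolding set_integrable_def
    proof (rule Bochner_Integration.integrable_bound)
      have "0 \<le> C" using b[of undefined] by linarith
      then show "AE x in lborel. norm (indicat_real torus_cell x *\<^sub>R (F t x * complex_of_real (h (t, cell_rep x))))
         \<le> norm (indicat_real torus_cell x *\<^sub>R (C * cmod (F t x)))"
        using b by (auto split: split_indicator simp: norm_mult mult.commute[of C] intro!: mult_left_mono)
    qed measurable
  qed
  have ind: "J (indicator E) \<in> borel_measurable borel" if "E \<in> sets borel" for E :: "'d spacetime set"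
  proof -
    let ?G = "{a \<times> b | a b. a \<in> sets (borel :: real measure) \<and> b \<in> sets (borel :: (real^'d) measure)}"
    have st: "Int_stable ?G"
      unfolding Int_stable_def by (auto simp: Times_Int_Times) (metis sets.Int)
    have GP: "?G \<subseteq> Pow UNIV" by simp
    have E: "E \<in> sigma_sets UNIV ?G"
      using that unfolding borel_prod[symmetric] sets_pair_measure by simp
    have sg: "sigma_sets UNIV ?G = sets (borel :: 'd spacetime measure)"
      unfolding borel_prod[symmetric] sets_pair_measure by simp
    show ?thesis
      using st GP E
    proof (induction rule: sigma_sets_induct_disjoint)
      case (basic E)
      then obtain a b where E: "E = a \<times> b" and [measurable]: "a \<in> sets borel" "b \<in> sets borel" by auto
      have b2: "(\<lambda>x. complex_of_real (indicator b (cell_rep x))) \<in> L2_torus"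
        by (rule L2_torus_boundedI[where C=1]) (auto simp: periodic_def cell_rep_add_lattice split: split_indicator)
      have "J (indicator E) t = indicator a t *\<^sub>R L2_inner (F t) (\<lambda>x. of_real (indicator b (cell_rep x)))" for t
        unfolding J_def L2_inner_def E by (auto split: split_indicator simp: indicator_times)
      then show ?case using weak[OF b2] by (simp add: fun_eq_iff[THEN iffD2])
    next
      case empty
      then show ?case by (simp add: J_def[abs_def])
    next
      case (compl E)
      then have [measurable]: "E \<in> sets borel" using sg by auto
      have "J (indicator (UNIV - E)) t = L2_inner (F t) (\<lambda>_. 1) - J (indicator E) t" for t
      proof -
        have "L2_inner (F t) (\<lambda>_. 1) - J (indicator E) t = (LINT x:torus_cell|lborel. F t x - F t x * of_real (indicator E (t, cell_rep x)))"
          unfolding L2_inner_def J_def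
          by (subst set_integral_diff(2)) (auto intro!: Fi ib[of _ 1] split: split_indicator)
        also have "\<dots> = J (indicator (UNIV - E)) t"
          unfolding J_def by (intro set_lebesgue_integral_cong) (auto split: split_indicator)
        finally show ?thesis by simp
      qed
      then have "J (indicator (UNIV - E)) = (\<lambda>t. L2_inner (F t) (\<lambda>_. 1) - J (indicator E) t)" by blast
      then show ?case using weak[OF one] compl by simp
    next
      case (union A)
      then have Am [measurable]: "A i \<in> sets borel" for i using sg by auto
      \<comment> \<open>For fixed \<open>t\<close> the functional \<open>J\<close> is the integral
        of \<open>F t\<close> over a slice, so disjoint unions are handled by countable additivity
        of the integral.\<close>
      define S where "S t E = {x \<in> torus_cell. (t, cell_rep x) \<in> E}" for t and E :: "'d spacetime set"
      have Sm: "S t E \<in> sets lborel" if "E \<in> sets borel" for t E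
      proof -
        have "(\<lambda>x. (t, cell_rep x)) \<in> borel_measurable borel" by (simp add: borel_prod[symmetric])
        from measurable_sets[OF this that] have "(\<lambda>x. (t, cell_rep x)) -` E \<inter> torus_cell \<in> sets lborel" by auto
        also have "(\<lambda>x. (t, cell_rep x)) -` E \<inter> torus_cell = S t E" by (auto simp: S_def)
        finally show ?thesis .
      qed
      have JS: "J (indicator E) t = (LINT x:S t E|lborel. F t x)" for t E
        unfolding J_def set_lebesgue_integral_def S_def
        by (intro Bochner_Integration.integral_cong refl) (auto split: split_indicator)
      have "J (indicator (\<Union>i. A i)) t = (\<Sum>i. J (indicator (A i)) t)" for t
      proof -
        have U: "S t (\<Union>i. A i) = (\<Union>i. S t (A i))" by (auto simp: S_def)
        show ?thesis unfolding JS U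
        proof (rule lebesgue_integral_countable_add)
          show "S t (A i) \<inter> S t (A j) = {}" if "i \<noteq> j" for i j
            using union(1) that by (auto simp: disjoint_family_on_def S_def)
          have "(\<Union>i. S t (A i)) \<in> sets lborel" using Sm[OF Am] by (intro sets.countable_UN) auto
          then show "set_integrable lborel (\<Union>i. S t (A i)) (F t)"
            by (intro set_integrable_subset[OF Fi[of t]]) (auto simp: S_def)
        qed (rule Sm[OF Am])
      qed
      then have "J (indicator (\<Union>i. A i)) = (\<lambda>t. \<Sum>i. J (indicator (A i)) t)" by blast
      then show ?case using union(3) by (simp add: borel_measurable_suminf)
    qed
  qed
  have simple: "J s \<in> borel_measurable borel" if s: "simple_function borel s" for s :: "'d spacetime \<Rightarrow> real"
  proof -
    have fin: "finite (range s)" and sm: "\<And>y. s -` {y} \<in> sets borel"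
      using simple_functionD[OF s] by auto
    have "J s t = (\<Sum>y\<in>range s. of_real y * J (indicator (s -` {y})) t)" for t
    proof -
      have "F t x * of_real (s (t, cell_rep x)) = (\<Sum>y\<in>range s. of_real y * (F t x * of_real (indicator (s -` {y}) (t, cell_rep x))))" for x
      proof -
        have "(\<Sum>y\<in>range s. of_real y * (F t x * of_real (indicator (s -` {y}) (t, cell_rep x)))) =
          (\<Sum>y\<in>range s. if y = s (t, cell_rep x) then of_real y * F t x else 0)"
          by (intro sum.cong refl) (auto split: split_indicator)
        then show ?thesis using fin by (simp add: mult.commute)
      qed
      then have "J s t = (LINT x:torus_cell|lborel. \<Sum>y\<in>range s. of_real y * (F t x * of_real (indicator (s -` {y}) (t, cell_rep x))))"
        unfolding J_def by simp
      also have "\<dots> = (\<Sum>y\<in>range s. LINT x:torus_cell|lborel. of_real y * (F t x * of_real (indicator (s -` {y}) (t, cell_rep x))))"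
        unfolding set_lebesgue_integral_def scaleR_sum_right
      proof (rule Bochner_Integration.integral_sum)
        fix y
        have "set_integrable lborel torus_cell (\<lambda>x. of_real y * (F t x * of_real (indicator (s -` {y}) (t, cell_rep x))))"
          by (intro set_integrable_mult_right ib[of _ 1]) (use sm in \<open>auto split: split_indicator\<close>)
        then show "integrable lborel (\<lambda>x. indicator torus_cell x *\<^sub>R (of_real y * (F t x * of_real (indicator (s -` {y}) (t, cell_rep x)))))"
          unfolding set_integrable_def .
      qed
      also have "\<dots> = (\<Sum>y\<in>range s. of_real y * J (indicator (s -` {y})) t)"
        unfolding J_def by simp
      finally show ?thesis .
    qed
    then have "J s = (\<lambda>t. \<Sum>y\<in>range s. of_real y * J (indicator (s -` {y})) t)" by blast
    then show ?thesis by (simp only:) (intro borel_measurable_sum borel_measurable_times borel_measurable_const ind sm)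
  qed
  obtain s where s: "\<And>i. simple_function borel (s i)" and sl: "\<And>p. (\<lambda>i. s i p) \<longlonglongrightarrow> g p"
      and sb: "\<And>i p. \<bar>s i p\<bar> \<le> 2 * \<bar>g p\<bar>"
    using borel_measurable_implies_sequence_metric[OF gm, of 0] by auto
  show ?thesis
  proof (rule borel_measurable_LIMSEQ_metric)
    show "J (s i) \<in> borel_measurable borel" for i by (rule simple[OF s])
    fix t
    have gp: "g (t, cell_rep x) = g (t, x)" for x
      using gs[of t] periodic_at_cell_rep[of "time_slice g t" x] by (auto simp: L2_torus_def time_slice_def)
    have cj: "cnj (time_slice g t x) = of_real (g (t, x))" for x by (simp add: time_slice_def)
    have cj': "cnj (time_slice g t x) = of_real (g (t, cell_rep x))" for x by (simp only: cj gp)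
    show "(\<lambda>i. J (s i) t) \<longlonglongrightarrow> L2_inner (F t) (time_slice g t)"
      unfolding J_def L2_inner_def set_lebesgue_integral_def
    proof (rule integral_dominated_convergence)
      have "set_integrable lborel torus_cell (\<lambda>x. 2 * cmod (F t x * cnj (time_slice g t x)))"
        by (intro set_integrable_mult_right set_integrable_norm L2_torus_integrable_prod(1) F gs)
      then show "integrable lborel (\<lambda>x. indicat_real torus_cell x *\<^sub>R (2 * cmod (F t x * cnj (time_slice g t x))))"
        unfolding set_integrable_def .
      have sm: "(\<lambda>x. s i (t, cell_rep x)) \<in> borel_measurable borel" for i
        by (rule hm[OF borel_measurable_simple_function[OF s]])
      show "(\<lambda>x. indicat_real torus_cell x *\<^sub>R (F t x * complex_of_real (s i (t, cell_rep x)))) \<in> borel_measurable lborel" for i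
        using sm[of i] by simp
      have [measurable]: "time_slice g t \<in> borel_measurable borel" using gs[of t] by (auto simp: L2_torus_def)
      show "(\<lambda>x. indicat_real torus_cell x *\<^sub>R (F t x * cnj (time_slice g t x))) \<in> borel_measurable lborel"
        by measurable
      show "AE x in lborel. (\<lambda>i. indicat_real torus_cell x *\<^sub>R (F t x * complex_of_real (s i (t, cell_rep x)))) \<longlonglongrightarrow> indicat_real torus_cell x *\<^sub>R (F t x * cnj (time_slice g t x))"
        unfolding cj'
        by (intro AE_I2 tendsto_scaleR tendsto_mult tendsto_of_real tendsto_const sl)
      show "AE x in lborel. norm (indicat_real torus_cell x *\<^sub>R (F t x * complex_of_real (s i (t, cell_rep x)))) \<le> indicat_real torus_cell x *\<^sub>R (2 * cmod (F t x * cnj (time_slice g t x)))" for i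
      proof (rule AE_I2)
        fix x
        have "cmod (F t x) * \<bar>s i (t, cell_rep x)\<bar> \<le> cmod (F t x) * (2 * \<bar>g (t, x)\<bar>)"
          using sb[of i "(t, cell_rep x)"] by (intro mult_left_mono) (auto simp: gp)
        then show "norm (indicat_real torus_cell x *\<^sub>R (F t x * complex_of_real (s i (t, cell_rep x)))) \<le> indicat_real torus_cell x *\<^sub>R (2 * cmod (F t x * cnj (time_slice g t x)))"
          unfolding cj by (auto split: split_indicator simp: norm_mult)
      qed
    qed
  qed
qed

text \<open>Against a fixed \<open>v\<close>, symmetry moves \<open>Q\<close> onto \<open>v\<close>.
  What remains is the jointly measurable \<open>f\<close> paired with one fixed function, and this
  is measurable in time by Fubini.\<close>

lemma Q_inner_measurable:
  assumes Q: "covariance_operator Q q \<beta>" and f: "f \<in> L2_time_torus" and g: "g \<in> L2_time_torus"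
  shows "(\<lambda>t. L2_inner (Q (time_slice f t)) (time_slice g t)) \<in> borel_measurable borel"
proof (rule weakly_measurable_inner[OF _ _ g])
  have fm [measurable]: "f \<in> borel_measurable borel" and fs: "\<And>t. time_slice f t \<in> L2_torus"
    using f by (auto simp: L2_time_torus_def)
  show "Q (time_slice f t) \<in> L2_torus" for t
    using Q fs by (auto simp: covariance_operator_def)
  fix v :: "real^'a \<Rightarrow> complex" assume v: "v \<in> L2_torus"
  then have Qv: "Q v \<in> L2_torus" using Q by (auto simp: covariance_operator_def)
  then have [measurable]: "Q v \<in> borel_measurable borel" by (auto simp: L2_torus_def)
  have eq: "L2_inner (Q (time_slice f t)) v = (LINT x|lborel. indicat_real torus_cell x *\<^sub>R (of_real (f (t, x)) * cnj (Q v x)))" for t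
    using Q fs[of t] v unfolding covariance_operator_def by (simp add: L2_inner_def set_lebesgue_integral_def time_slice_def)
  have [measurable]: "f \<in> borel_measurable (borel \<Otimes>\<^sub>M borel)" unfolding borel_prod by (rule fm)
  have "(\<lambda>t. LINT x|lborel. indicat_real torus_cell x *\<^sub>R (of_real (f (t, x)) * cnj (Q v x))) \<in> borel_measurable borel"
    by (rule lborel.borel_measurable_lebesgue_integral) measurable
  then show "(\<lambda>t. L2_inner (Q (time_slice f t)) v) \<in> borel_measurable borel" unfolding eq .
qed

lemma Q_inner_integrable:
  assumes Q: "covariance_operator Q q \<beta>" and f: "f \<in> L2_time_torus"
  shows "integrable lborel (\<lambda>t. Re (L2_inner (Q (time_slice f t)) (time_slice f t)))"
proof -
  have fs: "\<And>t. time_slice f t \<in> L2_torus" and fi: "integrable lborel (\<lambda>t. (L2_norm_torus (time_slice f t))\<^sup>2)"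
    using f by (auto simp: L2_time_torus_def)
  obtain B where B: "\<And>u. u \<in> L2_torus \<Longrightarrow> L2_norm_torus (Q u) \<le> B * L2_norm_torus u"
    using Q unfolding covariance_operator_def by blast
  note [measurable] = Q_inner_measurable[OF Q f f]
  have nn: "0 \<le> L2_norm_torus u" for u :: "real^'a \<Rightarrow> complex" by (simp add: L2_norm_torus_def set_lebesgue_integral_def)
  have i: "integrable lborel (\<lambda>t. (B\<^sup>2 + 1) / 2 * (L2_norm_torus (time_slice f t))\<^sup>2)"
    by (intro integrable_mult_right fi)
  show ?thesis
  proof (rule Bochner_Integration.integrable_bound[OF i])
    show "AE t in lborel. norm (Re (L2_inner (Q (time_slice f t)) (time_slice f t))) \<le> norm ((B\<^sup>2 + 1) / 2 * (L2_norm_torus (time_slice f t))\<^sup>2)"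
    proof (rule AE_I2)
      fix t
      have QL: "Q (time_slice f t) \<in> L2_torus" using Q fs by (auto simp: covariance_operator_def)
      have "norm (Re (L2_inner (Q (time_slice f t)) (time_slice f t))) \<le> cmod (L2_inner (Q (time_slice f t)) (time_slice f t))"
        using abs_Re_le_cmod by simp
      also have "\<dots> \<le> ((L2_norm_torus (Q (time_slice f t)))\<^sup>2 + (L2_norm_torus (time_slice f t))\<^sup>2) / 2"
        by (rule L2_torus_integrable_prod(2)[OF QL fs])
      also have "(L2_norm_torus (Q (time_slice f t)))\<^sup>2 \<le> (B * L2_norm_torus (time_slice f t))\<^sup>2"
        by (intro power_mono B fs nn)
      also have "((B * L2_norm_torus (time_slice f t))\<^sup>2 + (L2_norm_torus (time_slice f t))\<^sup>2) / 2 = (B\<^sup>2 + 1) / 2 * (L2_norm_torus (time_slice f t))\<^sup>2"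
        by (simp add: power_mult_distrib field_simps)
      also have "\<dots> \<le> norm ((B\<^sup>2 + 1) / 2 * (L2_norm_torus (time_slice f t))\<^sup>2)" by simp
      finally show "norm (Re (L2_inner (Q (time_slice f t)) (time_slice f t))) \<le> norm ((B\<^sup>2 + 1) / 2 * (L2_norm_torus (time_slice f t))\<^sup>2)"
        by simp
    qed
  qed measurable
qed

section \<open>Cutting off and delaying in time\<close>

definition time_cut :: "real set \<Rightarrow> ('d spacetime \<Rightarrow> real) \<Rightarrow> ('d::finite) spacetime \<Rightarrow> real" where
  "time_cut T f w = indicator T (fst w) * f w"

lemma zero_L2_torus: "(\<lambda>_. 0) \<in> L2_torus"
  by (rule L2_torus_boundedI[where C=0]) (auto simp: periodic_def)

lemma time_slice_cut: "time_slice (time_cut T f) t = (if t \<in> T then time_slice f t else (\<lambda>_. 0))"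
  by (auto simp: time_slice_def time_cut_def fun_eq_iff)

lemma L2_norm_zero: "L2_norm_torus (\<lambda>_. 0) = 0"
  by (simp add: L2_norm_torus_def)

lemma time_cut_L2:
  assumes f: "f \<in> L2_time_torus" and [measurable]: "T \<in> sets borel"
  shows "time_cut T f \<in> L2_time_torus"
proof -
  have fm [measurable]: "f \<in> borel_measurable borel" and fs: "\<And>t. time_slice f t \<in> L2_torus" and
     fi: "integrable lborel (\<lambda>t. (L2_norm_torus (time_slice f t))\<^sup>2)"
    using f by (auto simp: L2_time_torus_def)
  have "(\<lambda>w. indicator T (fst w) * f w) \<in> borel_measurable borel"
  proof -
    have [measurable]: "fst \<in> measurable (borel :: 'a spacetime measure) borel" by (intro borel_measurable_continuous_onI continuous_intros)
    show ?thesis by measurable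
  qed
  moreover have "integrable lborel (\<lambda>t. indicator T t *\<^sub>R (L2_norm_torus (time_slice f t))\<^sup>2)"
    by (intro integrable_mult_indicator fi) simp
  then have "integrable lborel (\<lambda>t. (L2_norm_torus (time_slice (time_cut T f) t))\<^sup>2)"
    by (rule Bochner_Integration.integrable_cong[THEN iffD1, rotated -1]) (auto simp: time_slice_cut L2_norm_zero)
  ultimately show ?thesis
    unfolding time_cut_def[symmetric]
    using fs zero_L2_torus by (auto simp: L2_time_torus_def time_slice_cut)
qed

lemma Q_inner_zero:
  assumes Q: "covariance_operator Q q \<beta>" and v: "v \<in> L2_torus"
  shows "L2_inner (Q (\<lambda>_. 0)) v = 0" "L2_inner (Q v) (\<lambda>_. 0) = 0"
proof -
  have "L2_inner (Q (\<lambda>_. 0)) v = L2_inner (\<lambda>_. 0) (Q v)"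
    using Q v zero_L2_torus by (auto simp: covariance_operator_def)
  then show "L2_inner (Q (\<lambda>_. 0)) v = 0" by (simp add: L2_inner_def)
  show "L2_inner (Q v) (\<lambda>_. 0) = 0" by (simp add: L2_inner_def)
qed

text \<open>The form pairs the two functions at one and the same time and then integrates: this is
  whiteness in time, and the source of the exact orthogonality of well separated delays.\<close>

lemma Q_form_disjoint_times:
  assumes Q: "covariance_operator Q q \<beta>" and f: "f \<in> L2_time_torus" and g: "g \<in> L2_time_torus"
    and disj: "\<And>t. (\<forall>x. f (t, x) = 0) \<or> (\<forall>x. g (t, x) = 0)"
  shows "Q_form Q f g = 0"
proof -
  have "L2_inner (Q (time_slice f t)) (time_slice g t) = 0" for t
  proof -
    have s: "time_slice f t \<in> L2_torus" "time_slice g t \<in> L2_torus" using f g by (auto simp: L2_time_torus_def)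
    have "time_slice f t = (\<lambda>_. 0) \<or> time_slice g t = (\<lambda>_. 0)"
      using disj[of t] by (auto simp: time_slice_def fun_eq_iff)
    then show ?thesis using Q_inner_zero[OF Q] s by auto
  qed
  then show ?thesis by (simp add: Q_form_def)
qed

text \<open>The form of \<open>f\<close> with its cut equals the form of the cut with itself, since
  \<open>Q\<close> acts at each time separately. The squared distance between their images is
  therefore the tail of an integrable function of time.\<close>

lemma completion_time_cut_dense:
  fixes \<iota> :: "('d::finite spacetime \<Rightarrow> real) \<Rightarrow> 'h::{real_inner,complete_space}"
  assumes Q: "covariance_operator Q q \<beta>" and \<iota>: "is_Q_completion Q \<iota>"
  shows "closure {\<iota> (time_cut {-m..m} f) | f m. f \<in> L2_time_torus} = UNIV"
proof -
  let ?D = "{\<iota> (time_cut {-m..m} f) | f m. f \<in> L2_time_torus}"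
  have "\<iota> f \<in> closure ?D" if f: "f \<in> L2_time_torus" for f
  proof -
    let ?c = "\<lambda>n. time_cut {- real n..real n} f"
    define w where "w t = Re (L2_inner (Q (time_slice f t)) (time_slice f t))" for t
    have iw: "integrable lborel w" unfolding w_def by (rule Q_inner_integrable[OF Q f])
    have c: "?c n \<in> L2_time_torus" for n by (rule time_cut_L2[OF f]) simp
    have fs: "\<And>t. time_slice f t \<in> L2_torus" using f by (auto simp: L2_time_torus_def)
    have ip: "\<iota> a \<bullet> \<iota> b = Q_form Q a b" if "a \<in> L2_time_torus" "b \<in> L2_time_torus" for a b
      using \<iota> that by (auto simp: is_Q_completion_def)
    have in1: "\<iota> f \<bullet> \<iota> (?c n) = (LINT t|lborel. indicator {- real n..real n} t * w t)" for n
      unfolding ip[OF f c] Q_form_def w_def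
      by (intro Bochner_Integration.integral_cong refl) (auto simp: time_slice_cut Q_inner_zero[OF Q fs] split: split_indicator)
    have in2: "\<iota> (?c n) \<bullet> \<iota> (?c n) = (LINT t|lborel. indicator {- real n..real n} t * w t)" for n
      unfolding ip[OF c c] Q_form_def w_def
      by (intro Bochner_Integration.integral_cong refl) (auto simp: time_slice_cut Q_inner_zero[OF Q zero_L2_torus] split: split_indicator)
    have in0: "\<iota> f \<bullet> \<iota> f = (LINT t|lborel. w t)" unfolding ip[OF f f] Q_form_def w_def ..
    have d: "(norm (\<iota> (?c n) - \<iota> f))\<^sup>2 = (LINT t|lborel. w t) - (LINT t|lborel. indicator {- real n..real n} t * w t)" for n
      unfolding power2_norm_eq_inner by (simp add: inner_diff_left inner_diff_right in0 in1 in2 inner_commute[of "\<iota> (?c n)" "\<iota> f"])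
    have "(\<lambda>n. LINT t|lborel. indicator {- real n..real n} t * w t) \<longlonglongrightarrow> (LINT t|lborel. w t)"
    proof (rule integral_dominated_convergence)
      show "integrable lborel (\<lambda>t. norm (w t))" using iw by simp
      show "AE t in lborel. (\<lambda>n. indicator {- real n..real n} t * w t) \<longlonglongrightarrow> w t"
      proof (rule AE_I2, rule tendsto_eventually)
        fix t :: real
        obtain n0 where n0: "\<bar>t\<bar> \<le> real n0" using real_arch_simple by blast
        show "\<forall>\<^sub>F n in sequentially. indicator {- real n..real n} t * w t = w t"
          using eventually_ge_at_top[of n0] by eventually_elim (use n0 in \<open>auto split: split_indicator\<close>)
      qed
    qed (use iw in \<open>auto split: split_indicator\<close>)
    then have "(\<lambda>n. (norm (\<iota> (?c n) - \<iota> f))\<^sup>2) \<longlonglongrightarrow> 0"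
      unfolding d using tendsto_diff[OF tendsto_const[of "LINT t|lborel. w t"]] by fastforce
    then have "(\<lambda>n. sqrt ((norm (\<iota> (?c n) - \<iota> f))\<^sup>2)) \<longlonglongrightarrow> sqrt 0" by (rule tendsto_real_sqrt)
    then have "(\<lambda>n. norm (\<iota> (?c n) - \<iota> f)) \<longlonglongrightarrow> 0" by simp
    then have "(\<lambda>n. \<iota> (?c n)) \<longlonglongrightarrow> \<iota> f" by (rule LIM_zero_cancel[OF tendsto_norm_zero_cancel])
    moreover have "\<iota> (?c n) \<in> ?D" for n using f by blast
    ultimately show ?thesis unfolding closure_sequential by (intro exI[of _ "\<lambda>n. \<iota> (?c n)"]) auto
  qed
  then have "\<iota> ` L2_time_torus \<subseteq> closure ?D" by auto
  then have "closure (\<iota> ` L2_time_torus) \<subseteq> closure ?D" by (rule closure_minimal) simp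
  then show ?thesis using \<iota> by (auto simp: is_Q_completion_def)
qed

definition delay :: "real \<Rightarrow> ('d spacetime \<Rightarrow> real) \<Rightarrow> ('d::finite) spacetime \<Rightarrow> real" where
  "delay a f w = f (w - (a, 0))"

lemma time_slice_delay: "time_slice (delay a f) t = time_slice f (t - a)"
  by (simp add: time_slice_def delay_def fun_eq_iff)

lemma lborel_integrable_minus_iff:
  fixes h :: "real \<Rightarrow> real"
  assumes "integrable lborel h" shows "integrable lborel (\<lambda>t. h (t - a))"
  using lborel_integrable_real_affine[of h 1 "- a"] assms by simp

lemma delay_L2:
  assumes f: "f \<in> L2_time_torus"
  shows "delay a f \<in> L2_time_torus"
proof -
  have fm [measurable]: "f \<in> borel_measurable borel" and fs: "\<And>t. time_slice f t \<in> L2_torus" and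
     fi: "integrable lborel (\<lambda>t. (L2_norm_torus (time_slice f t))\<^sup>2)"
    using f by (auto simp: L2_time_torus_def)
  have "(\<lambda>w::'a spacetime. w - (a, 0)) \<in> borel_measurable borel" by (intro borel_measurable_continuous_onI continuous_intros)
  from measurable_compose[OF this fm] have "delay a f \<in> borel_measurable borel" by (simp add: delay_def[abs_def])
  then show ?thesis using fs lborel_integrable_minus_iff[OF fi, of a] by (auto simp: L2_time_torus_def time_slice_delay)
qed

lemma Q_form_delay: "Q_form Q (delay a f) (delay a g) = Q_form Q f g"
  unfolding Q_form_def time_slice_delay
  by (subst (2) lborel_integral_real_affine[of 1 _ "- a"]) auto

text \<open>The delay preserves distances between images, so it descends to the range of \<iota> and
  extends to the closure by uniform continuity. Inner products are then extended by density, one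
  argument at a time.\<close>

lemma completion_delay_isometry:
  fixes \<iota> :: "('d::finite spacetime \<Rightarrow> real) \<Rightarrow> 'h::{real_inner,complete_space}"
  assumes \<iota>: "is_Q_completion Q \<iota>"
  obtains V where "\<And>x y. V x \<bullet> V y = x \<bullet> y" "\<And>f. f \<in> L2_time_torus \<Longrightarrow> V (\<iota> f) = \<iota> (delay a f)"
proof -
  let ?L = "\<iota> ` L2_time_torus"
  have cl: "closure ?L = UNIV" using \<iota> by (auto simp: is_Q_completion_def)
  have ip: "\<iota> (delay a f) \<bullet> \<iota> (delay a g) = \<iota> f \<bullet> \<iota> g" if "f \<in> L2_time_torus" "g \<in> L2_time_torus" for f g
    using \<iota> that delay_L2[of f a] delay_L2[of g a] by (auto simp: is_Q_completion_def Q_form_delay)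
  have dist: "dist (\<iota> (delay a f)) (\<iota> (delay a g)) = dist (\<iota> f) (\<iota> g)" if "f \<in> L2_time_torus" "g \<in> L2_time_torus" for f g
    unfolding dist_norm norm_eq_sqrt_inner using that by (simp add: inner_diff_left inner_diff_right ip)
  \<comment> \<open>The choice of the preimage does not matter: two functions with the same image
    have delays at distance 0.\<close>
  define V0 where "V0 x = \<iota> (delay a (SOME f. f \<in> L2_time_torus \<and> \<iota> f = x))" for x
  have V0: "V0 (\<iota> f) = \<iota> (delay a f)" if f: "f \<in> L2_time_torus" for f
  proof -
    have "(SOME g. g \<in> L2_time_torus \<and> \<iota> g = \<iota> f) \<in> L2_time_torus \<and> \<iota> (SOME g. g \<in> L2_time_torus \<and> \<iota> g = \<iota> f) = \<iota> f"
      by (rule someI[of _ f]) (use f in simp)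
    then have "dist (V0 (\<iota> f)) (\<iota> (delay a f)) = 0" unfolding V0_def using dist f by simp
    then show ?thesis by simp
  qed
  have "uniformly_continuous_on ?L V0"
    unfolding uniformly_continuous_on_def using V0 dist by (auto intro!: exI)
  then obtain V where Vu: "uniformly_continuous_on (closure ?L) V" and V: "\<And>x. x \<in> ?L \<Longrightarrow> V0 x = V x"
    by (rule uniformly_continuous_on_extension_on_closure) blast
  have Vc: "continuous_on UNIV V" using uniformly_continuous_imp_continuous[OF Vu] cl by simp
  have VL: "V (\<iota> f) = \<iota> (delay a f)" if "f \<in> L2_time_torus" for f using V V0 that by auto
  have 1: "V (\<iota> f) \<bullet> V y = \<iota> f \<bullet> y" if f: "f \<in> L2_time_torus" for f y
  proof -
    have "continuous_on UNIV (\<lambda>y. V (\<iota> f) \<bullet> V y - \<iota> f \<bullet> y)"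
      by (intro continuous_intros Vc)
    then have "V (\<iota> f) \<bullet> V y - \<iota> f \<bullet> y = 0"
      using continuous_constant_on_closure[of ?L "\<lambda>y. V (\<iota> f) \<bullet> V y - \<iota> f \<bullet> y" 0 y] cl f by (force simp: VL ip)
    then show ?thesis by simp
  qed
  have 2: "V x \<bullet> V y = x \<bullet> y" for x y
  proof -
    have "continuous_on (closure ?L) (\<lambda>x. V x \<bullet> V y - x \<bullet> y)"
      unfolding cl by (intro continuous_intros Vc)
    moreover have "V x \<bullet> V y - x \<bullet> y = 0" if "x \<in> ?L" for x
      using that 1 by auto
    ultimately have "V x \<bullet> V y - x \<bullet> y = 0"
      by (rule continuous_constant_on_closure) (use cl in auto)
    then show ?thesis by simp
  qed
  show ?thesis by (rule that[OF 2 VL])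
qed

section \<open>Square integrability of periodized kernels\<close>

lemma finite_lattice_ball: "finite {k :: int ^ ('d::finite). norm (lattice_vec k) \<le> R}"
proof -
  let ?S = "{- \<lceil>R\<rceil>..\<lceil>R\<rceil>}"
  have "finite (vec_lambda ` (PiE (UNIV :: 'd set) (\<lambda>_. ?S)))" by (intro finite_imageI finite_PiE) auto
  moreover have "{k :: int ^ 'd. norm (lattice_vec k) \<le> R} \<subseteq> vec_lambda ` (PiE (UNIV :: 'd set) (\<lambda>_. ?S))"
  proof
    fix k :: "int ^ 'd" assume "k \<in> {k. norm (lattice_vec k) \<le> R}"
    then have k: "norm (lattice_vec k) \<le> R" by simp
    have "k $ i \<in> ?S" for i
    proof -
      have "\<bar>lattice_vec k $ i\<bar> \<le> R" using component_le_norm_cart[of "lattice_vec k" i] k by linarith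
      then have "2 * pi * \<bar>real_of_int (k $ i)\<bar> \<le> R" by (simp add: lattice_vec_def abs_mult)
      moreover have "1 * \<bar>real_of_int (k $ i)\<bar> \<le> 2 * pi * \<bar>real_of_int (k $ i)\<bar>"
        using pi_gt3 by (intro mult_right_mono) auto
      ultimately have "\<bar>real_of_int (k $ i)\<bar> \<le> R" by linarith
      then show ?thesis by (simp add: abs_le_iff) linarith
    qed
    then show "k \<in> vec_lambda ` (PiE UNIV (\<lambda>_. ?S))"
      by (intro image_eqI[of _ _ "vec_nth k"]) auto
  qed
  ultimately show ?thesis by (rule finite_subset[rotated])
qed

lemma lattice_vec_add: "lattice_vec (k + l) = lattice_vec k + lattice_vec l"
  by (simp add: lattice_vec_def vec_eq_iff algebra_simps)

text \<open>Over a bounded region of space only finitely many translates meet the support, so the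
  infinite sum is locally finite. Measurability, boundedness over the cell and compact support in
  time all follow from that.\<close>

lemma periodize_L2:
  fixes \<psi> :: "('d::finite) spacetime \<Rightarrow> real"
  assumes c: "continuous_on UNIV \<psi>" and supp: "\<And>z. M < norm z \<Longrightarrow> \<psi> z = 0" and b: "\<And>z. \<bar>\<psi> z\<bar> \<le> C"
  shows "periodize \<psi> \<in> L2_time_torus"
proof -
  define F where "F R = {k :: int^'d. norm (lattice_vec k) \<le> M + R}" for R
  have fin: "finite (F R)" for R unfolding F_def by (rule finite_lattice_ball)
  have per: "periodize \<psi> w = (\<Sum>k\<in>F R. \<psi> (w + (0, lattice_vec k)))" if w: "norm (snd w) \<le> R" for w R
  proof -
    have z: "\<psi> (w + (0, lattice_vec k)) = 0" if "k \<notin> F R" for k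
    proof (rule supp)
      have "norm (lattice_vec k) > M + R" using that by (simp add: F_def)
      moreover have "norm (lattice_vec k) \<le> norm (snd w + lattice_vec k) + norm (snd w)"
        using norm_triangle_ineq4[of "snd w + lattice_vec k" "snd w"] by simp
      moreover have "norm (snd w + lattice_vec k) \<le> norm (w + (0, lattice_vec k))"
        using norm_snd_le[of "snd w + lattice_vec k" "fst w"] by (simp add: plus_prod_def)
      ultimately show "M < norm (w + (0, lattice_vec k))" using w by linarith
    qed
    have "periodize \<psi> w = (\<Sum>\<^sub>\<infinity>k\<in>F R. \<psi> (w + (0, lattice_vec k)))"
      unfolding periodize_def by (rule infsum_cong_neutral) (auto simp: z)
    then show ?thesis using fin by simp
  qed
  have pm: "periodize \<psi> \<in> borel_measurable borel"
  proof (rule borel_measurable_LIMSEQ_metric)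
    show "(\<lambda>w. \<Sum>k\<in>F (real n). \<psi> (w + (0, lattice_vec k))) \<in> borel_measurable borel" for n
      by (intro borel_measurable_sum borel_measurable_continuous_onI continuous_on_compose2[OF c] continuous_intros) auto
    show "(\<lambda>n. \<Sum>k\<in>F (real n). \<psi> (w + (0, lattice_vec k))) \<longlonglongrightarrow> periodize \<psi> w" for w
    proof (rule tendsto_eventually)
      obtain n0 where n0: "norm (snd w) \<le> real n0" using real_arch_simple by blast
      show "\<forall>\<^sub>F n in sequentially. (\<Sum>k\<in>F (real n). \<psi> (w + (0, lattice_vec k))) = periodize \<psi> w"
        using eventually_ge_at_top[of n0] by eventually_elim (rule per[symmetric], use n0 in simp)
    qed
  qed
  have pp: "periodic (\<lambda>x. periodize \<psi> (t, x))" for t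
    unfolding periodic_def
  proof (intro allI)
    fix l :: "int^'d" and x
    have "periodize \<psi> (t, x + lattice_vec l) = (\<Sum>\<^sub>\<infinity>k. \<psi> ((t, x) + (0, lattice_vec (l + k))))"
      unfolding periodize_def by (simp add: lattice_vec_add add.assoc)
    also have "\<dots> = (\<Sum>\<^sub>\<infinity>k. \<psi> ((t, x) + (0, lattice_vec k)))"
      by (rule infsum_reindex_bij_betw[where g="\<lambda>k. l + k" and f="\<lambda>k. \<psi> ((t, x) + (0, lattice_vec k))"])
         (auto intro!: bij_betwI[where g="\<lambda>k. k - l"])
    finally show "periodize \<psi> (t, x + lattice_vec l) = periodize \<psi> (t, x)" by (simp add: periodize_def)
  qed
  obtain R where R: "\<And>x::real^'d. x \<in> torus_cell \<Longrightarrow> norm x \<le> R"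
    using compact_imp_bounded[OF compact_cbox] unfolding torus_cell_cbox bounded_iff by metis
  define E where "E = real (card (F R)) * C"
  have bd: "\<bar>periodize \<psi> (t, x)\<bar> \<le> E" if "x \<in> torus_cell" for t x
  proof -
    have "\<bar>periodize \<psi> (t, x)\<bar> \<le> (\<Sum>k\<in>F R. \<bar>\<psi> ((t, x) + (0, lattice_vec k))\<bar>)"
      using per[of "(t, x)" R] R[OF that] by (simp add: sum_abs)
    also have "\<dots> \<le> E" unfolding E_def using sum_bounded_above[of "F R" "\<lambda>k. \<bar>\<psi> ((t, x) + (0, lattice_vec k))\<bar>" C] b by simp
    finally show ?thesis .
  qed
  have t0: "periodize \<psi> (t, x) = 0" if "\<bar>t\<bar> > M" for t x
  proof -
    have "\<psi> ((t, x) + (0, lattice_vec k)) = 0" for k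
      using norm_fst_le[of t "x + lattice_vec k"] that by (intro supp) simp
    then show ?thesis by (simp add: periodize_def)
  qed
  have slm: "time_slice (periodize \<psi>) t \<in> borel_measurable borel" for t
  proof -
    have "(\<lambda>x. (t, x)) \<in> measurable borel (borel :: 'd spacetime measure)" by (intro borel_measurable_continuous_onI continuous_intros)
    from measurable_compose[OF this pm] show ?thesis unfolding time_slice_def[abs_def] by simp
  qed
  have sl: "time_slice (periodize \<psi>) t \<in> L2_torus" for t
    by (rule L2_torus_boundedI[where C=E, OF slm]) (use pp[of t] bd in \<open>auto simp: time_slice_def periodic_def\<close>)
  have sq: "(L2_norm_torus (time_slice (periodize \<psi>) t))\<^sup>2 = (LINT x|lborel. indicator torus_cell x * (periodize \<psi> (t, x))\<^sup>2)" for t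
    unfolding L2_norm_torus_def set_lebesgue_integral_def time_slice_def
    by (subst real_sqrt_pow2) (auto intro!: integral_nonneg_AE)
  have "integrable lborel (\<lambda>t. (L2_norm_torus (time_slice (periodize \<psi>) t))\<^sup>2)"
  proof (rule Bochner_Integration.integrable_bound)
    show "integrable lborel (\<lambda>t. indicator {-M..M} t * (measure lborel (torus_cell :: (real^'d) set) * E\<^sup>2))"
      by (intro integrable_mult_left integrable_real_indicator) (auto simp: emeasure_lborel_Icc_eq)
    have pm2 [measurable]: "periodize \<psi> \<in> borel_measurable (borel \<Otimes>\<^sub>M borel)" unfolding borel_prod by (rule pm)
    have "(\<lambda>t. LINT x|lborel. indicator torus_cell x * (periodize \<psi> (t, x))\<^sup>2) \<in> borel_measurable borel"
      by (rule lborel.borel_measurable_lebesgue_integral) measurable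
    then show "(\<lambda>t. (L2_norm_torus (time_slice (periodize \<psi>) t))\<^sup>2) \<in> borel_measurable lborel" unfolding sq by simp
    show "AE t in lborel. norm ((L2_norm_torus (time_slice (periodize \<psi>) t))\<^sup>2) \<le> norm (indicator {-M..M} t * (measure lborel (torus_cell :: (real^'d) set) * E\<^sup>2))"
    proof (rule AE_I2)
      fix t
      show "norm ((L2_norm_torus (time_slice (periodize \<psi>) t))\<^sup>2) \<le> norm (indicator {-M..M} t * (measure lborel (torus_cell :: (real^'d) set) * E\<^sup>2))"
      proof (cases "\<bar>t\<bar> > M")
        case True
        then show ?thesis unfolding sq by (simp add: t0)
      next
        case False
        have "(LINT x|lborel. indicator torus_cell x * (periodize \<psi> (t, x))\<^sup>2) \<le> (LINT x|lborel. indicator (torus_cell :: (real^'d) set) x * E\<^sup>2)"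
        proof (rule integral_mono)
          show "integrable lborel (\<lambda>x. indicat_real torus_cell x * (periodize \<psi> (t, x))\<^sup>2)"
            using sl[of t] by (simp add: L2_torus_def set_integrable_def time_slice_def)
          show "integrable lborel (\<lambda>x. indicator (torus_cell :: (real^'d) set) x * E\<^sup>2)"
            using emeasure_torus_cell by (intro integrable_mult_left integrable_real_indicator) auto
          show "indicat_real torus_cell x * (periodize \<psi> (t, x))\<^sup>2 \<le> indicator torus_cell x * E\<^sup>2" for x
            using bd[of x t] by (auto split: split_indicator simp: abs_le_square_iff[symmetric])
        qed
        moreover have "indicat_real {-M..M} t = 1" using False by (auto simp: indicator_def abs_le_iff not_less)
        ultimately show ?thesis unfolding sq[symmetric] by (simp add: abs_mult)
      qed
    qed
  qed
  then show ?thesis using pm sl by (auto simp: L2_time_torus_def)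
qed

section \<open>The flow on the Gaussian space\<close>

text \<open>A property of a single map for a single delay. The null set may depend on
  \<open>f\<close> and on the chosen versions, and no relation between the maps of different delays
  is included.\<close>

definition noise_delay ::
    "((('d::finite) spacetime \<Rightarrow> real) \<Rightarrow> 'h) \<Rightarrow> (nat \<Rightarrow> 'h::{real_inner,complete_space}) \<Rightarrow> real \<Rightarrow> ((nat \<Rightarrow> real) \<Rightarrow> nat \<Rightarrow> real) \<Rightarrow> bool" where
  "noise_delay \<iota> e a T \<longleftrightarrow> T \<in> measurable gauss_space gauss_space \<and> distr gauss_space gauss_space T = gauss_space \<and>
     (\<forall>f\<in>L2_time_torus. \<forall>X Y. is_white_noise_integral e (\<iota> f) X \<longrightarrow> is_white_noise_integral e (\<iota> (delay a f)) Y \<longrightarrow>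
       (AE \<omega> in gauss_space. X (T \<omega>) = Y \<omega>))"

lemma noise_delayD:
  fixes \<iota> :: "('d::finite spacetime \<Rightarrow> real) \<Rightarrow> 'h::{real_inner,complete_space}"
  assumes "noise_delay \<iota> e a T"
  shows "T \<in> measurable gauss_space gauss_space" "distr gauss_space gauss_space T = gauss_space"
    "f \<in> L2_time_torus \<Longrightarrow> is_white_noise_integral e (\<iota> f) X \<Longrightarrow> is_white_noise_integral e (\<iota> (delay a f)) Y \<Longrightarrow> AE \<omega> in gauss_space. X (T \<omega>) = Y \<omega>"
  using assms unfolding noise_delay_def by blast+

lemma noise_flow:
  fixes \<iota> :: "('d::finite spacetime \<Rightarrow> real) \<Rightarrow> 'h::{real_inner,complete_space}"
  assumes Q: "covariance_operator Q q \<beta>" and \<iota>: "is_Q_completion Q \<iota>" and e: "orthonormal_basis e"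
  obtains \<theta> :: "real \<Rightarrow> (nat \<Rightarrow> real) \<Rightarrow> (nat \<Rightarrow> real)"
  where "\<And>a. noise_delay \<iota> e a (\<theta> a)"
    "\<And>B. B \<in> sets gauss_space \<Longrightarrow> (\<And>a. AE \<omega> in gauss_space. \<theta> a \<omega> \<in> B \<longleftrightarrow> \<omega> \<in> B) \<Longrightarrow> measure gauss_space B \<in> {0, 1}"
proof -
  have "\<exists>V. (\<forall>x y. V x \<bullet> V y = x \<bullet> y) \<and> (\<forall>f\<in>L2_time_torus. V (\<iota> f) = \<iota> (delay a f))" for a
    by (rule completion_delay_isometry[OF \<iota>, of a]) blast
  then have "\<forall>a. \<exists>V. (\<forall>x y. V x \<bullet> V y = x \<bullet> y) \<and> (\<forall>f\<in>L2_time_torus. V (\<iota> f) = \<iota> (delay a f))" by blast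
  then obtain V where V: "\<And>a x y. V a x \<bullet> V a y = x \<bullet> y" and V\<iota>: "\<And>a f. f \<in> L2_time_torus \<Longrightarrow> V a (\<iota> f) = \<iota> (delay a f)"
    unfolding choice_iff by blast
  have "\<exists>\<theta>. \<theta> \<in> measurable gauss_space gauss_space \<and> distr gauss_space gauss_space \<theta> = gauss_space \<and>
    (\<forall>h X Y. is_white_noise_integral e h X \<longrightarrow> is_white_noise_integral e (V a h) Y \<longrightarrow> (AE \<omega> in gauss_space. X (\<theta> \<omega>) = Y \<omega>))" for a
    by (rule white_noise_isometry_lift[OF e V, of a]) blast
  then have "\<forall>a. \<exists>\<theta>. \<theta> \<in> measurable gauss_space gauss_space \<and> distr gauss_space gauss_space \<theta> = gauss_space \<and>
    (\<forall>h X Y. is_white_noise_integral e h X \<longrightarrow> is_white_noise_integral e (V a h) Y \<longrightarrow> (AE \<omega> in gauss_space. X (\<theta> \<omega>) = Y \<omega>))" by blast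
  then obtain \<theta> where \<theta>: "\<And>a. \<theta> a \<in> measurable gauss_space gauss_space" "\<And>a. distr gauss_space gauss_space (\<theta> a) = gauss_space"
    and lift: "\<And>a h X Y. is_white_noise_integral e h X \<Longrightarrow> is_white_noise_integral e (V a h) Y \<Longrightarrow> AE \<omega> in gauss_space. X (\<theta> a \<omega>) = Y \<omega>"
    unfolding choice_iff by blast
  show ?thesis
  proof (rule that)
    show "noise_delay \<iota> e a (\<theta> a)" for a
      unfolding noise_delay_def using \<theta> lift V\<iota> by metis
  next
    fix B assume B [measurable]: "B \<in> sets gauss_space" and inv: "\<And>a. AE \<omega> in gauss_space. \<theta> a \<omega> \<in> B \<longleftrightarrow> \<omega> \<in> B"
    show "measure gauss_space B \<in> {0, 1}"
    proof (rule zero_one_of_char_on_event[OF e B completion_time_cut_dense[OF Q \<iota>]])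
      fix h X assume "h \<in> {\<iota> (time_cut {- m..m} f) |f m. f \<in> L2_time_torus}" and X: "is_white_noise_integral e h X"
      then obtain f m where f: "f \<in> L2_time_torus" and h: "h = \<iota> (time_cut {- m..m} f)" by blast
      define c where "c = time_cut {- m..m} f"
      have c: "c \<in> L2_time_torus" unfolding c_def by (rule time_cut_L2[OF f]) simp
      \<comment> \<open>A time window from -m to m has length at most
        \<open>2 * \<bar>m\<bar>\<close>, so delays by multiples of a larger number have pairwise
        disjoint time supports. The absolute value also covers negative \<open>m\<close>, where the
        cut is zero.\<close>
      define p where "p k = (2 * \<bar>m\<bar> + 1) * real k" for k :: nat
      define g where "g k = V (p k) h" for k
      have g\<iota>: "g k = \<iota> (delay (p k) c)" for k unfolding g_def h c_def[symmetric] by (rule V\<iota>[OF c])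
      have "\<forall>k. \<exists>Y. is_white_noise_integral e (g k) Y" using white_noise_integral_exists[OF e] by blast
      then obtain Y where Y: "\<And>k. is_white_noise_integral e (g k) (Y k)" unfolding choice_iff by blast
      note Xm = white_noise_integral_measurable[OF X] and Ym = white_noise_integral_measurable[OF Y]
      show "(LINT \<omega>|gauss_space. indicator B \<omega> * iexp (X \<omega>)) = of_real (measure gauss_space B * exp (- (norm h)\<^sup>2 / 2))"
      proof (rule char_on_invariant_event[OF e B X _ _ Y])
        show "norm (g k) = norm h" for k unfolding g_def norm_eq_sqrt_inner V ..
        show "g j \<bullet> g k = 0" if "j \<noteq> k" for j k
        proof -
          have "Q_form Q (delay (p j) c) (delay (p k) c) = 0"
          proof (rule Q_form_disjoint_times[OF Q delay_L2[OF c] delay_L2[OF c]])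
            fix t
            have "\<not> (\<bar>t - p j\<bar> \<le> m \<and> \<bar>t - p k\<bar> \<le> m)"
            proof
              assume "\<bar>t - p j\<bar> \<le> m \<and> \<bar>t - p k\<bar> \<le> m"
              then have "\<bar>p j - p k\<bar> \<le> 2 * \<bar>m\<bar>" by linarith
              moreover have "\<bar>p j - p k\<bar> = (2 * \<bar>m\<bar> + 1) * \<bar>real j - real k\<bar>"
                unfolding p_def right_diff_distrib[symmetric] abs_mult by simp
              moreover have "1 \<le> \<bar>real j - real k\<bar>" using that by linarith
              then have "(2 * \<bar>m\<bar> + 1) * 1 \<le> (2 * \<bar>m\<bar> + 1) * \<bar>real j - real k\<bar>" by (intro mult_left_mono) auto
              ultimately have "2 * \<bar>m\<bar> + 1 \<le> \<bar>p j - p k\<bar>" by simp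
              then show False using \<open>\<bar>p j - p k\<bar> \<le> 2 * \<bar>m\<bar>\<close> by linarith
            qed
            then show "(\<forall>x. delay (p j) c (t, x) = 0) \<or> (\<forall>x. delay (p k) c (t, x) = 0)"
              by (auto simp: delay_def c_def time_cut_def split: split_indicator)
          qed
          then show ?thesis unfolding g\<iota> using \<iota> delay_L2[OF c] by (auto simp: is_Q_completion_def)
        qed
        fix k
        have ind: "(\<lambda>\<omega>. indicator B \<omega> :: complex) \<in> borel_measurable gauss_space" by measurable
        have Xi: "(\<lambda>\<omega>. iexp (X \<omega>)) \<in> borel_measurable gauss_space" by (rule borel_measurable_integrable[OF gauss_iexp_integrable[OF Xm]])
        have Yi: "(\<lambda>\<omega>. iexp (Y k \<omega>)) \<in> borel_measurable gauss_space" by (rule borel_measurable_integrable[OF gauss_iexp_integrable[OF Ym]])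
        have BX: "(\<lambda>\<omega>. indicator B \<omega> * iexp (X \<omega>)) \<in> borel_measurable gauss_space" by (rule borel_measurable_times[OF ind Xi])
        \<comment> \<open>The correlation with \<open>B\<close> is the same for every delay:
          \<open>B\<close> is almost surely invariant, \<open>Y k\<close> is almost surely
          \<open>X\<close> composed with the flow map, and that map preserves the measure.\<close>
        have "(LINT \<omega>|gauss_space. indicator B \<omega> * iexp (Y k \<omega>)) = (LINT \<omega>|gauss_space. indicator B (\<theta> (p k) \<omega>) * iexp (X (\<theta> (p k) \<omega>)))"
        proof (rule integral_cong_AE)
          show "(\<lambda>\<omega>. indicator B \<omega> * iexp (Y k \<omega>)) \<in> borel_measurable gauss_space" by (rule borel_measurable_times[OF ind Yi])
          show "(\<lambda>\<omega>. indicator B (\<theta> (p k) \<omega>) * iexp (X (\<theta> (p k) \<omega>))) \<in> borel_measurable gauss_space"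
            by (rule measurable_compose[OF \<theta>(1) BX])
          show "AE \<omega> in gauss_space. indicator B \<omega> * iexp (Y k \<omega>) = indicator B (\<theta> (p k) \<omega>) * iexp (X (\<theta> (p k) \<omega>))"
            using inv[of "p k"] lift[OF X Y[of k, unfolded g_def]]
            by eventually_elim (auto split: split_indicator)
        qed
        also have "\<dots> = (LINT \<omega>|distr gauss_space gauss_space (\<theta> (p k)). indicator B \<omega> * iexp (X \<omega>))"
          by (rule integral_distr[OF \<theta>(1) BX, symmetric])
        also have "\<dots> = (LINT \<omega>|gauss_space. indicator B \<omega> * iexp (X \<omega>))" unfolding \<theta>(2) ..
        finally show "(LINT \<omega>|gauss_space. indicator B \<omega> * iexp (Y k \<omega>)) = (LINT \<omega>|gauss_space. indicator B \<omega> * iexp (X \<omega>))" .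
      qed
    qed
  qed
qed

text \<open>Rounding the coordinates of \<open>z\<close> down to a grid of mesh
  \<open>1 / Suc n\<close> leaves countably many values, so each rounded function is jointly
  measurable; continuity in \<open>z\<close> removes the rounding.\<close>

lemma caratheodory_measurable:
  fixes f :: "'a \<Rightarrow> 'b::euclidean_space \<Rightarrow> real"
  assumes m: "\<And>z. (\<lambda>\<omega>. f \<omega> z) \<in> borel_measurable M" and c: "\<And>\<omega>. continuous_on UNIV (f \<omega>)"
  shows "(\<lambda>(\<omega>, z). f \<omega> z) \<in> borel_measurable (M \<Otimes>\<^sub>M borel)"
proof -
  define R where "R n z = (\<Sum>b\<in>Basis. (of_int \<lfloor>real (Suc n) * (z \<bullet> b)\<rfloor> / real (Suc n)) *\<^sub>R b)" for n and z :: 'b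
  have Rl: "(\<lambda>n. R n z) \<longlonglongrightarrow> z" for z
  proof -
    have "(\<lambda>n. of_int \<lfloor>real (Suc n) * (z \<bullet> b)\<rfloor> / real (Suc n)) \<longlonglongrightarrow> z \<bullet> b" for b
    proof (rule tendsto_sandwich[OF _ _ _ tendsto_const])
      have ev: "z \<bullet> b - 1 / real (Suc n) \<le> of_int \<lfloor>real (Suc n) * (z \<bullet> b)\<rfloor> / real (Suc n) \<and> of_int \<lfloor>real (Suc n) * (z \<bullet> b)\<rfloor> / real (Suc n) \<le> z \<bullet> b" for n
      proof -
        have "real (Suc n) * (z \<bullet> b) - 1 \<le> of_int \<lfloor>real (Suc n) * (z \<bullet> b)\<rfloor>" "of_int \<lfloor>real (Suc n) * (z \<bullet> b)\<rfloor> \<le> real (Suc n) * (z \<bullet> b)" by linarith+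
        then have "(real (Suc n) * (z \<bullet> b) - 1) / real (Suc n) \<le> of_int \<lfloor>real (Suc n) * (z \<bullet> b)\<rfloor> / real (Suc n)"
          "of_int \<lfloor>real (Suc n) * (z \<bullet> b)\<rfloor> / real (Suc n) \<le> (real (Suc n) * (z \<bullet> b)) / real (Suc n)"
          by (intro divide_right_mono; simp)+
        then show ?thesis by (simp add: diff_divide_distrib del: of_nat_Suc)
      qed
      show "\<forall>\<^sub>F n in sequentially. z \<bullet> b - 1 / real (Suc n) \<le> of_int \<lfloor>real (Suc n) * (z \<bullet> b)\<rfloor> / real (Suc n)" using ev by simp
      show "\<forall>\<^sub>F n in sequentially. of_int \<lfloor>real (Suc n) * (z \<bullet> b)\<rfloor> / real (Suc n) \<le> z \<bullet> b" using ev by simp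
      show "(\<lambda>n. z \<bullet> b - 1 / real (Suc n)) \<longlonglongrightarrow> z \<bullet> b"
        using tendsto_diff[OF tendsto_const LIMSEQ_inverse_real_of_nat, of "z \<bullet> b"] by (simp add: inverse_eq_divide)
    qed
    note l = this
    have "(\<lambda>n. R n z) \<longlonglongrightarrow> (\<Sum>b\<in>Basis. (z \<bullet> b) *\<^sub>R b)"
      unfolding R_def by (intro tendsto_sum tendsto_scaleR tendsto_const l)
    then show ?thesis by (simp add: euclidean_representation)
  qed
  have Rm: "R n \<in> borel_measurable borel" for n
    unfolding R_def[abs_def] by measurable
  have Rc: "countable (range (R n))" for n
  proof -
    have "range (R n) \<subseteq> (\<lambda>k. \<Sum>b\<in>Basis. (of_int (k b) / real (Suc n)) *\<^sub>R b) ` (PiE Basis (\<lambda>_. UNIV :: int set))"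
    proof
      fix y assume "y \<in> range (R n)"
      then obtain z where y: "y = R n z" by auto
      show "y \<in> (\<lambda>k. \<Sum>b\<in>Basis. (of_int (k b) / real (Suc n)) *\<^sub>R b) ` (PiE Basis (\<lambda>_. UNIV :: int set))"
        unfolding y R_def
        by (rule image_eqI[of _ _ "restrict (\<lambda>b. \<lfloor>real (Suc n) * (z \<bullet> b)\<rfloor>) Basis"]) auto
    qed
    then show ?thesis
      by (rule countable_subset) (intro countable_image countable_PiE finite_Basis, auto)
  qed
  show ?thesis
  proof (rule borel_measurable_LIMSEQ_metric)
    fix n
    have f1: "(\<lambda>p. f (fst p) r) \<in> borel_measurable (M \<Otimes>\<^sub>M borel)" for r
      by (rule measurable_compose[OF measurable_fst m])
    have "(\<lambda>p. R n (snd p)) \<in> measurable (M \<Otimes>\<^sub>M borel) borel" by (rule measurable_compose[OF measurable_snd Rm])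
    then have f2: "(\<lambda>p. R n (snd p)) \<in> measurable (M \<Otimes>\<^sub>M borel) (count_space (range (R n)))"
      unfolding measurable_count_space_eq_countable[OF Rc]
      by (auto intro!: measurable_sets[of _ _ borel])
    show "(\<lambda>p. f (fst p) (R n (snd p))) \<in> borel_measurable (M \<Otimes>\<^sub>M borel)"
      by (rule measurable_compose_countable'[where f="\<lambda>r p. f (fst p) r" and g="\<lambda>p. R n (snd p)", OF f1 f2 Rc])
  next
    fix p
    show "(\<lambda>n. f (fst p) (R n (snd p))) \<longlonglongrightarrow> (case p of (\<omega>, z) \<Rightarrow> f \<omega> z)"
      unfolding case_prod_beta using c[of "fst p"] Rl[of "snd p"]
      by (auto simp: continuous_on_eq_continuous_at intro: isCont_tendsto_compose)
  qed
qed

section \<open>Test functions\<close>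

lemma frechet_works: "f differentiable (at x) \<Longrightarrow> (f has_derivative frechet_derivative f (at x)) (at x)"
  by (simp add: frechet_derivative_works)

lemma frechet_eqI: "(f has_derivative f') (at x) \<Longrightarrow> frechet_derivative f (at x) = f'"
  using frechet_derivative_at by metis

lemma Ck_on_Suc_UNIV:
  "Ck_on (Suc k) f UNIV \<longleftrightarrow> (\<forall>x. f differentiable (at x)) \<and> (\<forall>b\<in>Basis. Ck_on k (\<lambda>x. frechet_derivative f (at x) b) UNIV)"
  by simp

lemma Ck_on_continuous: "Ck_on k f UNIV \<Longrightarrow> continuous_on UNIV f"
  by (cases k) (auto intro!: continuous_at_imp_continuous_on differentiable_imp_continuous_within)

lemma Ck_on_SucD: "Ck_on (Suc k) f UNIV \<Longrightarrow> Ck_on k f UNIV"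
proof (induction k arbitrary: f)
  case 0
  then show ?case using Ck_on_continuous[OF 0] by simp
next
  case (Suc k)
  then have d: "\<And>x. f differentiable (at x)" and D: "\<And>b. b \<in> Basis \<Longrightarrow> Ck_on (Suc k) (\<lambda>x. frechet_derivative f (at x) b) UNIV"
    unfolding Ck_on_Suc_UNIV[of "Suc k"] by auto
  show ?case unfolding Ck_on_Suc_UNIV using d Suc.IH[OF D] by auto
qed

lemma Ck_on_const: "Ck_on k (\<lambda>_. c) UNIV"
  by (induction k arbitrary: c) (auto simp: continuous_on_const)

lemma Ck_on_linear_comb:
  "Ck_on k f UNIV \<Longrightarrow> Ck_on k g UNIV \<Longrightarrow> Ck_on k (\<lambda>x. a * f x + b * g x) UNIV"
proof (induction k arbitrary: f g)
  case 0
  then show ?case by (auto intro!: continuous_intros)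
next
  case (Suc k)
  then have f: "\<And>x. f differentiable (at x)" and g: "\<And>x. g differentiable (at x)" by auto
  have D: "((\<lambda>x. a * f x + b * g x) has_derivative (\<lambda>h. a * frechet_derivative f (at x) h + b * frechet_derivative g (at x) h)) (at x)" for x
    by (auto intro!: derivative_eq_intros frechet_works f g)
  have "(\<lambda>x. a * f x + b * g x) differentiable (at x)" for x using D by (auto simp: differentiable_def)
  moreover have "Ck_on k (\<lambda>x. a * frechet_derivative f (at x) c + b * frechet_derivative g (at x) c) UNIV" if "c \<in> Basis" for c
    using Suc that by auto
  ultimately show ?case by (simp add: frechet_eqI[OF D])
qed

lemma Ck_on_mult:
  "Ck_on k f UNIV \<Longrightarrow> Ck_on k g UNIV \<Longrightarrow> Ck_on k (\<lambda>x. f x * g x) UNIV"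
proof (induction k arbitrary: f g)
  case 0
  then show ?case by (auto intro!: continuous_intros)
next
  case (Suc k)
  then have f: "\<And>x. f differentiable (at x)" and g: "\<And>x. g differentiable (at x)" by auto
  have D: "((\<lambda>x. f x * g x) has_derivative (\<lambda>h. 1 * (f x * frechet_derivative g (at x) h) + 1 * (frechet_derivative f (at x) h * g x))) (at x)" for x
    using has_derivative_mult[OF frechet_works[OF f] frechet_works[OF g]] by simp
  have "(\<lambda>x. f x * g x) differentiable (at x)" for x using D by (auto simp: differentiable_def)
  moreover have "Ck_on k (\<lambda>x. 1 * (f x * frechet_derivative g (at x) c) + 1 * (frechet_derivative f (at x) c * g x)) UNIV" if "c \<in> Basis" for c
  proof -
    have "Ck_on k f UNIV" "Ck_on k g UNIV" by (rule Ck_on_SucD[OF Suc.prems(1)], rule Ck_on_SucD[OF Suc.prems(2)])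
    moreover have "Ck_on k (\<lambda>x. frechet_derivative f (at x) c) UNIV" "Ck_on k (\<lambda>x. frechet_derivative g (at x) c) UNIV"
      using Suc.prems that by auto
    ultimately show ?thesis by (intro Ck_on_linear_comb Suc.IH)
  qed
  ultimately show ?case unfolding Ck_on_Suc_UNIV frechet_eqI[OF D] by auto
qed

lemma Ck_on_sum:
  "(\<And>i. i \<in> I \<Longrightarrow> Ck_on k (f i) UNIV) \<Longrightarrow> Ck_on k (\<lambda>x. \<Sum>i\<in>I. f i x) UNIV"
proof (induction I rule: infinite_finite_induct)
  case (insert i I)
  then show ?case using Ck_on_linear_comb[of k "f i" "\<lambda>x. \<Sum>i\<in>I. f i x" 1 1] by auto
qed (simp_all add: Ck_on_const)

lemma Ck_on_affine:
  fixes f :: "'b::euclidean_space \<Rightarrow> real" and L :: "'a::euclidean_space \<Rightarrow> 'b"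
  assumes L: "linear L"
  shows "Ck_on k f UNIV \<Longrightarrow> Ck_on k (\<lambda>x. f (L x + c)) UNIV"
proof (induction k arbitrary: f)
  case 0
  have "continuous_on UNIV (\<lambda>x. L x + c)"
    using L by (intro continuous_intros linear_continuous_on linear_conv_bounded_linear[THEN iffD1])
  with 0 show ?case by (auto intro: continuous_on_compose2)
next
  case (Suc k)
  then have f: "\<And>x. f differentiable (at x)" by auto
  have La: "((\<lambda>x. L x + c) has_derivative L) (at x)" for x
    using bounded_linear_imp_has_derivative[OF linear_conv_bounded_linear[THEN iffD1, OF L], of "at x"]
    by (auto intro!: derivative_eq_intros)
  have D: "((\<lambda>x. f (L x + c)) has_derivative (\<lambda>h. frechet_derivative f (at (L x + c)) (L h))) (at x)" for x
    by (rule has_derivative_compose[OF La frechet_works[OF f]])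
  have lin: "linear (frechet_derivative f (at y))" for y
    using f frechet_works has_derivative_linear by blast
  have e: "frechet_derivative f (at (L x + c)) (L b) = (\<Sum>d\<in>Basis. (L b \<bullet> d) * frechet_derivative f (at (L x + c)) d)" for x b
  proof -
    have "frechet_derivative f (at (L x + c)) (\<Sum>d\<in>Basis. (L b \<bullet> d) *\<^sub>R d) = (\<Sum>d\<in>Basis. (L b \<bullet> d) *\<^sub>R frechet_derivative f (at (L x + c)) d)"
      by (simp add: linear_sum[OF lin] linear_scale[OF lin])
    then show ?thesis by (simp add: euclidean_representation)
  qed
  have "(\<lambda>x. f (L x + c)) differentiable (at x)" for x using D by (auto simp: differentiable_def)
  moreover have "Ck_on k (\<lambda>x. \<Sum>d\<in>Basis. (L b \<bullet> d) * frechet_derivative f (at (L x + c)) d) UNIV" for b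
  proof (rule Ck_on_sum)
    fix d :: 'b assume d: "d \<in> Basis"
    have "Ck_on k (\<lambda>x. frechet_derivative f (at (L x + c)) d) UNIV"
      using Suc.IH[of "\<lambda>y. frechet_derivative f (at y) d"] Suc.prems d by simp
    from Ck_on_linear_comb[OF this Ck_on_const, of "L b \<bullet> d" 0 0]
    show "Ck_on k (\<lambda>x. (L b \<bullet> d) * frechet_derivative f (at (L x + c)) d) UNIV" by simp
  qed
  ultimately show ?case unfolding Ck_on_Suc_UNIV frechet_eqI[OF D] e by auto
qed

text \<open>The point at issue is 0, where the difference quotient is the truncated power of one
  order less and tends to 0. Two applications give the regularity of
  \<open>cubic_plus\<close>.\<close>

lemma max_power_deriv: "((\<lambda>s::real. (max 0 s) ^ Suc (Suc n)) has_derivative (\<lambda>h. (of_nat (Suc (Suc n)) * (max 0 s) ^ Suc n) * h)) (at s)"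
proof -
  have "((\<lambda>s::real. (max 0 s) ^ Suc (Suc n)) has_field_derivative (of_nat (Suc (Suc n)) * (max 0 s) ^ Suc n)) (at s)"
  proof (cases s "0::real" rule: linorder_cases)
    case less
    have "((\<lambda>s::real. 0) has_field_derivative 0) (at s)" by simp
    then have "((\<lambda>s::real. (max 0 s) ^ Suc (Suc n)) has_field_derivative 0) (at s)"
      by (rule has_field_derivative_transform_within_open[of _ _ _ "{..<0}"]) (use less in auto)
    then show ?thesis using less by simp
  next
    case greater
    have "((\<lambda>s::real. s ^ Suc (Suc n)) has_field_derivative (of_nat (Suc (Suc n)) * s ^ Suc n)) (at s)"
      using DERIV_pow[of "Suc (Suc n)" s] by simp
    then have "((\<lambda>s::real. (max 0 s) ^ Suc (Suc n)) has_field_derivative (of_nat (Suc (Suc n)) * s ^ Suc n)) (at s)"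
      by (rule has_field_derivative_transform_within_open[of _ _ _ "{0<..}"]) (use greater in auto)
    then show ?thesis using greater by simp
  next
    case equal
    have "((\<lambda>h. (max 0 h) ^ Suc n) \<longlongrightarrow> (max 0 0) ^ Suc n) (at (0::real))"
      by (intro tendsto_intros)
    then have "((\<lambda>h. (max 0 h) ^ Suc n) \<longlongrightarrow> 0) (at (0::real))" by simp
    moreover have "\<forall>\<^sub>F h in at (0::real). (max 0 h) ^ Suc n = (max 0 h) ^ Suc (Suc n) / h"
      unfolding eventually_at_filter by (intro always_eventually) (auto simp: max_def)
    ultimately have "((\<lambda>h. (max 0 h) ^ Suc (Suc n) / h) \<longlongrightarrow> 0) (at (0::real))"
      by (rule Lim_transform_eventually)
    then show ?thesis using equal by (simp add: DERIV_def)
  qed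
  then show ?thesis by (simp only: has_field_derivative_def)
qed

text \<open>The lowest truncated power of class C^2, the regularity demanded of test functions; all
  cutoffs and bumps below are made from it.\<close>

definition cubic_plus :: "real \<Rightarrow> real" where "cubic_plus s = (max 0 s) ^ 3"

lemma cubic_plus_C2: "Ck_on 2 cubic_plus UNIV"
proof -
  have d1: "(cubic_plus has_derivative (\<lambda>h. (3 * (max 0 s) ^ 2) * h)) (at s)" for s
    using max_power_deriv[of 1 s] by (simp add: cubic_plus_def[abs_def] numeral_3_eq_3 numeral_2_eq_2)
  have d2: "((\<lambda>s::real. 3 * (max 0 s) ^ 2) has_derivative (\<lambda>h. 6 * max 0 s * h)) (at s)" for s
    using has_derivative_mult_right[OF max_power_deriv[of 0 s], of 3] by (simp add: numeral_2_eq_2 mult.assoc)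
  note f = frechet_eqI[OF d1] frechet_eqI[OF d2]
  have "cubic_plus differentiable (at s)" "(\<lambda>s::real. 3 * (max 0 s) ^ 2) differentiable (at s)" for s
    using d1 d2 by (auto simp: differentiable_def)
  moreover have "continuous_on UNIV (\<lambda>s::real. 6 * max 0 s)" by (intro continuous_intros)
  ultimately have "Ck_on (Suc (Suc 0)) cubic_plus UNIV"
    unfolding Ck_on_Suc_UNIV Ck_on.simps(1) f by (simp add: f)
  then show ?thesis by (simp only: numeral_2_eq_2)
qed

text \<open>The third difference of a cubic over its leading factor 3!. It is the integral of the
  quadratic B-spline on the interval from 0 to 3, so it rises from 0 to 1 there.\<close>

definition smooth_step :: "real \<Rightarrow> real" where
  "smooth_step s = (cubic_plus s - 3 * cubic_plus (s - 1) + 3 * cubic_plus (s - 2) - cubic_plus (s - 3)) / 6"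

lemma smooth_step_0: "s \<le> 0 \<Longrightarrow> smooth_step s = 0"
  by (simp add: smooth_step_def cubic_plus_def)

lemma smooth_step_1: "3 \<le> s \<Longrightarrow> smooth_step s = 1"
  by (simp add: smooth_step_def cubic_plus_def power3_eq_cube algebra_simps)

lemma cubic_plus_inner_C2: "Ck_on 2 (\<lambda>w. cubic_plus (\<mu> * (w \<bullet> b) + c)) UNIV"
  by (rule Ck_on_affine[OF _ cubic_plus_C2]) (auto intro!: linearI simp: inner_add_left algebra_simps)

lemma smooth_step_inner_C2: "Ck_on 2 (\<lambda>w. smooth_step (\<mu> * (w \<bullet> b) + c)) UNIV"
proof -
  have eq: "smooth_step s = 1 * ((1/6) * cubic_plus s + (- 1/2) * cubic_plus (s + - 1)) + 1 * ((1/2) * cubic_plus (s + - 2) + (- 1/6) * cubic_plus (s + - 3))" for s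
    by (simp add: smooth_step_def field_simps)
  show ?thesis unfolding eq add.assoc
    by (intro Ck_on_linear_comb cubic_plus_inner_C2)
qed

section \<open>Operations on test functions\<close>

lemma test_functions_linear_comb:
  assumes "\<phi> \<in> test_functions" "\<psi> \<in> test_functions"
  shows "(\<lambda>w. a * \<phi> w + b * \<psi> w) \<in> test_functions"
proof -
  obtain C D where CD: "compact C" "\<And>z. z \<notin> C \<Longrightarrow> \<phi> z = 0" "compact D" "\<And>z. z \<notin> D \<Longrightarrow> \<psi> z = 0"
    using assms by (auto simp: test_functions_def)
  have "compact (C \<union> D) \<and> (\<forall>z. z \<notin> C \<union> D \<longrightarrow> a * \<phi> z + b * \<psi> z = 0)"
    using CD by auto
  moreover have "Ck_on 2 (\<lambda>w. a * \<phi> w + b * \<psi> w) UNIV"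
    using assms by (intro Ck_on_linear_comb) (auto simp: test_functions_def)
  ultimately show ?thesis unfolding test_functions_def by blast
qed

lemma test_functions_mult:
  assumes "\<phi> \<in> test_functions" "Ck_on 2 \<psi> UNIV"
  shows "(\<lambda>w. \<phi> w * \<psi> w) \<in> test_functions"
  using assms unfolding test_functions_def by (auto intro!: Ck_on_mult)

lemma test_functions_zero: "(\<lambda>_. 0) \<in> test_functions"
  by (auto simp: test_functions_def Ck_on_const intro: exI[of _ "{}"])

lemma test_functions_sum:
  "finite I \<Longrightarrow> (\<And>i. i \<in> I \<Longrightarrow> f i \<in> test_functions) \<Longrightarrow> (\<lambda>w. \<Sum>i\<in>I. f i w) \<in> test_functions"
proof (induction I rule: finite_induct)
  case (insert i I)
  then show ?case using test_functions_linear_comb[of "f i" "\<lambda>w. \<Sum>i\<in>I. f i w" 1 1] by auto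
qed (simp add: test_functions_zero)

lemma test_functions_affine:
  fixes \<phi> :: "('d::finite) spacetime \<Rightarrow> real"
  assumes \<phi>: "\<phi> \<in> test_functions" and L: "linear L" and M: "continuous_on UNIV M" and inv: "\<And>x. M (L x + c) = x"
  shows "(\<lambda>w. \<phi> (L w + c)) \<in> test_functions"
proof -
  obtain C where C: "compact C" "\<And>z. z \<notin> C \<Longrightarrow> \<phi> z = 0" using \<phi> by (auto simp: test_functions_def)
  have "compact (M ` C)" by (rule compact_continuous_image[OF continuous_on_subset[OF M] C(1)]) simp
  moreover have "\<phi> (L w + c) = 0" if "w \<notin> M ` C" for w
    using C(2)[of "L w + c"] that inv[of w] by (metis imageI)
  ultimately show ?thesis using \<phi> Ck_on_affine[OF L] by (auto simp: test_functions_def)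
qed

lemma test_functions_translate:
  fixes \<phi> :: "('d::finite) spacetime \<Rightarrow> real"
  assumes "\<phi> \<in> test_functions"
  shows "(\<lambda>w. \<phi> (w - c)) \<in> test_functions"
proof -
  have "(\<lambda>w. \<phi> (w + - c)) \<in> test_functions"
  proof (rule test_functions_affine[OF assms linear_ident])
    show "continuous_on UNIV (\<lambda>y. y + c)" by (intro continuous_intros)
  qed simp
  then show ?thesis by simp
qed

lemma test_functions_translate_iff:
  fixes \<phi> :: "('d::finite) spacetime \<Rightarrow> real"
  shows "(\<lambda>w. \<phi> (w - c)) \<in> test_functions \<longleftrightarrow> \<phi> \<in> test_functions"
  using test_functions_translate[of "\<lambda>w. \<phi> (w - c)" "- c"] test_functions_translate[of \<phi> c] by auto

lemma rescale_test:
  fixes \<phi> :: "('d::finite) spacetime \<Rightarrow> real"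
  assumes "\<phi> \<in> test_functions" and l: "l > 0"
  shows "rescale l z \<phi> \<in> test_functions"
proof -
  define L :: "'d spacetime \<Rightarrow> 'd spacetime" where "L w = (fst w / l\<^sup>2, snd w /\<^sub>R l)" for w
  define c :: "'d spacetime" where "c = (- fst z / l\<^sup>2, - (snd z /\<^sub>R l))"
  have L: "linear L" by (rule linearI) (auto simp: L_def prod_eq_iff add_divide_distrib scaleR_add_right)
  have e: "L w + c = ((fst w - fst z) / l\<^sup>2, (snd w - snd z) /\<^sub>R l)" for w
    by (simp add: L_def c_def diff_divide_distrib scaleR_diff_right)
  have "(\<lambda>w. \<phi> (L w + c)) \<in> test_functions"
  proof (rule test_functions_affine[OF assms(1) L])
    show "continuous_on UNIV (\<lambda>y. (fst y * l\<^sup>2 + fst z, l *\<^sub>R snd y + snd z))" by (intro continuous_intros)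
    show "(fst (L x + c) * l\<^sup>2 + fst z, l *\<^sub>R snd (L x + c) + snd z) = x" for x
      unfolding e using l by (simp add: prod_eq_iff)
  qed
  from test_functions_linear_comb[OF this test_functions_zero, of "1 / l ^ (CARD('d) + 2)" 0]
  show ?thesis unfolding e rescale_def[abs_def] by simp
qed

text \<open>Linear functionals that vanish on test functions with small support vanish: decompose one
  coordinate at a time with differences of shifted steps.\<close>

lemma functional_zero_local:
  fixes \<Upsilon> :: "('d::finite) functional"
  assumes lin: "\<And>\<phi> \<psi> a b. \<phi> \<in> test_functions \<Longrightarrow> \<psi> \<in> test_functions \<Longrightarrow>
      \<Upsilon> (\<lambda>w. a * \<phi> w + b * \<psi> w) = a * \<Upsilon> \<phi> + b * \<Upsilon> \<psi>"
    and \<mu>: "\<mu> > 0"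
    and loc: "\<And>\<phi> m. \<phi> \<in> test_functions \<Longrightarrow> (\<And>w b. \<phi> w \<noteq> 0 \<Longrightarrow> b \<in> Basis \<Longrightarrow> \<mu> * (w \<bullet> b) \<in> {m b..m b + 4}) \<Longrightarrow> \<Upsilon> \<phi> = 0"
    and \<phi>: "\<phi> \<in> test_functions"
  shows "\<Upsilon> \<phi> = 0"
proof -
  have sum: "\<Upsilon> (\<lambda>w. \<Sum>i\<in>I. f i w) = (\<Sum>i\<in>I. \<Upsilon> (f i))" if "finite I" "\<And>i. i \<in> I \<Longrightarrow> f i \<in> test_functions" for I :: "nat set" and f
    using that
  proof (induction I rule: finite_induct)
    case empty
    then show ?case using lin[OF test_functions_zero test_functions_zero, of 0 0] by simp
  next
    case (insert i I)
    then show ?case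
      using lin[of "f i" "\<lambda>w. \<Sum>i\<in>I. f i w" 1 1] test_functions_sum[of I f] by auto
  qed
  \<comment> \<open>\<open>A\<close> holds the coordinates in which the support is already confined
    to a window, \<open>B\<close> those still to be treated. The induction runs over
    \<open>B\<close>, and the windows \<open>m\<close> change along with it.\<close>
  have claim: "A \<subseteq> Basis \<Longrightarrow> Basis - A = B \<Longrightarrow> \<phi> \<in> test_functions \<Longrightarrow>
      (\<And>w b. \<phi> w \<noteq> 0 \<Longrightarrow> b \<in> A \<Longrightarrow> \<mu> * (w \<bullet> b) \<in> {m b..m b + 4}) \<Longrightarrow> \<Upsilon> \<phi> = 0"
    if "finite B" for A B :: "'d spacetime set" and \<phi> m
    using that
  proof (induction B arbitrary: A \<phi> m rule: finite_induct)
    case empty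
    then have "A = Basis" by auto
    then show ?case using loc[of \<phi> m] empty by auto
  next
    case (insert b B)
    have b: "b \<in> Basis" "b \<notin> A" using insert by auto
    obtain C where C: "compact C" "\<And>z. z \<notin> C \<Longrightarrow> \<phi> z = 0" using insert.prems by (auto simp: test_functions_def)
    obtain R where R: "\<And>z. z \<in> C \<Longrightarrow> norm z \<le> R" using compact_imp_bounded[OF C(1)] by (auto simp: bounded_iff)
    \<comment> \<open>The step needs width 3 to rise. With this \<open>K\<close> the first shifted
      step is 1 and the last is 0 on the support, so the differences \<open>u i\<close> add up to 1
      there. Each \<open>u i\<close> lives in a window of width 4, the rise plus the unit
      shift.\<close>
    obtain K :: nat where K: "\<mu> * \<bar>R\<bar> + 3 \<le> real K" using real_arch_simple by blast
    define g where "g i w = smooth_step (\<mu> * (w \<bullet> b) + (real K - real i))" for i :: nat and w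
    define u where "u i w = g i w - g (Suc i) w" for i :: nat and w
    have uC: "Ck_on 2 (u i) UNIV" for i
    proof -
      have "u i = (\<lambda>w. 1 * g i w + (-1) * g (Suc i) w)"
        by (simp add: u_def fun_eq_iff)
      then show ?thesis unfolding g_def by (simp only:) (intro Ck_on_linear_comb smooth_step_inner_C2)
    qed
    have tel: "(\<Sum>i<2*K. u i w) = g 0 w - g (2*K) w" for w
      unfolding u_def by (rule sum_lessThan_telescope')
    have dec: "\<phi> w = (\<Sum>i<2*K. \<phi> w * u i w)" for w
    proof (cases "\<phi> w = 0")
      case False
      then have "norm w \<le> R" using C R by blast
      then have "\<bar>w \<bullet> b\<bar> \<le> \<bar>R\<bar>" using Basis_le_norm[OF b(1), of w] by linarith
      then have "\<bar>\<mu> * (w \<bullet> b)\<bar> \<le> \<mu> * \<bar>R\<bar>" using \<mu> by (simp add: abs_mult)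
      then have "g 0 w = 1" "g (2*K) w = 0"
        unfolding g_def using K by (auto intro!: smooth_step_1 smooth_step_0)
      then show ?thesis unfolding sum_distrib_left[symmetric] tel by simp
    qed simp
    have "\<Upsilon> (\<lambda>w. \<phi> w * u i w) = 0" for i
    proof (rule insert.IH[of "insert b A" _ "m(b := real i - real K)"])
      show "insert b A \<subseteq> Basis" "Basis - insert b A = B" using insert b by auto
      show "(\<lambda>w. \<phi> w * u i w) \<in> test_functions" by (rule test_functions_mult[OF insert.prems(3) uC])
      fix w c assume nz: "\<phi> w * u i w \<noteq> 0" and c: "c \<in> insert b A"
      show "\<mu> * (w \<bullet> c) \<in> {(m(b := real i - real K)) c..(m(b := real i - real K)) c + 4}"
      proof (cases "c = b")
        case True
        have "\<not> \<mu> * (w \<bullet> b) + (real K - real i) \<le> 0"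
          using nz by (auto simp: u_def g_def smooth_step_0)
        moreover have "\<not> 4 \<le> \<mu> * (w \<bullet> b) + (real K - real i)"
          using nz by (auto simp: u_def g_def smooth_step_1)
        ultimately show ?thesis using True by auto
      next
        case False
        then show ?thesis using insert.prems(4)[of w c] nz c by auto
      qed
    qed
    then have "(\<Sum>i<2*K. \<Upsilon> (\<lambda>w. \<phi> w * u i w)) = 0" by simp
    moreover have "\<Upsilon> (\<lambda>w. \<Sum>i<2*K. \<phi> w * u i w) = (\<Sum>i<2*K. \<Upsilon> (\<lambda>w. \<phi> w * u i w))"
      by (rule sum) (auto intro!: test_functions_mult insert.prems uC)
    ultimately show ?case using dec by (metis (no_types, lifting) ext)
  qed
  show ?thesis using claim[of Basis "{}" \<phi>] \<phi> by auto
qed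

text \<open>A C^2 bump that is positive exactly on the open box of half-width \<delta> around
  \<open>z\<close>. The factors \<open>1\<close> and \<open>(-1)\<close> give each argument the
  shape expected by \<open>cubic_plus_inner_C2\<close>.\<close>

definition box_bump :: "real \<Rightarrow> ('d::finite) spacetime \<Rightarrow> 'd spacetime \<Rightarrow> real" where
  "box_bump \<delta> z w = (\<Prod>b\<in>Basis. cubic_plus (1 * (w \<bullet> b) + (\<delta> - z \<bullet> b)) * cubic_plus ((-1) * (w \<bullet> b) + (\<delta> + z \<bullet> b)))"

lemma Ck_on_prod:
  "(\<And>i. i \<in> I \<Longrightarrow> Ck_on k (f i) UNIV) \<Longrightarrow> Ck_on k (\<lambda>x. \<Prod>i\<in>I. f i x) UNIV"
proof (induction I rule: infinite_finite_induct)
  case (insert i I)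
  then show ?case using Ck_on_mult[of k "f i" "\<lambda>x. \<Prod>i\<in>I. f i x"] by auto
qed (simp_all add: Ck_on_const)

lemma box_bump_C2: "Ck_on 2 (box_bump \<delta> z) UNIV"
  unfolding box_bump_def[abs_def] by (intro Ck_on_prod Ck_on_mult cubic_plus_inner_C2)

lemma box_bump_nonneg: "0 \<le> box_bump \<delta> z w"
  unfolding box_bump_def by (intro prod_nonneg ballI mult_nonneg_nonneg) (auto simp: cubic_plus_def)

lemma box_bump_pos_iff: "0 < box_bump \<delta> z w \<longleftrightarrow> (\<forall>b\<in>Basis. \<bar>w \<bullet> b - z \<bullet> b\<bar> < \<delta>)"
proof -
  have c: "cubic_plus s = 0 \<longleftrightarrow> s \<le> 0" for s by (auto simp: cubic_plus_def max_def)
  have "0 < box_bump \<delta> z w \<longleftrightarrow> box_bump \<delta> z w \<noteq> 0" using box_bump_nonneg[of \<delta> z w] by linarith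
  also have "\<dots> \<longleftrightarrow> (\<forall>b\<in>Basis. \<bar>w \<bullet> b - z \<bullet> b\<bar> < \<delta>)"
    unfolding box_bump_def by (auto simp: c abs_less_iff not_le)
  finally show ?thesis .
qed

lemma box_bump_test: "box_bump \<delta> z \<in> test_functions"
proof -
  let ?C = "cbox (z - (\<Sum>b\<in>Basis. \<delta> *\<^sub>R b)) (z + (\<Sum>b\<in>Basis. \<delta> *\<^sub>R b))"
  have zero: "box_bump \<delta> z w = 0" if "w \<notin> ?C" for w
  proof (rule ccontr)
    assume "box_bump \<delta> z w \<noteq> 0"
    then have "0 < box_bump \<delta> z w" using box_bump_nonneg[of \<delta> z w] by linarith
    then have "\<forall>b\<in>Basis. \<bar>w \<bullet> b - z \<bullet> b\<bar> < \<delta>" by (simp add: box_bump_pos_iff)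
    then have "w \<in> ?C" by (fastforce simp: mem_box inner_diff_left inner_add_left inner_sum_left_Basis abs_less_iff)
    with that show False ..
  qed
  then show ?thesis unfolding test_functions_def
    by (intro CollectI conjI box_bump_C2 exI[of _ ?C] compact_cbox allI impI zero)
qed

text \<open>A real \<open>Sup\<close> is informative only for bounded sets, so each use of
  \<open>C2_norm\<close> as an upper bound rests on the boundedness shown here. The derivatives are
  continuous and vanish off the support, hence they are bounded.\<close>

lemma test_function_bounds:
  fixes \<phi> :: "('d::finite) spacetime \<Rightarrow> real"
  assumes "\<phi> \<in> test_functions"
  shows test_measurable: "\<phi> \<in> borel_measurable borel"
    and C2_bdd: "bdd_above ({\<bar>\<phi> z\<bar> | z. True} \<union> {\<bar>frechet_derivative \<phi> (at z) b\<bar> | z b. b \<in> Basis} \<union>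
     {\<bar>frechet_derivative (\<lambda>w. frechet_derivative \<phi> (at w) b) (at z) c\<bar> | z b c. b \<in> Basis \<and> c \<in> Basis})"
    and test_zero_derivs: "closed C \<Longrightarrow> (\<And>z. z \<notin> C \<Longrightarrow> \<phi> z = 0) \<Longrightarrow> z \<notin> C \<Longrightarrow> frechet_derivative \<phi> (at z) b = 0"
    and "closed C \<Longrightarrow> (\<And>z. z \<notin> C \<Longrightarrow> \<phi> z = 0) \<Longrightarrow> z \<notin> C \<Longrightarrow> frechet_derivative (\<lambda>w. frechet_derivative \<phi> (at w) b) (at z) c = 0"
proof -
  have C2: "Ck_on (Suc (Suc 0)) \<phi> UNIV" using assms by (simp add: test_functions_def numeral_2_eq_2)
  then have d1: "\<And>x. \<phi> differentiable (at x)"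
    and d2: "\<And>b x. b \<in> Basis \<Longrightarrow> (\<lambda>w. frechet_derivative \<phi> (at w) b) differentiable (at x)"
    and c2: "\<And>b c. b \<in> Basis \<Longrightarrow> c \<in> Basis \<Longrightarrow> continuous_on UNIV (\<lambda>z. frechet_derivative (\<lambda>w. frechet_derivative \<phi> (at w) b) (at z) c)"
    by auto
  have c0: "continuous_on UNIV \<phi>" using C2 by (rule Ck_on_continuous)
  have c1: "continuous_on UNIV (\<lambda>w. frechet_derivative \<phi> (at w) b)" if "b \<in> Basis" for b
    using d2[OF that] by (intro continuous_at_imp_continuous_on ballI differentiable_imp_continuous_within) auto
  show "\<phi> \<in> borel_measurable borel" by (rule borel_measurable_continuous_onI[OF c0])
  have loc: "frechet_derivative f (at z) b = 0" if C: "closed C" and z0: "\<And>z. z \<notin> C \<Longrightarrow> f z = 0" and z: "z \<notin> C"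
    for f :: "'d spacetime \<Rightarrow> real" and z b and C
  proof -
    have "((\<lambda>_. 0) has_derivative (\<lambda>_. 0)) (at z)" by simp
    then have "(f has_derivative (\<lambda>_. 0)) (at z)"
      by (rule has_derivative_transform_within_open[of _ _ _ _ "- C"]) (use C z z0 in auto)
    then show ?thesis by (simp add: frechet_eqI)
  qed
  show l1: "frechet_derivative \<phi> (at z) b = 0" if "closed C" "\<And>z. z \<notin> C \<Longrightarrow> \<phi> z = 0" "z \<notin> C" for C z b
    using loc that by blast
  show l2: "frechet_derivative (\<lambda>w. frechet_derivative \<phi> (at w) b) (at z) c = 0" if "closed C" "\<And>z. z \<notin> C \<Longrightarrow> \<phi> z = 0" "z \<notin> C" for C z b c
    by (rule loc[OF that(1) l1[OF that(1) that(2)] that(3)])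
  obtain C where C: "compact C" and z0: "\<And>z. z \<notin> C \<Longrightarrow> \<phi> z = 0" using assms by (auto simp: test_functions_def)
  have cl: "closed C" using C by (rule compact_imp_closed)
  have B: "\<exists>B. \<forall>z. \<bar>f z\<bar> \<le> B" if f: "continuous_on UNIV f" and "\<And>z. z \<notin> C \<Longrightarrow> f z = 0" for f :: "'d spacetime \<Rightarrow> real"
  proof -
    have "bounded (f ` C)"
      by (intro compact_imp_bounded compact_continuous_image C continuous_on_subset[OF f]) auto
    then obtain B where "\<And>z. z \<in> C \<Longrightarrow> \<bar>f z\<bar> \<le> B" by (auto simp: bounded_iff)
    then have "\<bar>f z\<bar> \<le> \<bar>B\<bar>" for z using that(2)[of z] by (cases "z \<in> C") fastforce+
    then show ?thesis by blast
  qed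
  obtain B0 where B0: "\<And>z. \<bar>\<phi> z\<bar> \<le> B0" using B[OF c0 z0] by blast
  have "\<forall>b. b \<in> Basis \<longrightarrow> (\<exists>B. \<forall>z. \<bar>frechet_derivative \<phi> (at z) b\<bar> \<le> B)" using B[OF c1 l1[OF cl z0]] by blast
  then obtain B1 where B1: "\<And>b z. b \<in> Basis \<Longrightarrow> \<bar>frechet_derivative \<phi> (at z) b\<bar> \<le> B1 b" by metis
  have "\<forall>b c. b \<in> Basis \<and> c \<in> Basis \<longrightarrow> (\<exists>B. \<forall>z. \<bar>frechet_derivative (\<lambda>w. frechet_derivative \<phi> (at w) b) (at z) c\<bar> \<le> B)"
    using B[OF c2 l2[OF cl z0]] by blast
  then obtain B2 where B2: "\<And>b c z. b \<in> Basis \<Longrightarrow> c \<in> Basis \<Longrightarrow> \<bar>frechet_derivative (\<lambda>w. frechet_derivative \<phi> (at w) b) (at z) c\<bar> \<le> B2 b c" by metis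
  define BB where "BB = \<bar>B0\<bar> + (\<Sum>b\<in>(Basis :: 'd spacetime set). \<bar>B1 b\<bar>) + (\<Sum>b\<in>(Basis :: 'd spacetime set). \<Sum>c\<in>(Basis :: 'd spacetime set). \<bar>B2 b c\<bar>)"
  have s1: "\<bar>B1 b\<bar> \<le> (\<Sum>b\<in>Basis. \<bar>B1 b\<bar>)" if "b \<in> Basis" for b by (rule member_le_sum) (use that in auto)
  have s2: "\<bar>B2 b c\<bar> \<le> (\<Sum>b\<in>Basis. \<Sum>c\<in>Basis. \<bar>B2 b c\<bar>)" if "b \<in> Basis" "c \<in> Basis" for b c
  proof -
    have "\<bar>B2 b c\<bar> \<le> (\<Sum>c\<in>Basis. \<bar>B2 b c\<bar>)" by (rule member_le_sum) (use that in auto)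
    also have "\<dots> \<le> (\<Sum>b\<in>Basis. \<Sum>c\<in>Basis. \<bar>B2 b c\<bar>)"
      by (rule member_le_sum[of b Basis "\<lambda>b. \<Sum>c\<in>Basis. \<bar>B2 b c\<bar>"]) (use that in \<open>auto intro: sum_nonneg\<close>)
    finally show ?thesis .
  qed
  have n1: "0 \<le> (\<Sum>b\<in>(Basis :: 'd spacetime set). \<bar>B1 b\<bar>)" and n2: "0 \<le> (\<Sum>b\<in>(Basis :: 'd spacetime set). \<Sum>c\<in>(Basis :: 'd spacetime set). \<bar>B2 b c\<bar>)"
    by (auto intro!: sum_nonneg)
  show "bdd_above ({\<bar>\<phi> z\<bar> | z. True} \<union> {\<bar>frechet_derivative \<phi> (at z) b\<bar> | z b. b \<in> Basis} \<union>
     {\<bar>frechet_derivative (\<lambda>w. frechet_derivative \<phi> (at w) b) (at z) c\<bar> | z b c. b \<in> Basis \<and> c \<in> Basis})"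
  proof (rule bdd_aboveI[of _ BB])
    fix x assume "x \<in> {\<bar>\<phi> z\<bar> | z. True} \<union> {\<bar>frechet_derivative \<phi> (at z) b\<bar> | z b. b \<in> Basis} \<union>
     {\<bar>frechet_derivative (\<lambda>w. frechet_derivative \<phi> (at w) b) (at z) c\<bar> | z b c. b \<in> Basis \<and> c \<in> Basis}"
    then consider z where "x = \<bar>\<phi> z\<bar>" | z b where "b \<in> Basis" "x = \<bar>frechet_derivative \<phi> (at z) b\<bar>"
      | z b c where "b \<in> Basis" "c \<in> Basis" "x = \<bar>frechet_derivative (\<lambda>w. frechet_derivative \<phi> (at w) b) (at z) c\<bar>" by blast
    then show "x \<le> BB"
    proof cases
      case (1 z) then show ?thesis using B0[of z] n1 n2 unfolding BB_def by linarith
    next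
      case (2 z b) then show ?thesis using B1[OF 2(1), of z] s1[OF 2(1)] n2 unfolding BB_def by linarith
    next
      case (3 z b c) then show ?thesis using B2[OF 3(1,2), of z] s2[OF 3(1,2)] n1 unfolding BB_def by linarith
    qed
  qed
qed

section \<open>The C^2 norm and separability of the unit tests\<close>

lemma C2_norm_ge:
  assumes "\<phi> \<in> test_functions"
  shows "\<bar>\<phi> z\<bar> \<le> C2_norm \<phi>"
  unfolding C2_norm_def by (rule cSup_upper[OF _ C2_bdd[OF assms]]) blast

lemma C2_norm_nonneg: "\<phi> \<in> test_functions \<Longrightarrow> 0 \<le> C2_norm \<phi>"
  using C2_norm_ge[of \<phi> undefined] abs_ge_zero order_trans by blast

lemma C2_norm_le:
  fixes \<phi> :: "('d::finite) spacetime \<Rightarrow> real"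
  assumes "\<And>z. \<bar>\<phi> z\<bar> \<le> B" "\<And>z b. b \<in> Basis \<Longrightarrow> \<bar>frechet_derivative \<phi> (at z) b\<bar> \<le> B"
    "\<And>z b c. b \<in> Basis \<Longrightarrow> c \<in> Basis \<Longrightarrow> \<bar>frechet_derivative (\<lambda>w. frechet_derivative \<phi> (at w) b) (at z) c\<bar> \<le> B"
  shows "C2_norm \<phi> \<le> B"
  unfolding C2_norm_def by (rule cSup_least) (blast, use assms in blast)

lemma test_scale_derivs:
  fixes \<phi> :: "('d::finite) spacetime \<Rightarrow> real"
  assumes "\<phi> \<in> test_functions" "\<psi> \<in> test_functions" "b \<in> Basis"
  shows "frechet_derivative (\<lambda>w. u * \<phi> w + v * \<psi> w) (at z) = (\<lambda>h. u * frechet_derivative \<phi> (at z) h + v * frechet_derivative \<psi> (at z) h)"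
    and "frechet_derivative (\<lambda>w. frechet_derivative (\<lambda>w. u * \<phi> w + v * \<psi> w) (at w) b) (at z) =
      (\<lambda>h. u * frechet_derivative (\<lambda>w. frechet_derivative \<phi> (at w) b) (at z) h + v * frechet_derivative (\<lambda>w. frechet_derivative \<psi> (at w) b) (at z) h)"
proof -
  have C2: "Ck_on (Suc (Suc 0)) \<phi> UNIV" "Ck_on (Suc (Suc 0)) \<psi> UNIV" using assms by (simp_all add: test_functions_def numeral_2_eq_2)
  then have d: "\<And>x. \<phi> differentiable (at x)" "\<And>x. \<psi> differentiable (at x)"
    and d2: "\<And>x. (\<lambda>w. frechet_derivative \<phi> (at w) b) differentiable (at x)" "\<And>x. (\<lambda>w. frechet_derivative \<psi> (at w) b) differentiable (at x)"
    using assms(3) by auto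
  have *: "frechet_derivative (\<lambda>w. u * f w + v * g w) (at z) = (\<lambda>h. u * frechet_derivative f (at z) h + v * frechet_derivative g (at z) h)"
    if "f differentiable (at z)" "g differentiable (at z)" for f g :: "'d spacetime \<Rightarrow> real" and z
    by (rule frechet_eqI) (intro has_derivative_add has_derivative_mult_right frechet_works that)
  show 1: "frechet_derivative (\<lambda>w. u * \<phi> w + v * \<psi> w) (at z) = (\<lambda>h. u * frechet_derivative \<phi> (at z) h + v * frechet_derivative \<psi> (at z) h)" for z
    by (rule *[OF d])
  show "frechet_derivative (\<lambda>w. frechet_derivative (\<lambda>w. u * \<phi> w + v * \<psi> w) (at w) b) (at z) =
      (\<lambda>h. u * frechet_derivative (\<lambda>w. frechet_derivative \<phi> (at w) b) (at z) h + v * frechet_derivative (\<lambda>w. frechet_derivative \<psi> (at w) b) (at z) h)"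
    unfolding 1 by (rule *[OF d2])
qed

lemma unit_test_multiple:
  fixes \<phi> :: "('d::finite) spacetime \<Rightarrow> real"
  assumes \<phi>: "\<phi> \<in> test_functions" and s: "\<And>z. z \<notin> cball 0 1 \<Longrightarrow> \<phi> z = 0"
  shows "\<exists>c. \<exists>\<psi>\<in>unit_tests. \<phi> = (\<lambda>w. c * \<psi> w)"
proof -
  \<comment> \<open>Adding 1 keeps the divisor positive when the norm is 0.\<close>
  define c where "c = C2_norm \<phi> + 1"
  have c: "c > 0" using C2_norm_nonneg[OF \<phi>] by (simp add: c_def)
  define \<psi> where "\<psi> w = (1/c) * \<phi> w + 0 * \<phi> w" for w
  have \<psi>: "\<psi> \<in> test_functions" unfolding \<psi>_def[abs_def] by (rule test_functions_linear_comb[OF \<phi> \<phi>])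
  have le: "x / c \<le> 1" if "x \<le> C2_norm \<phi>" for x using that c by (simp add: c_def)
  have "C2_norm \<psi> \<le> 1"
  proof (rule C2_norm_le)
    show "\<bar>\<psi> z\<bar> \<le> 1" for z using le[OF C2_norm_ge[OF \<phi>, of z]] c by (simp add: \<psi>_def)
    fix b z assume b: "b \<in> (Basis :: 'd spacetime set)"
    have "\<bar>frechet_derivative \<phi> (at z) b\<bar> \<le> C2_norm \<phi>"
      unfolding C2_norm_def by (rule cSup_upper[OF _ C2_bdd[OF \<phi>]]) (use b in blast)
    from le[OF this] show "\<bar>frechet_derivative \<psi> (at z) b\<bar> \<le> 1"
      unfolding \<psi>_def[abs_def] test_scale_derivs(1)[OF \<phi> \<phi> b] using c by simp
    fix d assume d: "d \<in> (Basis :: 'd spacetime set)"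
    have "\<bar>frechet_derivative (\<lambda>w. frechet_derivative \<phi> (at w) b) (at z) d\<bar> \<le> C2_norm \<phi>"
      unfolding C2_norm_def by (rule cSup_upper[OF _ C2_bdd[OF \<phi>]]) (use b d in blast)
    from le[OF this] show "\<bar>frechet_derivative (\<lambda>w. frechet_derivative \<psi> (at w) b) (at z) d\<bar> \<le> 1"
      unfolding \<psi>_def[abs_def] test_scale_derivs(2)[OF \<phi> \<phi> b] using c by simp
  qed
  then have "\<psi> \<in> unit_tests" using \<psi> s by (auto simp: unit_tests_def \<psi>_def)
  moreover have "\<phi> = (\<lambda>w. c * \<psi> w)" using c by (simp add: \<psi>_def)
  ultimately show ?thesis by blast
qed

text \<open>Round the values on finite nets: there are only countably many patterns.\<close>

lemma uniform_separable:
  fixes F :: "'x \<Rightarrow> 'i \<Rightarrow> 'a::metric_space \<Rightarrow> real"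
  assumes K: "compact K" and I: "finite I" and c: "\<And>x i. x \<in> X \<Longrightarrow> i \<in> I \<Longrightarrow> continuous_on K (F x i)"
  obtains D where "countable D" "D \<subseteq> X" "\<And>x \<delta>. x \<in> X \<Longrightarrow> \<delta> > 0 \<Longrightarrow> \<exists>d\<in>D. \<forall>i\<in>I. \<forall>p\<in>K. \<bar>F x i p - F d i p\<bar> < \<delta>"
proof -
  have "\<exists>N. finite N \<and> N \<subseteq> K \<and> K \<subseteq> (\<Union>p\<in>N. ball p (1 / real (Suc n)))" for n
    using compactE_image[OF K, of K "\<lambda>p. ball p (1 / real (Suc n))"] by (metis centre_in_ball open_ball of_nat_0_less_iff subsetI UN_I zero_less_Suc zero_less_divide_1_iff)
  then have "\<forall>n. \<exists>N. finite N \<and> N \<subseteq> K \<and> K \<subseteq> (\<Union>p\<in>N. ball p (1 / real (Suc n)))" by blast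
  then obtain N where N: "\<And>n. finite (N n)" "\<And>n. N n \<subseteq> K" "\<And>n. K \<subseteq> (\<Union>p\<in>N n. ball p (1 / real (Suc n)))"
    unfolding choice_iff by blast
  \<comment> \<open>A pattern fixes rounded values on the finite net only. Admitting just those
    families that oscillate by less than \<open>1 / Suc m\<close> at the scale of the net lets
    agreement on the net carry over to all of \<open>K\<close>.\<close>
  define good where "good x m n \<longleftrightarrow> (\<forall>i\<in>I. \<forall>p\<in>K. \<forall>q\<in>K. dist p q < 1 / real (Suc n) \<longrightarrow> \<bar>F x i p - F x i q\<bar> < 1 / real (Suc m))" for x and m n :: nat
  define pat where "pat x m n = restrict (\<lambda>(i, q). \<lfloor>real (Suc m) * F x i q\<rfloor>) (I \<times> N n)" for x and m n :: nat
  define S where "S m n f = (SOME x. x \<in> X \<and> good x m n \<and> pat x m n = f)" for m n f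
  \<comment> \<open>One admissible element is picked for each pattern that occurs; for patterns that
    do not occur the choice is arbitrary, and \<open>D\<close> keeps it only if it lies in
    \<open>X\<close>.\<close>
  define D where "D = {x \<in> X. \<exists>m n f. f \<in> PiE (I \<times> N n) (\<lambda>_. UNIV :: int set) \<and> x = S m n f}"
  have "countable (\<Union>m. \<Union>n. S m n ` PiE (I \<times> N n) (\<lambda>_. UNIV :: int set))"
    by (intro countable_UN countable_image countable_PiE finite_cartesian_product I N countableI_type)
  then have "countable D" by (rule countable_subset[rotated]) (auto simp: D_def)
  moreover have "D \<subseteq> X" by (auto simp: D_def)
  moreover have "\<exists>d\<in>D. \<forall>i\<in>I. \<forall>p\<in>K. \<bar>F x i p - F d i p\<bar> < \<delta>" if x: "x \<in> X" and \<delta>: "\<delta> > 0" for x \<delta>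
  proof -
    \<comment> \<open>Three errors are to be added: the oscillation of \<open>x\<close>, that of
      \<open>d\<close>, and the rounding.\<close>
    obtain m where m: "1 / real (Suc m) < \<delta> / 3" using nat_approx_posE[of "\<delta>/3"] \<delta> by auto
    have "\<exists>\<eta>>0. \<forall>p\<in>K. \<forall>q\<in>K. dist p q < \<eta> \<longrightarrow> \<bar>F x i p - F x i q\<bar> < 1 / real (Suc m)" if "i \<in> I" for i
      using compact_uniformly_continuous[OF c[OF x that] K] unfolding uniformly_continuous_on_def dist_real_def
      by (metis dist_commute of_nat_0_less_iff zero_less_Suc zero_less_divide_1_iff abs_minus_commute)
    then obtain \<eta> where \<eta>: "\<And>i. i \<in> I \<Longrightarrow> \<eta> i > 0" "\<And>i p q. i \<in> I \<Longrightarrow> p \<in> K \<Longrightarrow> q \<in> K \<Longrightarrow> dist p q < \<eta> i \<Longrightarrow> \<bar>F x i p - F x i q\<bar> < 1 / real (Suc m)"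
      by metis
    define \<eta>0 where "\<eta>0 = Min (insert 1 (\<eta> ` I))"
    have \<eta>0: "\<eta>0 > 0" "\<And>i. i \<in> I \<Longrightarrow> \<eta>0 \<le> \<eta> i" unfolding \<eta>0_def using I \<eta>(1) by auto
    obtain n where n: "1 / real (Suc n) < \<eta>0" using nat_approx_posE[OF \<eta>0(1)] by auto
    have g: "good x m n" unfolding good_def using \<eta>(2) \<eta>0(2) n by (meson less_le_trans less_trans)
    define d where "d = S m n (pat x m n)"
    have d: "d \<in> X" "good d m n" "pat d m n = pat x m n"
      using someI[of "\<lambda>y. y \<in> X \<and> good y m n \<and> pat y m n = pat x m n" x] x g unfolding d_def S_def by auto
    have "pat x m n \<in> PiE (I \<times> N n) (\<lambda>_. UNIV :: int set)" by (simp add: pat_def)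
    then have "d \<in> D" unfolding D_def using d(1) d_def by blast
    moreover have "\<bar>F x i p - F d i p\<bar> < \<delta>" if i: "i \<in> I" and p: "p \<in> K" for i p
    proof -
      obtain q where q: "q \<in> N n" "dist q p < 1 / real (Suc n)" using N(3)[of n] p by auto
      have qK: "q \<in> K" using q N by blast
      have 1: "\<bar>F x i q - F x i p\<bar> < 1 / real (Suc m)" using g i p qK q(2) unfolding good_def by blast
      have 2: "\<bar>F d i q - F d i p\<bar> < 1 / real (Suc m)" using d(2) i p qK q(2) unfolding good_def by blast
      have "\<lfloor>real (Suc m) * F x i q\<rfloor> = \<lfloor>real (Suc m) * F d i q\<rfloor>"
        using fun_cong[OF d(3), of "(i, q)"] i q(1) by (simp add: pat_def)
      then have "\<bar>real (Suc m) * F x i q - real (Suc m) * F d i q\<bar> < 1" by linarith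
      then have "real (Suc m) * \<bar>F x i q - F d i q\<bar> < 1" unfolding right_diff_distrib[symmetric] abs_mult by simp
      then have 3: "\<bar>F x i q - F d i q\<bar> < 1 / real (Suc m)" by (simp add: pos_less_divide_eq mult.commute del: of_nat_Suc)
      show ?thesis using 1 2 3 m by linarith
    qed
    ultimately show ?thesis by blast
  qed
  ultimately show ?thesis by (rule that)
qed

text \<open>C2 closeness is uniform closeness of finitely many continuous functions on the unit
  ball: the value and the first and second partial derivatives. Outside the ball all of them vanish,
  so the compact ball suffices.\<close>

lemma unit_tests_separable:
  obtains D :: "(('d::finite) spacetime \<Rightarrow> real) set" where "countable D" "D \<subseteq> unit_tests"
    "\<And>\<phi> \<delta>. \<phi> \<in> unit_tests \<Longrightarrow> \<delta> > 0 \<Longrightarrow> \<exists>\<psi>\<in>D. C2_norm (\<lambda>w. \<phi> w - \<psi> w) \<le> \<delta>"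
proof -
  \<comment> \<open>The number codes the order of the derivative; the two basis vectors are its
    directions and are ignored as far as the order is lower.\<close>
  define J where "J = {0::nat, 1, 2} \<times> (Basis :: 'd spacetime set) \<times> (Basis :: 'd spacetime set)"
  define F where "F \<phi> = (\<lambda>(j::nat, b, c) z. if j = 0 then \<phi> z else if j = 1 then frechet_derivative \<phi> (at z) b else frechet_derivative (\<lambda>w. frechet_derivative \<phi> (at w) b) (at z) c)" for \<phi> :: "'d spacetime \<Rightarrow> real"
  have J: "finite J" unfolding J_def by simp
  have jm: "(0, b, c) \<in> J" "(1, b, c) \<in> J" "(2, b, c) \<in> J" if "b \<in> Basis" "c \<in> Basis" for b c
    using that unfolding J_def by simp_all
  have ut: "\<phi> \<in> test_functions" "\<And>z. z \<notin> cball 0 1 \<Longrightarrow> \<phi> z = 0" if "\<phi> \<in> unit_tests" for \<phi> :: "'d spacetime \<Rightarrow> real"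
    using that by (auto simp: unit_tests_def)
  have c: "continuous_on (cball 0 1) (F \<phi> j)" if \<phi>: "\<phi> \<in> unit_tests" and j: "j \<in> J" for \<phi> j
  proof -
    have C2: "Ck_on (Suc (Suc 0)) \<phi> UNIV" using ut(1)[OF \<phi>] by (simp add: test_functions_def numeral_2_eq_2)
    have c0: "continuous_on UNIV \<phi>" using C2 by (rule Ck_on_continuous)
    have "Ck_on (Suc 0) (\<lambda>w. frechet_derivative \<phi> (at w) b) UNIV" if "b \<in> Basis" for b using C2 that by auto
    then have c1: "continuous_on UNIV (\<lambda>w. frechet_derivative \<phi> (at w) b)" if "b \<in> Basis" for b using that Ck_on_continuous by blast
    have c2: "continuous_on UNIV (\<lambda>z. frechet_derivative (\<lambda>w. frechet_derivative \<phi> (at w) b) (at z) c)" if "b \<in> Basis" "c \<in> Basis" for b c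
      using C2 that by auto
    have "continuous_on UNIV (F \<phi> j)" using j c0 c1 c2 unfolding J_def F_def by auto
    then show ?thesis by (rule continuous_on_subset) simp
  qed
  have "\<exists>D. countable D \<and> D \<subseteq> unit_tests \<and> (\<forall>\<phi>\<in>unit_tests. \<forall>\<delta>>0. \<exists>\<psi>\<in>D. \<forall>j\<in>J. \<forall>p\<in>cball 0 1. \<bar>F \<phi> j p - F \<psi> j p\<bar> < \<delta>)"
  proof (rule uniform_separable[where X=unit_tests and F=F and I=J and K="cball 0 1", OF compact_cball J c], goal_cases)
    case (3 D)
    show ?case by (rule exI[of _ D], intro conjI ballI allI impI) (rule 3; assumption?)+
  qed auto
  then obtain D where D: "countable D" "D \<subseteq> unit_tests" and dense: "\<And>\<phi> \<delta>. \<phi> \<in> unit_tests \<Longrightarrow> \<delta> > 0 \<Longrightarrow> \<exists>\<psi>\<in>D. \<forall>j\<in>J. \<forall>p\<in>cball 0 1. \<bar>F \<phi> j p - F \<psi> j p\<bar> < \<delta>"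
    by blast
  have "\<exists>\<psi>\<in>D. C2_norm (\<lambda>w. \<phi> w - \<psi> w) \<le> \<delta>" if \<phi>: "\<phi> \<in> unit_tests" and \<delta>: "\<delta> > 0" for \<phi> \<delta>
  proof -
    obtain \<psi> where \<psi>D: "\<psi> \<in> D" and cl: "\<And>j p. j \<in> J \<Longrightarrow> p \<in> cball 0 1 \<Longrightarrow> \<bar>F \<phi> j p - F \<psi> j p\<bar> < \<delta>" using dense[OF \<phi> \<delta>] by blast
    have \<psi>: "\<psi> \<in> unit_tests" using \<psi>D D by blast
    have lc: "(\<lambda>w. \<phi> w - \<psi> w) = (\<lambda>w. 1 * \<phi> w + (-1) * \<psi> w)" by simp
    note td = test_scale_derivs[OF ut(1)[OF \<phi>] ut(1)[OF \<psi>], of _ 1 "-1"]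
    have "C2_norm (\<lambda>w. \<phi> w - \<psi> w) \<le> \<delta>"
    proof (rule C2_norm_le)
      obtain b0 :: "'d spacetime" where b0: "b0 \<in> Basis" using nonempty_Basis by blast
      show "\<bar>\<phi> z - \<psi> z\<bar> \<le> \<delta>" for z
      proof (cases "z \<in> cball 0 1")
        case True
        then show ?thesis using cl[OF jm(1)[OF b0 b0] True] by (simp add: F_def less_imp_le)
      next
        case False
        then show ?thesis using ut(2)[OF \<phi>, of z] ut(2)[OF \<psi>, of z] \<delta> by simp
      qed
      fix z b assume b: "b \<in> (Basis :: 'd spacetime set)"
      show "\<bar>frechet_derivative (\<lambda>w. \<phi> w - \<psi> w) (at z) b\<bar> \<le> \<delta>"
      proof (cases "z \<in> cball 0 1")
        case True
        then show ?thesis using cl[OF jm(2)[OF b b0] True] unfolding lc td(1)[OF b] by (simp add: F_def less_imp_le)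
      next
        case False
        then show ?thesis using test_zero_derivs[OF ut(1)[OF \<phi>] closed_cball ut(2)[OF \<phi>] False, of b] test_zero_derivs[OF ut(1)[OF \<psi>] closed_cball ut(2)[OF \<psi>] False, of b] \<delta>
          unfolding lc td(1)[OF b] by simp
      qed
      fix c assume c: "c \<in> (Basis :: 'd spacetime set)"
      show "\<bar>frechet_derivative (\<lambda>w. frechet_derivative (\<lambda>w. \<phi> w - \<psi> w) (at w) b) (at z) c\<bar> \<le> \<delta>"
      proof (cases "z \<in> cball 0 1")
        case True
        then show ?thesis using cl[OF jm(3)[OF b c] True] unfolding lc td(2)[OF b] by (simp add: F_def less_imp_le)
      next
        case False
        then show ?thesis using test_function_bounds(4)[OF ut(1)[OF \<phi>] closed_cball ut(2)[OF \<phi>] False, of b c] test_function_bounds(4)[OF ut(1)[OF \<psi>] closed_cball ut(2)[OF \<psi>] False, of b c] \<delta>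
          unfolding lc td(2)[OF b] by simp
      qed
    qed
    then show ?thesis using \<psi>D by blast
  qed
  with D show ?thesis by (rule that)
qed

text \<open>The fundamental lemma of the calculus of variations: a bump inside the part of
  \<open>S\<close> where \<open>h\<close> keeps the sign it has at \<open>z\<close> would have a
  nonzero integral against \<open>h\<close>.\<close>

lemma cont_density_unique:
  fixes h :: "('d::finite) spacetime \<Rightarrow> real"
  assumes h: "continuous_on UNIV h" and eq: "\<And>\<phi>. \<phi> \<in> test_functions \<Longrightarrow> (\<And>w. \<phi> w \<noteq> 0 \<Longrightarrow> w \<in> S) \<Longrightarrow> (LINT w|lborel. h w * \<phi> w) = 0"
    and S: "open S" and z: "z \<in> S"
  shows "h z = 0"
proof (rule ccontr)
  assume hz: "h z \<noteq> 0"
  define s where "s = sgn (h z)"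
  have "open {w. s * h w > 0}" by (rule open_Collect_less) (intro continuous_intros h)+
  then have op: "open ({w. s * h w > 0} \<inter> S)" using S by (rule open_Int)
  have zin: "z \<in> {w. s * h w > 0} \<inter> S" using hz z by (auto simp: s_def sgn_if)
  obtain r where r: "r > 0" "ball z r \<subseteq> {w. s * h w > 0} \<inter> S" using op zin open_contains_ball by blast
  \<comment> \<open>The Euclidean norm is at most the sum of the coordinates, so a box of this
    half-width lies in the ball of radius \<open>r\<close>.\<close>
  define \<delta> where "\<delta> = r / (real DIM('d spacetime) + 1)"
  have \<delta>: "\<delta> > 0" using r by (simp add: \<delta>_def add_nonneg_pos)
  have inb: "w \<in> ball z r" if "0 < box_bump \<delta> z w" for w
  proof -
    have "norm (w - z) \<le> (\<Sum>b\<in>Basis. \<bar>(w - z) \<bullet> b\<bar>)" by (rule norm_le_l1)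
    also have "\<dots> \<le> (\<Sum>b\<in>(Basis :: 'd spacetime set). \<delta>)"
      using that unfolding box_bump_pos_iff by (intro sum_mono) (auto simp: inner_diff_left intro: less_imp_le)
    also have "\<dots> = real DIM('d spacetime) * \<delta>" by simp
    also have "\<dots> < (real DIM('d spacetime) + 1) * \<delta>" using \<delta> by simp
    also have "\<dots> = r" by (simp add: \<delta>_def add_nonneg_eq_0_iff)
    finally show ?thesis by (simp add: dist_norm norm_minus_commute)
  qed
  define f where "f w = s * h w * box_bump \<delta> z w" for w
  have fnn: "0 \<le> f w" for w
  proof (cases "0 < box_bump \<delta> z w")
    case True
    then show ?thesis using inb[OF True] r(2) by (auto simp: f_def intro!: mult_nonneg_nonneg less_imp_le)
  next
    case False
    then show ?thesis using box_bump_nonneg[of \<delta> z w] by (simp add: f_def)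
  qed
  have bc: "continuous_on UNIV (box_bump \<delta> z)" by (rule Ck_on_continuous[OF box_bump_C2])
  have fc: "continuous_on UNIV f" unfolding f_def by (intro continuous_intros h bc)
  obtain C where C: "compact C" "\<And>w. w \<notin> C \<Longrightarrow> box_bump \<delta> z w = 0" using box_bump_test[of \<delta> z] by (auto simp: test_functions_def)
  have fi: "integrable lborel f"
  proof -
    have "integrable lborel (\<lambda>x. indicator C x *\<^sub>R f x)"
      using borel_integrable_compact[OF C(1) continuous_on_subset[OF fc]] by simp
    then show ?thesis by (rule Bochner_Integration.integrable_cong[THEN iffD1, rotated -1]) (auto simp: f_def C split: split_indicator)
  qed
  have "(LINT w|lborel. h w * box_bump \<delta> z w) = 0"
  proof (rule eq[OF box_bump_test])
    fix w assume "box_bump \<delta> z w \<noteq> 0"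
    then have "0 < box_bump \<delta> z w" using box_bump_nonneg[of \<delta> z w] by linarith
    then show "w \<in> S" using inb r(2) by blast
  qed
  then have "(LINT w|lborel. f w) = 0" unfolding f_def mult.assoc by simp
  then have "AE w in lborel. f w = 0" using integral_nonneg_eq_0_iff_AE[OF fi] fnn by auto
  then have nl: "{w. f w \<noteq> 0} \<in> null_sets lborel"
    using borel_measurable_continuous_onI[OF fc] by (subst (asm) AE_iff_null) (auto simp: fc)
  have "open {w. f w \<noteq> 0}"
    using open_Collect_neq[OF fc continuous_on_const, of 0] by simp
  moreover have "z \<in> {w. f w \<noteq> 0}"
  proof -
    have "0 < box_bump \<delta> z z" using \<delta> by (simp add: box_bump_pos_iff)
    then show ?thesis using hz by (simp add: f_def s_def sgn_if)
  qed
  ultimately have "\<not> negligible {w. f w \<noteq> 0}" using open_not_negligible by blast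
  moreover have "negligible {w. f w \<noteq> 0}" unfolding negligible_iff_null_sets using nl by (rule null_sets_completionI)
  ultimately show False ..
qed

section \<open>Distributions and models\<close>

declare split_paired_All [simp del] split_paired_Ex [simp del]

lemma rescale_1: "rescale 1 z \<phi> = (\<lambda>w. \<phi> (w - z))"
  by (rule ext) (simp add: rescale_def minus_prod_def)

lemma C2_norm_translate:
  fixes \<phi> :: "('d::finite) spacetime \<Rightarrow> real"
  assumes "\<phi> \<in> test_functions"
  shows "C2_norm (\<lambda>w. \<phi> (w - c)) = C2_norm \<phi>"
proof -
  have fd: "frechet_derivative (\<lambda>w. f (w - c)) (at z) = frechet_derivative f (at (z - c))" if "f differentiable (at (z - c))" for f :: "'d spacetime \<Rightarrow> real" and z
  proof (rule frechet_eqI)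
    have "((\<lambda>w. w - c) has_derivative (\<lambda>h. h)) (at z)" by (auto intro!: derivative_eq_intros)
    from has_derivative_compose[OF this frechet_works[OF that]]
    show "((\<lambda>w. f (w - c)) has_derivative frechet_derivative f (at (z - c))) (at z)" .
  qed
  have C2: "Ck_on (Suc (Suc 0)) \<phi> UNIV" using assms by (simp add: test_functions_def numeral_2_eq_2)
  then have d1: "\<And>x. \<phi> differentiable (at x)" and d2: "\<And>b x. b \<in> Basis \<Longrightarrow> (\<lambda>w. frechet_derivative \<phi> (at w) b) differentiable (at x)"
    by auto
  have e1: "frechet_derivative (\<lambda>w. \<phi> (w - c)) (at z) = frechet_derivative \<phi> (at (z - c))" for z by (rule fd[OF d1])
  have e2: "frechet_derivative (\<lambda>w. frechet_derivative (\<lambda>w. \<phi> (w - c)) (at w) b) (at z) = frechet_derivative (\<lambda>w. frechet_derivative \<phi> (at w) b) (at (z - c))" if "b \<in> Basis" for b z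
    unfolding e1 by (rule fd[where f="\<lambda>w. frechet_derivative \<phi> (at w) b", OF d2[OF that]])
  have "{\<bar>\<phi> (z - c)\<bar> | z. True} = {\<bar>\<phi> z\<bar> | z. True}" (is "?A = ?B")
  proof (intro equalityI subsetI)
    fix x assume "x \<in> ?B"
    then obtain z where "x = \<bar>\<phi> z\<bar>" by blast
    then have "x = \<bar>\<phi> ((z + c) - c)\<bar>" by simp
    then show "x \<in> ?A" by blast
  qed blast
  moreover have "{\<bar>frechet_derivative (\<lambda>w. \<phi> (w - c)) (at z) b\<bar> | z b. b \<in> Basis} = {\<bar>frechet_derivative \<phi> (at z) b\<bar> | z b. b \<in> Basis}" (is "?A = ?B")
  proof (intro equalityI subsetI)
    fix x assume "x \<in> ?B"
    then obtain z b where b: "b \<in> Basis" and "x = \<bar>frechet_derivative \<phi> (at z) b\<bar>" by blast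
    then have "x = \<bar>frechet_derivative (\<lambda>w. \<phi> (w - c)) (at (z + c)) b\<bar>" by (simp add: e1)
    then show "x \<in> ?A" using b by blast
  next
    fix x assume "x \<in> ?A"
    then obtain z b where b: "b \<in> Basis" and "x = \<bar>frechet_derivative (\<lambda>w. \<phi> (w - c)) (at z) b\<bar>" by blast
    then have "x = \<bar>frechet_derivative \<phi> (at (z - c)) b\<bar>" by (simp add: e1)
    then show "x \<in> ?B" using b by blast
  qed
  moreover have "{\<bar>frechet_derivative (\<lambda>w. frechet_derivative (\<lambda>w. \<phi> (w - c)) (at w) b) (at z) d\<bar> | z b d. b \<in> Basis \<and> d \<in> Basis} =
    {\<bar>frechet_derivative (\<lambda>w. frechet_derivative \<phi> (at w) b) (at z) d\<bar> | z b d. b \<in> Basis \<and> d \<in> Basis}" (is "?A = ?B")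
  proof (intro equalityI subsetI)
    fix x assume "x \<in> ?B"
    then obtain z b d where b: "b \<in> Basis" "d \<in> Basis" and "x = \<bar>frechet_derivative (\<lambda>w. frechet_derivative \<phi> (at w) b) (at z) d\<bar>" by blast
    then have "x = \<bar>frechet_derivative (\<lambda>w. frechet_derivative (\<lambda>w. \<phi> (w - c)) (at w) b) (at (z + c)) d\<bar>" by (simp add: e2[OF b(1)])
    then show "x \<in> ?A" using b by blast
  next
    fix x assume "x \<in> ?A"
    then obtain z b d where b: "b \<in> Basis" "d \<in> Basis" and "x = \<bar>frechet_derivative (\<lambda>w. frechet_derivative (\<lambda>w. \<phi> (w - c)) (at w) b) (at z) d\<bar>" by blast
    then have "x = \<bar>frechet_derivative (\<lambda>w. frechet_derivative \<phi> (at w) b) (at (z - c)) d\<bar>" by (simp only: e2[OF b(1)])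
    then show "x \<in> ?B" using b by blast
  qed
  ultimately show ?thesis unfolding C2_norm_def by simp
qed

lemma distribution_linear:
  "\<Upsilon> \<in> distributions \<Longrightarrow> \<phi> \<in> test_functions \<Longrightarrow> \<psi> \<in> test_functions \<Longrightarrow>
    \<Upsilon> (\<lambda>w. a * \<phi> w + b * \<psi> w) = a * \<Upsilon> \<phi> + b * \<Upsilon> \<psi>"
  by (simp add: distributions_def)

lemma distribution_off_tests: "\<Upsilon> \<in> distributions \<Longrightarrow> \<phi> \<notin> test_functions \<Longrightarrow> \<Upsilon> \<phi> = 0"
  by (simp add: distributions_def)

text \<open>On tests supported in one fixed ball a distribution is bounded by a multiple of the C2
  norm. Two distributions that agree on a C2 dense set of tests translated to \<open>z\<close>
  therefore agree on all of them.\<close>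

lemma distributions_agree_dense:
  fixes \<Upsilon> \<Upsilon>' :: "('d::finite) functional"
  assumes \<Upsilon>: "\<Upsilon> \<in> distributions" "\<Upsilon>' \<in> distributions"
    and D: "D \<subseteq> unit_tests" "\<And>\<phi> \<delta>. \<phi> \<in> unit_tests \<Longrightarrow> \<delta> > 0 \<Longrightarrow> \<exists>\<psi>\<in>D. C2_norm (\<lambda>w. \<phi> w - \<psi> w) \<le> \<delta>"
    and eq: "\<And>\<psi>. \<psi> \<in> D \<Longrightarrow> \<Upsilon> (rescale 1 z \<psi>) = \<Upsilon>' (rescale 1 z \<psi>)" and \<phi>: "\<phi> \<in> unit_tests"
  shows "\<Upsilon> (rescale 1 z \<phi>) = \<Upsilon>' (rescale 1 z \<phi>)"
proof -
  have close: "\<exists>B\<ge>0. \<forall>\<psi>\<in>unit_tests. \<bar>\<Upsilon> (rescale 1 z \<phi>) - \<Upsilon> (rescale 1 z \<psi>)\<bar> \<le> B * C2_norm (\<lambda>w. \<phi> w - \<psi> w)"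
    if \<Upsilon>: "\<Upsilon> \<in> distributions" for \<Upsilon> :: "'d functional"
  proof -
    obtain B where B: "\<And>\<psi>. \<psi> \<in> test_functions \<Longrightarrow> (\<And>w. w \<notin> cball z 1 \<Longrightarrow> \<psi> w = 0) \<Longrightarrow> \<bar>\<Upsilon> \<psi>\<bar> \<le> B * C2_norm \<psi>"
    proof -
      have "\<forall>C. compact C \<longrightarrow> (\<exists>B. \<forall>\<psi>\<in>test_functions. (\<forall>w. w \<notin> C \<longrightarrow> \<psi> w = 0) \<longrightarrow> \<bar>\<Upsilon> \<psi>\<bar> \<le> B * C2_norm \<psi>)"
        using \<Upsilon> by (simp add: distributions_def)
      from spec[OF this, of "cball z 1"] compact_cball[of z 1]
      have "\<exists>B. \<forall>\<psi>\<in>test_functions. (\<forall>w. w \<notin> cball z 1 \<longrightarrow> \<psi> w = 0) \<longrightarrow> \<bar>\<Upsilon> \<psi>\<bar> \<le> B * C2_norm \<psi>"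
        by (rule mp)
      then show thesis using that by blast
    qed
    have "\<bar>\<Upsilon> (rescale 1 z \<phi>) - \<Upsilon> (rescale 1 z \<psi>)\<bar> \<le> \<bar>B\<bar> * C2_norm (\<lambda>w. \<phi> w - \<psi> w)" if \<psi>: "\<psi> \<in> unit_tests" for \<psi>
    proof -
      have t: "\<phi> \<in> test_functions" "\<psi> \<in> test_functions" using \<phi> \<psi> by (auto simp: unit_tests_def)
      define \<chi>' where "\<chi>' w = 1 * \<phi> w + (-1) * \<psi> w" for w
      have ct: "\<chi>' \<in> test_functions" unfolding \<chi>'_def[abs_def] by (rule test_functions_linear_comb[OF t])
      have "\<Upsilon> (rescale 1 z \<phi>) - \<Upsilon> (rescale 1 z \<psi>) = \<Upsilon> (\<lambda>w. 1 * \<phi> (w - z) + (-1) * \<psi> (w - z))"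
        unfolding rescale_1 by (subst distribution_linear[OF \<Upsilon> test_functions_translate test_functions_translate]) (use t in auto)
      also have "\<bar>\<dots>\<bar> \<le> B * C2_norm (\<lambda>w. \<chi>' (w - z))"
        unfolding \<chi>'_def[symmetric]
      proof (rule B[OF test_functions_translate[OF ct]])
        fix w assume "w \<notin> cball z 1"
        then have "w - z \<notin> cball 0 1" by (simp add: dist_norm norm_minus_commute)
        then show "\<chi>' (w - z) = 0" using \<phi> \<psi> by (auto simp: \<chi>'_def unit_tests_def)
      qed
      also have "C2_norm (\<lambda>w. \<chi>' (w - z)) = C2_norm \<chi>'" by (rule C2_norm_translate[OF ct])
      also have "B * C2_norm \<chi>' \<le> \<bar>B\<bar> * C2_norm \<chi>'" using C2_norm_nonneg[OF ct] by (intro mult_right_mono) auto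
      finally show ?thesis by (simp add: \<chi>'_def[abs_def])
    qed
    then show ?thesis by (intro exI[of _ "\<bar>B\<bar>"]) auto
  qed
  obtain B where B: "B \<ge> 0" "\<And>\<psi>. \<psi> \<in> unit_tests \<Longrightarrow> \<bar>\<Upsilon> (rescale 1 z \<phi>) - \<Upsilon> (rescale 1 z \<psi>)\<bar> \<le> B * C2_norm (\<lambda>w. \<phi> w - \<psi> w)"
    using close[OF \<Upsilon>(1)] by blast
  obtain B' where B': "B' \<ge> 0" "\<And>\<psi>. \<psi> \<in> unit_tests \<Longrightarrow> \<bar>\<Upsilon>' (rescale 1 z \<phi>) - \<Upsilon>' (rescale 1 z \<psi>)\<bar> \<le> B' * C2_norm (\<lambda>w. \<phi> w - \<psi> w)"
    using close[OF \<Upsilon>(2)] by blast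
  have "\<bar>\<Upsilon> (rescale 1 z \<phi>) - \<Upsilon>' (rescale 1 z \<phi>)\<bar> \<le> \<epsilon>" if "\<epsilon> > 0" for \<epsilon>
  proof -
    define \<delta> where "\<delta> = \<epsilon> / (B + B' + 1)"
    have \<delta>: "\<delta> > 0" using that B B' by (simp add: \<delta>_def)
    obtain \<psi> where \<psi>: "\<psi> \<in> D" "C2_norm (\<lambda>w. \<phi> w - \<psi> w) \<le> \<delta>" using D(2)[OF \<phi> \<delta>] by blast
    then have "B * C2_norm (\<lambda>w. \<phi> w - \<psi> w) \<le> B * \<delta>" "B' * C2_norm (\<lambda>w. \<phi> w - \<psi> w) \<le> B' * \<delta>"
      using B B' by (auto intro!: mult_left_mono)
    moreover have "B * \<delta> + B' * \<delta> \<le> (B + B' + 1) * \<delta>" using \<delta> by (simp add: algebra_simps)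
    moreover have "(B + B' + 1) * \<delta> = \<epsilon>" using B(1) B'(1) by (simp add: \<delta>_def)
    ultimately show ?thesis using B(2)[of \<psi>] B'(2)[of \<psi>] eq[OF \<psi>(1)] \<psi>(1) D(1) by fastforce
  qed
  then have "\<bar>\<Upsilon> (rescale 1 z \<phi>) - \<Upsilon>' (rescale 1 z \<phi>)\<bar> \<le> 0" by (rule field_le_epsilon[of _ 0, simplified])
  then show ?thesis by simp
qed

lemma test_product_integrable:
  fixes h :: "('d::finite) spacetime \<Rightarrow> real"
  assumes "continuous_on UNIV h" "\<phi> \<in> test_functions"
  shows "integrable lborel (\<lambda>w. h w * \<phi> w)"
proof -
  obtain C where C: "compact C" "\<And>w. w \<notin> C \<Longrightarrow> \<phi> w = 0" and C2: "Ck_on 2 \<phi> UNIV" using assms by (auto simp: test_functions_def)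
  have "continuous_on UNIV (\<lambda>w. h w * \<phi> w)" by (intro continuous_intros assms Ck_on_continuous[OF C2])
  then have "integrable lborel (\<lambda>x. indicator C x *\<^sub>R (h x * \<phi> x))"
    using borel_integrable_compact[OF C(1) continuous_on_subset[OF _ subset_UNIV]] by blast
  then show ?thesis by (rule Bochner_Integration.integrable_cong[THEN iffD1, rotated -1]) (auto simp: C split: split_indicator)
qed

text \<open>The restriction to \<open>S\<close> matters in the identification of models, where
  agreement is known only for tests supported near a base point.\<close>

lemma of_fun_local_unique:
  fixes h h' :: "('d::finite) spacetime \<Rightarrow> real"
  assumes h: "continuous_on UNIV h" "continuous_on UNIV h'" and S: "open S" "z \<in> S"
    and eq: "\<And>\<phi>. \<phi> \<in> test_functions \<Longrightarrow> (\<And>w. \<phi> w \<noteq> 0 \<Longrightarrow> w \<in> S) \<Longrightarrow> of_fun h \<phi> = of_fun h' \<phi>"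
  shows "h z = h' z"
proof -
  have "h z - h' z = 0"
  proof (rule cont_density_unique[where h="\<lambda>w. h w - h' w" and S=S])
    show "continuous_on UNIV (\<lambda>w. h w - h' w)" by (intro continuous_intros h)
    fix \<phi> assume \<phi>: "\<phi> \<in> test_functions" and s: "\<And>w. \<phi> w \<noteq> 0 \<Longrightarrow> w \<in> S"
    have "(LINT w|lborel. (h w - h' w) * \<phi> w) = of_fun h \<phi> - of_fun h' \<phi>"
      using \<phi> by (simp add: of_fun_def left_diff_distrib Bochner_Integration.integral_diff test_product_integrable h)
    then show "(LINT w|lborel. (h w - h' w) * \<phi> w) = 0" using eq[OF \<phi> s] by simp
  qed (use S in auto)
  then show ?thesis by simp
qed

lemma cont_density_of_fun:
  assumes "continuous_on UNIV h"
  shows "cont_density (of_fun h) = h"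
  unfolding cont_density_def
proof (rule the_equality)
  show "continuous_on UNIV h \<and> of_fun h = of_fun h" using assms by simp
  fix k assume "continuous_on UNIV k \<and> of_fun h = of_fun k"
  then show "k = h" using of_fun_local_unique[of k h UNIV] assms by (auto simp: fun_eq_iff)
qed

lemma linear_eq_bas:
  fixes f g :: "('d::finite) tspace \<Rightarrow> 'b::real_vector"
  assumes "linear f" "linear g" "\<And>a. f (bas a) = g (bas a)"
  shows "f = g"
proof
  fix \<tau> :: "'d tspace"
  have "\<tau> = (\<Sum>a\<in>UNIV. (\<tau> $ a) *\<^sub>R bas a)"
    by (simp add: vec_eq_iff axis_def if_distrib sum.delta cong: if_cong)
  then have e: "h \<tau> = (\<Sum>a\<in>UNIV. (\<tau> $ a) *\<^sub>R h (bas a))" if "linear h" for h :: "'d tspace \<Rightarrow> 'b"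
    using linear_sum[OF that, of "\<lambda>a. (\<tau> $ a) *\<^sub>R bas a" UNIV] linear_scale[OF that] by simp
  show "f \<tau> = g \<tau>" unfolding e[OF assms(1)] e[OF assms(2)] assms(3) ..
qed

text \<open>The formulas prescribe \<Gamma> on the whole basis and depend on \<Pi> only through the
  densities of \<open>II\<close> and \<open>XX i\<close>. This makes the description in
  \<open>Gamma_of\<close> definite, and it lets \<Gamma> be compared through \<Pi> alone.\<close>

lemma Gamma_formulas_unique:
  assumes G: "Gamma_formulas P G" and G': "Gamma_formulas P' G'"
    and II: "\<And>z w. cont_density (P z (bas II)) w = cont_density (P' z (bas II)) w"
    and XX: "\<And>z w i. cont_density (P z (bas (XX i))) w = cont_density (P' z (bas (XX i))) w"
  shows "G = G'"
proof (intro ext)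
  fix z w \<tau>
  have "G z w = G' z w"
  proof (rule linear_eq_bas)
    show "linear (G z w)" "linear (G' z w)" using G G' by (auto simp: Gamma_formulas_def)
    show "G z w (bas a) = G' z w (bas a)" for a
      using G G' II XX by (cases a) (auto simp: Gamma_formulas_def)
  qed
  then show "G z w \<tau> = G' z w \<tau>" by simp
qed

lemma Gamma_of_eq: "Gamma_formulas P G \<Longrightarrow> Gamma_of P = G"
  unfolding Gamma_of_def by (rule the_equality) (auto intro: Gamma_formulas_unique)

lemma is_modelD:
  assumes "is_model \<kappa> (P, G)"
  shows "P z \<tau> \<in> distributions" "linear (\<lambda>\<tau>. P z \<tau> \<phi>)" "P z (bas Unit) = of_fun (\<lambda>_. 1)"
    "P z (bas (XX i)) = of_fun (\<lambda>w. snd w $ i - snd z $ i)"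
    "\<exists>g. continuous_on UNIV g \<and> (\<forall>z. P z (bas II) = of_fun (\<lambda>w. g w - g z))"
    "Gamma_formulas P G" "G z w \<circ> G w v = G z v" "P z \<circ> G z w = P w"
    "P (z + (0, lattice_vec k)) \<tau> (\<lambda>w. \<phi> (w - (0, lattice_vec k))) = P z \<tau> \<phi>"
    "G (z + (0, lattice_vec k)) (w + (0, lattice_vec k)) = G z w"
    "compact S \<Longrightarrow> Pi_seminorm \<kappa> S P < \<infinity>" "compact S \<Longrightarrow> 1 + Gamma_seminorm \<kappa> S G < \<infinity>"
  using assms by (auto simp: is_model_def)

lemma cont_density_XX:
  assumes "is_model \<kappa> (P, G)"
  shows "cont_density (P z (bas (XX i))) = (\<lambda>w. snd w $ i - snd z $ i)"
  unfolding is_modelD(4)[OF assms] by (rule cont_density_of_fun) (intro continuous_intros)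

text \<open>Unit-scale evaluations at a dense set of base points know only tests close to their own
  base point. The algebra does the rest: the densities of \<open>II\<close> agree up to one
  constant, hence the two \<Gamma> coincide, and
  \<open>\<Pi>\<^sub>0 = \<Pi>\<^sub>z \<Gamma>\<^sub>z\<^sub>0\<close> carries the knowledge near
  \<open>z\<close> to the base point 0. Localising tests to small boxes covers every test, and
  \<Gamma> moves the result from 0 to all base points.\<close>

lemma model_eqI:
  fixes P P' :: "('d::finite) pimap"
  assumes M: "is_model \<kappa> (P, G)" and M': "is_model \<kappa> (P', G')" and D: "closure D = UNIV"
    and eq: "\<And>z a \<phi>. z \<in> D \<Longrightarrow> \<phi> \<in> unit_tests \<Longrightarrow> P z (bas a) (rescale 1 z \<phi>) = P' z (bas a) (rescale 1 z \<phi>)"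
  shows "(P, G) = (P', G')"
proof -
  have near: "\<exists>z\<in>D. dist z x < r" if "r > 0" for x :: "'d spacetime" and r
    using D closure_approachable[of x D] that by auto
  have 1: "P z \<tau> \<phi> = P' z \<tau> \<phi>" if z: "z \<in> D" and \<phi>: "\<phi> \<in> test_functions" and s: "\<And>w. w \<notin> cball z 1 \<Longrightarrow> \<phi> w = 0" for z \<phi> \<tau>
  proof -
    have t: "(\<lambda>w. \<phi> (w - (- z))) \<in> test_functions" by (rule test_functions_translate[OF \<phi>])
    have "\<exists>c. \<exists>\<psi>\<in>unit_tests. (\<lambda>w. \<phi> (w - (- z))) = (\<lambda>w. c * \<psi> w)"
    proof (rule unit_test_multiple[OF t])
      fix w :: "'d spacetime" assume "w \<notin> cball 0 1"
      then have "w - (- z) \<notin> cball z 1" by (simp add: dist_norm)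
      then show "\<phi> (w - (- z)) = 0" by (rule s)
    qed
    then obtain c \<psi> where \<psi>: "\<psi> \<in> unit_tests" and c: "(\<lambda>w. \<phi> (w - (- z))) = (\<lambda>w. c * \<psi> w)" by blast
    have rt: "rescale 1 z \<psi> \<in> test_functions" using \<psi> by (intro rescale_test) (auto simp: unit_tests_def)
    have \<phi>c: "\<phi> = (\<lambda>w. c * rescale 1 z \<psi> w + 0 * rescale 1 z \<psi> w)"
    proof
      fix w show "\<phi> w = c * rescale 1 z \<psi> w + 0 * rescale 1 z \<psi> w"
        using fun_cong[OF c, of "w - z"] by (simp add: rescale_1)
    qed
    have b: "P z (bas a) \<phi> = P' z (bas a) \<phi>" for a
      by (subst (1 2) \<phi>c) (simp only: distribution_linear[OF is_modelD(1)[OF M] rt rt] distribution_linear[OF is_modelD(1)[OF M'] rt rt] eq[OF z \<psi>])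
    have "(\<lambda>\<tau>. P z \<tau> \<phi>) = (\<lambda>\<tau>. P' z \<tau> \<phi>)"
      by (rule linear_eq_bas[OF is_modelD(2)[OF M] is_modelD(2)[OF M'] b])
    then show ?thesis by (rule fun_cong)
  qed
  obtain g where g: "continuous_on UNIV g" "\<And>z. P z (bas II) = of_fun (\<lambda>w. g w - g z)" using is_modelD(5)[OF M] by blast
  obtain g' where g': "continuous_on UNIV g'" "\<And>z. P' z (bas II) = of_fun (\<lambda>w. g' w - g' z)" using is_modelD(5)[OF M'] by blast
  define u where "u w = g w - g' w" for w
  have u: "u w = u z" if z: "z \<in> D" and w: "w \<in> ball z 1" for z w
  proof -
    have "g w - g z = g' w - g' z"
    proof (rule of_fun_local_unique[where h="\<lambda>w. g w - g z" and h'="\<lambda>w. g' w - g' z" and S="ball z 1"])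
      show "continuous_on UNIV (\<lambda>w. g w - g z)" "continuous_on UNIV (\<lambda>w. g' w - g' z)" by (intro continuous_intros g g')+
      fix \<phi> :: "'d spacetime \<Rightarrow> real" assume \<phi>: "\<phi> \<in> test_functions" and s: "\<And>w. \<phi> w \<noteq> 0 \<Longrightarrow> w \<in> ball z 1"
      show "of_fun (\<lambda>w. g w - g z) \<phi> = of_fun (\<lambda>w. g' w - g' z) \<phi>"
        unfolding g(2)[symmetric] g'(2)[symmetric] by (rule 1[OF z \<phi>]) (use s in force)
    qed (use w in auto)
    then show ?thesis by (simp add: u_def)
  qed
  \<comment> \<open>Around each base point of \<open>D\<close> the two densities differ by a
    constant on the unit ball. Such balls overlap and space-time is connected, so there is a single
    constant, which drops out of the differences \<open>g w - g z\<close>.\<close>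
  have "u constant_on UNIV"
  proof (rule locally_constant_imp_constant[OF connected_UNIV])
    fix x :: "'d spacetime"
    obtain z where z: "z \<in> D" "dist z x < 1/2" using near[of "1/2" x] by auto
    have "u y = u x" if "y \<in> ball x (1/2)" for y
    proof -
      have "y \<in> ball z 1" using that z(2) dist_triangle[of z y x] by simp
      moreover have "x \<in> ball z 1" using z(2) by simp
      ultimately show ?thesis using u[OF z(1)] by metis
    qed
    then show "\<exists>T. openin (top_of_set UNIV) T \<and> x \<in> T \<and> (\<forall>y\<in>T. u y = u x)"
    proof (intro exI[of _ "ball x (1/2)"] conjI ballI)
      show "openin (top_of_set UNIV) (ball x (1/2))" by simp
      show "x \<in> ball x (1/2)" by simp
    qed (rule \<open>\<And>y. y \<in> ball x (1/2) \<Longrightarrow> u y = u x\<close>)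
  qed
  then obtain c where c: "\<And>x. u x = c" by (auto simp: constant_on_def)
  have gg: "g w - g z = g' w - g' z" for w z using c[of w] c[of z] unfolding u_def by linarith
  have PII: "P z (bas II) = P' z (bas II)" for z unfolding g g' gg ..
  have GG: "G = G'"
    by (rule Gamma_formulas_unique[OF is_modelD(6)[OF M] is_modelD(6)[OF M']])
       (simp_all add: PII cont_density_XX[OF M] cont_density_XX[OF M'])
  \<comment> \<open>A box of side \<open>4 / \<mu>\<close> then lies within distance 1/4 of its
    centre \<open>x\<close>. With a base point of \<open>D\<close> within 1/4 of \<open>x\<close>,
    the box lies in the unit ball around that base point.\<close>
  define \<mu> where "\<mu> = 8 * real DIM('d spacetime)"
  have dim: "1 \<le> real DIM('d spacetime)" using DIM_positive[where 'a="'d spacetime"] by linarith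
  have \<mu>: "\<mu> > 0" using dim by (simp add: \<mu>_def)
  have 2: "P 0 \<tau> \<phi> - P' 0 \<tau> \<phi> = 0" if \<phi>: "\<phi> \<in> test_functions" for \<tau> \<phi>
  proof (rule functional_zero_local[where \<Upsilon>="\<lambda>\<phi>. P 0 \<tau> \<phi> - P' 0 \<tau> \<phi>", OF _ \<mu> _ \<phi>])
    fix \<phi> \<psi> :: "'d spacetime \<Rightarrow> real" and a b assume t: "\<phi> \<in> test_functions" "\<psi> \<in> test_functions"
    show "P 0 \<tau> (\<lambda>w. a * \<phi> w + b * \<psi> w) - P' 0 \<tau> (\<lambda>w. a * \<phi> w + b * \<psi> w) = a * (P 0 \<tau> \<phi> - P' 0 \<tau> \<phi>) + b * (P 0 \<tau> \<psi> - P' 0 \<tau> \<psi>)"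
      by (simp only: distribution_linear[OF is_modelD(1)[OF M] t] distribution_linear[OF is_modelD(1)[OF M'] t]) (simp add: algebra_simps)
  next
    fix \<phi> :: "'d spacetime \<Rightarrow> real" and m assume t: "\<phi> \<in> test_functions"
      and s: "\<And>w b. \<phi> w \<noteq> 0 \<Longrightarrow> b \<in> Basis \<Longrightarrow> \<mu> * (w \<bullet> b) \<in> {m b..m b + 4}"
    define x where "x = (\<Sum>b\<in>(Basis :: 'd spacetime set). ((m b + 2) / \<mu>) *\<^sub>R b)"
    obtain z where z: "z \<in> D" "dist z x < 1/4" using near[of "1/4" x] by auto
    have "\<phi> w = 0" if "w \<notin> cball z 1" for w
    proof (rule ccontr)
      assume nz: "\<phi> w \<noteq> 0"
      have "norm (w - x) \<le> (\<Sum>b\<in>Basis. \<bar>(w - x) \<bullet> b\<bar>)" by (rule norm_le_l1)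
      also have "\<dots> \<le> (\<Sum>b\<in>(Basis :: 'd spacetime set). 2 / \<mu>)"
      proof (rule sum_mono)
        fix b :: "'d spacetime" assume b: "b \<in> Basis"
        have "(w - x) \<bullet> b = (\<mu> * (w \<bullet> b) - (m b + 2)) / \<mu>"
          using b \<mu> by (simp add: x_def inner_diff_left inner_sum_left_Basis field_simps)
        moreover have "\<bar>\<mu> * (w \<bullet> b) - (m b + 2)\<bar> \<le> 2" using s[OF nz b] by auto
        ultimately show "\<bar>(w - x) \<bullet> b\<bar> \<le> 2 / \<mu>" using \<mu> by (simp add: divide_right_mono)
      qed
      also have "\<dots> = 1/4" using dim by (simp add: \<mu>_def)
      finally have "dist x w \<le> 1/4" by (simp add: dist_norm norm_minus_commute)
      then have "dist z w \<le> 1" using z(2) dist_triangle[of z w x] by linarith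
      then show False using that by simp
    qed
    \<comment> \<open>The known values at the base point \<open>z\<close>, applied to the
      re-expanded symbol, are by the model identity the values at the base point 0.\<close>
    then have "P z (G z 0 \<tau>) \<phi> = P' z (G z 0 \<tau>) \<phi>" by (rule 1[OF z(1) t])
    then show "P 0 \<tau> \<phi> - P' 0 \<tau> \<phi> = 0"
      using is_modelD(8)[OF M, of z 0] is_modelD(8)[OF M', of z 0] GG by (metis comp_apply cancel_comm_monoid_add_class.diff_cancel)
  qed
  have 3: "P 0 \<tau> = P' 0 \<tau>" for \<tau>
  proof
    fix \<phi> show "P 0 \<tau> \<phi> = P' 0 \<tau> \<phi>"
      using 2[of \<phi> \<tau>] distribution_off_tests[OF is_modelD(1)[OF M]] distribution_off_tests[OF is_modelD(1)[OF M']]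
      by (cases "\<phi> \<in> test_functions") auto
  qed
  have "P w = P' w" for w
    using is_modelD(8)[OF M, of 0 w] is_modelD(8)[OF M', of 0 w] GG 3 by (metis (no_types, lifting) comp_apply ext)
  then show ?thesis using GG by auto
qed

section \<open>Translating models in time\<close>

lemma lborel_integral_translate:
  fixes f :: "'a::euclidean_space \<Rightarrow> real"
  assumes "f \<in> borel_measurable borel"
  shows "(LINT w|lborel. f (w + c)) = (LINT w|lborel. f w)"
proof -
  have "(LINT w|lborel. f w) = (LINT w|distr lborel borel ((+) c). f w)" by (simp add: lborel_distr_plus)
  also have "\<dots> = (LINT w|lborel. f (c + w))" using assms by (intro integral_distr) auto
  finally show ?thesis by (simp add: add.commute)
qed

lemma time_shift_of_fun:
  assumes h: "continuous_on UNIV h"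
  shows "time_shift t (of_fun h) = of_fun (\<lambda>w. h (w + (t, 0)))"
proof
  fix \<phi>
  show "time_shift t (of_fun h) \<phi> = of_fun (\<lambda>w. h (w + (t, 0))) \<phi>"
  proof (cases "\<phi> \<in> test_functions")
    case True
    then have t: "(\<lambda>w. \<phi> (w - (t, 0))) \<in> test_functions" by (rule test_functions_translate)
    have "(\<lambda>w. h w * \<phi> (w - (t, 0))) \<in> borel_measurable borel"
      by (intro borel_measurable_times borel_measurable_continuous_onI[OF h] test_measurable[OF t])
    from lborel_integral_translate[OF this, of "(t, 0)"] show ?thesis
      using True t by (simp add: time_shift_def of_fun_def)
  next
    case False
    then show ?thesis using test_functions_translate_iff[of \<phi> "(t, 0)"] by (simp add: time_shift_def of_fun_def)
  qed
qed

lemma time_shift_distribution: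
  fixes \<Upsilon> :: "('d::finite) functional"
  assumes \<Upsilon>: "\<Upsilon> \<in> distributions"
  shows "time_shift t \<Upsilon> \<in> distributions"
proof -
  have d1: "\<exists>B. \<forall>\<phi>\<in>test_functions. (\<forall>z. z \<notin> C \<longrightarrow> \<phi> z = 0) \<longrightarrow> \<bar>time_shift t \<Upsilon> \<phi>\<bar> \<le> B * C2_norm \<phi>" if C: "compact C" for C
  proof -
    let ?C = "(\<lambda>z. z + (t, 0)) ` C"
    have cC: "compact ?C" by (intro compact_continuous_image C continuous_intros)
    have "\<forall>C. compact C \<longrightarrow> (\<exists>B. \<forall>\<psi>\<in>test_functions. (\<forall>w. w \<notin> C \<longrightarrow> \<psi> w = 0) \<longrightarrow> \<bar>\<Upsilon> \<psi>\<bar> \<le> B * C2_norm \<psi>)"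
      using \<Upsilon> by (simp add: distributions_def)
    from spec[OF this, of ?C] cC obtain B where B: "\<forall>\<psi>\<in>test_functions. (\<forall>w. w \<notin> ?C \<longrightarrow> \<psi> w = 0) \<longrightarrow> \<bar>\<Upsilon> \<psi>\<bar> \<le> B * C2_norm \<psi>"
      by blast
    show ?thesis
    proof (intro exI[of _ B] ballI impI)
      fix \<phi> :: "'d spacetime \<Rightarrow> real" assume \<phi>: "\<phi> \<in> test_functions" and s: "\<forall>z. z \<notin> C \<longrightarrow> \<phi> z = 0"
      have "\<forall>w. w \<notin> ?C \<longrightarrow> \<phi> (w - (t, 0)) = 0"
      proof (intro allI impI)
        fix w :: "'d spacetime" assume "w \<notin> ?C"
        then have "w - (t, 0) \<notin> C" by (auto intro: image_eqI[of _ _ "w - (t, 0)"])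
        then show "\<phi> (w - (t, 0)) = 0" using s by blast
      qed
      then show "\<bar>time_shift t \<Upsilon> \<phi>\<bar> \<le> B * C2_norm \<phi>"
        using B test_functions_translate[OF \<phi>, of "(t, 0)"] C2_norm_translate[OF \<phi>, of "(t, 0)"] by (auto simp: time_shift_def)
    qed
  qed
  have d2: "time_shift t \<Upsilon> \<phi> = 0" if "\<phi> \<notin> test_functions" for \<phi>
    using that test_functions_translate_iff[of \<phi> "(t, 0)"] distribution_off_tests[OF \<Upsilon>] by (simp add: time_shift_def)
  have d3: "time_shift t \<Upsilon> (\<lambda>w. a * \<phi> w + b * \<psi> w) = a * time_shift t \<Upsilon> \<phi> + b * time_shift t \<Upsilon> \<psi>"
    if "\<phi> \<in> test_functions" "\<psi> \<in> test_functions" for \<phi> \<psi> a b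
    unfolding time_shift_def by (rule distribution_linear[OF \<Upsilon>]) (intro test_functions_translate that)+
  show ?thesis unfolding distributions_def
    by (intro CollectI conjI allI ballI impI; (rule d1 d2 d3; assumption))
qed

definition shift_Pi :: "real \<Rightarrow> ('d::finite) pimap \<Rightarrow> 'd pimap" where
  "shift_Pi t P z \<tau> \<phi> = P (z + (t, 0)) \<tau> (\<lambda>w. \<phi> (w - (t, 0)))"

text \<open>The explicit witness for the description in \<open>Gamma_of\<close>: the densities of
  the shifted \<Pi> are the shifted densities, so this map satisfies the formulas. All later work
  uses it in place of the description.\<close>

definition shift_Gamma :: "real \<Rightarrow> ('d::finite) gmap \<Rightarrow> 'd gmap" where
  "shift_Gamma t G z w = G (z + (t, 0)) (w + (t, 0))"

lemma rescale_shift: "(\<lambda>w. rescale l z \<phi> (w - (t, 0))) = rescale l (z + (t, 0)) \<phi>"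
  by (rule ext) (simp add: rescale_def algebra_simps)

lemma Pi_seminorm_shift: "Pi_seminorm \<kappa> S (shift_Pi t P) = Pi_seminorm \<kappa> ((\<lambda>z. z + (t, 0)) ` S) P"
  unfolding Pi_seminorm_def shift_Pi_def rescale_shift by (simp add: image_comp comp_def)

lemma torus_pairs_shift:
  "torus_pairs ((\<lambda>z. z + (t, 0)) ` S) = (\<lambda>(z, w). (z + (t, 0), w + (t, 0))) ` torus_pairs S" (is "?A = ?f ` ?B")
proof -
  have m: "z \<in> (\<lambda>z. z + (t, 0)) ` S \<longleftrightarrow> z - (t, 0) \<in> S" for z
    by (auto intro: image_eqI[of _ _ "z - (t, 0)"])
  have A: "(z, w) \<in> ?A \<longleftrightarrow> (z - (t, 0), w - (t, 0)) \<in> ?B" for z w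
    by (simp add: torus_pairs_def m algebra_simps)
  show ?thesis
  proof (intro equalityI subsetI)
    fix p assume "p \<in> ?A"
    then have "(fst p - (t, 0), snd p - (t, 0)) \<in> ?B" using A[of "fst p" "snd p"] by simp
    then show "p \<in> ?f ` ?B" by (rule image_eqI[rotated]) simp
  next
    fix p assume "p \<in> ?f ` ?B"
    then obtain z w where p: "p = (z + (t, 0), w + (t, 0))" "(z, w) \<in> ?B" by auto
    then show "p \<in> ?A" using A[of "z + (t, 0)" "w + (t, 0)"] by simp
  qed
qed

lemma Gamma_seminorm_shift: "Gamma_seminorm \<kappa> S (shift_Gamma t G) = Gamma_seminorm \<kappa> ((\<lambda>z. z + (t, 0)) ` S) G"
  unfolding Gamma_seminorm_def torus_pairs_shift
  by (simp add: image_comp comp_def case_prod_beta shift_Gamma_def par_dist_def)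

lemma compact_shift: "compact S \<Longrightarrow> compact ((\<lambda>z :: ('d::finite) spacetime. z + (t, 0)) ` S)"
  by (intro compact_continuous_image continuous_intros)

lemma shift_Pi_time_shift: "shift_Pi t P z \<tau> = time_shift t (P (z + (t, 0)) \<tau>)"
  by (rule ext) (simp add: shift_Pi_def time_shift_def)

lemma shift_Gamma_formulas:
  assumes M: "is_model \<kappa> (P, G)"
  shows "Gamma_formulas (shift_Pi t P) (shift_Gamma t G)"
proof -
  obtain g where g: "continuous_on UNIV g" "\<And>z. P z (bas II) = of_fun (\<lambda>w. g w - g z)" using is_modelD(5)[OF M] by blast
  have c: "cont_density (time_shift t (of_fun h)) w = cont_density (of_fun h) (w + (t, 0))" if h: "continuous_on UNIV h" for h w
  proof -
    have "continuous_on UNIV (\<lambda>w. h (w + (t, 0)))" by (intro continuous_on_compose2[OF h] continuous_intros) auto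
    then show ?thesis unfolding time_shift_of_fun[OF h] by (simp add: cont_density_of_fun h)
  qed
  have "cont_density (shift_Pi t P z (bas II)) w = cont_density (P (z + (t, 0)) (bas II)) (w + (t, 0))" for z w
    unfolding shift_Pi_time_shift g by (rule c) (intro continuous_intros g)
  moreover have "cont_density (shift_Pi t P z (bas (XX i))) w = cont_density (P (z + (t, 0)) (bas (XX i))) (w + (t, 0))" for z w i
    unfolding shift_Pi_time_shift is_modelD(4)[OF M] by (rule c) (intro continuous_intros)
  ultimately show ?thesis using is_modelD(6)[OF M] unfolding Gamma_formulas_def shift_Gamma_def by simp
qed

lemma time_translation_model:
  assumes "is_model \<kappa> (P, G)"
  shows "time_translation t (P, G) = (shift_Pi t P, shift_Gamma t G)"
  using Gamma_of_eq[OF shift_Gamma_formulas[OF assms]]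
  by (simp add: time_translation_def Let_def shift_Pi_time_shift[symmetric])

lemma shift_is_model:
  fixes P :: "('d::finite) pimap"
  assumes M: "is_model \<kappa> (P, G)"
  shows "is_model \<kappa> (shift_Pi t P, shift_Gamma t G)"
proof -
  note D = is_modelD[OF M]
  obtain g where g: "continuous_on UNIV g" "\<And>z. P z (bas II) = of_fun (\<lambda>w. g w - g z)" using D(5) by blast
  have 1: "shift_Pi t P z \<tau> \<in> distributions" for z \<tau> unfolding shift_Pi_time_shift by (intro time_shift_distribution D)
  have 2: "linear (\<lambda>\<tau>. shift_Pi t P z \<tau> \<phi>)" for z \<phi> unfolding shift_Pi_def by (rule D(2))
  have 3: "shift_Pi t P z (bas Unit) = of_fun (\<lambda>_. 1)" for z
    unfolding shift_Pi_time_shift D(3) by (subst time_shift_of_fun) (auto intro: continuous_intros)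
  have 4: "shift_Pi t P z (bas (XX i)) = of_fun (\<lambda>w. snd w $ i - snd z $ i)" for z i
    unfolding shift_Pi_time_shift D(4) by (subst time_shift_of_fun) (auto intro!: continuous_intros)
  have 5: "\<exists>g. continuous_on UNIV g \<and> (\<forall>z. shift_Pi t P z (bas II) = of_fun (\<lambda>w. g w - g z))"
  proof (intro exI[of _ "\<lambda>w. g (w + (t, 0))"] conjI allI)
    show "continuous_on UNIV (\<lambda>w. g (w + (t, 0)))" by (intro continuous_on_compose2[OF g(1)] continuous_intros) auto
    show "shift_Pi t P z (bas II) = of_fun (\<lambda>w. g (w + (t, 0)) - g (z + (t, 0)))" for z
      unfolding shift_Pi_time_shift g by (subst time_shift_of_fun) (auto intro!: continuous_intros g)
  qed
  have 6: "shift_Gamma t G z w \<circ> shift_Gamma t G w v = shift_Gamma t G z v" for z w v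
    unfolding shift_Gamma_def by (rule D(7))
  have 7: "shift_Pi t P z \<circ> shift_Gamma t G z w = shift_Pi t P w" for z w
  proof
    fix \<tau>
    have "P (z + (t, 0)) (G (z + (t, 0)) (w + (t, 0)) \<tau>) = P (w + (t, 0)) \<tau>"
      using fun_cong[OF D(8)[of "z + (t, 0)" "w + (t, 0)"], of \<tau>] by simp
    then show "(shift_Pi t P z \<circ> shift_Gamma t G z w) \<tau> = shift_Pi t P w \<tau>"
      by (simp add: shift_Pi_time_shift shift_Gamma_def)
  qed
  have 8: "shift_Pi t P (z + (0, lattice_vec k)) \<tau> (\<lambda>w. \<phi> (w - (0, lattice_vec k))) = shift_Pi t P z \<tau> \<phi>" for k z \<tau> \<phi>
  proof -
    have "shift_Pi t P (z + (0, lattice_vec k)) \<tau> (\<lambda>w. \<phi> (w - (0, lattice_vec k))) =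
      P ((z + (t, 0)) + (0, lattice_vec k)) \<tau> (\<lambda>w. (\<lambda>w. \<phi> (w - (t, 0))) (w - (0, lattice_vec k)))"
      by (simp add: shift_Pi_def algebra_simps)
    also have "\<dots> = P (z + (t, 0)) \<tau> (\<lambda>w. \<phi> (w - (t, 0)))" by (rule D(9))
    finally show ?thesis by (simp add: shift_Pi_def)
  qed
  have 9: "shift_Gamma t G (z + (0, lattice_vec k)) (w + (0, lattice_vec k)) = shift_Gamma t G z w" for k z w
  proof -
    have "shift_Gamma t G (z + (0, lattice_vec k)) (w + (0, lattice_vec k)) = G ((z + (t, 0)) + (0, lattice_vec k)) ((w + (t, 0)) + (0, lattice_vec k))"
      by (simp add: shift_Gamma_def algebra_simps)
    also have "\<dots> = G (z + (t, 0)) (w + (t, 0))" by (rule D(10))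
    finally show ?thesis by (simp add: shift_Gamma_def)
  qed
  show ?thesis
    unfolding is_model_def prod.case
    using 1 2 3 4 5 shift_Gamma_formulas[OF M] 6 7 8 9 D(11,12)[OF compact_shift]
    by (intro conjI allI impI) (auto simp: Pi_seminorm_shift Gamma_seminorm_shift)
qed

lemma models_iff: "Z \<in> models \<kappa> \<longleftrightarrow> is_model \<kappa> (fst Z, snd Z)"
  by (simp add: models_def)

lemma time_translation_models:
  assumes "Z \<in> models \<kappa>"
  shows "time_translation t Z = (shift_Pi t (fst Z), shift_Gamma t (snd Z))" "time_translation t Z \<in> models \<kappa>"
proof -
  have M: "is_model \<kappa> (fst Z, snd Z)" using assms by (simp add: models_iff)
  show *: "time_translation t Z = (shift_Pi t (fst Z), shift_Gamma t (snd Z))"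
    using time_translation_model[OF M, of t] by simp
  show "time_translation t Z \<in> models \<kappa>" unfolding * models_iff using shift_is_model[OF M, of t] by simp
qed

lemma time_translation_zero: "Z \<in> models \<kappa> \<Longrightarrow> time_translation 0 Z = Z"
  unfolding time_translation_models(1)
  by (simp add: prod_eq_iff shift_Pi_def shift_Gamma_def fun_eq_iff zero_prod_def[symmetric])

lemma time_translation_add:
  assumes "Z \<in> models \<kappa>"
  shows "time_translation (t + s) Z = time_translation t (time_translation s Z)"
proof -
  have p: "z + (t + s, 0) = z + (t, 0) + (s, 0)" "z - (t + s, 0) = z - (s, 0) - (t, 0)" for z :: "'a spacetime"
    by (simp_all add: prod_eq_iff)
  have "time_translation t (time_translation s Z) = (shift_Pi t (fst (time_translation s Z)), shift_Gamma t (snd (time_translation s Z)))"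
    by (rule time_translation_models(1)[OF time_translation_models(2)[OF assms]])
  then show ?thesis
    unfolding time_translation_models(1)[OF assms]
    by (simp add: shift_Pi_def shift_Gamma_def fun_eq_iff p)
qed

lemma model_diff_shift:
  assumes "Z \<in> models \<kappa>" "Z' \<in> models \<kappa>"
  shows "model_diff \<kappa> S (time_translation t Z) (time_translation t Z') = model_diff \<kappa> ((\<lambda>z. z + (t, 0)) ` S) Z Z'"
proof -
  have 1: "(\<lambda>z \<tau> \<phi>. shift_Pi t (fst Z) z \<tau> \<phi> - shift_Pi t (fst Z') z \<tau> \<phi>) = shift_Pi t (\<lambda>z \<tau> \<phi>. fst Z z \<tau> \<phi> - fst Z' z \<tau> \<phi>)"
    by (simp add: fun_eq_iff shift_Pi_def)
  have 2: "(\<lambda>z w \<tau>. shift_Gamma t (snd Z) z w \<tau> - shift_Gamma t (snd Z') z w \<tau>) = shift_Gamma t (\<lambda>z w \<tau>. snd Z z w \<tau> - snd Z' z w \<tau>)"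
    by (simp add: fun_eq_iff shift_Gamma_def)
  show ?thesis
    unfolding model_diff_def time_translation_models(1)[OF assms(1)] time_translation_models(1)[OF assms(2)] fst_conv snd_conv 1 2
      Pi_seminorm_shift Gamma_seminorm_shift ..
qed

section \<open>Inequalities for the seminorms and for differences of models\<close>

lemma Pi_seminorm_ge:
  assumes "\<phi> \<in> unit_tests" "0 < l" "l \<le> 1" "z \<in> S"
  shows "ennreal (l powr (- homog \<kappa> a) * \<bar>P z (bas a) (rescale l z \<phi>)\<bar>) \<le> Pi_seminorm \<kappa> S P"
  unfolding Pi_seminorm_def
  by (rule SUP_upper2[of a], simp, rule SUP_upper2[of \<phi>], rule assms, rule SUP_upper2[of l], use assms in simp, rule SUP_upper2[of z], rule assms, simp)

lemma Pi_seminorm_le: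
  assumes "\<And>a \<phi> l z. \<phi> \<in> unit_tests \<Longrightarrow> 0 < l \<Longrightarrow> l \<le> 1 \<Longrightarrow> z \<in> S \<Longrightarrow> ennreal (l powr (- homog \<kappa> a) * \<bar>P z (bas a) (rescale l z \<phi>)\<bar>) \<le> C"
  shows "Pi_seminorm \<kappa> S P \<le> C"
  unfolding Pi_seminorm_def by (intro SUP_least assms) auto

lemma Gamma_seminorm_ge:
  assumes "homog \<kappa> a < homog \<kappa> b" "(z, w) \<in> torus_pairs S"
  shows "ennreal (\<bar>G z w (bas b) $ a\<bar> * par_dist z w powr (homog \<kappa> a - homog \<kappa> b)) \<le> Gamma_seminorm \<kappa> S G"
  unfolding Gamma_seminorm_def
  by (rule SUP_upper2[of "(a, b)"], use assms in simp, simp, rule SUP_upper2[of "(z, w)"], rule assms, simp)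

lemma Gamma_seminorm_le:
  assumes "\<And>a b z w. homog \<kappa> a < homog \<kappa> b \<Longrightarrow> (z, w) \<in> torus_pairs S \<Longrightarrow>
    ennreal (\<bar>G z w (bas b) $ a\<bar> * par_dist z w powr (homog \<kappa> a - homog \<kappa> b)) \<le> C"
  shows "Gamma_seminorm \<kappa> S G \<le> C"
  unfolding Gamma_seminorm_def using assms by (auto intro!: SUP_least)

lemma Pi_seminorm_add:
  assumes "\<And>z a \<phi>. \<bar>P z (bas a) \<phi>\<bar> \<le> \<bar>Q z (bas a) \<phi>\<bar> + \<bar>R z (bas a) \<phi>\<bar>"
  shows "Pi_seminorm \<kappa> S P \<le> Pi_seminorm \<kappa> S Q + Pi_seminorm \<kappa> S R"
proof (rule Pi_seminorm_le)
  fix a :: "'a symb" and l :: real and z and \<phi> :: "'a spacetime \<Rightarrow> real" assume h: "\<phi> \<in> unit_tests" "0 < l" "l \<le> 1" "z \<in> S"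
  have "ennreal (l powr (- homog \<kappa> a) * \<bar>P z (bas a) (rescale l z \<phi>)\<bar>) \<le> ennreal (l powr (- homog \<kappa> a) * (\<bar>Q z (bas a) (rescale l z \<phi>)\<bar> + \<bar>R z (bas a) (rescale l z \<phi>)\<bar>))"
    by (intro ennreal_leI mult_left_mono assms) simp
  also have "\<dots> = ennreal (l powr (- homog \<kappa> a) * \<bar>Q z (bas a) (rescale l z \<phi>)\<bar>) + ennreal (l powr (- homog \<kappa> a) * \<bar>R z (bas a) (rescale l z \<phi>)\<bar>)"
    by (simp add: distrib_left ennreal_plus)
  also have "\<dots> \<le> Pi_seminorm \<kappa> S Q + Pi_seminorm \<kappa> S R"
    by (intro add_mono Pi_seminorm_ge h)
  finally show "ennreal (l powr (- homog \<kappa> a) * \<bar>P z (bas a) (rescale l z \<phi>)\<bar>) \<le> Pi_seminorm \<kappa> S Q + Pi_seminorm \<kappa> S R" .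
qed

lemma Gamma_seminorm_add:
  assumes "\<And>z w a b. \<bar>G z w (bas b) $ a\<bar> \<le> \<bar>H z w (bas b) $ a\<bar> + \<bar>K z w (bas b) $ a\<bar>"
  shows "Gamma_seminorm \<kappa> S G \<le> Gamma_seminorm \<kappa> S H + Gamma_seminorm \<kappa> S K"
proof (rule Gamma_seminorm_le)
  fix a b :: "'a symb" and z w assume h: "homog \<kappa> a < homog \<kappa> b" "(z, w) \<in> torus_pairs S"
  let ?d = "par_dist z w powr (homog \<kappa> a - homog \<kappa> b)"
  have "ennreal (\<bar>G z w (bas b) $ a\<bar> * ?d) \<le> ennreal ((\<bar>H z w (bas b) $ a\<bar> + \<bar>K z w (bas b) $ a\<bar>) * ?d)"
    by (intro ennreal_leI mult_right_mono assms) simp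
  also have "\<dots> = ennreal (\<bar>H z w (bas b) $ a\<bar> * ?d) + ennreal (\<bar>K z w (bas b) $ a\<bar> * ?d)"
    by (simp add: distrib_right ennreal_plus)
  also have "\<dots> \<le> Gamma_seminorm \<kappa> S H + Gamma_seminorm \<kappa> S K"
    by (intro add_mono Gamma_seminorm_ge h)
  finally show "ennreal (\<bar>G z w (bas b) $ a\<bar> * ?d) \<le> Gamma_seminorm \<kappa> S H + Gamma_seminorm \<kappa> S K" .
qed

lemma model_diff_triangle: "model_diff \<kappa> S Z Z'' \<le> model_diff \<kappa> S Z Z' + model_diff \<kappa> S Z' Z''"
proof -
  have 1: "Pi_seminorm \<kappa> S (\<lambda>z \<tau> \<phi>. fst Z z \<tau> \<phi> - fst Z'' z \<tau> \<phi>) \<le>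
    Pi_seminorm \<kappa> S (\<lambda>z \<tau> \<phi>. fst Z z \<tau> \<phi> - fst Z' z \<tau> \<phi>) + Pi_seminorm \<kappa> S (\<lambda>z \<tau> \<phi>. fst Z' z \<tau> \<phi> - fst Z'' z \<tau> \<phi>)"
    by (rule Pi_seminorm_add) simp
  have 2: "Gamma_seminorm \<kappa> S (\<lambda>z w \<tau>. snd Z z w \<tau> - snd Z'' z w \<tau>) \<le>
    Gamma_seminorm \<kappa> S (\<lambda>z w \<tau>. snd Z z w \<tau> - snd Z' z w \<tau>) + Gamma_seminorm \<kappa> S (\<lambda>z w \<tau>. snd Z' z w \<tau> - snd Z'' z w \<tau>)"
    by (rule Gamma_seminorm_add) simp
  show ?thesis unfolding model_diff_def using add_mono[OF 1 2] by (simp add: ac_simps)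
qed

lemma model_diff_commute: "model_diff \<kappa> S Z Z' = model_diff \<kappa> S Z' Z"
proof -
  have le: "model_diff \<kappa> S Z Z' \<le> model_diff \<kappa> S Z' Z" for Z Z' :: "'a model"
    unfolding model_diff_def
  proof (intro add_mono Pi_seminorm_le Gamma_seminorm_le)
    fix a :: "'a symb" and l :: real and z and \<phi> :: "'a spacetime \<Rightarrow> real" assume h: "\<phi> \<in> unit_tests" "0 < l" "l \<le> 1" "z \<in> S"
    show "ennreal (l powr (- homog \<kappa> a) * \<bar>fst Z z (bas a) (rescale l z \<phi>) - fst Z' z (bas a) (rescale l z \<phi>)\<bar>) \<le> Pi_seminorm \<kappa> S (\<lambda>z \<tau> \<phi>. fst Z' z \<tau> \<phi> - fst Z z \<tau> \<phi>)"
      using Pi_seminorm_ge[OF h, of \<kappa> a "\<lambda>z \<tau> \<phi>. fst Z' z \<tau> \<phi> - fst Z z \<tau> \<phi>"] by (subst abs_minus_commute)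
  next
    fix a b :: "'a symb" and z w assume h: "homog \<kappa> a < homog \<kappa> b" "(z, w) \<in> torus_pairs S"
    show "ennreal (\<bar>(snd Z z w (bas b) - snd Z' z w (bas b)) $ a\<bar> * par_dist z w powr (homog \<kappa> a - homog \<kappa> b)) \<le> Gamma_seminorm \<kappa> S (\<lambda>z w \<tau>. snd Z' z w \<tau> - snd Z z w \<tau>)"
      using Gamma_seminorm_ge[OF h, of "\<lambda>z w \<tau>. snd Z' z w \<tau> - snd Z z w \<tau>"] unfolding vector_minus_component by (subst abs_minus_commute)
  qed
  show ?thesis by (rule antisym[OF le le])
qed

lemma model_diff_finite:
  assumes "Z \<in> models \<kappa>" "Z' \<in> models \<kappa>" "compact S"
  shows "model_diff \<kappa> S Z Z' < \<infinity>"
proof -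
  have M: "is_model \<kappa> (fst Z, snd Z)" "is_model \<kappa> (fst Z', snd Z')" using assms by (simp_all add: models_iff)
  have "Pi_seminorm \<kappa> S (\<lambda>z \<tau> \<phi>. fst Z z \<tau> \<phi> - fst Z' z \<tau> \<phi>) \<le> Pi_seminorm \<kappa> S (fst Z) + Pi_seminorm \<kappa> S (fst Z')"
    by (rule Pi_seminorm_add) simp
  also have "\<dots> < \<infinity>" using is_modelD(11)[OF M(1) assms(3)] is_modelD(11)[OF M(2) assms(3)] by simp
  finally have 1: "Pi_seminorm \<kappa> S (\<lambda>z \<tau> \<phi>. fst Z z \<tau> \<phi> - fst Z' z \<tau> \<phi>) < \<infinity>" .
  have "Gamma_seminorm \<kappa> S (\<lambda>z w \<tau>. snd Z z w \<tau> - snd Z' z w \<tau>) \<le> Gamma_seminorm \<kappa> S (snd Z) + Gamma_seminorm \<kappa> S (snd Z')"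
    by (rule Gamma_seminorm_add) simp
  also have "\<dots> < \<infinity>" using is_modelD(12)[OF M(1) assms(3)] is_modelD(12)[OF M(2) assms(3)] by simp
  finally show ?thesis using 1 unfolding model_diff_def by simp
qed

lemma model_diff_mono: "S \<subseteq> S' \<Longrightarrow> model_diff \<kappa> S Z Z' \<le> model_diff \<kappa> S' Z Z'"
proof -
  assume S: "S \<subseteq> S'"
  then have "torus_pairs S \<subseteq> torus_pairs S'" unfolding torus_pairs_def by blast
  with S show ?thesis unfolding model_diff_def
    by (intro add_mono Pi_seminorm_le Gamma_seminorm_le Pi_seminorm_ge Gamma_seminorm_ge) auto
qed

lemma model_diff_eval:
  assumes "\<phi> \<in> unit_tests" "z \<in> S"
  shows "ennreal \<bar>fst Z z (bas a) (rescale 1 z \<phi>) - fst Z' z (bas a) (rescale 1 z \<phi>)\<bar> \<le> model_diff \<kappa> S Z Z'"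
  using Pi_seminorm_ge[OF assms(1) _ _ assms(2), of 1 \<kappa> a "\<lambda>z \<tau> \<phi>. fst Z z \<tau> \<phi> - fst Z' z \<tau> \<phi>"]
  unfolding model_diff_def by (auto intro: order_trans)

section \<open>The metric space of models\<close>

lemma compact_model_box: "compact (model_box n :: ('d::finite) spacetime set)"
  unfolding model_box_def torus_cell_cbox by (intro compact_Times) auto

lemma model_box_mono: "m \<le> n \<Longrightarrow> model_box m \<subseteq> model_box n"
  by (auto simp: model_box_def)

text \<open>The index is shifted because the series for the metric starts with the first box.
  Passing to a real number loses nothing for models, whose differences are finite on compact
  sets.\<close>

definition box_diff :: "real \<Rightarrow> nat \<Rightarrow> ('d::finite) model \<Rightarrow> 'd model \<Rightarrow> real" where
  "box_diff \<kappa> n Z Z' = enn2real (model_diff \<kappa> (model_box (Suc n)) Z Z')"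

lemma box_diff_ennreal:
  assumes "Z \<in> models \<kappa>" "Z' \<in> models \<kappa>"
  shows "ennreal (box_diff \<kappa> n Z Z') = model_diff \<kappa> (model_box (Suc n)) Z Z'"
  using model_diff_finite[OF assms compact_model_box[of "Suc n"]] unfolding box_diff_def by simp

lemma box_diff_nonneg: "0 \<le> box_diff \<kappa> n Z Z'"
  by (simp add: box_diff_def)

lemma box_diff_leI: "model_diff \<kappa> (model_box (Suc n)) Z Z' \<le> ennreal x \<Longrightarrow> 0 \<le> x \<Longrightarrow> box_diff \<kappa> n Z Z' \<le> x"
  unfolding box_diff_def by (simp add: enn2real_leI)

lemma box_diff_triangle:
  assumes "Z \<in> models \<kappa>" "Z' \<in> models \<kappa>" "Z'' \<in> models \<kappa>"
  shows "box_diff \<kappa> n Z Z'' \<le> box_diff \<kappa> n Z Z' + box_diff \<kappa> n Z' Z''"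
proof (rule box_diff_leI)
  show "model_diff \<kappa> (model_box (Suc n)) Z Z'' \<le> ennreal (box_diff \<kappa> n Z Z' + box_diff \<kappa> n Z' Z'')"
    unfolding ennreal_plus[OF box_diff_nonneg box_diff_nonneg] box_diff_ennreal[OF assms(1,2)] box_diff_ennreal[OF assms(2,3)]
    by (rule model_diff_triangle)
qed (intro add_nonneg_nonneg box_diff_nonneg)

lemma box_diff_commute: "box_diff \<kappa> n Z Z' = box_diff \<kappa> n Z' Z"
  by (simp add: box_diff_def model_diff_commute)

lemma box_diff_mono:
  assumes "Z \<in> models \<kappa>" "Z' \<in> models \<kappa>" "m \<le> n"
  shows "box_diff \<kappa> m Z Z' \<le> box_diff \<kappa> n Z Z'"
proof (rule box_diff_leI[OF _ box_diff_nonneg])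
  show "model_diff \<kappa> (model_box (Suc m)) Z Z' \<le> ennreal (box_diff \<kappa> n Z Z')"
    unfolding box_diff_ennreal[OF assms(1,2)] by (rule model_diff_mono[OF model_box_mono]) (use assms in simp)
qed

definition dist_term :: "real \<Rightarrow> nat \<Rightarrow> ('d::finite) model \<Rightarrow> 'd model \<Rightarrow> real" where
  "dist_term \<kappa> n Z Z' = (1/2) ^ Suc n * (box_diff \<kappa> n Z Z' / (1 + box_diff \<kappa> n Z Z'))"

lemma model_dist_eq: "model_dist \<kappa> Z Z' = (\<Sum>n. dist_term \<kappa> n Z Z')"
  by (simp add: model_dist_def box_diff_def dist_term_def)

lemma dist_term_bounds: "0 \<le> dist_term \<kappa> n Z Z'" "dist_term \<kappa> n Z Z' \<le> (1/2) ^ Suc n"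
  "dist_term \<kappa> n Z Z' \<le> (1/2) ^ Suc n * box_diff \<kappa> n Z Z'"
proof -
  define x where "x = box_diff \<kappa> n Z Z'"
  have x: "0 \<le> x" by (simp add: x_def box_diff_nonneg)
  then have f: "0 \<le> x / (1 + x)" "x / (1 + x) \<le> 1" "x / (1 + x) \<le> x"
    by (auto simp: divide_le_eq mult_le_cancel_left1 algebra_simps)
  have d: "dist_term \<kappa> n Z Z' = (1/2) ^ Suc n * (x / (1 + x))" unfolding dist_term_def x_def ..
  have p: "0 \<le> (1/2::real) ^ Suc n" by simp
  show "0 \<le> dist_term \<kappa> n Z Z'" unfolding d by (rule mult_nonneg_nonneg[OF p f(1)])
  show "dist_term \<kappa> n Z Z' \<le> (1/2) ^ Suc n" unfolding d using mult_left_mono[OF f(2) p] by simp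
  show "dist_term \<kappa> n Z Z' \<le> (1/2) ^ Suc n * box_diff \<kappa> n Z Z'" unfolding d x_def[symmetric] by (rule mult_left_mono[OF f(3) p])
qed

lemma half_sums: "(\<lambda>n. (1/2::real) ^ Suc n) sums 1"
  by (rule power_half_series)

lemma dist_term_summable: "summable (\<lambda>n. dist_term \<kappa> n Z Z')"
proof (rule summable_comparison_test'[OF sums_summable[OF half_sums]])
  show "norm (dist_term \<kappa> n Z Z') \<le> (1/2::real) ^ Suc n" for n
    using dist_term_bounds(1,2)[of \<kappa> n Z Z'] by (simp only: real_norm_def abs_of_nonneg)
qed

lemma model_dist_nonneg: "0 \<le> model_dist \<kappa> Z Z'"
  unfolding model_dist_eq by (rule suminf_nonneg[OF dist_term_summable dist_term_bounds(1)])

lemma model_dist_ge: "dist_term \<kappa> n Z Z' \<le> model_dist \<kappa> Z Z'"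
proof -
  have "(\<Sum>k\<in>{n}. dist_term \<kappa> k Z Z') \<le> model_dist \<kappa> Z Z'"
    unfolding model_dist_eq by (rule sum_le_suminf[OF dist_term_summable]) (simp_all add: dist_term_bounds)
  then show ?thesis by simp
qed

text \<open>Up to index \<open>n\<close> every box lies in the n-th one and the weights sum to at
  most 1; beyond \<open>n\<close> each fraction is at most 1 and the remaining weights sum to
  \<open>(1/2) ^ Suc n\<close>.\<close>

lemma model_dist_le:
  assumes "Z \<in> models \<kappa>" "Z' \<in> models \<kappa>"
  shows "model_dist \<kappa> Z Z' \<le> box_diff \<kappa> n Z Z' + (1/2) ^ Suc n"
proof -
  have s1: "(\<lambda>k. (1/2) ^ Suc k * box_diff \<kappa> n Z Z') sums (1 * box_diff \<kappa> n Z Z')" by (rule sums_mult2[OF half_sums])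
  have s2: "(\<lambda>k. if k \<in> {..n} then 0 else (1/2::real) ^ Suc k) sums ((1/2) ^ Suc n)"
  proof -
    have "(\<lambda>k. if k \<in> {..n} then 0 else (1/2::real) ^ Suc k) sums (1 + (\<Sum>k\<in>{..n}. 0 - (1/2) ^ Suc k))"
      by (rule sums_If_finite_set'[OF half_sums]) auto
    moreover have "(\<Sum>k\<in>{..n}. 0 - (1/2::real) ^ Suc k) = (1/2) ^ Suc n - 1"
      by (induction n) (simp_all add: field_simps)
    ultimately show ?thesis by simp
  qed
  have "model_dist \<kappa> Z Z' \<le> (\<Sum>k. (1/2) ^ Suc k * box_diff \<kappa> n Z Z' + (if k \<in> {..n} then 0 else (1/2::real) ^ Suc k))"
    unfolding model_dist_eq
  proof (rule suminf_le[OF _ dist_term_summable sums_summable[OF sums_add[OF s1 s2]]])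
    fix k
    show "dist_term \<kappa> k Z Z' \<le> (1/2) ^ Suc k * box_diff \<kappa> n Z Z' + (if k \<in> {..n} then 0 else (1/2::real) ^ Suc k)"
    proof (cases "k \<le> n")
      case True
      have "(1/2::real) ^ Suc k * box_diff \<kappa> k Z Z' \<le> (1/2) ^ Suc k * box_diff \<kappa> n Z Z'"
        by (rule mult_left_mono[OF box_diff_mono[OF assms True]]) simp
      moreover have "(if k \<in> {..n} then 0 else (1/2::real) ^ Suc k) = 0" using True by simp
      ultimately show ?thesis using dist_term_bounds(3)[of \<kappa> k Z Z'] by linarith
    next
      case False
      have "0 \<le> (1/2::real) ^ Suc k * box_diff \<kappa> n Z Z'" by (simp add: box_diff_nonneg)
      moreover have "(if k \<in> {..n} then 0 else (1/2::real) ^ Suc k) = (1/2) ^ Suc k" using False by simp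
      ultimately show ?thesis using dist_term_bounds(2)[of \<kappa> k Z Z'] by linarith
    qed
  qed
  also have "\<dots> = box_diff \<kappa> n Z Z' + (1/2) ^ Suc n" using sums_unique[OF sums_add[OF s1 s2]] by simp
  finally show ?thesis .
qed

text \<open>Together with \<open>box_diff_small\<close> this lets metric estimates be replaced by
  estimates on one large box, with constants uniform over all pairs of models.\<close>

lemma model_dist_small:
  assumes "\<epsilon> > 0"
  obtains n \<delta> where "\<delta> > 0" "\<And>Z Z'. Z \<in> models \<kappa> \<Longrightarrow> Z' \<in> models \<kappa> \<Longrightarrow> box_diff \<kappa> n Z Z' < \<delta> \<Longrightarrow> model_dist \<kappa> Z Z' < \<epsilon>"
proof -
  obtain n where n: "(1/2::real) ^ n < \<epsilon> / 2" using real_arch_pow_inv[of "\<epsilon>/2" "1/2"] assms by auto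
  have "model_dist \<kappa> Z Z' < \<epsilon>" if "Z \<in> models \<kappa>" "Z' \<in> models \<kappa>" "box_diff \<kappa> n Z Z' < \<epsilon> / 2" for Z Z' :: "'a model"
  proof -
    have "(1/2::real) ^ Suc n \<le> (1/2) ^ n" by simp
    then show ?thesis using model_dist_le[OF that(1,2), of n] that(3) n by linarith
  qed
  then show ?thesis using that[of "\<epsilon>/2" n] assms by auto
qed

text \<open>The n-th summand alone bounds the metric from below, and \<open>x / (1 + x)\<close> is
  increasing.\<close>

lemma box_diff_small:
  assumes "\<delta> > 0"
  obtains \<epsilon> where "\<epsilon> > 0" "\<And>Z Z'. model_dist \<kappa> Z Z' < \<epsilon> \<Longrightarrow> box_diff \<kappa> n Z Z' < \<delta>"
proof -
  define \<epsilon> where "\<epsilon> = (1/2::real) ^ Suc n * (\<delta> / (1 + \<delta>))"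
  have "\<epsilon> > 0" using assms by (simp add: \<epsilon>_def)
  moreover have "box_diff \<kappa> n Z Z' < \<delta>" if "model_dist \<kappa> Z Z' < \<epsilon>" for Z Z' :: "'a model"
  proof (rule ccontr)
    assume "\<not> box_diff \<kappa> n Z Z' < \<delta>"
    then have "\<delta> / (1 + \<delta>) \<le> box_diff \<kappa> n Z Z' / (1 + box_diff \<kappa> n Z Z')"
      using assms by (simp add: divide_le_eq le_divide_eq field_simps)
    then have "\<epsilon> \<le> dist_term \<kappa> n Z Z'"
      unfolding \<epsilon>_def dist_term_def by (rule mult_left_mono) simp
    then show False using model_dist_ge[of \<kappa> n Z Z'] that by linarith
  qed
  ultimately show ?thesis by (rule that)
qed

lemma cell_rep_in_cell: "cell_rep x \<in> torus_cell"
proof -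
  have "- pi \<le> cell_rep x $ i \<and> cell_rep x $ i \<le> pi" for i
  proof -
    define y where "y = (x $ i + pi) / (2 * pi)"
    have x: "x $ i = 2 * pi * y - pi" by (simp add: y_def)
    have "cell_rep x $ i = 2 * pi * (y - of_int \<lfloor>y\<rfloor>) - pi"
      unfolding cell_rep_def y_def[symmetric] by (simp add: x algebra_simps)
    moreover have "0 \<le> 2 * pi * (y - of_int \<lfloor>y\<rfloor>)" by simp
    moreover have "2 * pi * (y - of_int \<lfloor>y\<rfloor>) \<le> 2 * pi * 1" by (intro mult_left_mono) (auto, linarith)
    ultimately show ?thesis by linarith
  qed
  then show ?thesis by (simp add: torus_cell_def)
qed

text \<open>The boxes contain base points of one spatial period only. Invariance under the lattice
  brings any base point into a box without changing the evaluation.\<close>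

lemma model_eq_of_box_diff:
  fixes Z Z' :: "('d::finite) model"
  assumes Z: "Z \<in> models \<kappa>" "Z' \<in> models \<kappa>" and 0: "\<And>n. box_diff \<kappa> n Z Z' = 0"
  shows "Z = Z'"
proof -
  have M: "is_model \<kappa> (fst Z, snd Z)" "is_model \<kappa> (fst Z', snd Z')" using Z by (simp_all add: models_iff)
  have "(fst Z, snd Z) = (fst Z', snd Z')"
  proof (rule model_eqI[OF M closure_UNIV])
    fix z :: "'d spacetime" and a and \<phi> :: "'d spacetime \<Rightarrow> real" assume \<phi>: "\<phi> \<in> unit_tests"
    obtain k where k: "cell_rep (snd z) = snd z + lattice_vec k" using cell_rep_lattice by blast
    define y where "y = z + (0, lattice_vec k)"
    obtain n :: nat where n: "\<bar>fst z\<bar> \<le> real n" using real_arch_simple by blast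
    have "y \<in> model_box (Suc n)"
    proof -
      have "snd y = cell_rep (snd z)" "fst y = fst z" by (simp_all add: y_def k)
      then show ?thesis using n cell_rep_in_cell[of "snd z"] by (auto simp: model_box_def mem_Times_iff)
    qed
    from model_diff_eval[OF \<phi> this, of Z a Z' \<kappa>]
    have "ennreal \<bar>fst Z y (bas a) (rescale 1 y \<phi>) - fst Z' y (bas a) (rescale 1 y \<phi>)\<bar> \<le> 0"
      unfolding box_diff_ennreal[OF Z, symmetric] 0 by simp
    then have e: "fst Z y (bas a) (rescale 1 y \<phi>) = fst Z' y (bas a) (rescale 1 y \<phi>)" by (simp add: ennreal_eq_0_iff)
    have r: "rescale 1 y \<phi> = (\<lambda>w. rescale 1 z \<phi> (w - (0, lattice_vec k)))"
      by (simp add: rescale_1 y_def fun_eq_iff algebra_simps)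
    have "fst Z z (bas a) (rescale 1 z \<phi>) = fst Z y (bas a) (rescale 1 y \<phi>)"
      unfolding r unfolding y_def by (rule is_modelD(9)[OF M(1), symmetric])
    moreover have "fst Z' z (bas a) (rescale 1 z \<phi>) = fst Z' y (bas a) (rescale 1 y \<phi>)"
      unfolding r unfolding y_def by (rule is_modelD(9)[OF M(2), symmetric])
    ultimately show "fst Z z (bas a) (rescale 1 z \<phi>) = fst Z' z (bas a) (rescale 1 z \<phi>)" using e by simp
  qed
  then show ?thesis by (simp add: prod_eq_iff)
qed

lemma frac_add: "0 \<le> x \<Longrightarrow> 0 \<le> y \<Longrightarrow> 0 \<le> z \<Longrightarrow> z \<le> x + y \<Longrightarrow> z / (1 + z) \<le> x / (1 + x) + y / (1 + (y::real))"
proof -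
  assume h: "0 \<le> x" "0 \<le> y" "0 \<le> z" "z \<le> x + y"
  have "z / (1 + z) \<le> (x + y) / (1 + (x + y))" using h by (simp add: divide_le_eq le_divide_eq field_simps)
  also have "\<dots> = x / (1 + (x + y)) + y / (1 + (x + y))" by (simp add: add_divide_distrib)
  also have "\<dots> \<le> x / (1 + x) + y / (1 + y)" using h by (intro add_mono divide_left_mono) auto
  finally show ?thesis .
qed

lemma model_diff_refl: "model_diff \<kappa> S Z Z = 0"
proof -
  have "Pi_seminorm \<kappa> S (\<lambda>z \<tau> \<phi>. 0) \<le> 0" by (rule Pi_seminorm_le) simp
  moreover have "Gamma_seminorm \<kappa> S (\<lambda>z w \<tau>. 0) \<le> 0" by (rule Gamma_seminorm_le) simp
  ultimately show ?thesis by (simp add: model_diff_def)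
qed

lemma models_Metric_space: "Metric_space (models \<kappa>) (model_dist \<kappa> :: ('d::finite) model \<Rightarrow> _)"
proof
  show "0 \<le> model_dist \<kappa> x y" for x y :: "'d model" by (rule model_dist_nonneg)
  show "model_dist \<kappa> x y = model_dist \<kappa> y x" for x y :: "'d model" unfolding model_dist_eq dist_term_def box_diff_commute[of \<kappa> _ x y] ..
next
  fix x y :: "'d model" assume xy: "x \<in> models \<kappa>" "y \<in> models \<kappa>"
  show "model_dist \<kappa> x y = 0 \<longleftrightarrow> x = y"
  proof
    assume "x = y"
    then have "box_diff \<kappa> n x y = 0" for n by (simp add: box_diff_def model_diff_refl)
    then show "model_dist \<kappa> x y = 0" by (simp add: model_dist_eq dist_term_def)
  next
    assume 0: "model_dist \<kappa> x y = 0"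
    have "box_diff \<kappa> n x y = 0" for n
    proof -
      have "dist_term \<kappa> n x y = 0" using model_dist_ge[of \<kappa> n x y] dist_term_bounds(1)[of \<kappa> n x y] 0 by linarith
      then show ?thesis using box_diff_nonneg[of \<kappa> n x y] by (auto simp: dist_term_def)
    qed
    then show "x = y" by (rule model_eq_of_box_diff[OF xy])
  qed
next
  fix x y z :: "'d model" assume xyz: "x \<in> models \<kappa>" "y \<in> models \<kappa>" "z \<in> models \<kappa>"
  show "model_dist \<kappa> x z \<le> model_dist \<kappa> x y + model_dist \<kappa> y z"
    unfolding model_dist_eq suminf_add[OF dist_term_summable dist_term_summable]
  proof (rule suminf_le[OF _ dist_term_summable summable_add[OF dist_term_summable dist_term_summable]])
    fix n
    show "dist_term \<kappa> n x z \<le> dist_term \<kappa> n x y + dist_term \<kappa> n y z"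
      unfolding dist_term_def distrib_left[symmetric]
      by (intro mult_left_mono frac_add box_diff_nonneg box_diff_triangle xyz) simp
  qed
qed

section \<open>Open sets and Borel sets of \<open>models0\<close>\<close>

lemma openin_models_iff:
  "openin (model_topology \<kappa>) U \<longleftrightarrow> U \<subseteq> models \<kappa> \<and> (\<forall>x\<in>U. \<exists>r>0. \<forall>y\<in>models \<kappa>. model_dist \<kappa> x y < r \<longrightarrow> y \<in> U)"
proof -
  interpret Metric_space "models \<kappa>" "model_dist \<kappa> :: 'a model \<Rightarrow> _" by (rule models_Metric_space)
  have "mball x r \<subseteq> U \<longleftrightarrow> (\<forall>y\<in>models \<kappa>. model_dist \<kappa> x y < r \<longrightarrow> y \<in> U)" if "x \<in> models \<kappa>" for x r
    using that unfolding mball_def by blast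
  then show ?thesis unfolding model_topology_def openin_mtopology by (meson subsetD)
qed

lemma models0_iff:
  "Z \<in> models0 \<kappa> \<longleftrightarrow> Z \<in> models \<kappa> \<and> (\<forall>r>0. \<exists>f g c. f \<in> C_torus \<and> g \<in> C1_torus \<and> canonical_model f g c \<in> models \<kappa> \<and> model_dist \<kappa> Z (canonical_model f g c) < r)"
proof -
  interpret Metric_space "models \<kappa>" "model_dist \<kappa> :: 'a model \<Rightarrow> _" by (rule models_Metric_space)
  show ?thesis unfolding models0_def model_topology_def metric_closure_of mball_def by blast
qed

lemma models0_subset: "models0 \<kappa> \<subseteq> models \<kappa>"
  using models0_iff by blast

lemma space_borel_models0: "space (borel_models0 \<kappa>) = models0 \<kappa>"
  and sets_borel_models0: "sets (borel_models0 \<kappa>) = sigma_sets (models0 \<kappa>) {U. openin (subtopology (model_topology \<kappa>) (models0 \<kappa>)) U}"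
proof -
  have sub: "{U. openin (subtopology (model_topology \<kappa>) (models0 \<kappa>)) U} \<subseteq> Pow (models0 \<kappa>)"
    by (auto simp: openin_subtopology)
  show "space (borel_models0 \<kappa>) = models0 \<kappa>" unfolding borel_models0_def by (rule space_measure_of[OF sub])
  show "sets (borel_models0 \<kappa>) = sigma_sets (models0 \<kappa>) {U. openin (subtopology (model_topology \<kappa>) (models0 \<kappa>)) U}"
    unfolding borel_models0_def by (rule sets_measure_of[OF sub])
qed

lemma open_in_borel_models0:
  assumes "U \<subseteq> models0 \<kappa>" "\<And>x. x \<in> U \<Longrightarrow> \<exists>r>0. \<forall>y\<in>models0 \<kappa>. model_dist \<kappa> x y < r \<longrightarrow> y \<in> U"
  shows "U \<in> sets (borel_models0 \<kappa>)"
proof -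
  interpret Metric_space "models \<kappa>" "model_dist \<kappa> :: 'a model \<Rightarrow> _" by (rule models_Metric_space)
  \<comment> \<open>The union of the balls of the ambient space whose traces on
    \<open>models0\<close> lie in \<open>U\<close>; it exhibits \<open>U\<close> as a relatively
    open set.\<close>
  define V where "V = {y \<in> models \<kappa>. \<exists>x\<in>U. \<exists>r>0. (\<forall>y\<in>models0 \<kappa>. model_dist \<kappa> x y < r \<longrightarrow> y \<in> U) \<and> model_dist \<kappa> x y < r}"
  have "openin (model_topology \<kappa>) V"
    unfolding openin_models_iff
  proof (intro conjI ballI)
    fix y assume "y \<in> V"
    then obtain x r where y: "y \<in> models \<kappa>" and x: "x \<in> U" and r: "r > 0" "\<forall>y\<in>models0 \<kappa>. model_dist \<kappa> x y < r \<longrightarrow> y \<in> U" "model_dist \<kappa> x y < r"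
      unfolding V_def by blast
    show "\<exists>r>0. \<forall>z\<in>models \<kappa>. model_dist \<kappa> y z < r \<longrightarrow> z \<in> V"
    proof (intro exI[of _ "r - model_dist \<kappa> x y"] conjI ballI impI)
      fix z assume z: "z \<in> models \<kappa>" "model_dist \<kappa> y z < r - model_dist \<kappa> x y"
      have "x \<in> models \<kappa>" using x assms(1) models0_subset by blast
      then have "model_dist \<kappa> x z < r" using triangle[OF _ y z(1), of x] z(2) by linarith
      then show "z \<in> V" unfolding V_def using z(1) x r(1,2) by blast
    qed (use r in simp)
  qed (auto simp: V_def)
  moreover have "U = V \<inter> models0 \<kappa>"
  proof (intro equalityI subsetI)
    fix x assume x: "x \<in> U"
    then have xm: "x \<in> models0 \<kappa>" "x \<in> models \<kappa>" using assms(1) models0_subset by blast+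
    obtain r where r: "r > 0" "\<forall>y\<in>models0 \<kappa>. model_dist \<kappa> x y < r \<longrightarrow> y \<in> U" using assms(2)[OF x] by blast
    have "model_dist \<kappa> x x = 0" using zero[OF xm(2) xm(2)] by simp
    then have "x \<in> V" unfolding V_def using x xm(2) r by (intro CollectI conjI bexI[of _ x] exI[of _ r]) simp_all
    then show "x \<in> V \<inter> models0 \<kappa>" using xm by blast
  next
    fix x assume "x \<in> V \<inter> models0 \<kappa>" then show "x \<in> U" unfolding V_def by blast
  qed
  ultimately have "openin (subtopology (model_topology \<kappa>) (models0 \<kappa>)) U" unfolding openin_subtopology by blast
  then show ?thesis unfolding sets_borel_models0 by (intro sigma_sets.Basic) simp
qed

lemma measurable_borel_models0I:
  fixes f :: "'a \<Rightarrow> ('d::finite) model"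
  assumes "\<And>x. x \<in> space M \<Longrightarrow> f x \<in> models0 \<kappa>"
    and "\<And>U :: 'd model set. U \<subseteq> models0 \<kappa> \<Longrightarrow> (\<And>x. x \<in> U \<Longrightarrow> \<exists>r>0. \<forall>y\<in>models0 \<kappa>. model_dist \<kappa> x y < r \<longrightarrow> y \<in> U) \<Longrightarrow> f -` U \<inter> space M \<in> sets M"
  shows "f \<in> measurable M (borel_models0 \<kappa>)"
  unfolding borel_models0_def
proof (rule measurable_measure_of)
  show "{U. openin (subtopology (model_topology \<kappa>) (models0 \<kappa>)) U} \<subseteq> Pow (models0 \<kappa> :: 'd model set)" by (auto simp: openin_subtopology)
  show "f \<in> space M \<rightarrow> models0 \<kappa>" using assms(1) by auto
  fix U :: "'d model set" assume "U \<in> {U. openin (subtopology (model_topology \<kappa>) (models0 \<kappa>)) U}"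
  then obtain T where T: "openin (model_topology \<kappa>) T" and U: "U = T \<inter> models0 \<kappa>" by (auto simp: openin_subtopology)
  show "f -` U \<inter> space M \<in> sets M"
  proof (rule assms(2))
    show "U \<subseteq> models0 \<kappa>" using U by blast
    fix x assume "x \<in> U"
    then obtain r where "r > 0" "\<forall>y\<in>models \<kappa>. model_dist \<kappa> x y < r \<longrightarrow> y \<in> T" using T U unfolding openin_models_iff by blast
    then show "\<exists>r>0. \<forall>y\<in>models0 \<kappa>. model_dist \<kappa> x y < r \<longrightarrow> y \<in> U" using U models0_subset by blast
  qed
qed

text \<open>Every translated box lies in a larger box, so translations are equicontinuous for times in a
  bounded interval.\<close>

lemma box_diff_translation_le:
  assumes Z: "Z \<in> models \<kappa>" "Z' \<in> models \<kappa>" and t: "\<bar>t\<bar> \<le> real m"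
  shows "box_diff \<kappa> n (time_translation t Z) (time_translation t Z') \<le> box_diff \<kappa> (n + m) Z Z'"
proof (rule box_diff_leI[OF _ box_diff_nonneg])
  have "(\<lambda>z :: 'a spacetime. z + (t, 0)) ` model_box (Suc n) \<subseteq> model_box (Suc (n + m))"
    using t by (auto simp: model_box_def)
  from model_diff_mono[OF this, of \<kappa> Z Z']
  show "model_diff \<kappa> (model_box (Suc n)) (time_translation t Z) (time_translation t Z') \<le> ennreal (box_diff \<kappa> (n + m) Z Z')"
    unfolding model_diff_shift[OF Z] box_diff_ennreal[OF Z] .
qed

lemma time_translation_equicontinuous:
  fixes m :: nat
  assumes "\<epsilon> > 0"
  obtains \<delta> where "\<delta> > 0" "\<And>t Z Z'. \<bar>t\<bar> \<le> real m \<Longrightarrow> Z \<in> models \<kappa> \<Longrightarrow> Z' \<in> models \<kappa> \<Longrightarrow> model_dist \<kappa> Z Z' < \<delta> \<Longrightarrow>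
    model_dist \<kappa> (time_translation t Z) (time_translation t Z') < \<epsilon>"
proof -
  obtain n \<eta> where n: "\<eta> > 0" "\<And>Z Z' :: 'a model. Z \<in> models \<kappa> \<Longrightarrow> Z' \<in> models \<kappa> \<Longrightarrow> box_diff \<kappa> n Z Z' < \<eta> \<Longrightarrow> model_dist \<kappa> Z Z' < \<epsilon>"
    by (rule model_dist_small[OF assms, of \<kappa>]) blast
  obtain \<delta> where \<delta>: "\<delta> > 0" "\<And>Z Z' :: 'a model. model_dist \<kappa> Z Z' < \<delta> \<Longrightarrow> box_diff \<kappa> (n + m) Z Z' < \<eta>"
    by (rule box_diff_small[OF n(1), of \<kappa> "n + m"]) blast
  show ?thesis
  proof (rule that[OF \<delta>(1)])
    fix t and Z Z' :: "'a model" assume h: "\<bar>t\<bar> \<le> real m" "Z \<in> models \<kappa>" "Z' \<in> models \<kappa>" "model_dist \<kappa> Z Z' < \<delta>"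
    show "model_dist \<kappa> (time_translation t Z) (time_translation t Z') < \<epsilon>"
      using box_diff_translation_le[OF h(2,3,1), of n] \<delta>(2)[OF h(4)]
      by (intro n(2) time_translation_models h) linarith
  qed
qed

section \<open>Canonical models\<close>

text \<open>The sign is opposite to that of \<open>delay\<close>: delaying the test functions
  advances the noise tested against them.\<close>

definition advance :: "real \<Rightarrow> ('d spacetime \<Rightarrow> real) \<Rightarrow> ('d::finite) spacetime \<Rightarrow> real" where
  "advance t f w = f (w + (t, 0))"

lemma canonical_Pi_bas: "canonical_Pi f g c z (bas a) = of_fun (canonical_fun f g c z a)"
proof -
  have "(\<Sum>b\<in>UNIV. bas a $ b * canonical_fun f g c z b w) = canonical_fun f g c z a w" for w
    by (simp add: axis_def if_distrib[of "\<lambda>x. x * _"] sum.delta cong: if_cong)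
  then show ?thesis by (simp add: canonical_Pi_def)
qed

lemma canonical_fun_continuous:
  fixes f g :: "('d::finite) spacetime \<Rightarrow> real"
  assumes "continuous_on UNIV f" "continuous_on UNIV g"
  shows "continuous_on UNIV (canonical_fun f g c z a)"
  by (cases a) (auto intro!: continuous_intros assms)

lemma canonical_fun_advance:
  "canonical_fun f g c (z + (t, 0)) a (w + (t, 0)) = canonical_fun (advance t f) (advance t g) c z a w"
  by (cases a) (simp_all add: advance_def)

lemma time_translation_canonical:
  assumes "continuous_on UNIV f" "continuous_on UNIV g"
  shows "time_translation t (canonical_model f g c) = canonical_model (advance t f) (advance t g) c"
proof -
  have "time_shift t (canonical_Pi f g c (z + (t, 0)) \<tau>) = canonical_Pi (advance t f) (advance t g) c z \<tau>" for z \<tau>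
    unfolding canonical_Pi_def
    by (subst time_shift_of_fun) (auto intro!: continuous_intros canonical_fun_continuous assms simp: canonical_fun_advance)
  then show ?thesis by (simp add: time_translation_def canonical_model_def Let_def)
qed

lemma C1_torusD:
  assumes "g \<in> C1_torus"
  shows "\<And>x. g differentiable (at x)" "\<And>b. b \<in> Basis \<Longrightarrow> continuous_on UNIV (\<lambda>x. frechet_derivative g (at x) b)" "continuous_on UNIV g"
    "space_periodic g"
proof -
  have C: "Ck_on (Suc 0) g UNIV" using assms by (simp add: C1_torus_def)
  then show "\<And>x. g differentiable (at x)" "\<And>b. b \<in> Basis \<Longrightarrow> continuous_on UNIV (\<lambda>x. frechet_derivative g (at x) b)" by auto
  show "continuous_on UNIV g" by (rule Ck_on_continuous[OF C])
  show "space_periodic g" using assms by (simp add: C1_torus_def)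
qed

lemma advance_periodic: "space_periodic f \<Longrightarrow> space_periodic (advance t f)"
  by (simp add: space_periodic_def periodic_def advance_def)

lemma advance_torus:
  assumes "f \<in> C_torus" shows "advance t f \<in> C_torus"
  using assms advance_periodic unfolding C_torus_def advance_def[abs_def]
  by (auto intro!: continuous_on_compose2[where f="\<lambda>w. w + (t, 0)"] continuous_intros simp: advance_def[abs_def])

lemma advance_C1_torus:
  assumes "g \<in> C1_torus" shows "advance t g \<in> C1_torus"
  using assms advance_periodic[of g t] Ck_on_affine[of "\<lambda>w. w" 1 g "(t, 0)"] unfolding C1_torus_def
  by (auto simp: advance_def[abs_def] linear_ident)

lemma frechet_advance:
  assumes "g differentiable (at (w + (t, 0)))"
  shows "(advance t g has_derivative frechet_derivative g (at (w + (t, 0)))) (at w)"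
proof -
  have "((\<lambda>w. w + (t, 0)) has_derivative (\<lambda>h. h)) (at w)" by (auto intro!: derivative_eq_intros)
  from has_derivative_compose[OF this frechet_works[OF assms]] show ?thesis unfolding advance_def[abs_def] .
qed

section \<open>Canonical models depend continuously on their data\<close>

lemma content_cylinder:
  fixes z :: "('d::finite) spacetime"
  assumes l: "0 < l"
  defines "v \<equiv> (l\<^sup>2, (\<chi> i. l) :: real ^ 'd)"
  shows "measure lborel (cbox (z - v) (z + v)) = 2 ^ (CARD('d) + 1) * l ^ (CARD('d) + 2)"
proof -
  have c: "cbox (z - v) (z + v) = cbox (fst z - l\<^sup>2, snd z - (\<chi> i. l)) (fst z + l\<^sup>2, snd z + (\<chi> i. l))"
    by (simp add: v_def prod_eq_iff minus_prod_def plus_prod_def)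
  have "measure lborel (cbox (snd z - (\<chi> i. l)) (snd z + (\<chi> i. l))) = (\<Prod>i\<in>(UNIV::'d set). 2 * l)"
    using l by (subst content_cbox_cart) (auto simp: interval_ne_empty_cart)
  moreover have "measure lborel (cbox (fst z - l\<^sup>2) (fst z + l\<^sup>2)) = 2 * l\<^sup>2"
    by simp
  ultimately show ?thesis unfolding c content_Pair by (simp add: power_mult_distrib power2_eq_square)
qed

text \<open>The rescaled test lives in a parabolic box whose volume carries the same power of
  \<open>l\<close> as its normalisation. The powers cancel, and the bound does not depend on
  \<open>l\<close>.\<close>

lemma rescale_integral_bound:
  fixes z :: "('d::finite) spacetime"
  assumes h: "continuous_on UNIV h" and \<phi>: "\<phi> \<in> unit_tests" and l: "0 < l" "l \<le> 1"
    and B: "\<And>w. \<bar>fst w - fst z\<bar> \<le> l\<^sup>2 \<Longrightarrow> norm (snd w - snd z) \<le> l \<Longrightarrow> \<bar>h w\<bar> \<le> B"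
  shows "\<bar>of_fun h (rescale l z \<phi>)\<bar> \<le> 2 ^ (CARD('d) + 1) * B"
proof -
  define v where "v = (l\<^sup>2, (\<chi> i. l) :: real ^ 'd)"
  let ?b = "cbox (z - v) (z + v)"
  have \<phi>t: "\<phi> \<in> test_functions" and \<phi>0: "\<And>p. p \<notin> cball 0 1 \<Longrightarrow> \<phi> p = 0" and \<phi>1: "\<And>p. \<bar>\<phi> p\<bar> \<le> 1"
    using \<phi> C2_norm_ge[of \<phi>] by (auto simp: unit_tests_def intro: order_trans)
  have rt: "rescale l z \<phi> \<in> test_functions" by (rule rescale_test[OF \<phi>t l(1)])
  have "\<bar>h z\<bar> \<le> B" by (rule B) (use l in auto)
  then have B0: "0 \<le> B" using abs_ge_zero[of "h z"] by linarith
  have pt: "norm (h w * rescale l z \<phi> w) \<le> indicator ?b w * (B / l ^ (CARD('d) + 2))" for w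
  proof (cases "\<bar>fst w - fst z\<bar> \<le> l\<^sup>2 \<and> norm (snd w - snd z) \<le> l")
    case True
    have "w \<in> ?b"
    proof -
      have c: "snd z $ i - l \<le> snd w $ i \<and> snd w $ i \<le> snd z $ i + l" for i
      proof -
        have "\<bar>snd w $ i - snd z $ i\<bar> \<le> l"
          using component_le_norm_cart[of "snd w - snd z" i] True by simp
        then show ?thesis by linarith
      qed
      have e: "?b = cbox (fst z - l\<^sup>2) (fst z + l\<^sup>2) \<times> cbox (snd z - (\<chi> i. l)) (snd z + (\<chi> i. l))"
        unfolding cbox_Pair_eq[symmetric] by (simp add: v_def minus_prod_def plus_prod_def)
      show ?thesis unfolding e using True c by (auto simp: mem_Times_iff mem_box_cart abs_le_iff)
    qed
    moreover have "\<bar>h w\<bar> * \<bar>rescale l z \<phi> w\<bar> \<le> B * (1 / l ^ (CARD('d) + 2))"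
      using B[of w] True B0 \<phi>1 l unfolding rescale_def abs_divide
      by (intro mult_mono) (auto intro!: divide_right_mono)
    ultimately show ?thesis by (simp add: abs_mult)
  next
    case False
    have "((fst w - fst z) / l\<^sup>2, (snd w - snd z) /\<^sub>R l) \<notin> cball 0 1"
    proof
      assume "((fst w - fst z) / l\<^sup>2, (snd w - snd z) /\<^sub>R l) \<in> cball 0 1"
      then have n: "norm ((fst w - fst z) / l\<^sup>2, (snd w - snd z) /\<^sub>R l) \<le> 1" by simp
      have "\<bar>(fst w - fst z) / l\<^sup>2\<bar> \<le> 1" "norm ((snd w - snd z) /\<^sub>R l) \<le> 1"
        using order_trans[OF norm_fst_le n] order_trans[OF norm_snd_le n] by simp_all
      then show False using False l by (simp add: divide_le_eq abs_divide inverse_eq_divide)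
    qed
    then have "rescale l z \<phi> w = 0" by (simp add: rescale_def \<phi>0)
    then show ?thesis using B0 l by simp
  qed
  have "\<bar>of_fun h (rescale l z \<phi>)\<bar> = norm (LINT w|lborel. h w * rescale l z \<phi> w)" using rt by (simp add: of_fun_def)
  also have "\<dots> \<le> (LINT w|lborel. norm (h w * rescale l z \<phi> w))" by (rule integral_norm_bound)
  also have "\<dots> \<le> (LINT w|lborel. indicator ?b w * (B / l ^ (CARD('d) + 2)))"
  proof (rule integral_mono[OF integrable_norm[OF test_product_integrable[OF h rt]] _ pt])
    show "integrable lborel (\<lambda>w. indicator ?b w * (B / l ^ (CARD('d) + 2)))"
      by (intro integrable_mult_left integrable_real_indicator) (auto simp: emeasure_lborel_cbox_eq)
  qed
  also have "\<dots> = measure lborel ?b * (B / l ^ (CARD('d) + 2))" by simp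
  also have "measure lborel ?b = 2 ^ (CARD('d) + 1) * l ^ (CARD('d) + 2)"
    unfolding v_def by (rule content_cylinder[OF l(1)])
  also have "2 ^ (CARD('d) + 1) * l ^ (CARD('d) + 2) * (B / l ^ (CARD('d) + 2)) = 2 ^ (CARD('d) + 1) * B"
    using l by simp
  finally show ?thesis .
qed

lemma norm_spacetime_le: "norm (w::('d::finite) spacetime) \<le> \<bar>fst w\<bar> + norm (snd w)"
  using norm_Pair_le[of "fst w" "snd w"] by simp

lemma torus_dist_bounds:
  assumes "snd z \<in> torus_cell" "w + (0, lattice_vec k) \<in> S" "\<And>p. p \<in> S \<Longrightarrow> snd p \<in> torus_cell" "\<And>x::real^('d::finite). x \<in> torus_cell \<Longrightarrow> norm x \<le> r"
  shows "torus_dist (snd z) (snd w) \<le> 2 * r" "0 \<le> torus_dist (snd z) (snd (w::'d spacetime))"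
proof -
  have bdd: "bdd_below (range (\<lambda>k. norm (snd z - snd w + lattice_vec k)))" by (rule bdd_belowI[of _ 0]) auto
  have "torus_dist (snd z) (snd w) \<le> norm (snd z - snd w + lattice_vec (- k))"
    unfolding torus_dist_def by (rule cINF_lower[OF bdd]) simp
  also have "snd z - snd w + lattice_vec (- k) = snd z - (snd w + lattice_vec k)"
    by (simp add: lattice_vec_def vec_eq_iff)
  also have "norm \<dots> \<le> norm (snd z) + norm (snd w + lattice_vec k)" by (rule norm_triangle_ineq4)
  also have "\<dots> \<le> r + r" using assms(4)[OF assms(1)] assms(4)[OF assms(3)[OF assms(2)]] by (intro add_mono) simp_all
  finally show "torus_dist (snd z) (snd w) \<le> 2 * r" by simp
  show "0 \<le> torus_dist (snd z) (snd w)" unfolding torus_dist_def by (rule cINF_greatest) auto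
qed

text \<open>Bounding each partial derivative by \<eta> bounds the operator norm of the derivative by
  the dimension times \<eta>; convexity then allows the mean value inequality.\<close>

lemma C1_lipschitz:
  fixes G :: "('d::finite) spacetime \<Rightarrow> real"
  assumes d: "\<And>x. x \<in> R \<Longrightarrow> (G has_derivative G' x) (at x)" and R: "convex R"
    and b: "\<And>x b. x \<in> R \<Longrightarrow> b \<in> Basis \<Longrightarrow> \<bar>G' x b\<bar> \<le> \<eta>" and xy: "x \<in> R" "y \<in> R"
  shows "\<bar>G x - G y\<bar> \<le> real DIM('d spacetime) * \<eta> * norm (x - y)"
proof -
  have "norm (G x - G y) \<le> (real DIM('d spacetime) * \<eta>) * norm (x - y)"
  proof (rule differentiable_bound[OF R _ _ xy])
    show "(G has_derivative G' x) (at x within R)" if "x \<in> R" for x using d[OF that] by (rule has_derivative_at_withinI)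
    fix x assume x: "x \<in> R"
    have lin: "linear (G' x)" using d[OF x] has_derivative_linear by blast
    show "onorm (G' x) \<le> real DIM('d spacetime) * \<eta>"
    proof (rule onorm_le)
      fix h
      have "G' x h = G' x (\<Sum>b\<in>Basis. (h \<bullet> b) *\<^sub>R b)" by (simp add: euclidean_representation)
      also have "\<dots> = (\<Sum>b\<in>Basis. (h \<bullet> b) * G' x b)" by (simp add: linear_sum[OF lin] linear_scale[OF lin])
      finally have "norm (G' x h) \<le> (\<Sum>b\<in>Basis. \<bar>(h \<bullet> b) * G' x b\<bar>)" by (simp add: sum_abs)
      also have "\<dots> \<le> (\<Sum>b\<in>(Basis :: 'd spacetime set). norm h * \<eta>)"
        unfolding abs_mult by (intro sum_mono mult_mono Basis_le_norm b x) auto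
      also have "\<dots> = real DIM('d spacetime) * \<eta> * norm h" by simp
      finally show "norm (G' x h) \<le> real DIM('d spacetime) * \<eta> * norm h" .
    qed
  qed
  then show ?thesis by simp
qed

lemma canonical_model_fst: "fst (canonical_model f g c) z (bas a) = of_fun (canonical_fun f g c z a)"
  by (simp add: canonical_model_def canonical_Pi_bas)

lemma of_fun_diff:
  assumes "continuous_on UNIV h" "continuous_on UNIV h'" "\<phi> \<in> test_functions"
  shows "of_fun h \<phi> - of_fun h' \<phi> = of_fun (\<lambda>w. h w - h' w) \<phi>"
  using assms by (simp add: of_fun_def left_diff_distrib Bochner_Integration.integral_diff test_product_integrable)

text \<open>For symbols of nonpositive homogeneity the weight in \<open>l\<close> is at most 1, so
  uniform closeness suffices. For \<open>II\<close> the weight is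
  \<open>l powr (\<kappa> - 1)\<close>; the Lipschitz bound on \<open>g - g'\<close> supplies the
  missing factor \<open>l\<close>, and this is why closeness of first derivatives enters. For
  \<open>XX i\<close> the two functions coincide, and the common constant \<open>c\<close> cancels
  in \<open>IXi\<close>.\<close>

lemma canonical_Pi_diff_bound:
  fixes f g f' g' :: "('d::finite) spacetime \<Rightarrow> real"
  assumes cont: "continuous_on UNIV f" "continuous_on UNIV g" "continuous_on UNIV f'" "continuous_on UNIV g'"
    and \<kappa>: "0 < \<kappa>" "\<kappa> < 1/3"
    and R: "\<And>w. \<bar>fst w - fst z\<bar> \<le> 1 \<Longrightarrow> norm (snd w - snd z) \<le> 1 \<Longrightarrow> w \<in> R"
    and A: "1 \<le> A" "\<And>w. w \<in> R \<Longrightarrow> \<bar>f w\<bar> \<le> A \<and> \<bar>g' w\<bar> \<le> A"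
    and \<eta>: "0 \<le> \<eta>" "\<And>w. w \<in> R \<Longrightarrow> \<bar>f w - f' w\<bar> \<le> \<eta>" "\<And>w. w \<in> R \<Longrightarrow> \<bar>g w - g' w\<bar> \<le> \<eta>"
    and L: "1 \<le> L" "\<And>x y. x \<in> R \<Longrightarrow> y \<in> R \<Longrightarrow> \<bar>(g x - g' x) - (g y - g' y)\<bar> \<le> L * \<eta> * norm (x - y)"
    and \<phi>: "\<phi> \<in> unit_tests" and l: "0 < l" "l \<le> 1"
  shows "l powr (- homog \<kappa> a) * \<bar>of_fun (canonical_fun f g c z a) (rescale l z \<phi>) - of_fun (canonical_fun f' g' c z a) (rescale l z \<phi>)\<bar>
    \<le> 2 ^ (CARD('d) + 1) * (4 * A * L * \<eta>)"
proof -
  have zR: "z \<in> R" by (rule R) auto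
  have t: "rescale l z \<phi> \<in> test_functions" using \<phi> l by (intro rescale_test) (auto simp: unit_tests_def)
  have l2: "l\<^sup>2 \<le> l" using l by (simp add: power2_eq_square mult_left_le)
  have wR: "w \<in> R" if "\<bar>fst w - fst z\<bar> \<le> l\<^sup>2" "norm (snd w - snd z) \<le> l" for w
    using that l l2 by (intro R) auto
  have nz: "norm (w - z) \<le> 2 * l" if "\<bar>fst w - fst z\<bar> \<le> l\<^sup>2" "norm (snd w - snd z) \<le> l" for w
    using norm_spacetime_le[of "w - z"] that l2 by simp
  have p: "0 \<le> A * L * \<eta>" using A(1) L(1) \<eta>(1) by simp
  have ALe: "\<eta> \<le> A * L * \<eta>"
    using mult_right_mono[of 1 "A * L" \<eta>] mult_mono[of 1 A 1 L] A(1) L(1) \<eta>(1) by simp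
  have A2: "A * \<eta> \<le> A * L * \<eta>"
    using mult_right_mono[of A "A * L" \<eta>] mult_left_mono[of 1 L A] A(1) L(1) \<eta>(1) by simp
  have L2: "L * \<eta> \<le> A * L * \<eta>"
    using mult_right_mono[of L "A * L" \<eta>] mult_right_mono[of 1 A L] A(1) L(1) \<eta>(1) by simp
  define h where "h w = canonical_fun f g c z a w - canonical_fun f' g' c z a w" for w
  have hc: "continuous_on UNIV h" unfolding h_def by (intro continuous_intros canonical_fun_continuous cont)
  have *: "l powr (- homog \<kappa> a) * \<bar>of_fun (canonical_fun f g c z a) (rescale l z \<phi>) - of_fun (canonical_fun f' g' c z a) (rescale l z \<phi>)\<bar>
    \<le> l powr (- homog \<kappa> a) * (2 ^ (CARD('d) + 1) * B)"
    if B: "\<And>w. \<bar>fst w - fst z\<bar> \<le> l\<^sup>2 \<Longrightarrow> norm (snd w - snd z) \<le> l \<Longrightarrow> \<bar>h w\<bar> \<le> B" for B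
    unfolding of_fun_diff[OF canonical_fun_continuous[OF cont(1,2)] canonical_fun_continuous[OF cont(3,4)] t] h_def[symmetric]
    by (intro mult_left_mono rescale_integral_bound[OF hc \<phi> l B]) auto
  have pw: "l powr s \<le> 1" if "0 \<le> s" for s using that l by (intro powr_le1) auto
  have fin: "l powr (- homog \<kappa> a) * (2 ^ (CARD('d) + 1) * B) \<le> 2 ^ (CARD('d) + 1) * (4 * A * L * \<eta>)"
    if "l powr (- homog \<kappa> a) * B \<le> 4 * (A * L * \<eta>)" for B
    using mult_left_mono[OF that, of "2 ^ (CARD('d) + 1)"] by (simp add: mult_ac)
  have simple: ?thesis if "0 \<le> - homog \<kappa> a" "0 \<le> B" "B \<le> 4 * (A * L * \<eta>)"
    "\<And>w. \<bar>fst w - fst z\<bar> \<le> l\<^sup>2 \<Longrightarrow> norm (snd w - snd z) \<le> l \<Longrightarrow> \<bar>h w\<bar> \<le> B" for B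
  proof (rule order_trans[OF *[OF that(4)] fin])
    have "l powr (- homog \<kappa> a) * B \<le> 1 * B" by (rule mult_right_mono[OF pw[OF that(1)] that(2)])
    then show "l powr (- homog \<kappa> a) * B \<le> 4 * (A * L * \<eta>)" using that(3) by simp
  qed
  show ?thesis
  proof (cases a)
    case Xi
    show ?thesis by (rule simple[of \<eta>]) (use Xi \<kappa> \<eta>(1) ALe p wR \<eta>(2) in \<open>auto simp: h_def\<close>)
  next
    case IXi
    show ?thesis
    proof (rule simple[of "4 * (A * \<eta>)"])
      fix w assume w: "\<bar>fst w - fst z\<bar> \<le> l\<^sup>2" "norm (snd w - snd z) \<le> l"
      \<comment> \<open>The product rule for differences: one factor changes at a time. The first
        term uses the bound \<open>A\<close> on \<open>f\<close>, the second the bound on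
        \<open>g'\<close>.\<close>
      have "h w = ((g w - g' w) - (g z - g' z)) * f w + (g' w - g' z) * (f w - f' w)"
        by (simp add: h_def IXi algebra_simps)
      also have "\<bar>\<dots>\<bar> \<le> \<bar>(g w - g' w) - (g z - g' z)\<bar> * \<bar>f w\<bar> + \<bar>g' w - g' z\<bar> * \<bar>f w - f' w\<bar>"
        by (simp add: abs_mult[symmetric])
      also have "\<dots> \<le> (2 * \<eta>) * A + (2 * A) * \<eta>"
      proof (intro add_mono mult_mono)
        show "\<bar>(g w - g' w) - (g z - g' z)\<bar> \<le> 2 * \<eta>" using \<eta>(3)[OF wR[OF w]] \<eta>(3)[OF zR] by linarith
        show "\<bar>g' w - g' z\<bar> \<le> 2 * A" using A(2)[OF wR[OF w]] A(2)[OF zR] by linarith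
      qed (use A(1) A(2)[OF wR[OF w]] \<eta>(1) \<eta>(2)[OF wR[OF w]] in auto)
      finally show "\<bar>h w\<bar> \<le> 4 * (A * \<eta>)" by simp
    qed (use IXi \<kappa> A(1) \<eta>(1) A2 in auto)
  next
    case (XXi i)
    show ?thesis
    proof (rule simple[of \<eta>])
      fix w assume w: "\<bar>fst w - fst z\<bar> \<le> l\<^sup>2" "norm (snd w - snd z) \<le> l"
      have "\<bar>snd w $ i - snd z $ i\<bar> \<le> 1" using component_le_norm_cart[of "snd w - snd z" i] w(2) l(2) by simp
      then have "\<bar>f w - f' w\<bar> * \<bar>snd w $ i - snd z $ i\<bar> \<le> \<eta> * 1"
        using \<eta>(1) \<eta>(2)[OF wR[OF w]] by (intro mult_mono) auto
      then show "\<bar>h w\<bar> \<le> \<eta>" by (simp add: h_def XXi left_diff_distrib[symmetric] abs_mult)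
    qed (use XXi \<kappa> \<eta>(1) ALe p in auto)
  next
    case Unit
    show ?thesis by (rule simple[of 0]) (use Unit p in \<open>auto simp: h_def\<close>)
  next
    case II
    show ?thesis
    proof (rule order_trans[OF *[of "L * \<eta> * (2 * l)"] fin])
      fix w assume w: "\<bar>fst w - fst z\<bar> \<le> l\<^sup>2" "norm (snd w - snd z) \<le> l"
      have "\<bar>h w\<bar> = \<bar>(g w - g' w) - (g z - g' z)\<bar>" by (simp add: h_def II algebra_simps)
      also have "\<dots> \<le> L * \<eta> * norm (w - z)" by (rule L(2)[OF wR[OF w] zR])
      also have "\<dots> \<le> L * \<eta> * (2 * l)" using nz[OF w] L(1) \<eta>(1) by (intro mult_left_mono) auto
      finally show "\<bar>h w\<bar> \<le> L * \<eta> * (2 * l)" .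
    next
      have "l powr (- homog \<kappa> a) * l = l powr \<kappa>"
        using l powr_add[of l "- homog \<kappa> a" 1] by (simp add: II)
      then have "l powr (- homog \<kappa> a) * (L * \<eta> * (2 * l)) = 2 * (L * \<eta>) * l powr \<kappa>" by (simp add: mult_ac)
      also have "\<dots> \<le> 2 * (L * \<eta>) * 1" using L(1) \<eta>(1) \<kappa> by (intro mult_left_mono pw) auto
      also have "\<dots> \<le> 4 * (A * L * \<eta>)" using L2 p by simp
      finally show "l powr (- homog \<kappa> a) * (L * \<eta> * (2 * l)) \<le> 4 * (A * L * \<eta>)" .
    qed
  next
    case (XX i)
    have "h w = 0" for w by (simp add: h_def XX)
    then show ?thesis by (intro order_trans[OF *[of 0] fin]) (use p in auto)
  qed
qed

text \<open>The polynomial entries of \<Gamma> are common to both models and cancel. What remains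
  are the entries from \<open>II\<close> to \<open>Unit\<close> and from \<open>IXi\<close> to
  \<open>Xi\<close>, and both have the same difference of homogeneities,
  \<open>\<kappa> - 1\<close>.\<close>

lemma canonical_Gamma_diff:
  fixes f g f' g' :: "('d::finite) spacetime \<Rightarrow> real"
  assumes M: "canonical_model f g c \<in> models \<kappa>" and M': "canonical_model f' g' c \<in> models \<kappa>"
    and cg: "continuous_on UNIV g" "continuous_on UNIV g'" and hom: "homog \<kappa> a < homog \<kappa> b" and \<kappa>: "0 < \<kappa>" "\<kappa> < 1/3"
  shows "\<bar>(snd (canonical_model f g c) z w (bas b) - snd (canonical_model f' g' c) z w (bas b)) $ a\<bar> * d powr (homog \<kappa> a - homog \<kappa> b)
     \<le> \<bar>(g w - g z) - (g' w - g' z)\<bar> * d powr (\<kappa> - 1)"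
proof -
  have F: "Gamma_formulas (canonical_Pi f g c) (snd (canonical_model f g c))" "Gamma_formulas (canonical_Pi f' g' c) (snd (canonical_model f' g' c))"
    using M M' is_modelD(6) unfolding models_def canonical_model_def by auto
  have cII: "cont_density (canonical_Pi f g c z (bas II)) w = g w - g z" "cont_density (canonical_Pi f' g' c z (bas II)) w = g' w - g' z"
    unfolding canonical_Pi_bas by (subst cont_density_of_fun, auto intro!: continuous_intros cg)+
  have cXX: "cont_density (canonical_Pi f g c z (bas (XX i))) w = snd w $ i - snd z $ i" "cont_density (canonical_Pi f' g' c z (bas (XX i))) w = snd w $ i - snd z $ i" for i
    unfolding canonical_Pi_bas by (subst cont_density_of_fun, auto intro!: continuous_intros)+
  define D where "D = snd (canonical_model f g c) z w (bas b) - snd (canonical_model f' g' c) z w (bas b)"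
  have D: "D = (case b of II \<Rightarrow> (- ((g w - g z) - (g' w - g' z))) *\<^sub>R bas Unit | IXi \<Rightarrow> (- ((g w - g z) - (g' w - g' z))) *\<^sub>R bas Xi | _ \<Rightarrow> 0)"
  proof -
    have e: "snd (canonical_model f g c) z w (bas Xi) = bas Xi" "snd (canonical_model f g c) z w (bas Unit) = bas Unit"
      "snd (canonical_model f g c) z w (bas II) = bas II - (g w - g z) *\<^sub>R bas Unit"
      "snd (canonical_model f g c) z w (bas IXi) = bas IXi - (g w - g z) *\<^sub>R bas Xi"
      "snd (canonical_model f g c) z w (bas (XX i)) = bas (XX i) - (snd w $ i - snd z $ i) *\<^sub>R bas Unit"
      "snd (canonical_model f g c) z w (bas (XXi i)) = bas (XXi i) - (snd w $ i - snd z $ i) *\<^sub>R bas Xi" for i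
      using F(1)[unfolded Gamma_formulas_def, THEN spec, THEN spec, of z w, unfolded cII cXX] by blast+
    have e': "snd (canonical_model f' g' c) z w (bas Xi) = bas Xi" "snd (canonical_model f' g' c) z w (bas Unit) = bas Unit"
      "snd (canonical_model f' g' c) z w (bas II) = bas II - (g' w - g' z) *\<^sub>R bas Unit"
      "snd (canonical_model f' g' c) z w (bas IXi) = bas IXi - (g' w - g' z) *\<^sub>R bas Xi"
      "snd (canonical_model f' g' c) z w (bas (XX i)) = bas (XX i) - (snd w $ i - snd z $ i) *\<^sub>R bas Unit"
      "snd (canonical_model f' g' c) z w (bas (XXi i)) = bas (XXi i) - (snd w $ i - snd z $ i) *\<^sub>R bas Xi" for i
      using F(2)[unfolded Gamma_formulas_def, THEN spec, THEN spec, of z w, unfolded cII cXX] by blast+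
    show ?thesis unfolding D_def by (cases b) (simp_all add: e e' algebra_simps)
  qed
  have nn: "0 \<le> \<bar>(g w - g z) - (g' w - g' z)\<bar> * d powr (\<kappa> - 1)" by simp
  show ?thesis unfolding D_def[symmetric]
  proof (cases b)
    case II
    then show "\<bar>D $ a\<bar> * d powr (homog \<kappa> a - homog \<kappa> b) \<le> \<bar>(g w - g z) - (g' w - g' z)\<bar> * d powr (\<kappa> - 1)"
      using nn by (cases "a = Unit") (simp_all add: D axis_def abs_minus_commute)
  next
    case IXi
    then show "\<bar>D $ a\<bar> * d powr (homog \<kappa> a - homog \<kappa> b) \<le> \<bar>(g w - g z) - (g' w - g' z)\<bar> * d powr (\<kappa> - 1)"
      using nn by (cases "a = Xi") (simp_all add: D axis_def abs_minus_commute)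
  qed (use nn in \<open>auto simp: D\<close>)
qed

text \<open>On a box the model distance is controlled by the distance of the data in C and C1 on a
  larger compact set. It has to be larger because tests reach out to distance 1 from their base
  point, and because the second point of a torus pair may lie outside the fundamental cell.\<close>

lemma canonical_box_diff_bound:
  fixes n :: nat
  assumes \<kappa>: "0 < \<kappa>" "\<kappa> < 1/3"
  obtains R :: "('d::finite) spacetime set" and K where "compact R" "K > 0"
    "\<And>f g f' g' c A \<eta>. canonical_model f g c \<in> models \<kappa> \<Longrightarrow> canonical_model f' g' c \<in> models \<kappa> \<Longrightarrow>
      f \<in> C_torus \<Longrightarrow> f' \<in> C_torus \<Longrightarrow> g \<in> C1_torus \<Longrightarrow> g' \<in> C1_torus \<Longrightarrow>
      1 \<le> A \<Longrightarrow> (\<And>w. w \<in> R \<Longrightarrow> \<bar>f w\<bar> \<le> A \<and> \<bar>g' w\<bar> \<le> A) \<Longrightarrow> 0 \<le> \<eta> \<Longrightarrow>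
      (\<And>w. w \<in> R \<Longrightarrow> \<bar>f w - f' w\<bar> \<le> \<eta>) \<Longrightarrow> (\<And>w. w \<in> R \<Longrightarrow> \<bar>g w - g' w\<bar> \<le> \<eta>) \<Longrightarrow>
      (\<And>w b. w \<in> R \<Longrightarrow> b \<in> Basis \<Longrightarrow> \<bar>frechet_derivative g (at w) b - frechet_derivative g' (at w) b\<bar> \<le> \<eta>) \<Longrightarrow>
      box_diff \<kappa> n (canonical_model f g c) (canonical_model f' g' c) \<le> K * A * \<eta>"
proof -
  obtain r0 where r0: "\<And>x::real^'d. x \<in> torus_cell \<Longrightarrow> norm x \<le> r0"
    using compact_imp_bounded[OF compact_cbox] unfolding torus_cell_cbox bounded_iff by metis
  define r where "r = \<bar>r0\<bar> + 1"
  have r: "\<And>x::real^'d. x \<in> torus_cell \<Longrightarrow> norm x \<le> r" "r \<ge> 1" using r0 by (force simp: r_def)+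
  define N where "N = real (Suc n)"
  \<comment> \<open>\<open>N + r + 2\<close> accommodates base points and test supports. The second
    point of a torus pair lies within \<open>2 * r\<close> of the first in space, which accounts for
    the coefficient 3.\<close>
  define R :: "'d spacetime set" where "R = cball 0 (N + 3 * r + 2)"
  define L where "L = real DIM('d spacetime)"
  have L1: "1 \<le> L" unfolding L_def using DIM_positive[where 'a="'d spacetime"] by linarith
  \<comment> \<open>An upper bound for parabolic distances of torus pairs in the box: the square
    root of a time difference of at most \<open>2 * N\<close>, and a torus distance of at most
    \<open>2 * r\<close>. Being at least 1, it may be raised to higher powers.\<close>
  define M where "M = 2 * N + 1 + 2 * r"
  have M1: "1 \<le> M" using r(2) by (simp add: M_def N_def)
  define K where "K = 2 ^ (CARD('d) + 1) * (4 * L) + L * (2 * M\<^sup>2)"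
  have K0: "K > 0" unfolding K_def using L1 by (intro add_pos_nonneg mult_pos_pos mult_nonneg_nonneg) auto
  show ?thesis
  proof (rule that[of R K])
    show "compact R" by (simp add: R_def)
    show "K > 0" by (rule K0)
    fix f g f' g' :: "'d spacetime \<Rightarrow> real" and c A \<eta>
    assume mod: "canonical_model f g c \<in> models \<kappa>" "canonical_model f' g' c \<in> models \<kappa>"
      and tor: "f \<in> C_torus" "f' \<in> C_torus" "g \<in> C1_torus" "g' \<in> C1_torus"
      and A: "1 \<le> A" "\<And>w. w \<in> R \<Longrightarrow> \<bar>f w\<bar> \<le> A \<and> \<bar>g' w\<bar> \<le> A" and \<eta>: "0 \<le> \<eta>"
      and ff: "\<And>w. w \<in> R \<Longrightarrow> \<bar>f w - f' w\<bar> \<le> \<eta>" and gg: "\<And>w. w \<in> R \<Longrightarrow> \<bar>g w - g' w\<bar> \<le> \<eta>"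
      and dg: "\<And>w b. w \<in> R \<Longrightarrow> b \<in> Basis \<Longrightarrow> \<bar>frechet_derivative g (at w) b - frechet_derivative g' (at w) b\<bar> \<le> \<eta>"
    have cont: "continuous_on UNIV f" "continuous_on UNIV g" "continuous_on UNIV f'" "continuous_on UNIV g'"
      using tor C1_torusD(3) by (auto simp: C_torus_def)
    have lip: "\<bar>(g x - g' x) - (g y - g' y)\<bar> \<le> L * \<eta> * norm (x - y)" if "x \<in> R" "y \<in> R" for x y
      unfolding L_def
    proof (rule C1_lipschitz[where R=R and G="\<lambda>x. g x - g' x" and G'="\<lambda>x h. frechet_derivative g (at x) h - frechet_derivative g' (at x) h", OF _ _ dg that])
      show "((\<lambda>x. g x - g' x) has_derivative (\<lambda>h. frechet_derivative g (at x) h - frechet_derivative g' (at x) h)) (at x)" for x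
        by (intro has_derivative_diff frechet_works C1_torusD tor)
      show "convex R" by (simp add: R_def)
    qed
    have zb: "\<bar>fst z\<bar> \<le> N" "snd z \<in> torus_cell" if "z \<in> model_box (Suc n)" for z :: "'d spacetime"
      using that by (auto simp: model_box_def N_def abs_le_iff)
    have zR: "z \<in> R" if "z \<in> model_box (Suc n)" for z :: "'d spacetime"
      using norm_spacetime_le[of z] zb[OF that] r(1)[OF zb(2)[OF that]] r(2) by (simp add: R_def)
    have "model_diff \<kappa> (model_box (Suc n)) (canonical_model f g c) (canonical_model f' g' c) \<le>
      ennreal (2 ^ (CARD('d) + 1) * (4 * A * L * \<eta>)) + ennreal (L * \<eta> * (2 * M\<^sup>2))"
      unfolding model_diff_def
    proof (intro add_mono Pi_seminorm_le Gamma_seminorm_le)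
      fix a :: "'d symb" and \<phi> :: "'d spacetime \<Rightarrow> real" and l :: real and z :: "'d spacetime"
      assume h: "\<phi> \<in> unit_tests" "0 < l" "l \<le> 1" "z \<in> model_box (Suc n)"
      have wR: "w \<in> R" if "\<bar>fst w - fst z\<bar> \<le> 1" "norm (snd w - snd z) \<le> 1" for w
      proof -
        have "norm (snd w) \<le> norm (snd z) + 1" using norm_triangle_ineq2[of "snd w" "snd z"] that(2) by linarith
        then show ?thesis
          using norm_spacetime_le[of w] that(1) zb[OF h(4)] r(1)[OF zb(2)[OF h(4)]] r(2) by (simp add: R_def)
      qed
      show "ennreal (l powr (- homog \<kappa> a) * \<bar>fst (canonical_model f g c) z (bas a) (rescale l z \<phi>) - fst (canonical_model f' g' c) z (bas a) (rescale l z \<phi>)\<bar>) \<le> ennreal (2 ^ (CARD('d) + 1) * (4 * A * L * \<eta>))"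
        unfolding canonical_model_fst
        by (intro ennreal_leI canonical_Pi_diff_bound[where R=R, OF cont \<kappa> wR A \<eta> ff gg L1 lip h(1-3)])
    next
      fix a b :: "'d symb" and z w :: "'d spacetime"
      assume hom: "homog \<kappa> a < homog \<kappa> b" and zw: "(z, w) \<in> torus_pairs (model_box (Suc n))"
      define d where "d = par_dist z w"
      obtain k where k: "w + (0, lattice_vec k) \<in> model_box (Suc n)" and z: "z \<in> model_box (Suc n)" and nd: "norm (snd z - snd w) = torus_dist (snd z) (snd w)"
        using zw by (auto simp: torus_pairs_def)
      have td: "torus_dist (snd z) (snd w) \<le> 2 * r" "0 \<le> torus_dist (snd z) (snd w)"
        by (rule torus_dist_bounds[OF zb(2)[OF z] k zb(2) r(1)]; assumption)+
      have wt: "\<bar>fst w\<bar> \<le> N" using zb(1)[OF k] by simp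
      have wRR: "w \<in> R"
      proof -
        have "norm (snd w) \<le> norm (snd z) + 2 * r"
          using norm_triangle_ineq2[of "snd w" "snd z"] nd td(1) by (simp add: norm_minus_commute)
        then show ?thesis using norm_spacetime_le[of w] wt r(1)[OF zb(2)[OF z]] by (simp add: R_def)
      qed
      have d0: "0 \<le> d" unfolding d_def par_dist_def by (simp add: le_max_iff_disj)
      have dM: "d \<le> M"
      proof -
        have "\<bar>fst z - fst w\<bar> \<le> 2 * N" using zb(1)[OF z] wt by linarith
        then have "sqrt \<bar>fst z - fst w\<bar> \<le> 2 * N + 1"
        proof -
          assume *: "\<bar>fst z - fst w\<bar> \<le> 2 * N"
          have "sqrt \<bar>fst z - fst w\<bar> \<le> sqrt ((2 * N + 1)\<^sup>2)"
            using * self_le_power[of "2 * N + 1" 2] by (intro real_sqrt_le_mono) (simp add: N_def)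
          then show ?thesis by (simp add: N_def)
        qed
        then show ?thesis unfolding d_def par_dist_def M_def using td(1) r(2) by (simp add: N_def)
      qed
      have "norm (w - z) \<le> d\<^sup>2 + d"
      proof -
        have "\<bar>fst w - fst z\<bar> = (sqrt \<bar>fst z - fst w\<bar>)\<^sup>2" by (simp add: abs_minus_commute)
        also have "\<dots> \<le> d\<^sup>2" unfolding d_def par_dist_def by (intro power_mono) auto
        finally have "\<bar>fst w - fst z\<bar> \<le> d\<^sup>2" .
        moreover have "norm (snd w - snd z) \<le> d" unfolding d_def par_dist_def using nd by (simp add: norm_minus_commute)
        ultimately show ?thesis using norm_spacetime_le[of "w - z"] by simp
      qed
      then have b1: "\<bar>(g w - g z) - (g' w - g' z)\<bar> \<le> L * \<eta> * (d\<^sup>2 + d)"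
        using lip[OF wRR zR[OF z]] mult_left_mono[of "norm (w - z)" "d\<^sup>2 + d" "L * \<eta>"] L1 \<eta> by (simp add: algebra_simps)
      \<comment> \<open>The increment of \<open>g - g'\<close> is bounded by
        \<open>d\<^sup>2\<close> from time and \<open>d\<close> from space. Against the weight this
        leaves the positive powers \<open>1 + \<kappa>\<close> and \<kappa> of \<open>d\<close>,
        which stay bounded, also for small \<open>d\<close>.\<close>
      have dp: "(d\<^sup>2 + d) * d powr (\<kappa> - 1) \<le> 2 * M\<^sup>2"
      proof (cases "d = 0")
        case False
        then have d: "d > 0" using d0 by simp
        have "(d\<^sup>2 + d) * d powr (\<kappa> - 1) = d powr (1 + \<kappa>) + d powr \<kappa>"
          using d powr_add[of d 2 "\<kappa> - 1"] powr_add[of d 1 "\<kappa> - 1"] by (simp add: distrib_right)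
        also have "\<dots> \<le> M powr (1 + \<kappa>) + M powr \<kappa>" using d dM \<kappa> by (intro add_mono powr_mono2) auto
        also have "\<dots> \<le> M powr 2 + M powr 2" using M1 \<kappa> by (intro add_mono powr_mono) auto
        finally show ?thesis using M1 by simp
      qed simp
      have "\<bar>(snd (canonical_model f g c) z w (bas b) - snd (canonical_model f' g' c) z w (bas b)) $ a\<bar> * d powr (homog \<kappa> a - homog \<kappa> b)
        \<le> \<bar>(g w - g z) - (g' w - g' z)\<bar> * d powr (\<kappa> - 1)"
        by (rule canonical_Gamma_diff[OF mod cont(2,4) hom \<kappa>])
      also have "\<dots> \<le> (L * \<eta> * (d\<^sup>2 + d)) * d powr (\<kappa> - 1)" by (rule mult_right_mono[OF b1]) simp
      also have "\<dots> = L * \<eta> * ((d\<^sup>2 + d) * d powr (\<kappa> - 1))" by (simp add: mult.assoc)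
      also have "\<dots> \<le> L * \<eta> * (2 * M\<^sup>2)" using dp L1 \<eta> by (intro mult_left_mono) auto
      finally show "ennreal (\<bar>(snd (canonical_model f g c) z w (bas b) - snd (canonical_model f' g' c) z w (bas b)) $ a\<bar> * par_dist z w powr (homog \<kappa> a - homog \<kappa> b)) \<le> ennreal (L * \<eta> * (2 * M\<^sup>2))"
        unfolding d_def by (rule ennreal_leI)
    qed
    also have "\<dots> = ennreal (2 ^ (CARD('d) + 1) * (4 * A * L * \<eta>) + L * \<eta> * (2 * M\<^sup>2))"
      using A(1) L1 \<eta> by (subst ennreal_plus) (auto intro!: mult_nonneg_nonneg)
    also have "\<dots> \<le> ennreal (K * A * \<eta>)"
    proof (rule ennreal_leI)
      have "L * \<eta> * (2 * M\<^sup>2) * 1 \<le> L * \<eta> * (2 * M\<^sup>2) * A" using A(1) L1 \<eta> by (intro mult_left_mono) auto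
      then show "2 ^ (CARD('d) + 1) * (4 * A * L * \<eta>) + L * \<eta> * (2 * M\<^sup>2) \<le> K * A * \<eta>"
        by (simp add: K_def algebra_simps)
    qed
    finally show "box_diff \<kappa> n (canonical_model f g c) (canonical_model f' g' c) \<le> K * A * \<eta>"
      using K0 A(1) \<eta> by (intro box_diff_leI) auto
  qed
qed

section \<open>Measurability of the time translations\<close>

lemmas model_dist_triangle = Metric_space.triangle[OF models_Metric_space]
lemmas model_dist_commute = Metric_space.commute[OF models_Metric_space]

lemma uniformly_close_shift:
  fixes h :: "('d::finite) spacetime \<Rightarrow> real"
  assumes h: "continuous_on UNIV h" and R: "compact R" and \<eta>: "\<eta> > 0"
  shows "\<forall>\<^sub>F t in nhds 0. \<forall>w\<in>R. \<bar>h w - h (w + (t, 0))\<bar> \<le> \<eta>"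
proof -
  obtain r where r: "\<And>w. w \<in> R \<Longrightarrow> norm w \<le> r" using compact_imp_bounded[OF R] unfolding bounded_iff by blast
  have "uniformly_continuous_on (cball 0 (r + 1)) h"
    by (intro compact_uniformly_continuous continuous_on_subset[OF h]) auto
  then obtain \<delta> where \<delta>: "\<delta> > 0" "\<And>w w'. w \<in> cball 0 (r + 1) \<Longrightarrow> w' \<in> cball 0 (r + 1) \<Longrightarrow> dist w' w < \<delta> \<Longrightarrow> dist (h w') (h w) < \<eta>"
    using \<eta> unfolding uniformly_continuous_on_def by metis
  have "\<bar>h w - h (w + (t, 0))\<bar> \<le> \<eta>" if t: "\<bar>t\<bar> < min \<delta> 1" and w: "w \<in> R" for t w
  proof -
    have n: "norm (t, 0::real^'d) = \<bar>t\<bar>" by (simp add: norm_Pair)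
    have "norm (w + (t, 0)) \<le> r + 1" using norm_triangle_ineq[of w "(t, 0)"] r[OF w] t unfolding n by linarith
    moreover have "norm w \<le> r + 1" using r[OF w] by simp
    moreover have "dist (w + (t, 0)) w < \<delta>" using t by (simp add: dist_norm n)
    ultimately have "dist (h (w + (t, 0))) (h w) < \<eta>" by (intro \<delta>(2)) auto
    then show ?thesis by (simp add: dist_norm abs_minus_commute)
  qed
  then show ?thesis unfolding eventually_nhds_metric using \<delta>(1) by (intro exI[of _ "min \<delta> 1"]) (simp add: dist_norm)
qed

text \<open>The translate is again canonical, with advanced data and the same constant. For small
  times the data and the first derivatives of \<open>g\<close> move uniformly little on the compact
  set \<open>R\<close>.\<close>

lemma canonical_translation_continuous:
  fixes f g :: "('d::finite) spacetime \<Rightarrow> real"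
  assumes \<kappa>: "0 < \<kappa>" "\<kappa> < 1/3" and f: "f \<in> C_torus" and g: "g \<in> C1_torus" and M: "canonical_model f g c \<in> models \<kappa>" and \<epsilon>: "\<epsilon> > 0"
  shows "\<forall>\<^sub>F t in nhds 0. model_dist \<kappa> (canonical_model f g c) (time_translation t (canonical_model f g c)) < \<epsilon>"
proof -
  have cf: "continuous_on UNIV f" using f by (simp add: C_torus_def)
  obtain n \<delta> where \<delta>: "\<delta> > 0" "\<And>Z Z' :: 'd model. Z \<in> models \<kappa> \<Longrightarrow> Z' \<in> models \<kappa> \<Longrightarrow> box_diff \<kappa> n Z Z' < \<delta> \<Longrightarrow> model_dist \<kappa> Z Z' < \<epsilon>"
    by (rule model_dist_small[OF \<epsilon>, of \<kappa>]) blast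
  obtain R :: "'d spacetime set" and K where R: "compact R" and K: "K > 0" and bd:
    "\<And>f g c f' g' A \<eta>. canonical_model f g c \<in> models \<kappa> \<Longrightarrow> canonical_model f' g' c \<in> models \<kappa> \<Longrightarrow>
      f \<in> C_torus \<Longrightarrow> f' \<in> C_torus \<Longrightarrow> g \<in> C1_torus \<Longrightarrow> g' \<in> C1_torus \<Longrightarrow>
      1 \<le> A \<Longrightarrow> (\<And>w. w \<in> R \<Longrightarrow> \<bar>f w\<bar> \<le> A \<and> \<bar>g' w\<bar> \<le> A) \<Longrightarrow> 0 \<le> \<eta> \<Longrightarrow>
      (\<And>w. w \<in> R \<Longrightarrow> \<bar>f w - f' w\<bar> \<le> \<eta>) \<Longrightarrow> (\<And>w. w \<in> R \<Longrightarrow> \<bar>g w - g' w\<bar> \<le> \<eta>) \<Longrightarrow>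
      (\<And>w b. w \<in> R \<Longrightarrow> b \<in> Basis \<Longrightarrow> \<bar>frechet_derivative g (at w) b - frechet_derivative g' (at w) b\<bar> \<le> \<eta>) \<Longrightarrow>
      box_diff \<kappa> n (canonical_model f g c) (canonical_model f' g' c) \<le> K * A * \<eta>"
    by (rule canonical_box_diff_bound[OF \<kappa>, of n]; rule that; assumption?; presburger)
  have bounded: "\<exists>B. \<forall>w\<in>R. \<bar>h w\<bar> \<le> B" if "continuous_on UNIV h" for h :: "'d spacetime \<Rightarrow> real"
    using compact_imp_bounded[OF compact_continuous_image[OF continuous_on_subset[OF that subset_UNIV] R]] unfolding bounded_iff by simp
  obtain B C where BC: "\<And>w. w \<in> R \<Longrightarrow> \<bar>f w\<bar> \<le> B" "\<And>w. w \<in> R \<Longrightarrow> \<bar>g w\<bar> \<le> C"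
    using bounded[OF cf] bounded[OF C1_torusD(3)[OF g]] by blast
  \<comment> \<open>The bound has to cover the advanced \<open>g\<close> too, which differs from
    \<open>g\<close> on \<open>R\<close> by at most \<eta>; this explains the summand 1 and the cap
    of \<eta> at 1 below.\<close>
  define A where "A = \<bar>B\<bar> + \<bar>C\<bar> + 1"
  have A: "1 \<le> A" by (simp add: A_def)
  define \<eta> where "\<eta> = min 1 (\<delta> / (2 * (K * A)))"
  have KA: "K * A > 0" using K A by simp
  have \<eta>: "0 < \<eta>" "\<eta> \<le> 1" "K * A * \<eta> < \<delta>"
  proof -
    show "0 < \<eta>" "\<eta> \<le> 1" using \<delta>(1) KA by (auto simp: \<eta>_def)
    have "K * A * \<eta> \<le> K * A * (\<delta> / (2 * (K * A)))" using KA by (intro mult_left_mono) (auto simp: \<eta>_def)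
    also have "\<dots> = \<delta> / 2" using K A by (simp add: field_simps)
    finally show "K * A * \<eta> < \<delta>" using \<delta>(1) by simp
  qed
  have ev: "\<forall>\<^sub>F t in nhds 0. (\<forall>w\<in>R. \<bar>f w - f (w + (t, 0))\<bar> \<le> \<eta>) \<and> (\<forall>w\<in>R. \<bar>g w - g (w + (t, 0))\<bar> \<le> \<eta>) \<and>
     (\<forall>b\<in>Basis. \<forall>w\<in>R. \<bar>frechet_derivative g (at w) b - frechet_derivative g (at (w + (t, 0))) b\<bar> \<le> \<eta>)"
    by (intro eventually_conj eventually_ball_finite ballI uniformly_close_shift[OF _ R \<eta>(1)] cf C1_torusD[OF g] finite_Basis)
  show ?thesis
  proof (rule eventually_mono[OF ev])
    fix t
    assume *: "(\<forall>w\<in>R. \<bar>f w - f (w + (t, 0))\<bar> \<le> \<eta>) \<and> (\<forall>w\<in>R. \<bar>g w - g (w + (t, 0))\<bar> \<le> \<eta>) \<and>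
     (\<forall>b\<in>Basis. \<forall>w\<in>R. \<bar>frechet_derivative g (at w) b - frechet_derivative g (at (w + (t, 0))) b\<bar> \<le> \<eta>)"
    have tr: "time_translation t (canonical_model f g c) = canonical_model (advance t f) (advance t g) c"
      by (rule time_translation_canonical[OF cf C1_torusD(3)[OF g]])
    have M': "canonical_model (advance t f) (advance t g) c \<in> models \<kappa>"
      using time_translation_models(2)[OF M, of t] unfolding tr .
    have fd: "frechet_derivative (advance t g) (at w) = frechet_derivative g (at (w + (t, 0)))" for w
      by (rule frechet_derivative_at[symmetric, OF frechet_advance[OF C1_torusD(1)[OF g]]])
    have "box_diff \<kappa> n (canonical_model f g c) (canonical_model (advance t f) (advance t g) c) \<le> K * A * \<eta>"
    proof (rule bd[OF M M' f advance_torus[OF f] g advance_C1_torus[OF g] A])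
      fix w assume w: "w \<in> R"
      have "\<bar>g w - g (w + (t, 0))\<bar> \<le> 1" using * w \<eta>(2) by force
      then show "\<bar>f w\<bar> \<le> A \<and> \<bar>advance t g w\<bar> \<le> A"
        using BC(1)[OF w] BC(2)[OF w] unfolding A_def advance_def by linarith
    next
      show "0 \<le> \<eta>" using \<eta>(1) by simp
      show "\<bar>f w - advance t f w\<bar> \<le> \<eta>" "\<bar>g w - advance t g w\<bar> \<le> \<eta>" if "w \<in> R" for w
        using * that unfolding advance_def by blast+
      show "\<bar>frechet_derivative g (at w) b - frechet_derivative (advance t g) (at w) b\<bar> \<le> \<eta>" if "w \<in> R" "b \<in> Basis" for w b
        using * that unfolding fd by blast
    qed
    then have "box_diff \<kappa> n (canonical_model f g c) (canonical_model (advance t f) (advance t g) c) < \<delta>" using \<eta>(3) by linarith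
    then show "model_dist \<kappa> (canonical_model f g c) (time_translation t (canonical_model f g c)) < \<epsilon>"
      unfolding tr by (rule \<delta>(2)[OF M M'])
  qed
qed

text \<open>Translation maps canonical models to canonical models, and its equicontinuity lets it
  respect the closure.\<close>

lemma time_translation_models0:
  assumes "Z \<in> models0 \<kappa>" shows "time_translation t Z \<in> models0 \<kappa>"
proof -
  have Z: "Z \<in> models \<kappa>" using assms models0_subset by auto
  show ?thesis unfolding models0_iff
  proof (intro conjI allI impI time_translation_models(2)[OF Z])
    fix r :: real assume r: "r > 0"
    obtain \<delta> where \<delta>: "\<delta> > 0" "\<And>s Z Z' :: 'a model. \<bar>s\<bar> \<le> real (nat \<lceil>\<bar>t\<bar>\<rceil>) \<Longrightarrow> Z \<in> models \<kappa> \<Longrightarrow> Z' \<in> models \<kappa> \<Longrightarrow> model_dist \<kappa> Z Z' < \<delta> \<Longrightarrow>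
      model_dist \<kappa> (time_translation s Z) (time_translation s Z') < r"
      using time_translation_equicontinuous[OF r] by blast
    obtain f g c where fg: "f \<in> C_torus" "g \<in> C1_torus" and M: "canonical_model f g c \<in> models \<kappa>" "model_dist \<kappa> Z (canonical_model f g c) < \<delta>"
      using assms \<delta>(1) unfolding models0_iff by blast
    have tr: "time_translation t (canonical_model f g c) = canonical_model (advance t f) (advance t g) c"
      using fg(1) by (intro time_translation_canonical C1_torusD(3)[OF fg(2)]) (simp add: C_torus_def)
    have "model_dist \<kappa> (time_translation t Z) (canonical_model (advance t f) (advance t g) c) < r"
      unfolding tr[symmetric] by (rule \<delta>(2)[OF _ Z M]) linarith
    then show "\<exists>f g c. f \<in> C_torus \<and> g \<in> C1_torus \<and> canonical_model f g c \<in> models \<kappa> \<and> model_dist \<kappa> (time_translation t Z) (canonical_model f g c) < r"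
      using advance_torus[OF fg(1), of t] advance_C1_torus[OF fg(2), of t] time_translation_models(2)[OF M(1), of t] unfolding tr by blast
  qed
qed

text \<open>Continuity in time passes from a nearby canonical model \<open>Y\<close> to
  \<open>Z\<close> by an \<epsilon>/3 argument: the approximation, the motion of \<open>Y\<close>,
  and the approximation after translation, which equicontinuity keeps small for all times up to
  1.\<close>

lemma time_translation_continuous_zero:
  fixes Z :: "('d::finite) model"
  assumes \<kappa>: "0 < \<kappa>" "\<kappa> < 1/3" and Z0: "Z \<in> models0 \<kappa>" and \<epsilon>: "\<epsilon> > 0"
  shows "\<forall>\<^sub>F t in nhds 0. model_dist \<kappa> Z (time_translation t Z) < \<epsilon>"
proof -
  have Z: "Z \<in> models \<kappa>" using Z0 models0_subset by auto
  have e3: "\<epsilon> / 3 > 0" using \<epsilon> by simp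
  obtain \<delta> where \<delta>: "\<delta> > 0" "\<And>s Z Z' :: 'd model. \<bar>s\<bar> \<le> real 1 \<Longrightarrow> Z \<in> models \<kappa> \<Longrightarrow> Z' \<in> models \<kappa> \<Longrightarrow> model_dist \<kappa> Z Z' < \<delta> \<Longrightarrow>
    model_dist \<kappa> (time_translation s Z) (time_translation s Z') < \<epsilon> / 3"
    using time_translation_equicontinuous[OF e3] by blast
  have "min \<delta> (\<epsilon> / 3) > 0" using \<delta>(1) e3 by simp
  then obtain f g c where fg: "f \<in> C_torus" "g \<in> C1_torus" and M: "canonical_model f g c \<in> models \<kappa>" and d: "model_dist \<kappa> Z (canonical_model f g c) < min \<delta> (\<epsilon> / 3)"
    using Z0 unfolding models0_iff by blast
  define Y where "Y = canonical_model f g c"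
  have Y: "Y \<in> models \<kappa>" "model_dist \<kappa> Z Y < \<delta>" "model_dist \<kappa> Z Y < \<epsilon> / 3" using M d by (simp_all add: Y_def)
  have "\<forall>\<^sub>F t in nhds 0. dist t (0::real) < 1" unfolding eventually_nhds_metric by (intro exI[of _ 1]) auto
  moreover have "\<forall>\<^sub>F t in nhds 0. model_dist \<kappa> Y (time_translation t Y) < \<epsilon> / 3"
    unfolding Y_def by (rule canonical_translation_continuous[OF \<kappa> fg M e3])
  ultimately show ?thesis
  proof eventually_elim
    case (elim t)
    have tY: "time_translation t Y \<in> models \<kappa>" and tZ: "time_translation t Z \<in> models \<kappa>"
      by (rule time_translation_models(2)[OF Y(1)], rule time_translation_models(2)[OF Z])
    have "model_dist \<kappa> (time_translation t Z) (time_translation t Y) < \<epsilon> / 3"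
      using elim(1) by (intro \<delta>(2) Z Y) (simp add: dist_norm)
    then show ?case
      using model_dist_triangle[OF Z Y(1) tZ] model_dist_triangle[OF Y(1) tY tZ] Y(3) elim(2)
        model_dist_commute[of \<kappa> "time_translation t Y" "time_translation t Z"] by linarith
  qed
qed

lemma time_translation_continuous:
  fixes Z :: "('d::finite) model"
  assumes \<kappa>: "0 < \<kappa>" "\<kappa> < 1/3" and Z0: "Z \<in> models0 \<kappa>" and \<epsilon>: "\<epsilon> > 0"
    and s: "s \<longlonglongrightarrow> t"
  shows "\<forall>\<^sub>F n in sequentially. model_dist \<kappa> (time_translation t Z) (time_translation (s n) Z) < \<epsilon>"
proof -
  have Z: "Z \<in> models \<kappa>" using Z0 models0_subset by auto
  have "(\<lambda>n. s n - t) \<longlonglongrightarrow> 0" using s by (simp add: LIM_zero)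
  then have "\<forall>\<^sub>F n in sequentially. model_dist \<kappa> (time_translation t Z) (time_translation (s n - t) (time_translation t Z)) < \<epsilon>"
    by (rule eventually_compose_filterlim[OF time_translation_continuous_zero[OF \<kappa> time_translation_models0[OF Z0] \<epsilon>]])
  then show ?thesis unfolding time_translation_add[OF Z, symmetric] by simp
qed

lemma time_translation_measurable: "time_translation t \<in> measurable (borel_models0 \<kappa>) (borel_models0 \<kappa>)"
proof (rule measurable_borel_models0I)
  fix U :: "'a model set"
  assume U: "U \<subseteq> models0 \<kappa>" "\<And>x. x \<in> U \<Longrightarrow> \<exists>r>0. \<forall>y\<in>models0 \<kappa>. model_dist \<kappa> x y < r \<longrightarrow> y \<in> U"
  show "time_translation t -` U \<inter> space (borel_models0 \<kappa>) \<in> sets (borel_models0 \<kappa>)"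
    unfolding space_borel_models0
  proof (rule open_in_borel_models0)
    fix x :: "'a model" assume x: "x \<in> time_translation t -` U \<inter> models0 \<kappa>"
    then obtain r where r: "r > 0" "\<And>y. y \<in> models0 \<kappa> \<Longrightarrow> model_dist \<kappa> (time_translation t x) y < r \<Longrightarrow> y \<in> U" using U(2) by blast
    obtain \<delta> where \<delta>: "\<delta> > 0" "\<And>s Z Z' :: 'a model. \<bar>s\<bar> \<le> real (nat \<lceil>\<bar>t\<bar>\<rceil>) \<Longrightarrow> Z \<in> models \<kappa> \<Longrightarrow> Z' \<in> models \<kappa> \<Longrightarrow> model_dist \<kappa> Z Z' < \<delta> \<Longrightarrow>
      model_dist \<kappa> (time_translation s Z) (time_translation s Z') < r"
      using time_translation_equicontinuous[OF r(1)] by blast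
    have "y \<in> time_translation t -` U \<inter> models0 \<kappa>" if y: "y \<in> models0 \<kappa>" "model_dist \<kappa> x y < \<delta>" for y
    proof -
      have "model_dist \<kappa> (time_translation t x) (time_translation t y) < r"
        by (rule \<delta>(2)) (use x y models0_subset in \<open>auto intro: real_nat_ceiling_ge\<close>)
      then show ?thesis using r(2)[OF time_translation_models0[OF y(1)]] y(1) by simp
    qed
    then show "\<exists>r>0. \<forall>y\<in>models0 \<kappa>. model_dist \<kappa> x y < r \<longrightarrow> y \<in> time_translation t -` U \<inter> models0 \<kappa>" using \<delta>(1) by blast
  qed simp
qed (simp add: space_borel_models0 time_translation_models0)

text \<open>No separability is needed: an open set is a countable union of closed sets \<open>F m\<close>, and the limit
  of a sequence lies in it if and only if the sequence is eventually in one \<open>F m\<close>.\<close>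

lemma time_translation_jointly_measurable:
  assumes \<kappa>: "0 < \<kappa>" "\<kappa> < 1/3"
  shows "(\<lambda>(t, Z). time_translation t Z) \<in> measurable (borel \<Otimes>\<^sub>M borel_models0 \<kappa>) (borel_models0 \<kappa> :: ('d::finite) model measure)"
proof (rule measurable_borel_models0I)
  let ?P = "borel \<Otimes>\<^sub>M (borel_models0 \<kappa> :: 'd model measure)"
  have spP: "space ?P = UNIV \<times> models0 \<kappa>" by (simp add: space_pair_measure space_borel_models0)
  show "(case p of (t, Z) \<Rightarrow> time_translation t Z) \<in> models0 \<kappa>" if "p \<in> space ?P" for p
    using that unfolding spP by (cases p) (simp add: time_translation_models0)
  fix U :: "'d model set"
  assume U: "U \<subseteq> models0 \<kappa>" "\<And>x. x \<in> U \<Longrightarrow> \<exists>r>0. \<forall>y\<in>models0 \<kappa>. model_dist \<kappa> x y < r \<longrightarrow> y \<in> U"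
  \<comment> \<open>Times are rounded down to a grid, so that only countably many translations occur
    at stage \<open>n\<close> and the approximating map is measurable piece by piece.\<close>
  define s where "s n t = real_of_int \<lfloor>real (Suc n) * t\<rfloor> / real (Suc n)" for n t
  have s: "(\<lambda>n. s n t) \<longlonglongrightarrow> t" for t
  proof -
    have "\<bar>s n t - t\<bar> \<le> 1 / real (Suc n)" for n
    proof -
      have "s n t - t = (real_of_int \<lfloor>real (Suc n) * t\<rfloor> - real (Suc n) * t) / real (Suc n)" by (simp add: s_def field_simps)
      moreover have "\<bar>real_of_int \<lfloor>real (Suc n) * t\<rfloor> - real (Suc n) * t\<bar> \<le> 1" by linarith
      ultimately show ?thesis by (simp add: abs_divide divide_right_mono del: of_nat_Suc)
    qed
    then have "(\<lambda>n. s n t - t) \<longlonglongrightarrow> 0"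
      by (intro Lim_null_comparison[OF always_eventually LIMSEQ_inverse_real_of_nat]) (simp add: inverse_eq_divide)
    then show ?thesis by (simp add: LIM_zero_iff)
  qed
  \<comment> \<open>The points of \<open>models0\<close> whose ball of radius
    \<open>1 / Suc m\<close> stays in \<open>U\<close>. Keeping this margin prevents a limit of
    points of \<open>F m\<close> from leaving \<open>U\<close>.\<close>
  define F where "F m = {y \<in> models0 \<kappa>. \<forall>x\<in>models0 \<kappa>. model_dist \<kappa> y x < 1 / real (Suc m) \<longrightarrow> x \<in> U}" for m
  have F: "F m \<in> sets (borel_models0 \<kappa>)" for m
  proof -
    have "models0 \<kappa> - F m \<in> sets (borel_models0 \<kappa>)"
    proof (rule open_in_borel_models0)
      fix y assume "y \<in> models0 \<kappa> - F m"
      then obtain x where y: "y \<in> models0 \<kappa>" and x: "x \<in> models0 \<kappa>" "model_dist \<kappa> y x < 1 / real (Suc m)" "x \<notin> U" by (auto simp: F_def)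
      have "y' \<in> models0 \<kappa> - F m" if y': "y' \<in> models0 \<kappa>" "model_dist \<kappa> y y' < 1 / real (Suc m) - model_dist \<kappa> y x" for y'
      proof -
        have "model_dist \<kappa> y' x \<le> model_dist \<kappa> y' y + model_dist \<kappa> y x"
          using model_dist_triangle y y'(1) x(1) models0_subset by blast
        then have "model_dist \<kappa> y' x < 1 / real (Suc m)" using y'(2) model_dist_commute[of \<kappa> y y'] by linarith
        then show ?thesis using x y'(1) unfolding F_def by blast
      qed
      moreover have "1 / real (Suc m) - model_dist \<kappa> y x > 0" using x(2) by linarith
      ultimately show "\<exists>r>0. \<forall>y'\<in>models0 \<kappa>. model_dist \<kappa> y y' < r \<longrightarrow> y' \<in> models0 \<kappa> - F m" by blast
    qed simp
    then have "space (borel_models0 \<kappa>) - (models0 \<kappa> - F m) \<in> sets (borel_models0 \<kappa>)" by (rule sets.compl_sets)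
    moreover have "space (borel_models0 \<kappa>) - (models0 \<kappa> - F m) = F m" unfolding space_borel_models0 F_def by blast
    ultimately show ?thesis by simp
  qed
  have step: "(\<lambda>p. time_translation (s n (fst p)) (snd p)) \<in> measurable ?P (borel_models0 \<kappa>)" for n
  proof -
    have "(\<lambda>p. time_translation (real_of_int k / real (Suc n)) (snd p)) \<in> measurable ?P (borel_models0 \<kappa>)" for k
      by (rule measurable_compose[OF measurable_snd time_translation_measurable])
    moreover have "(\<lambda>p. \<lfloor>real (Suc n) * fst p\<rfloor>) \<in> measurable ?P (count_space UNIV)" by measurable
    ultimately show ?thesis unfolding s_def by (rule measurable_compose_countable)
  qed
  have "(\<lambda>p. time_translation (fst p) (snd p)) -` U \<inter> space ?P =
    (\<Union>m. \<Union>n0. \<Inter>n\<in>{n0..}. (\<lambda>p. time_translation (s n (fst p)) (snd p)) -` F m \<inter> space ?P)" (is "?L = ?R")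
  proof (rule set_eqI)
    fix p
    show "p \<in> ?L \<longleftrightarrow> p \<in> ?R"
    proof (cases "snd p \<in> models0 \<kappa>")
      case True
      define u where "u = time_translation (fst p) (snd p)"
      define y where "y n = time_translation (s n (fst p)) (snd p)" for n
      have u: "u \<in> models0 \<kappa>" and y: "y n \<in> models0 \<kappa>" for n using True by (simp_all add: u_def y_def time_translation_models0)
      have lim: "\<forall>\<^sub>F n in sequentially. model_dist \<kappa> u (y n) < \<epsilon>" if "\<epsilon> > 0" for \<epsilon>
        unfolding u_def y_def by (rule time_translation_continuous[OF \<kappa> True that s])
      have "u \<in> U \<longleftrightarrow> (\<exists>m n0. \<forall>n\<ge>n0. y n \<in> F m)"
      proof
        assume "u \<in> U"
        then obtain r where r: "r > 0" "\<And>x. x \<in> models0 \<kappa> \<Longrightarrow> model_dist \<kappa> u x < r \<Longrightarrow> x \<in> U" using U(2) by blast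
        obtain m where m: "1 / real (Suc m) < r / 2" using nat_approx_posE[of "r / 2"] r(1) by auto
        obtain n0 where n0: "\<And>n. n \<ge> n0 \<Longrightarrow> model_dist \<kappa> u (y n) < r / 2" using lim[of "r / 2"] r(1) unfolding eventually_sequentially by auto
        have "y n \<in> F m" if n: "n \<ge> n0" for n
          unfolding F_def
        proof (intro CollectI conjI ballI impI y)
          fix x assume x: "x \<in> models0 \<kappa>" "model_dist \<kappa> (y n) x < 1 / real (Suc m)"
          have "model_dist \<kappa> u x \<le> model_dist \<kappa> u (y n) + model_dist \<kappa> (y n) x"
            using model_dist_triangle u y x(1) models0_subset by blast
          then show "x \<in> U" using n0[OF n] x(2) m by (intro r(2)[OF x(1)]) linarith
        qed
        then show "\<exists>m n0. \<forall>n\<ge>n0. y n \<in> F m" by blast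
      next
        assume "\<exists>m n0. \<forall>n\<ge>n0. y n \<in> F m"
        then obtain m n0 where n0: "\<And>n. n \<ge> n0 \<Longrightarrow> y n \<in> F m" by blast
        have "0 < 1 / real (Suc m)" by simp
        then obtain n1 where n1: "\<And>n. n \<ge> n1 \<Longrightarrow> model_dist \<kappa> u (y n) < 1 / real (Suc m)" using lim unfolding eventually_sequentially by meson
        have "model_dist \<kappa> (y (max n0 n1)) u < 1 / real (Suc m)" using n1[of "max n0 n1"] model_dist_commute[of \<kappa> u "y (max n0 n1)"] by simp
        then show "u \<in> U" using n0[of "max n0 n1"] u unfolding F_def by simp
      qed
      moreover have "p \<in> space ?P" using True by (simp add: spP mem_Times_iff)
      moreover have "(\<forall>n\<ge>n0. y n \<in> F m) \<longleftrightarrow> (\<forall>n\<in>{n0..}. y n \<in> F m)" for n0 m by auto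
      ultimately show ?thesis by (simp add: u_def y_def)
    qed (auto simp: spP mem_Times_iff)
  qed
  moreover have "?R \<in> sets ?P"
    by (intro sets.countable_UN'' sets.countable_INT' image_subsetI measurable_sets[OF step F]) auto
  ultimately show "(\<lambda>(t, Z). time_translation t Z) -` U \<inter> space ?P \<in> sets ?P" unfolding case_prod_beta' by simp
qed

section \<open>Measurability of evaluations\<close>

lemma evaluation_lattice:
  assumes "Z \<in> models \<kappa>"
  shows "fst Z (z + (0, lattice_vec k)) \<tau> (rescale 1 (z + (0, lattice_vec k)) \<phi>) = fst Z z \<tau> (rescale 1 z \<phi>)"
proof -
  have "rescale 1 (z + (0, lattice_vec k)) \<phi> = (\<lambda>w. rescale 1 z \<phi> (w - (0, lattice_vec k)))"
    unfolding rescale_1 by (simp add: algebra_simps)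
  then show ?thesis using is_modelD(9)[OF assms[unfolded models_iff]] by simp
qed

text \<open>The metric controls base points in the boxes only, so the base point is first moved into
  a box along the lattice. There the evaluation is continuous.\<close>

lemma evaluation_measurable:
  fixes z :: "('d::finite) spacetime"
  assumes \<phi>: "\<phi> \<in> unit_tests"
  shows "(\<lambda>Z. fst Z z (bas a) (rescale 1 z \<phi>)) \<in> borel_measurable (borel_models0 \<kappa>)"
proof -
  obtain k where k: "cell_rep (snd z) = snd z + lattice_vec k" using cell_rep_lattice by blast
  define z' where "z' = z + (0, lattice_vec k)"
  define n where "n = nat \<lceil>\<bar>fst z\<bar>\<rceil>"
  have z': "z' \<in> model_box (Suc n)"
  proof -
    have "\<bar>fst z\<bar> \<le> real n" unfolding n_def by (rule real_nat_ceiling_ge)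
    then show ?thesis using cell_rep_in_cell[of "snd z"] k by (simp add: z'_def model_box_def mem_Times_iff abs_le_iff)
  qed
  let ?v = "\<lambda>Z :: 'd model. fst Z z' (bas a) (rescale 1 z' \<phi>)"
  have "?v \<in> borel_measurable (borel_models0 \<kappa>)"
  proof (rule borel_measurableI)
    fix S :: "real set" assume S: "open S"
    show "?v -` S \<inter> space (borel_models0 \<kappa>) \<in> sets (borel_models0 \<kappa>)"
      unfolding space_borel_models0
    proof (rule open_in_borel_models0)
      fix x assume x: "x \<in> ?v -` S \<inter> models0 \<kappa>"
      then obtain \<epsilon> where \<epsilon>: "\<epsilon> > 0" "\<And>r. \<bar>r - ?v x\<bar> < \<epsilon> \<Longrightarrow> r \<in> S" using S unfolding open_dist by (auto simp: dist_norm)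
      obtain \<delta> where \<delta>: "\<delta> > 0" "\<And>Z Z' :: 'd model. model_dist \<kappa> Z Z' < \<delta> \<Longrightarrow> box_diff \<kappa> n Z Z' < \<epsilon>"
        using box_diff_small[OF \<epsilon>(1)] by blast
      have "y \<in> ?v -` S \<inter> models0 \<kappa>" if y: "y \<in> models0 \<kappa>" "model_dist \<kappa> x y < \<delta>" for y
      proof -
        have xy: "x \<in> models \<kappa>" "y \<in> models \<kappa>" using x y(1) models0_subset by auto
        have "ennreal \<bar>?v x - ?v y\<bar> \<le> ennreal (box_diff \<kappa> n x y)"
          unfolding box_diff_ennreal[OF xy] by (rule model_diff_eval[OF \<phi> z'])
        then have "\<bar>?v x - ?v y\<bar> \<le> box_diff \<kappa> n x y" by (simp add: ennreal_le_iff box_diff_nonneg)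
        then have "\<bar>?v y - ?v x\<bar> < \<epsilon>" using \<delta>(2)[OF y(2)] by linarith
        then show ?thesis using \<epsilon>(2) y(1) by simp
      qed
      then show "\<exists>r>0. \<forall>y\<in>models0 \<kappa>. model_dist \<kappa> x y < r \<longrightarrow> y \<in> ?v -` S \<inter> models0 \<kappa>" using \<delta>(1) by blast
    qed simp
  qed
  moreover have "?v Z = fst Z z (bas a) (rescale 1 z \<phi>)" if "Z \<in> space (borel_models0 \<kappa>)" for Z :: "'d model"
    using that models0_subset unfolding z'_def space_borel_models0 by (intro evaluation_lattice) auto
  ultimately show ?thesis by (simp cong: measurable_cong)
qed

section \<open>The limiting model intertwines the two flows\<close>

lemma mollifier_L2:
  fixes \<rho> :: "('d::finite) spacetime \<Rightarrow> real"
  assumes \<rho>: "mollifier \<rho>" and \<epsilon>: "\<epsilon> > 0"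
  shows "periodize (rescale \<epsilon> z \<rho>) \<in> L2_time_torus"
proof -
  have c: "continuous_on UNIV \<rho>" using \<rho> unfolding mollifier_def smooth_on_def by (blast intro: Ck_on_continuous)
  have b: "0 \<le> \<rho> w" "\<rho> w \<le> 2" for w using \<rho> unfolding mollifier_def by blast+
  obtain C where C: "compact C" "\<And>w. w \<notin> C \<Longrightarrow> \<rho> w = 0" using \<rho> unfolding mollifier_def by blast
  obtain B where B: "B > 0" "\<And>w. w \<in> C \<Longrightarrow> norm w \<le> B" using compact_imp_bounded[OF C(1)] unfolding bounded_pos by blast
  show ?thesis
  proof (rule periodize_L2)
    show "continuous_on UNIV (rescale \<epsilon> z \<rho>)"
      unfolding rescale_def[abs_def] using \<epsilon> by (intro continuous_intros continuous_on_compose2[OF c]) auto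
    show "rescale \<epsilon> z \<rho> w = 0" if w: "norm z + B * \<epsilon>\<^sup>2 + B * \<epsilon> < norm w" for w
    proof -
      define u where "u = ((fst w - fst z) / \<epsilon>\<^sup>2, (snd w - snd z) /\<^sub>R \<epsilon>)"
      have "u \<notin> C"
      proof
        assume "u \<in> C"
        then have "norm u \<le> B" by (rule B(2))
        then have "\<bar>fst u\<bar> \<le> B" "norm (snd u) \<le> B"
          using norm_fst_le[of "fst u" "snd u"] norm_snd_le[of "snd u" "fst u"] by auto
        then have "\<bar>fst w - fst z\<bar> \<le> B * \<epsilon>\<^sup>2" "norm (snd w - snd z) \<le> B * \<epsilon>"
          using \<epsilon> by (simp_all add: u_def abs_divide divide_le_eq inverse_eq_divide)
        then have "norm (w - z) \<le> B * \<epsilon>\<^sup>2 + B * \<epsilon>" using norm_spacetime_le[of "w - z"] by simp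
        then show False using w norm_triangle_ineq2[of w z] by linarith
      qed
      then show ?thesis using C(2) by (simp add: rescale_def u_def)
    qed
    show "\<bar>rescale \<epsilon> z \<rho> w\<bar> \<le> 2 / \<epsilon> ^ (CARD('d) + 2)" for w
      unfolding rescale_def using b \<epsilon> by (simp add: abs_divide divide_right_mono)
  qed
qed

lemma delay_mollifier: "delay a (periodize (rescale \<epsilon> z \<rho>)) = periodize (rescale \<epsilon> (z + (a, 0)) \<rho>)"
  by (simp add: fun_eq_iff delay_def periodize_def rescale_def algebra_simps)

text \<open>For a single \<open>z\<close> the identity is the intertwining of
  \<open>noise_delay\<close> with a delayed mollifier. A countable dense set of points and
  continuity of both sides then give one null set that serves all \<open>z\<close>.\<close>

lemma noise_shift:
  fixes \<xi> :: "(nat \<Rightarrow> real) \<Rightarrow> ('d::finite) spacetime \<Rightarrow> real" and e :: "nat \<Rightarrow> 'h::{real_inner,complete_space}"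
  assumes \<rho>: "mollifier \<rho>" and \<epsilon>: "\<epsilon> > 0" and \<xi>: "mollified_noise \<iota> e \<rho> K \<epsilon> \<xi> N"
    and nd: "noise_delay \<iota> e a T"
  shows "AE \<omega> in gauss_space. \<omega> \<notin> N \<and> T \<omega> \<notin> N \<and> \<xi> (T \<omega>) = advance a (\<xi> \<omega>)"
proof -
  note T = noise_delayD(1,2)[OF nd]
  have wn: "\<And>z. is_white_noise_integral e (\<iota> (periodize (rescale \<epsilon> z \<rho>))) (\<lambda>\<omega>. \<xi> \<omega> z)"
    and N: "N \<in> null_sets gauss_space" and reg: "\<And>\<omega>. \<omega> \<notin> N \<Longrightarrow> \<xi> \<omega> \<in> C_torus"
    using \<xi> unfolding mollified_noise_def by blast+
  obtain D :: "'d spacetime set" where D: "countable D" "closure D = UNIV"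
    using separable[of "UNIV :: 'd spacetime set"] by (metis top.extremum_uniqueI)
  have AN: "AE \<omega> in gauss_space. \<omega> \<notin> N" by (rule AE_not_in[OF N])
  have AT: "AE \<omega> in gauss_space. T \<omega> \<notin> N" using AE_distrD[OF T(1), of "\<lambda>\<omega>. \<omega> \<notin> N"] AN unfolding T(2) by blast
  have "AE \<omega> in gauss_space. \<xi> (T \<omega>) z = \<xi> \<omega> (z + (a, 0))" for z
    by (rule noise_delayD(3)[OF nd mollifier_L2[OF \<rho> \<epsilon>] wn]) (unfold delay_mollifier, rule wn)
  then have "AE \<omega> in gauss_space. \<forall>z\<in>D. \<xi> (T \<omega>) z = \<xi> \<omega> (z + (a, 0))" using D(1) by (simp add: AE_ball_countable)
  then show ?thesis using AN AT
  proof eventually_elim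
    case (elim \<omega>)
    have c: "continuous_on UNIV (\<xi> (T \<omega>))" "continuous_on UNIV (advance a (\<xi> \<omega>))"
      using reg[OF elim(3)] advance_torus[OF reg[OF elim(2)]] by (simp_all add: C_torus_def)
    have "closed {z. \<xi> (T \<omega>) z = advance a (\<xi> \<omega>) z}" by (rule closed_Collect_eq[OF c])
    moreover have "D \<subseteq> {z. \<xi> (T \<omega>) z = advance a (\<xi> \<omega>) z}" using elim(1) by (auto simp: advance_def)
    ultimately have "UNIV \<subseteq> {z. \<xi> (T \<omega>) z = advance a (\<xi> \<omega>) z}" unfolding D(2)[symmetric] by (intro closure_minimal)
    then show ?case using elim(2,3) by auto
  qed
qed

lemma singular_kernel_measurable:
  assumes "singular_kernel \<gamma> K"
  shows "K \<in> borel_measurable borel"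
proof -
  have "Ck_on 0 K (- {0})" using assms unfolding singular_kernel_def smooth_on_def by blast
  then show ?thesis by (intro borel_measurable_continuous_countable_exceptions[of "{0}"]) auto
qed

lemma convolve_advance:
  assumes [measurable]: "K \<in> borel_measurable borel" "f \<in> borel_measurable borel"
  shows "convolve K (advance a f) = advance a (convolve K f)"
proof
  fix z
  have "convolve K (advance a f) z = (LINT w|lborel. (\<lambda>w. K (z + (a, 0) - w) * f w) (w + (a, 0)))"
    unfolding convolve_def advance_def by simp
  also have "\<dots> = (LINT w|lborel. K (z + (a, 0) - w) * f w)" by (rule lborel_integral_translate) measurable
  finally show "convolve K (advance a f) z = advance a (convolve K f) z" by (simp add: convolve_def advance_def)
qed

text \<open>The renormalisation constant does not depend on \<omega> and hence is the same on both
  sides, while convolution with \<open>K\<close> commutes with the time shift.\<close>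

lemma approx_model_shift:
  fixes \<xi> :: "(nat \<Rightarrow> real) \<Rightarrow> ('d::finite) spacetime \<Rightarrow> real" and e :: "nat \<Rightarrow> 'h::{real_inner,complete_space}"
  assumes \<rho>: "mollifier \<rho>" and \<epsilon>: "\<epsilon> > 0" and \<xi>: "mollified_noise \<iota> e \<rho> K \<epsilon> \<xi> N" and K: "K \<in> borel_measurable borel"
    and nd: "noise_delay \<iota> e a T"
  shows "AE \<omega> in gauss_space. approx_model K \<xi> N (T \<omega>) = time_translation a (approx_model K \<xi> N \<omega>)"
  using noise_shift[OF \<rho> \<epsilon> \<xi> nd]
proof eventually_elim
  case (elim \<omega>)
  have c: "continuous_on UNIV (\<xi> \<omega>)" "continuous_on UNIV (convolve K (\<xi> \<omega>))"
    using \<xi> elim C1_torusD(3) unfolding mollified_noise_def C_torus_def by blast+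
  have "\<xi> \<omega> \<in> borel_measurable borel" using c(1) by (rule borel_measurable_continuous_onI)
  then show ?case using elim by (simp add: approx_model_def time_translation_canonical[OF c] convolve_advance[OF K])
qed

text \<open>Continuous paths make the noise jointly measurable in \<omega> and the space-time point.
  The convolution and the pairing with the test are then parameter integrals, measurable by
  Fubini.\<close>

lemma approx_model_measurable:
  fixes \<xi> :: "(nat \<Rightarrow> real) \<Rightarrow> ('d::finite) spacetime \<Rightarrow> real" and e :: "nat \<Rightarrow> 'h::{real_inner,complete_space}"
  assumes \<xi>: "mollified_noise \<iota> e \<rho> K \<epsilon> \<xi> N" and K [measurable]: "K \<in> borel_measurable borel" and \<phi>: "\<phi> \<in> test_functions"
  shows "(\<lambda>\<omega>. fst (approx_model K \<xi> N \<omega>) z (bas a) \<phi>) \<in> borel_measurable gauss_space"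
proof -
  have wn: "\<And>z. (\<lambda>\<omega>. \<xi> \<omega> z) \<in> borel_measurable gauss_space"
    and N: "N \<in> sets gauss_space" and reg: "\<And>\<omega>. \<omega> \<notin> N \<Longrightarrow> \<xi> \<omega> \<in> C_torus"
    using \<xi> unfolding mollified_noise_def is_white_noise_integral_def null_sets_def by blast+
  \<comment> \<open>Setting the noise to 0 on the exceptional set makes every path continuous, as
    the Caratheodory argument demands; the value of the model there is put back at the end.\<close>
  define x where "x \<omega> w = (if \<omega> \<in> N then 0 else \<xi> \<omega> w)" for \<omega> w
  have xm: "(\<lambda>\<omega>. x \<omega> w) \<in> borel_measurable gauss_space" for w
    unfolding x_def by (rule measurable_If_set) (use wn N in auto)
  have xc: "continuous_on UNIV (x \<omega>)" for \<omega>
    unfolding x_def using reg[of \<omega>] by (cases "\<omega> \<in> N") (auto simp: C_torus_def)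
  have x [measurable]: "(\<lambda>p. x (fst p) (snd p)) \<in> borel_measurable (gauss_space \<Otimes>\<^sub>M borel)"
    using caratheodory_measurable[OF xm xc] by (simp add: case_prod_beta')
  have y [measurable]: "(\<lambda>p. convolve K (x (fst p)) (snd p)) \<in> borel_measurable (gauss_space \<Otimes>\<^sub>M borel)"
    unfolding convolve_def
  proof (rule lborel.borel_measurable_lebesgue_integral)
    have "(\<lambda>q. x (fst (fst q)) (snd q)) \<in> borel_measurable ((gauss_space \<Otimes>\<^sub>M borel) \<Otimes>\<^sub>M lborel)"
      by (rule measurable_compose[of "\<lambda>q. (fst (fst q), snd q)", OF _ x, simplified]) measurable
    then show "(\<lambda>(p, w). K (snd p - w) * x (fst p) w) \<in> borel_measurable ((gauss_space \<Otimes>\<^sub>M borel) \<Otimes>\<^sub>M lborel)"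
      unfolding case_prod_beta' by measurable
  qed
  define c where "c = renorm_const K \<xi> N"
  have yz: "(\<lambda>p. convolve K (x (fst p)) z) \<in> borel_measurable (gauss_space \<Otimes>\<^sub>M lborel)" for z
    by (rule measurable_compose[of "\<lambda>p. (fst p, z)", OF _ y, simplified]) measurable
  have xl: "(\<lambda>p. x (fst p) (snd p)) \<in> borel_measurable (gauss_space \<Otimes>\<^sub>M lborel)"
    and yl: "(\<lambda>p. convolve K (x (fst p)) (snd p)) \<in> borel_measurable (gauss_space \<Otimes>\<^sub>M lborel)"
    using x y by (simp_all cong: measurable_cong_sets sets_pair_measure_cong)
  have cl: "(\<lambda>p. snd (snd p) $ i) \<in> borel_measurable (gauss_space \<Otimes>\<^sub>M (lborel :: 'd spacetime measure))" for i
    by (rule measurable_compose[OF measurable_snd]) (simp, intro borel_measurable_continuous_onI continuous_intros)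
  have \<phi>l: "(\<lambda>p. \<phi> (snd p)) \<in> borel_measurable (gauss_space \<Otimes>\<^sub>M lborel)"
    by (rule measurable_compose[OF measurable_snd]) (simp add: test_measurable[OF \<phi>])
  have "(\<lambda>p. canonical_fun (x (fst p)) (convolve K (x (fst p))) c z a (snd p)) \<in> borel_measurable (gauss_space \<Otimes>\<^sub>M lborel)"
    by (cases a) (auto intro!: borel_measurable_times borel_measurable_diff xl yl yz cl)
  then have m: "(\<lambda>\<omega>. LINT w|lborel. canonical_fun (x \<omega>) (convolve K (x \<omega>)) c z a w * \<phi> w) \<in> borel_measurable gauss_space"
    by (intro lborel.borel_measurable_lebesgue_integral) (auto simp: case_prod_beta' intro!: borel_measurable_times \<phi>l)
  have "fst (approx_model K \<xi> N \<omega>) z (bas a) \<phi> = (if \<omega> \<in> N then fst (canonical_model (\<lambda>_. 0) (\<lambda>_. 0) 0) z (bas a) \<phi>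
     else LINT w|lborel. canonical_fun (x \<omega>) (convolve K (x \<omega>)) c z a w * \<phi> w)" for \<omega>
    using \<phi> by (simp add: approx_model_def canonical_model_fst of_fun_def x_def[abs_def] c_def)
  then show ?thesis by (simp only:) (rule measurable_If_set, use m N in auto)
qed

lemma evaluation_translation:
  "fst (time_translation a Z) z \<tau> (rescale 1 z \<phi>) = fst Z (z + (a, 0)) \<tau> (rescale 1 (z + (a, 0)) \<phi>)"
  by (simp add: time_translation_def Let_def time_shift_def rescale_shift)

lemma limiting_model_translation:
  fixes Z :: "(nat \<Rightarrow> real) \<Rightarrow> ('d::finite) model" and e :: "nat \<Rightarrow> 'h::{real_inner,complete_space}"
  assumes \<rho>: "mollifier \<rho>" and \<xi>: "\<And>\<epsilon>. \<epsilon> > 0 \<Longrightarrow> mollified_noise \<iota> e \<rho> K \<epsilon> (\<xi> \<epsilon>) (N \<epsilon>)" and K: "singular_kernel \<gamma> K"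
    and Z: "limiting_model \<kappa> K \<xi> N Z"
    and nd: "noise_delay \<iota> e a T"
  shows "AE \<omega> in gauss_space. Z (T \<omega>) = time_translation a (Z \<omega>)"
proof -
  note T = noise_delayD(1,2)[OF nd]
  have Zm: "Z \<in> measurable gauss_space (borel_models0 \<kappa>)" using Z unfolding limiting_model_def by blast
  have Km: "K \<in> borel_measurable borel" by (rule singular_kernel_measurable[OF K])
  have Z0: "Z \<omega> \<in> models \<kappa>" for \<omega>
    using measurable_space[OF Zm, of \<omega>] models0_subset by (auto simp: space_borel_models0 space_gauss_space)
  define ev where "ev z b \<phi> Y = fst Y z (bas b) (rescale 1 z \<phi>)" for z b \<phi> and Y :: "'d model"
  have ev: "AE \<omega> in gauss_space. ev z b \<phi> (Z (T \<omega>)) = ev z b \<phi> (time_translation a (Z \<omega>))" if \<phi>: "\<phi> \<in> unit_tests" for z b \<phi>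
  proof -
    define X where "X \<epsilon> = approx_model K (\<xi> \<epsilon>) (N \<epsilon>)" for \<epsilon>
    define z' where "z' = z + (a, 0)"
    have \<phi>t: "rescale 1 w \<phi> \<in> test_functions" for w using \<phi> rescale_test[of \<phi> 1 w] unfolding unit_tests_def by auto
    have Xm: "(\<lambda>\<omega>. ev w b \<phi> (X \<epsilon> \<omega>)) \<in> borel_measurable gauss_space" if "\<epsilon> > 0" for \<epsilon> w
      unfolding ev_def X_def by (rule approx_model_measurable[OF \<xi>[OF that] Km \<phi>t])
    have Zev: "(\<lambda>\<omega>. ev w b \<phi> (Z \<omega>)) \<in> borel_measurable gauss_space" for w
      unfolding ev_def by (rule measurable_compose[OF Zm evaluation_measurable[OF \<phi>]])
    define I where "I w \<epsilon> = (\<integral>\<^sup>+\<omega>. ennreal \<bar>ev w b \<phi> (X \<epsilon> \<omega>) - ev w b \<phi> (Z \<omega>)\<bar> \<partial>gauss_space)" for w \<epsilon>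
    have I0: "(I w \<longlongrightarrow> 0) (at_right 0)" for w
    proof (rule tendsto_sandwich[OF _ _ tendsto_const])
      \<comment> \<open>A one-point set is compact, and the model distance over it already dominates
        every unit-scale evaluation at that point.\<close>
      show "((\<lambda>\<epsilon>. \<integral>\<^sup>+\<omega>. model_diff \<kappa> {w} (X \<epsilon> \<omega>) (Z \<omega>) \<partial>gauss_space) \<longlongrightarrow> 0) (at_right 0)"
        using Z unfolding limiting_model_def X_def by (elim conjE allE[of _ "{w}"]) simp
      show "\<forall>\<^sub>F \<epsilon> in at_right 0. I w \<epsilon> \<le> (\<integral>\<^sup>+\<omega>. model_diff \<kappa> {w} (X \<epsilon> \<omega>) (Z \<omega>) \<partial>gauss_space)"
        unfolding I_def ev_def by (intro always_eventually allI nn_integral_mono model_diff_eval \<phi>) simp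
    qed simp
    \<comment> \<open>\<open>J\<close> does not depend on the mollification. The triangle inequality
      through the approximating models, which are intertwined almost surely, bounds it by two errors
      that tend to 0, one of them transported by the measure preserving \<open>T\<close>.\<close>
    define J where "J = (\<integral>\<^sup>+\<omega>. ennreal \<bar>ev z b \<phi> (Z (T \<omega>)) - ev z' b \<phi> (Z \<omega>)\<bar> \<partial>gauss_space)"
    have le: "J \<le> I z \<epsilon> + I z' \<epsilon>" if \<epsilon>: "\<epsilon> > 0" for \<epsilon>
    proof -
      have "J \<le> (\<integral>\<^sup>+\<omega>. ennreal \<bar>ev z b \<phi> (X \<epsilon> (T \<omega>)) - ev z b \<phi> (Z (T \<omega>))\<bar> + ennreal \<bar>ev z' b \<phi> (X \<epsilon> \<omega>) - ev z' b \<phi> (Z \<omega>)\<bar> \<partial>gauss_space)"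
        unfolding J_def
      proof (rule nn_integral_mono_AE, use approx_model_shift[OF \<rho> \<epsilon> \<xi>[OF \<epsilon>] Km nd] in eventually_elim)
        case (elim \<omega>)
        have "ev z b \<phi> (X \<epsilon> (T \<omega>)) = ev z' b \<phi> (X \<epsilon> \<omega>)" using elim by (simp add: ev_def X_def z'_def evaluation_translation)
        then show ?case unfolding ennreal_plus[OF abs_ge_zero abs_ge_zero, symmetric] by (intro ennreal_leI) linarith
      qed
      also have "\<dots> = (\<integral>\<^sup>+\<omega>. ennreal \<bar>ev z b \<phi> (X \<epsilon> (T \<omega>)) - ev z b \<phi> (Z (T \<omega>))\<bar> \<partial>gauss_space) + I z' \<epsilon>"
        unfolding I_def
        by (intro nn_integral_add measurable_compose[OF _ measurable_ennreal] borel_measurable_abs borel_measurable_diff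
            measurable_compose[OF T(1) Xm[OF \<epsilon>]] measurable_compose[OF T(1) Zev] Xm[OF \<epsilon>] Zev)
      also have "(\<integral>\<^sup>+\<omega>. ennreal \<bar>ev z b \<phi> (X \<epsilon> (T \<omega>)) - ev z b \<phi> (Z (T \<omega>))\<bar> \<partial>gauss_space) = I z \<epsilon>"
      proof -
        have "(\<lambda>\<omega>. ennreal \<bar>ev z b \<phi> (X \<epsilon> \<omega>) - ev z b \<phi> (Z \<omega>)\<bar>) \<in> borel_measurable gauss_space"
          by (intro measurable_compose[OF _ measurable_ennreal] borel_measurable_abs borel_measurable_diff Xm[OF \<epsilon>] Zev)
        then have "(\<integral>\<^sup>+\<omega>. ennreal \<bar>ev z b \<phi> (X \<epsilon> \<omega>) - ev z b \<phi> (Z \<omega>)\<bar> \<partial>distr gauss_space gauss_space T) =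
          (\<integral>\<^sup>+\<omega>. ennreal \<bar>ev z b \<phi> (X \<epsilon> (T \<omega>)) - ev z b \<phi> (Z (T \<omega>))\<bar> \<partial>gauss_space)"
          by (intro nn_integral_distr T(1)) simp
        then show ?thesis unfolding T(2) I_def by simp
      qed
      finally show ?thesis .
    qed
    have "((\<lambda>\<epsilon>. I z \<epsilon> + I z' \<epsilon>) \<longlongrightarrow> 0 + 0) (at_right 0)" by (intro tendsto_add I0)
    then have "J \<le> 0 + 0"
      by (rule tendsto_lowerbound) (auto simp: eventually_at_right_less intro!: eventually_mono[OF eventually_at_right_less[of 0]] le)
    then have J0: "J = 0" by simp
    have "AE \<omega> in gauss_space. ennreal \<bar>ev z b \<phi> (Z (T \<omega>)) - ev z' b \<phi> (Z \<omega>)\<bar> = 0"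
      using J0 unfolding J_def
      by (subst (asm) nn_integral_0_iff_AE)
        (auto intro!: measurable_compose[OF _ measurable_ennreal] borel_measurable_abs borel_measurable_diff measurable_compose[OF T(1) Zev] Zev)
    then show ?thesis by eventually_elim (simp add: ev_def z'_def evaluation_translation)
  qed
  \<comment> \<open>Countably many base points, tests and symbols leave a single null set. Off it,
    density in the tests extends the equality at each base point of \<open>D\<close> to all unit
    tests, and then \<open>model_eqI\<close> identifies the models.\<close>
  obtain D :: "'d spacetime set" where D: "countable D" "closure D = UNIV"
    using separable[of "UNIV :: 'd spacetime set"] by (metis top.extremum_uniqueI)
  obtain E :: "('d spacetime \<Rightarrow> real) set" where E: "countable E" "E \<subseteq> unit_tests"
    "\<And>\<phi> \<delta>. \<phi> \<in> unit_tests \<Longrightarrow> \<delta> > 0 \<Longrightarrow> \<exists>\<psi>\<in>E. C2_norm (\<lambda>w. \<phi> w - \<psi> w) \<le> \<delta>"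
    using unit_tests_separable by blast
  have "AE \<omega> in gauss_space. \<forall>z\<in>D. \<forall>\<phi>\<in>E. \<forall>b\<in>UNIV. ev z b \<phi> (Z (T \<omega>)) = ev z b \<phi> (time_translation a (Z \<omega>))"
    by (intro AE_ball_countable[OF D(1), THEN iffD2] AE_ball_countable[OF E(1), THEN iffD2] AE_ball_countable[OF countable_finite[OF finite], THEN iffD2] ballI)
      (rule ev, use E(2) in blast)
  then show ?thesis
  proof eventually_elim
    case (elim \<omega>)
    have M: "is_model \<kappa> (fst (Z (T \<omega>)), snd (Z (T \<omega>)))" "is_model \<kappa> (fst (time_translation a (Z \<omega>)), snd (time_translation a (Z \<omega>)))"
      using Z0 time_translation_models(2)[OF Z0] unfolding models_iff by blast+
    have "(fst (Z (T \<omega>)), snd (Z (T \<omega>))) = (fst (time_translation a (Z \<omega>)), snd (time_translation a (Z \<omega>)))"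
    proof (rule model_eqI[OF M D(2)])
      fix z b and \<phi> :: "'d spacetime \<Rightarrow> real" assume z: "z \<in> D" and \<phi>: "\<phi> \<in> unit_tests"
      show "fst (Z (T \<omega>)) z (bas b) (rescale 1 z \<phi>) = fst (time_translation a (Z \<omega>)) z (bas b) (rescale 1 z \<phi>)"
        by (rule distributions_agree_dense[OF is_modelD(1)[OF M(1)] is_modelD(1)[OF M(2)] E(2,3) _ \<phi>])
          (use elim z in \<open>auto simp: ev_def\<close>)
    qed
    then show ?case by simp
  qed
qed

theorem theorem27:
  fixes \<kappa> \<gamma>\<^sub>1 \<beta> :: real
    and Q :: "(real ^ ('d::finite) \<Rightarrow> complex) \<Rightarrow> (real ^ 'd \<Rightarrow> complex)"
    and q :: "int ^ 'd \<Rightarrow> real"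
    and \<iota> :: "('d spacetime \<Rightarrow> real) \<Rightarrow> 'h::{real_inner,complete_space}"
    and e :: "nat \<Rightarrow> 'h"
    and \<rho> K :: "'d spacetime \<Rightarrow> real"
    and \<xi> :: "real \<Rightarrow> (nat \<Rightarrow> real) \<Rightarrow> 'd spacetime \<Rightarrow> real"
    and N :: "real \<Rightarrow> (nat \<Rightarrow> real) set"
    and \<Z> :: "(nat \<Rightarrow> real) \<Rightarrow> 'd model"
  assumes "0 < \<kappa>" "\<kappa> < 1/3" "1 + \<kappa> < \<gamma>\<^sub>1" "\<gamma>\<^sub>1 < 2 - 2 * \<kappa>"
    and "0 < \<beta>" "\<beta> < real CARD('d) / 2" "\<beta> - real CARD('d) / 2 > - \<kappa>"
    and "covariance_operator Q q \<beta>"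
    and "is_Q_completion Q \<iota>"
    and "orthonormal_basis e"
    and "mollifier \<rho>"
    and "singular_kernel \<gamma>\<^sub>1 K"
    and "\<And>\<epsilon>. \<epsilon> > 0 \<Longrightarrow> mollified_noise \<iota> e \<rho> K \<epsilon> (\<xi> \<epsilon>) (N \<epsilon>)"
    and "limiting_model \<kappa> K \<xi> N \<Z>"
  shows "ergodic_mds (distr gauss_space (borel_models0 \<kappa>) \<Z>) time_translation"
proof -
  have Zm: "\<Z> \<in> measurable gauss_space (borel_models0 \<kappa>)" using assms(14) unfolding limiting_model_def by blast
  define M where "M = distr gauss_space (borel_models0 \<kappa>) \<Z>"
  have spM: "space M = models0 \<kappa>" and seM [measurable_cong]: "sets M = sets (borel_models0 \<kappa>)"
    by (simp_all add: M_def space_borel_models0)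
  have Z0: "\<Z> \<omega> \<in> models0 \<kappa>" for \<omega>
    using measurable_space[OF Zm, of \<omega>] by (simp add: space_borel_models0 space_gauss_space)
  have ZM: "\<Z> \<in> measurable gauss_space M" using Zm seM by (simp cong: measurable_cong_sets)
  have TM: "time_translation t \<in> measurable M M" for t
    using time_translation_measurable[of t \<kappa>, where 'a='d] seM by (simp cong: measurable_cong_sets)
  obtain \<theta> where nd: "\<And>a. noise_delay \<iota> e a (\<theta> a)"
    and zero_one: "\<And>B. B \<in> sets gauss_space \<Longrightarrow> (\<And>a. AE \<omega> in gauss_space. \<theta> a \<omega> \<in> B \<longleftrightarrow> \<omega> \<in> B) \<Longrightarrow> measure gauss_space B \<in> {0, 1}"
    using noise_flow[OF assms(8-10)] by blast
  note \<theta> = noise_delayD(1,2)[OF nd]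
  have twist: "AE \<omega> in gauss_space. \<Z> (\<theta> a \<omega>) = time_translation a (\<Z> \<omega>)" for a
    by (rule limiting_model_translation[OF assms(11,13,12,14) nd])
  have invariant: "distr M M (time_translation t) = M" for t
  proof -
    have "distr M M (time_translation t) = distr gauss_space M (time_translation t \<circ> \<Z>)"
      unfolding M_def by (rule distr_distr) (use TM Zm in \<open>simp_all add: M_def\<close>)
    also have "\<dots> = distr gauss_space M (\<Z> \<circ> \<theta> t)"
      by (rule distr_cong_AE) (use twist[of t] in \<open>auto intro: measurable_comp[OF ZM TM] measurable_comp[OF \<theta>(1) ZM]\<close>)
    also have "\<dots> = distr (distr gauss_space gauss_space (\<theta> t)) M \<Z>"
      by (rule distr_distr[symmetric, OF ZM \<theta>(1)])
    also have "\<dots> = M" unfolding \<theta>(2) by (subst (2) M_def) (rule distr_cong, simp_all add: seM)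
    finally show ?thesis .
  qed
  \<comment> \<open>The group law is demanded at every point of the space. On models it holds
    exactly, and this is why the system is formed there and not from the maps on the Gaussian
    space.\<close>
  have "metric_dynamical_system M time_translation"
    unfolding metric_dynamical_system_def spM
  proof (intro conjI allI ballI invariant)
    show "prob_space M" unfolding M_def by (rule gauss.prob_space_distr[OF Zm])
    show "time_translation 0 Z = Z" if "Z \<in> models0 \<kappa>" for Z :: "'d model"
      using that models0_subset by (blast intro: time_translation_zero)
    show "time_translation (t + s) Z = time_translation t (time_translation s Z)" if "Z \<in> models0 \<kappa>" for t s and Z :: "'d model"
      using that models0_subset by (blast intro: time_translation_add)
    show "(\<lambda>(t, Z). time_translation t Z) \<in> measurable (borel \<Otimes>\<^sub>M M) M"
      using time_translation_jointly_measurable[OF assms(1,2), where 'd='d] seM by (simp cong: measurable_cong_sets sets_pair_measure_cong)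
  qed
  moreover have "measure M A \<in> {0, 1}" if A: "A \<in> sets M" and inv: "\<And>t. time_translation t -` A \<inter> space M = A" for A
  proof -
    have "measure gauss_space (\<Z> -` A \<inter> space gauss_space) \<in> {0, 1}"
    proof (rule zero_one)
      show "\<Z> -` A \<inter> space gauss_space \<in> sets gauss_space" by (rule measurable_sets[OF ZM A])
      show "AE \<omega> in gauss_space. \<theta> a \<omega> \<in> \<Z> -` A \<inter> space gauss_space \<longleftrightarrow> \<omega> \<in> \<Z> -` A \<inter> space gauss_space" for a
        using twist[of a]
      proof eventually_elim
        case (elim \<omega>)
        \<comment> \<open>\<open>A\<close> is invariant as a set, so the only exceptional set is
          that of \<open>twist\<close>. The preimage is thus invariant up to a null set that may
          depend on \<open>a\<close>, which is the form of invariance that \<open>zero_one\<close>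
          accepts.\<close>
        have "time_translation a (\<Z> \<omega>) \<in> A \<longleftrightarrow> \<Z> \<omega> \<in> A" using inv[of a] Z0[of \<omega>] unfolding spM by blast
        then show ?case using elim by (simp add: space_gauss_space)
      qed
    qed
    then show ?thesis using A unfolding M_def by (simp add: measure_distr[OF Zm])
  qed
  ultimately show ?thesis unfolding ergodic_mds_def M_def[symmetric] by blast
qed

end
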